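(* Let $\Phi$ be an irreducible crystallographic root system in $V=\mathbb{R}^\ell$ with positive system $\Phi^+$ and Coxeter number $h$. Let $\Psi\subset\Phi^+$ be an order ideal such that $\mathcal{A}(\Psi)$ is free with exponents $(e_1',\dots,e_\ell')$. Then for every integer $m\ge0$ the cone $\mathbf{c}\mathcal{A}(\Phi^+,\Psi,m)$ is free with exponents $(1,e_1'+mh,e_2'+mh,\dots,e_\ell'+mh)$.
   Context: For $\alpha\in\Phi^+$, $k\in\mathbb{Z}$, $H_{\alpha,k}=\{v\in V:\alpha(v)=k\}$. For positive roots, $\alpha\le\beta$ means $\beta-\alpha$ is a nonnegative combination of simple roots; $\Psi\subset\Phi^+$ is an order ideal if $\alpha\in\Psi$, $\beta\in\Phi^+$, $\beta\le\alpha$ imply $\beta\in\Psi$. $\mathcal{A}(\Psi)=\{H_{\alpha,0}:\alpha\in\Psi\}$, a central arrangement in $V$ (the empty one has exponents all $0$). $[p,q]=\{k\in\mathbb{Z}:p\le k\le q\}$ (empty if $p>q$), $\mathcal{A}(\Phi^+)^{[p,q]}=\{H_{\alpha,k}:\alpha\in\Phi^+,k\in[p,q]\}$, and $\mathcal{A}(\Phi^+,\Psi,m)=\mathcal{A}(\Phi^+)^{[1-m,m]}\cup\{H_{\alpha,-m}:\alpha\in\Psi\}$. The cone $\mathbf{c}\mathcal{B}$ of an affine arrangement $\mathcal{B}$ in $V$ is the central arrangement in $\mathbb{R}\times V$ (coordinates $(x_0,x_1,\dots,x_\ell)$) consisting of $\{\alpha-kx_0=0\}$ for each $H_{\alpha,k}\in\mathcal{B}$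 together with $\{x_0=0\}$. A central arrangement is free with exponents $(d_i)$ if its module of logarithmic derivations $D=\{\delta\in\mathrm{Der}:\delta(\alpha_H)\in\alpha_HS\ \forall H\}$ is a free module over the polynomial ring $S$ with homogeneous basis of polynomial degrees $d_i$. *)

theory Defs
  imports "HOL-Analysis.Analysis"
begin

section \<open>Root systems (roots are vectors in V = real^'n; alpha(v) is alpha \<bullet> v)\<close>

definition refl_root :: "real^'n \<Rightarrow> real^'n \<Rightarrow> real^'n" where
  "refl_root a v = v - (2 * (v \<bullet> a) / (a \<bullet> a)) *\<^sub>R a"

definition crystallographic_root_system :: "(real^'n) set \<Rightarrow> bool" where
  "crystallographic_root_system R \<longleftrightarrow>
     finite R \<and> 0 \<notin> R \<and> span R = UNIV \<and>
     (\<forall>a\<in>R. \<forall>b\<in>R. refl_root a b \<in> R) \<and>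
     (\<forall>a\<in>R. \<forall>b\<in>R. 2 * (b \<bullet> a) / (a \<bullet> a) \<in> \<int>) \<and>
     (\<forall>a\<in>R. \<forall>c::real. c *\<^sub>R a \<in> R \<longrightarrow> c = 1 \<or> c = -1)"

definition irreducible_root_system :: "(real^'n) set \<Rightarrow> bool" where
  "irreducible_root_system R \<longleftrightarrow>
     R \<noteq> {} \<and>
     \<not> (\<exists>A B. A \<noteq> {} \<and> B \<noteq> {} \<and> A \<union> B = R \<and> A \<inter> B = {} \<and>
            (\<forall>a\<in>A. \<forall>b\<in>B. a \<bullet> b = 0))"

definition positive_system :: "(real^'n) set \<Rightarrow> (real^'n) set \<Rightarrow> bool" where
  "positive_system R P \<longleftrightarrow>
     (\<exists>c. (\<forall>a\<in>R. c \<bullet> a \<noteq> 0) \<and> P = {a\<in>R. c \<bullet> a > 0})"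

definition simple_system :: "(real^'n) set \<Rightarrow> (real^'n) set \<Rightarrow> bool" where
  "simple_system P S \<longleftrightarrow>
     S \<subseteq> P \<and> independent S \<and>
     (\<forall>a\<in>P. \<exists>c. (\<forall>s\<in>S. c s \<ge> (0::real)) \<and> a = (\<Sum>s\<in>S. c s *\<^sub>R s))"

definition root_le :: "(real^'n) set \<Rightarrow> real^'n \<Rightarrow> real^'n \<Rightarrow> bool" where
  "root_le S a b \<longleftrightarrow>
     (\<exists>c. (\<forall>s\<in>S. c s \<ge> (0::real)) \<and> b - a = (\<Sum>s\<in>S. c s *\<^sub>R s))"

definition order_ideal :: "(real^'n) set \<Rightarrow> (real^'n) set \<Rightarrow> (real^'n) set \<Rightarrow> bool" where
  "order_ideal S P I \<longleftrightarrow>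
     I \<subseteq> P \<and> (\<forall>a\<in>I. \<forall>b\<in>P. root_le S b a \<longrightarrow> b \<in> I)"

definition coxeter_element :: "(real^'n) set \<Rightarrow> real^'n \<Rightarrow> real^'n" where
  "coxeter_element S =
     fold (\<lambda>s f. refl_root s \<circ> f) (SOME ds. distinct ds \<and> set ds = S) id"

definition coxeter_number :: "(real^'n) set \<Rightarrow> nat" where
  "coxeter_number S = (LEAST k. k > 0 \<and> (coxeter_element S ^^ k) = id)"

definition monom :: "('m::finite \<Rightarrow> nat) \<Rightarrow> real^'m \<Rightarrow> real" where
  "monom e x = (\<Prod>i\<in>UNIV. (x $ i) ^ e i)"

definition poly_fun :: "(real^'m::finite \<Rightarrow> real) \<Rightarrow> bool" where
  "poly_fun f \<longleftrightarrow> (\<exists>E c. finite E \<and> f = (\<lambda>x. \<Sum>e\<in>E. c e * monom e x))"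

text \<open>Homogeneous polynomial of degree d (the zero polynomial included).\<close>
definition homog_poly :: "nat \<Rightarrow> (real^'m::finite \<Rightarrow> real) \<Rightarrow> bool" where
  "homog_poly d f \<longleftrightarrow>
     (\<exists>c. f = (\<lambda>x. \<Sum>e\<in>{e::'m \<Rightarrow> nat. sum e UNIV = d}. c e * monom e x))"

text \<open>A polynomial derivation sum_i theta_i d/dx_i is given by its coefficient functions.\<close>
type_synonym 'm derivation = "'m \<Rightarrow> real^'m \<Rightarrow> real"

definition apply_lin :: "'m::finite derivation \<Rightarrow> real^'m \<Rightarrow> real^'m \<Rightarrow> real" where
  "apply_lin \<theta> a x = (\<Sum>i\<in>UNIV. \<theta> i x * a $ i)"

definition log_derivations :: "(real^'m::finite) set set \<Rightarrow> 'm derivation set" where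
  "log_derivations A =
     {\<theta>. (\<forall>i. poly_fun (\<theta> i)) \<and>
          (\<forall>H\<in>A. \<forall>a. a \<noteq> 0 \<and> H = {x. a \<bullet> x = 0} \<longrightarrow>
              (\<exists>g. poly_fun g \<and> (\<forall>x. apply_lin \<theta> a x = (a \<bullet> x) * g x)))}"

definition free_with_exponents :: "(real^'m::finite) set set \<Rightarrow> ('m \<Rightarrow> nat) \<Rightarrow> bool" where
  "free_with_exponents A d \<longleftrightarrow>
     (\<exists>B :: 'm \<Rightarrow> 'm derivation.
        (\<forall>j. B j \<in> log_derivations A \<and> (\<forall>i. homog_poly (d j) (B j i))) \<and>
        (\<forall>\<theta>\<in>log_derivations A. \<exists>!f. (\<forall>j. poly_fun (f j)) \<and>
              \<theta> = (\<lambda>i x. \<Sum>j\<in>UNIV. f j x * B j i x)))"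

definition central_arr :: "(real^'n) set \<Rightarrow> (real^'n) set set" where
  "central_arr I = (\<lambda>a. {v. a \<bullet> v = 0}) ` I"

text \<open>Affine arrangement given by labels (alpha, k) standing for H_{alpha,k}.\<close>
definition shi_catalan_arr :: "(real^'n) set \<Rightarrow> (real^'n) set \<Rightarrow> nat \<Rightarrow> ((real^'n) \<times> int) set" where
  "shi_catalan_arr P I m =
     {(a, k) | a k. a \<in> P \<and> 1 - int m \<le> k \<and> k \<le> int m} \<union> {(a, - int m) | a. a \<in> I}"

text \<open>Cone in R x V, realised as real^('n option): coordinate None is x_0,
  coordinate Some i is the i-th coordinate of V.\<close>
definition cone_arr :: "((real^'n) \<times> int) set \<Rightarrow> (real^('n option)) set set" where
  "cone_arr B =
     insert {x. x $ None = 0}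
       ((\<lambda>(a, k). {x. (\<Sum>i\<in>UNIV. a $ i * x $ Some i) - of_int k * x $ None = 0}) ` B)"

end

theory Submission
 imports Defs
begin

text \<open>
 The arrangement is built up one hyperplane at a time, along a linear extension of the order on affine roots.
 By the addition theorem a homogeneous basis survives the addition of a hyperplane H as soon as some field of the
 module takes on the normal of H exactly the value of Terao's polynomial b. Such a field exists locally away from
 the origin: at finite points by the theorem on ideal arrangements, at points of the hyperplane at infinity by
 induction on the root system. It exists globally because otherwise fewer forms of positive degree than the
 dimension of H would generate an ideal containing a power of the maximal ideal. The degree of b is computed by
 counting inversions of an affine reflection, and it moves exactly one exponent by one. The heights of the roots
 therefore determine all exponents. Passing from one period to the next needs the duality p(t) + p(h+1-t) = l of
 the height partition, which follows from evaluating an equivariant basis at a regular eigenvector of a Coxeter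
 element. Finally the exponents of a free arrangement are unique.
\<close>

notation scaleR (infixr "*R" 75) and inner (infix "<.>" 70)

section \<open>Polynomial functions on Euclidean spaces\<close>

abbreviation rpoly :: "('a::real_normed_vector => real) => bool" where
 "rpoly \<equiv> real_polynomial_function"

declare real_polynomial_function.intros [rule del]

lemma rpoly_inner: "rpoly (%x::'a::euclidean_space. k <.> x)"
 by (intro real_polynomial_function.intros(1) bounded_linear_inner_right)

lemma rpoly_const: "rpoly (%x. c)"
 by (rule real_polynomial_function.intros(2))

lemma rpoly_mult: "rpoly f ==> rpoly g ==> rpoly (%x. f x * g x)"
 by (rule real_polynomial_function.intros(4))

lemma rpoly_add: "rpoly f ==> rpoly g ==> rpoly (%x. f x + g x)"
 by (rule real_polynomial_function.intros(3))

lemma rpoly_sum: "(!!i. i : I ==> rpoly (f i)) ==> rpoly (%x. SUM i:I. f i x)"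
 by (induction I rule: infinite_finite_induct) (auto intro: rpoly_const rpoly_add)

lemma rpoly_prod: "(!!i. i : I ==> rpoly (f i)) ==> rpoly (%x. PROD i:I. f i x)"
 by (induction I rule: infinite_finite_induct) (auto intro: rpoly_const rpoly_mult)

lemmas rpoly_intros = rpoly_inner rpoly_const rpoly_mult rpoly_add rpoly_sum rpoly_prod
 real_polynomial_function_diff real_polynomial_function_minus

lemma rpoly_prod_inner: "rpoly (%x::'a::euclidean_space. PROD l:L. l <.> x)"
 by (intro rpoly_intros)

lemma rpoly_compose_linear:
 assumes "rpoly f" "bounded_linear g"
 shows "rpoly (%x. f (g x))"
 using real_polynomial_function_compose[OF polynomial_function_bounded_linear[OF assms(2)] assms(1)]
 by (simp add: o_def)

lemma polynomial_function_inner_iff: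
 fixes th :: "'a::euclidean_space => 'b::euclidean_space"
 shows "polynomial_function th \<longleftrightarrow> (ALL u. rpoly (%x. u <.> th x))"
proof
 assume "polynomial_function th"
 then show "ALL u. rpoly (%x. u <.> th x)"
  unfolding polynomial_function_def o_def using bounded_linear_inner_right by blast
next
 assume *: "ALL u. rpoly (%x. u <.> th x)"
 show "polynomial_function th"
  unfolding polynomial_function_iff_Basis_inner real_polynomial_function_eq[symmetric]
  using * by (simp add: inner_commute)
qed

lemma rpoly_line:
 assumes "rpoly f"
 shows "EX p. ALL t. f (x + t *R v) = poly p t"
 using assms
proof (induction f rule: real_polynomial_function.induct)
 case (linear f)
 then have "ALL t. f (x + t *R v) = poly [:f x, f v:] t"
  by (simp add: bounded_linear.linear linear_add linear_scale)
 then show ?case by blast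
next
 case (const c)
 have "ALL t. c = poly [:c:] t" by simp
 then show ?case by blast
next
 case (add f g)
 then obtain p q where "ALL t. f (x + t *R v) = poly p t" "ALL t. g (x + t *R v) = poly q t" by blast
 then have "ALL t. f (x + t *R v) + g (x + t *R v) = poly (p + q) t" by simp
 then show ?case by blast
next
 case (mult f g)
 then obtain p q where "ALL t. f (x + t *R v) = poly p t" "ALL t. g (x + t *R v) = poly q t" by blast
 then have "ALL t. f (x + t *R v) * g (x + t *R v) = poly (p * q) t" by simp
 then show ?case by blast
qed

lemma rpoly_mult_eq_0:
 assumes f: "rpoly f" and g: "rpoly g" and K: "subspace K"
  and zero: "!!x. x : K ==> f x * g x = 0" and x: "x : K" "f x ~= 0" and y: "y : K"
 shows "g y = 0"
proof (rule ccontr)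
 assume gy: "g y ~= 0"
 obtain p where p: "ALL t. f (x + t *R (y - x)) = poly p t" using rpoly_line[OF f] by blast
 obtain q where q: "ALL t. g (x + t *R (y - x)) = poly q t" using rpoly_line[OF g] by blast
 have "poly p 0 ~= 0" using p[rule_format, of 0] x by simp
 moreover have "poly q 1 ~= 0" using q[rule_format, of 1] gy by simp
 ultimately have "p * q ~= 0" by auto
 moreover have "poly (p * q) t = 0" for t
 proof -
  have "x + t *R (y - x) : K"
   by (intro subspace_add[OF K] subspace_scale[OF K] subspace_diff[OF K] x y)
  then show ?thesis using zero p q by (metis poly_mult)
 qed
 ultimately show False using poly_all_0_iff_0 by blast
qed

lemma rpoly_cancel:
 assumes "rpoly b" "rpoly f" "rpoly g" "subspace K"
  and "!!x. x : K ==> b x * f x = b x * g x" and "z : K" "b z ~= 0" and y: "y : K"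
 shows "f y = g y"
proof -
 have "f y - g y = 0"
  by (rule rpoly_mult_eq_0[where f=b and g="%x. f x - g x" and K=K and x=z])
    (use assms in \<open>auto simp: algebra_simps intro: rpoly_intros\<close>)
 then show ?thesis by simp
qed

lemma rpoly_diff_shift:
 fixes f :: "'a::euclidean_space => real"
 assumes "rpoly f"
 shows "EX g. rpoly g & (ALL x. f x - f (x - (k <.> x) *R n) = (k <.> x) * g x)"
 using assms
proof (induction f rule: real_polynomial_function.induct)
 case (linear f)
 then have "ALL x. f x - f (x - (k <.> x) *R n) = (k <.> x) * f n"
  by (simp add: bounded_linear.linear linear_diff linear_scale)
 then show ?case using rpoly_const[of "f n"] by blast
next
 case (const c)
 show ?case by (rule exI[of _ "%_. 0"]) (simp add: rpoly_const)
next
 case (add f1 f2)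
 then obtain g1 g2 where g: "rpoly g1" "rpoly g2" and g1: "!!x. f1 x - f1 (x - (k <.> x) *R n) = (k <.> x) * g1 x"
  and g2: "!!x. f2 x - f2 (x - (k <.> x) *R n) = (k <.> x) * g2 x" by blast
 have "f1 x + f2 x - (f1 (x - (k <.> x) *R n) + f2 (x - (k <.> x) *R n)) = (k <.> x) * (g1 x + g2 x)" for x
  using g1[of x] g2[of x] by (simp add: distrib_left)
 then show ?case using rpoly_add[OF g] by (intro exI conjI allI)
next
 case (mult f1 f2)
 let ?p = "%x. x - (k <.> x) *R n"
 obtain g1 g2 where g: "rpoly g1" "rpoly g2" and g1: "!!x. f1 x - f1 (?p x) = (k <.> x) * g1 x"
  and g2: "!!x. f2 x - f2 (?p x) = (k <.> x) * g2 x" using mult.IH by blast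
 have "bounded_linear ?p"
  by (intro bounded_linear_sub bounded_linear_ident bounded_linear_scaleR_const bounded_linear_inner_right)
 then have "rpoly (%x. f1 (?p x))" using mult.hyps(1) by (rule rpoly_compose_linear[rotated])
 then have "rpoly (%x. g1 x * f2 x + f1 (?p x) * g2 x)" using g mult.hyps by (intro rpoly_intros)
 moreover have "f1 x * f2 x - f1 (?p x) * f2 (?p x) = (k <.> x) * (g1 x * f2 x + f1 (?p x) * g2 x)" for x
 proof -
  have "f1 x * f2 x - f1 (?p x) * f2 (?p x) = (f1 x - f1 (?p x)) * f2 x + f1 (?p x) * (f2 x - f2 (?p x))"
   by (simp add: algebra_simps)
  then show ?thesis unfolding g1 g2 by (simp add: algebra_simps)
 qed
 ultimately show ?case by (intro exI conjI allI)
qed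

lemma rpoly_divide_linear:
 fixes f :: "'a::euclidean_space => real"
 assumes f: "rpoly f" and K: "subspace K" and zero: "!!x. x : K ==> k <.> x = 0 ==> f x = 0"
 shows "EX g. rpoly g & (ALL x:K. f x = (k <.> x) * g x)"
proof (cases "ALL x:K. k <.> x = 0")
 case True
 then show ?thesis using zero rpoly_const[of 0] by auto
next
 case False
 then obtain m where m: "m : K" "k <.> m ~= 0" by blast
 define n where "n = (1 / (k <.> m)) *R m"
 have n: "n : K" "k <.> n = 1" using m K by (auto simp: n_def subspace_scale)
 obtain g where g: "rpoly g" "ALL x. f x - f (x - (k <.> x) *R n) = (k <.> x) * g x"
  using rpoly_diff_shift[OF f] by blast
 have "f x = (k <.> x) * g x" if "x : K" for x
 proof -
  have "x - (k <.> x) *R n : K" using that n K by (simp add: subspace_diff subspace_scale)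
  moreover have "k <.> (x - (k <.> x) *R n) = 0" using n by (simp add: inner_diff_right)
  ultimately show ?thesis using zero g(2) by (metis diff_zero)
 qed
 then show ?thesis using g by blast
qed

lemma subspace_kernel_on: "subspace K ==> subspace {x:K. k <.> x = (0::real)}"
 by (auto simp: subspace_def inner_add_right)

lemma prod_linear_nonzero:
 fixes L :: "'a::euclidean_space set"
 assumes K: "subspace K" and "finite L" and "!!l. l : L ==> EX x:K. l <.> x ~= 0"
 shows "EX x:K. (PROD l:L. l <.> x) ~= 0"
 using assms(2,3)
proof (induction L rule: finite_induct)
 case empty
 then show ?case using subspace_0[OF K] by auto
next
 case (insert k L)
 then obtain x y where x: "x : K" "(PROD l:L. l <.> x) ~= 0" and y: "y : K" "k <.> y ~= 0" by blast
 show ?case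
 proof (rule ccontr)
  assume "~ ?thesis"
  then have z: "(PROD l:L. l <.> u) * (k <.> u) = 0" if "u : K" for u
   using that insert.hyps by auto
  from rpoly_prod_inner have "k <.> y = 0"
   by (rule rpoly_mult_eq_0[OF _ rpoly_inner K z x y(1)])
  then show False using y by simp
 qed
qed

lemma rpoly_divide_linear_coprime:
 fixes L :: "'a::euclidean_space set"
 assumes K: "subspace K" and L: "finite L" "!!l. l : L ==> EX x:K. k <.> x = 0 & l <.> x ~= 0" and g: "rpoly g"
  and zero: "!!x. x : K ==> k <.> x = 0 ==> (PROD l:L. l <.> x) * g x = 0"
 shows "EX g'. rpoly g' & (ALL x:K. g x = (k <.> x) * g' x)"
proof (rule rpoly_divide_linear[OF g K])
 let ?K = "{x:K. k <.> x = 0}"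
 obtain z where z: "z : ?K" "(PROD l:L. l <.> z) ~= 0"
  using prod_linear_nonzero[OF subspace_kernel_on[OF K] L(1), of k] L(2) by blast
 fix x assume "x : K" "k <.> x = 0"
 then show "g x = 0"
  by (intro rpoly_mult_eq_0[OF rpoly_prod_inner g subspace_kernel_on[OF K] _ z]) (auto simp: zero)
qed

lemma rpoly_divide_by_prod:
 fixes L :: "'a::euclidean_space set"
 assumes K: "subspace K" and L: "finite L" and f: "rpoly f"
  and zero: "!!l x. l : L ==> x : K ==> l <.> x = 0 ==> f x = 0"
  and indep: "!!l l'. l : L ==> l' : L ==> l ~= l' ==> EX x:K. l <.> x = 0 & l' <.> x ~= 0"
 shows "EX g. rpoly g & (ALL x:K. f x = (PROD l:L. l <.> x) * g x)"
 using L zero indep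
proof (induction L rule: finite_induct)
 case empty
 then show ?case using f by auto
next
 case (insert k L)
 then obtain g where g: "rpoly g" "ALL x:K. f x = (PROD l:L. l <.> x) * g x" by auto
 have "EX g'. rpoly g' & (ALL x:K. g x = (k <.> x) * g' x)"
 proof (rule rpoly_divide_linear_coprime[OF K insert.hyps(1) _ g(1)])
  show "EX x:K. k <.> x = 0 & l <.> x ~= 0" if "l : L" for l using insert.prems(2)[of k l] insert.hyps that by auto
 qed (use g insert.prems(1) in force)
 then show ?case using g insert.hyps by auto
qed

lemma rpoly_divide_coprime:
 fixes L1 L2 :: "'a::euclidean_space set"
 assumes K: "subspace K" and L: "finite L1" "finite L2" "L1 Int L2 = {}"
  and g1: "rpoly g1" "!!x. x : K ==> f x = (PROD l:L1. l <.> x) * g1 x"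
  and g2: "rpoly g2" "!!x. x : K ==> f x = (PROD l:L2. l <.> x) * g2 x"
  and indep: "!!l l'. l : L1 ==> l' : L2 ==> EX x:K. l' <.> x = 0 & l <.> x ~= 0"
  and nonzero: "!!l. l : L2 ==> EX x:K. l <.> x ~= 0"
 shows "EX g. rpoly g & (ALL x:K. f x = (PROD l:L1 Un L2. l <.> x) * g x)"
 using L(2,3) g2 indep nonzero
proof (induction L2 arbitrary: g2 rule: finite_induct)
 case empty
 then show ?case using g1 by auto
next
 case (insert k L2)
 have rpoly_k_g2: "rpoly (%x. (k <.> x) * g2 x)" using insert.prems(2) by (intro rpoly_intros)
 have f_eq: "f x = (PROD l:L2. l <.> x) * ((k <.> x) * g2 x)" if "x : K" for x
  using insert.prems(3)[OF that] insert.hyps by (simp add: mult_ac)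
 obtain g where g: "rpoly g" "ALL x:K. f x = (PROD l:L1 Un L2. l <.> x) * g x"
  using insert.IH[OF _ rpoly_k_g2 f_eq] insert.prems(1,4,5) by auto
 have disj: "L1 Int L2 = {}" "k ~: L1" using insert.prems(1) by auto
 obtain z where z: "z : K" "(PROD l:L2. l <.> z) ~= 0"
  using prod_linear_nonzero[OF K insert.hyps(1)] insert.prems(5) by auto
 have cancelled: "(PROD l:L1. l <.> x) * g x = (k <.> x) * g2 x" if "x : K" for x
  using g(2) f_eq
  by (intro rpoly_cancel[OF rpoly_prod_inner rpoly_mult[OF rpoly_prod_inner g(1)] rpoly_k_g2 K _ z that])
   (auto simp: prod.union_disjoint[OF L(1) insert.hyps(1) disj(1)] mult_ac)
 have "EX g'. rpoly g' & (ALL x:K. g x = (k <.> x) * g' x)"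
  by (rule rpoly_divide_linear_coprime[OF K L(1) _ g(1)]) (use insert.prems(4) cancelled in auto)
 moreover have "L1 Un insert k L2 = insert k (L1 Un L2)" by auto
 ultimately show ?case using g insert.hyps disj L(1) by (auto simp: mult_ac)
qed

lemma homogeneous_component:
 fixes y :: "'b::euclidean_space"
 assumes "finite I" and "!!t. t ^ n *R y = (SUM i:I. t ^ d i *R w i)"
 shows "y = (SUM i:{i:I. d i = n}. w i)"
proof (rule euclidean_eqI)
 fix b :: 'b
 let ?p = "Polynomial.monom (y <.> b) n - (SUM i:I. Polynomial.monom (w i <.> b) (d i))"
 have "poly ?p t = 0" for t
  using arg_cong[OF assms(2)[of t], of "%v. v <.> b"] by (simp add: poly_sum poly_monom inner_sum_left mult.commute)
 then have "?p = 0" using poly_all_0_iff_0 by blast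
 then have "coeff ?p n = 0" by simp
 then have "y <.> b = (SUM i:I. if d i = n then w i <.> b else 0)" by (simp add: coeff_sum)
 then show "y <.> b = (SUM i:{i:I. d i = n}. w i) <.> b"
  unfolding inner_sum_left using assms(1) by (simp add: sum.inter_filter)
qed

section \<open>Too few forms do not generate a power of the maximal ideal\<close>

lemma nontrivial_left_kernel:
 fixes A :: "'i => 'k => 'f::field"
 assumes "finite K" "finite I" "card K < card I"
 shows "EX c. (EX i:I. c i ~= 0) & (ALL k:K. (SUM i:I. c i * A i k) = 0)"
 using assms
proof (induction K arbitrary: I A rule: finite_induct)
 case empty
 then obtain i where "i : I" by fastforce
 then show ?case by (intro exI[of _ "%_. 1"]) auto
next
 case (insert k K)
 show ?case
 proof (cases "ALL i:I. A i k = 0")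
  case True
  obtain c where "EX i:I. c i ~= 0" "ALL k:K. (SUM i:I. c i * A i k) = 0"
   using insert.IH[of I A] insert.prems insert.hyps by auto
  then show ?thesis using True by (intro exI[of _ c]) auto
 next
  case False
  then obtain j where j: "j : I" "A j k ~= 0" by blast
  define A' where "A' i l = A i l - A i k / A j k * A j l" for i l
  have "card K < card (I - {j})" using insert.prems insert.hyps j by simp
  then obtain c where c: "EX i:I - {j}. c i ~= 0" "ALL k:K. (SUM i:I - {j}. c i * A' i k) = 0"
   using insert.IH[of "I - {j}" A'] insert.prems by auto
  define c' where "c' i = (if i = j then - (SUM i:I - {j}. c i * (A i k / A j k)) else c i)" for i
  have "(SUM i:I. c' i * A i l) = (SUM i:I - {j}. c i * A' i l)" for l
  proof -
   have "(SUM i:I. c' i * A i l) = c' j * A j l + (SUM i:I - {j}. c' i * A i l)"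
    using sum.remove[OF insert.prems(1) j(1)] by simp
   also have "(SUM i:I - {j}. c' i * A i l) = (SUM i:I - {j}. c i * A i l)"
    by (rule sum.cong) (auto simp: c'_def)
   also have "c' j * A j l = - (SUM i:I - {j}. c i * (A i k / A j k * A j l))"
    by (simp add: c'_def sum_distrib_right mult.assoc)
   finally show ?thesis
    by (simp add: A'_def right_diff_distrib sum_subtractf)
  qed
  moreover have "A' i k = 0" for i using j by (simp add: A'_def)
  moreover have "EX i:I. c' i ~= 0" using c(1) by (auto simp: c'_def)
  ultimately show ?thesis using c(2) by (intro exI[of _ c']) auto
 qed
qed

definition lin_comb_on :: "'a set => ('i => 'a => real) => 'i set => ('a => real) => bool" where
 "lin_comb_on Z W F f \<longleftrightarrow> (EX c. ALL x:Z. f x = (SUM i:F. c i * W i x))"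

lemma lin_comb_on_cong: "lin_comb_on Z W F f ==> (!!x. x : Z ==> g x = f x) ==> lin_comb_on Z W F g"
 unfolding lin_comb_on_def by auto

lemma lin_comb_on_base: "finite F ==> i : F ==> lin_comb_on Z W F (W i)"
 unfolding lin_comb_on_def
 by (rule exI[of _ "%j. if j = i then 1 else 0"]) (simp add: if_distrib[of "%u. u * _"] cong: if_cong)

lemma lin_comb_on_add:
 assumes "lin_comb_on Z W F f" "lin_comb_on Z W F g"
 shows "lin_comb_on Z W F (%x. f x + g x)"
proof -
 obtain c d where "ALL x:Z. f x = (SUM i:F. c i * W i x)" "ALL x:Z. g x = (SUM i:F. d i * W i x)"
  using assms unfolding lin_comb_on_def by blast
 then have "ALL x:Z. f x + g x = (SUM i:F. (c i + d i) * W i x)" by (simp add: sum.distrib distrib_right)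
 then show ?thesis unfolding lin_comb_on_def by (rule exI[of _ "%i. c i + d i"])
qed

lemma lin_comb_on_scale:
 assumes "lin_comb_on Z W F f"
 shows "lin_comb_on Z W F (%x. t * f x)"
proof -
 obtain c where "ALL x:Z. f x = (SUM i:F. c i * W i x)" using assms unfolding lin_comb_on_def by blast
 then have "ALL x:Z. t * f x = (SUM i:F. (t * c i) * W i x)" by (simp add: sum_distrib_left mult.assoc)
 then show ?thesis unfolding lin_comb_on_def by (rule exI[of _ "%i. t * c i"])
qed

lemma lin_comb_on_zero: "lin_comb_on Z W F (%x. 0)"
 unfolding lin_comb_on_def by (rule exI[of _ "%_. 0"]) simp

lemma lin_comb_on_sum: "(!!i. i : I ==> lin_comb_on Z W F (f i)) ==> lin_comb_on Z W F (%x. SUM i:I. f i x)"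
 by (induction I rule: infinite_finite_induct) (auto intro: lin_comb_on_zero lin_comb_on_add)

lemma lin_comb_on_times:
 assumes "lin_comb_on Z W F f" and "!!i. i : F ==> lin_comb_on Z W' F' (%x. W i x * h x)"
 shows "lin_comb_on Z W' F' (%x. f x * h x)"
proof -
 obtain c where c: "ALL x:Z. f x = (SUM i:F. c i * W i x)" using assms(1) unfolding lin_comb_on_def by blast
 have "lin_comb_on Z W' F' (%x. SUM i:F. c i * (W i x * h x))"
  by (intro lin_comb_on_sum lin_comb_on_scale assms(2))
 then show ?thesis by (rule lin_comb_on_cong) (simp add: c sum_distrib_right mult.assoc)
qed

lemma lin_comb_on_mono:
 assumes "lin_comb_on Z W F f" "F \<subseteq> F'" "finite F'"
 shows "lin_comb_on Z W F' f"
 using lin_comb_on_times[OF assms(1), of W F' "%_. 1"] lin_comb_on_base[OF assms(3)] assms(2) by auto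

lemma lin_comb_on_card_le:
 assumes fin: "finite F" "finite M" and comb: "!!i. i : M ==> lin_comb_on Z W F (f i)"
  and indep: "!!c i. (!!x. x : Z ==> (SUM i:M. c i * f i x) = 0) ==> i : M ==> c i = 0"
 shows "card M <= card F"
proof (rule ccontr)
 assume "~ card M <= card F"
 obtain A where A: "!!i x. i : M ==> x : Z ==> f i x = (SUM k:F. A i k * W k x)"
  using comb unfolding lin_comb_on_def by metis
 obtain c where c: "EX i:M. c i ~= 0" "!!k. k : F ==> (SUM i:M. c i * A i k) = 0"
  using nontrivial_left_kernel[OF fin, of A] \<open>~ card M <= card F\<close> by auto
 have "(SUM i:M. c i * f i x) = 0" if x: "x : Z" for x
 proof -
  have "(SUM i:M. c i * f i x) = (SUM i:M. SUM k:F. c i * A i k * W k x)"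
   by (rule sum.cong) (auto simp: A[OF _ x] sum_distrib_left mult.assoc)
  also have "... = (SUM k:F. (SUM i:M. c i * A i k) * W k x)" by (subst sum.swap) (simp add: sum_distrib_right)
  finally show ?thesis using c(2) by simp
 qed
 then show False using indep c(1) by blast
qed

definition orthonormal :: "'a::euclidean_space set => bool" where
 "orthonormal B \<longleftrightarrow> finite B & (ALL b:B. ALL c:B. b <.> c = (if b = c then 1 else 0))"

lemma orthonormal_Basis: "orthonormal Basis" by (simp add: orthonormal_def inner_Basis)

lemma orthonormalD:
 assumes "orthonormal B"
 shows "finite B" "b : B ==> c : B ==> b <.> c = (if b = c then 1 else 0)"
 using assms by (auto simp: orthonormal_def)

lemma orthonormal_expand: "orthonormal B ==> x : span B ==> (SUM b:B. (b <.> x) *R b) = x"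
 using orthonormal_basis_expand[of B x]
 by (auto simp: orthonormal_def pairwise_def orthogonal_def norm_eq_1 inner_commute)

lemma orthonormal_inner_sum: "orthonormal B ==> b : B ==> b <.> (SUM c:B. t c *R c) = t b"
 by (simp add: inner_sum_right orthonormalD if_distrib[of "%u. _ * u"] cong: if_cong)

lemma orthonormal_basis_exists:
 assumes "subspace Z"
 obtains B where "orthonormal B" "span B = Z" "card B = dim Z"
proof -
 obtain B where B: "pairwise orthogonal B" "!!x. x : B ==> norm x = 1" "independent B" "card B = dim Z" "span B = Z"
  using orthonormal_basis_subspace[OF assms] by metis
 then have "orthonormal B"
  by (auto simp: orthonormal_def independent_imp_finite pairwise_def orthogonal_def dot_square_norm)
 then show ?thesis using that B by blast
qed

lemma orthonormal_family_exists:
 fixes U :: "'a::euclidean_space set"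
 assumes U: "subspace U" and I: "finite I" "card I = dim U"
 obtains f where "!!i. i : I ==> f i : U" "!!i j. i : I ==> j : I ==> f i <.> f j = (if i = j then 1 else 0)"
  "!!x. x : U ==> (SUM i:I. (f i <.> x) *R f i) = x"
proof -
 obtain B where B: "orthonormal B" "span B = U" "card B = dim U" using orthonormal_basis_exists[OF U] .
 obtain f where f: "bij_betw f I B"
  using finite_same_card_bij[OF I(1) orthonormalD(1)[OF B(1)]] I(2) B(3) by auto
 show ?thesis
 proof (rule that[of f])
  show "f i : U" if "i : I" for i using f that B(2) by (auto simp: bij_betw_def intro: span_base)
  show "f i <.> f j = (if i = j then 1 else 0)" if "i : I" "j : I" for i j
   using orthonormalD(2)[OF B(1), of "f i" "f j"] f that by (auto simp: bij_betw_def inj_on_def)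
  show "(SUM i:I. (f i <.> x) *R f i) = x" if "x : U" for x
   using sum.reindex_bij_betw[OF f, of "%b. (b <.> x) *R b"] orthonormal_expand[OF B(1)] B(2) that by simp
 qed
qed

definition monomial_on :: "'a::euclidean_space set => ('a => nat) => 'a => real" where
 "monomial_on B mu x = (PROD b:B. (b <.> x) ^ mu b)"

lemma rpoly_power: "rpoly f ==> rpoly (%x. f x ^ n)"
 by (induction n) (auto intro: rpoly_const rpoly_mult)

lemma rpoly_monomial_on: "rpoly (monomial_on B mu)"
 unfolding monomial_on_def by (intro rpoly_intros rpoly_power)

lemma monomial_on_add: "monomial_on B (%b. mu b + \<nu> b) x = monomial_on B mu x * monomial_on B \<nu> x"
 by (simp add: monomial_on_def power_add prod.distrib)

lemma monomial_on_scale: "monomial_on B mu (t *R x) = t ^ (SUM b:B. mu b) * monomial_on B mu x"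
 by (simp add: monomial_on_def power_mult_distrib prod.distrib power_sum)

lemma monomial_on_split:
 assumes "finite B" "b : B"
 shows "monomial_on B mu x = (b <.> x) ^ mu b * monomial_on (B - {b}) mu x"
 unfolding monomial_on_def by (rule prod.remove[OF assms])

lemma power_products_independent:
 fixes c :: "('b => nat) => real"
 assumes "finite B" "finite F" "!!mu \<nu>. mu : F ==> \<nu> : F ==> (ALL b:B. mu b = \<nu> b) ==> mu = \<nu>"
  and "!!t. (SUM mu:F. c mu * (PROD b:B. t b ^ mu b)) = 0" "mu : F"
 shows "c mu = 0"
 using assms
proof (induction B arbitrary: F rule: finite_induct)
 case empty
 then have "F = {mu}" by auto
 then show ?case using empty.prems(3) by simp
next
 case (insert b B)
 define n where "n = mu b"
 let ?F = "{\<nu>:F. \<nu> b = n}"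
 have "(SUM \<nu>:?F. c \<nu> * (PROD b:B. t b ^ \<nu> b)) = 0" for t
 proof -
  define d where "d \<nu> = c \<nu> * (PROD b:B. t b ^ \<nu> b)" for \<nu>
  let ?p = "SUM \<nu>:F. Polynomial.monom (d \<nu>) (\<nu> b)"
  have "poly ?p u = 0" for u
  proof -
   have "poly ?p u = (SUM \<nu>:F. c \<nu> * (PROD b':insert b B. (t(b := u)) b' ^ \<nu> b'))"
    unfolding poly_sum
   proof (rule sum.cong)
    fix \<nu>
    have "(PROD b':B. (t(b := u)) b' ^ \<nu> b') = (PROD b':B. t b' ^ \<nu> b')"
     by (rule prod.cong) (use insert.hyps in auto)
    then show "poly (Polynomial.monom (d \<nu>) (\<nu> b)) u = c \<nu> * (PROD b':insert b B. (t(b := u)) b' ^ \<nu> b')"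
     using insert.hyps by (simp add: poly_monom d_def mult_ac del: fun_upd_apply) simp
   qed simp
   then show ?thesis using insert.prems(3) by simp
  qed
  then have "?p = 0" using poly_all_0_iff_0 by blast
  then have "coeff ?p n = 0" by simp
  then have "(SUM \<nu>:F. if \<nu> b = n then d \<nu> else 0) = 0" by (simp add: coeff_sum)
  then show ?thesis unfolding d_def using insert.prems(1) by (simp add: sum.inter_filter)
 qed
 then show ?case
  using insert.IH[of ?F] insert.prems by (auto simp: n_def)
qed

lemma monomial_on_independent:
 assumes B: "orthonormal B" and F: "finite F" "!!mu \<nu>. mu : F ==> \<nu> : F ==> (ALL b:B. mu b = \<nu> b) ==> mu = \<nu>"
  and zero: "!!x. x : span B ==> (SUM mu:F. c mu * monomial_on B mu x) = 0" and "mu : F"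
 shows "c mu = 0"
proof (rule power_products_independent[OF orthonormalD(1)[OF B] F _ \<open>mu : F\<close>])
 fix t :: "'a => real"
 have "(SUM b:B. t b *R b) : span B" by (intro span_sum span_scale span_base)
 then show "(SUM mu:F. c mu * (PROD b:B. t b ^ mu b)) = 0"
  using zero[of "SUM b:B. t b *R b"] by (simp add: monomial_on_def orthonormal_inner_sum[OF B])
qed

definition monomial_comb :: "'a::euclidean_space set => ('a => real) => bool" where
 "monomial_comb B f \<longleftrightarrow> (EX F. finite F & lin_comb_on (span B) (monomial_on B) F f)"

lemma monomial_comb_cong: "monomial_comb B f ==> (!!x. x : span B ==> g x = f x) ==> monomial_comb B g"
 unfolding monomial_comb_def using lin_comb_on_cong by blast

lemma monomial_comb_scale_monomial: "monomial_comb B (%x. c * monomial_on B mu x)"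
 unfolding monomial_comb_def by (intro exI[of _ "{mu}"] conjI lin_comb_on_scale lin_comb_on_base) auto

lemma monomial_comb_const: "monomial_comb B (%x. c)"
 using monomial_comb_scale_monomial[of B c "%_. 0"] by (simp add: monomial_on_def)

lemma monomial_comb_inner:
 assumes "finite B" "b : B"
 shows "monomial_comb B (%x. b <.> x)"
proof -
 have "monomial_on B (%b'. if b' = b then 1 else 0) x = b <.> x" for x
  unfolding monomial_on_split[OF assms] by (simp add: monomial_on_def)
 then show ?thesis using monomial_comb_scale_monomial[of B 1 "%b'. if b' = b then 1 else 0"] by simp
qed

lemma monomial_comb_add:
 assumes "monomial_comb B f" "monomial_comb B g"
 shows "monomial_comb B (%x. f x + g x)"
proof -
 obtain F G where "finite F" "finite G" "lin_comb_on (span B) (monomial_on B) F f" "lin_comb_on (span B) (monomial_on B) G g"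
  using assms unfolding monomial_comb_def by blast
 then have "lin_comb_on (span B) (monomial_on B) (F Un G) (%x. f x + g x)"
  by (intro lin_comb_on_add) (auto elim: lin_comb_on_mono)
 then show ?thesis unfolding monomial_comb_def using \<open>finite F\<close> \<open>finite G\<close> by blast
qed

lemma monomial_comb_sum: "(!!i. i : I ==> monomial_comb B (f i)) ==> monomial_comb B (%x. SUM i:I. f i x)"
 by (induction I rule: infinite_finite_induct) (auto intro: monomial_comb_const monomial_comb_add)

lemma monomial_comb_mult:
 assumes "monomial_comb B f" "monomial_comb B g"
 shows "monomial_comb B (%x. f x * g x)"
proof -
 obtain F c G d where f: "ALL x:span B. f x = (SUM mu:F. c mu * monomial_on B mu x)"
  and g: "ALL x:span B. g x = (SUM mu:G. d mu * monomial_on B mu x)"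
  using assms unfolding monomial_comb_def lin_comb_on_def by blast
 have "monomial_comb B (%x. SUM mu:F. SUM \<nu>:G. (c mu * d \<nu>) * monomial_on B (%b. mu b + \<nu> b) x)"
  by (intro monomial_comb_sum monomial_comb_scale_monomial)
 then show ?thesis
  by (rule monomial_comb_cong) (simp add: f g monomial_on_add sum_product mult_ac)
qed

lemma rpoly_monomial_comb:
 assumes f: "rpoly f" and B: "orthonormal B"
 shows "monomial_comb B f"
 using f
proof (induction f rule: real_polynomial_function.induct)
 case (linear f)
 have "monomial_comb B (%x. SUM b:B. f b * (b <.> x))"
  by (intro monomial_comb_sum monomial_comb_mult monomial_comb_const monomial_comb_inner orthonormalD(1)[OF B])
 then show ?case
 proof (rule monomial_comb_cong)
  fix x assume "x : span B"
  then have "f x = f (SUM b:B. (b <.> x) *R b)" using orthonormal_expand[OF B] by simp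
  also have "... = (SUM b:B. f b * (b <.> x))"
   using linear by (simp add: bounded_linear.linear linear_sum linear_scale mult.commute)
  finally show "f x = (SUM b:B. f b * (b <.> x))" .
 qed
qed (auto intro: monomial_comb_const monomial_comb_add monomial_comb_mult)

lemma rpoly_monomialsE:
 assumes "rpoly f" "orthonormal B"
 obtains F c where "finite F" "!!x. x : span B ==> f x = (SUM mu:F. c mu * monomial_on B mu x)"
 using rpoly_monomial_comb[OF assms] unfolding monomial_comb_def lin_comb_on_def by blast

lemma homogeneous_monomialsE:
 assumes f: "rpoly f" "orthonormal B" and hom: "!!t x. x : span B ==> f (t *R x) = t ^ n * f x"
 obtains F c where "finite F" "!!mu. mu : F ==> (SUM b:B. mu b) = n"
  "!!x. x : span B ==> f x = (SUM mu:F. c mu * monomial_on B mu x)"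
proof -
 obtain F c where F: "finite F" "!!x. x : span B ==> f x = (SUM mu:F. c mu * monomial_on B mu x)"
  using rpoly_monomialsE[OF f] by blast
 have expansion: "f x = (SUM mu:{mu:F. (SUM b:B. mu b) = n}. c mu * monomial_on B mu x)" if x: "x : span B" for x
 proof (rule homogeneous_component[OF F(1)])
  show "t ^ n *R f x = (SUM mu:F. t ^ (SUM b:B. mu b) *R (c mu * monomial_on B mu x))" for t
   using hom[OF x, of t] F(2)[OF span_scale[OF x, of t]] by (simp add: monomial_on_scale mult_ac)
 qed
 show ?thesis by (rule that[OF _ _ expansion]) (use F(1) in auto)
qed

definition ideal_on :: "'a::euclidean_space set => (('a => real) => bool) => bool" where
 "ideal_on Z J \<longleftrightarrow> (ALL f g. J f --> J g --> J (%x. f x + g x)) & J (%_. 0) &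
   (ALL f h. J f --> rpoly h --> J (%x. h x * f x)) &
   (ALL f g. (ALL x:Z. f x = g x) --> J f --> J g)"

lemma ideal_onD:
 assumes "ideal_on Z J"
 shows "J f ==> J g ==> J (%x. f x + g x)" "J (%_. 0)"
  "J f ==> rpoly h ==> J (%x. h x * f x)"
  "J f ==> (!!x. x : Z ==> g x = f x) ==> J g"
proof -
 show "J f ==> J g ==> J (%x. f x + g x)" "J (%_. 0)" "J f ==> rpoly h ==> J (%x. h x * f x)"
  using assms unfolding ideal_on_def by simp_all
 show "J f ==> (!!x. x : Z ==> g x = f x) ==> J g"
  using assms[unfolded ideal_on_def, THEN conjunct2, THEN conjunct2, THEN conjunct2, rule_format, of f g] by simp
qed

definition adjoin :: "'a::euclidean_space set => (('a => real) => bool) => ('a => real) => ('a => real) => bool" where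
 "adjoin Z J q f \<longleftrightarrow> (EX j h. J j & rpoly h & (ALL x:Z. f x = j x + h x * q x))"

lemma adjoinI: "J j ==> rpoly h ==> (!!x. x : Z ==> f x = j x + h x * q x) ==> adjoin Z J q f"
 unfolding adjoin_def by blast

lemma ideal_on_adjoin:
 fixes Z :: "'a::euclidean_space set"
 assumes J: "ideal_on Z J" and q: "rpoly q"
 shows "ideal_on Z (adjoin Z J q)"
 unfolding ideal_on_def
proof (intro conjI allI impI)
 fix f g :: "'a => real" assume adj: "adjoin Z J q f" "adjoin Z J q g"
 obtain j h where f: "J j" "rpoly h" "ALL x:Z. f x = j x + h x * q x" using adj(1) unfolding adjoin_def by blast
 obtain j' h' where g: "J j'" "rpoly h'" "ALL x:Z. g x = j' x + h' x * q x" using adj(2) unfolding adjoin_def by blast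
 have "J (%x. j x + j' x)" using ideal_onD(1)[OF J] f(1) g(1) by blast
 then show "adjoin Z J q (%x. f x + g x)"
  by (rule adjoinI[OF _ rpoly_add[OF f(2) g(2)]]) (simp add: f g distrib_right)
next
 show "adjoin Z J q (%_. 0)" by (rule adjoinI[of J "%_. 0" "%_. 0"]) (auto simp: ideal_onD(2)[OF J] rpoly_const)
next
 fix f k :: "'a => real" assume adj: "adjoin Z J q f" and k: "rpoly k"
 obtain j h where f: "J j" "rpoly h" "ALL x:Z. f x = j x + h x * q x" using adj unfolding adjoin_def by blast
 have "J (%x. k x * j x)" using ideal_onD(3)[OF J] f(1) k by blast
 then show "adjoin Z J q (%x. k x * f x)"
  by (rule adjoinI[OF _ rpoly_mult[OF k f(2)]]) (simp add: f distrib_left mult.assoc)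
next
 fix f g :: "'a => real" assume "ALL x:Z. f x = g x" "adjoin Z J q f"
 then show "adjoin Z J q g" unfolding adjoin_def by metis
qed

lemma adjoin_superset: "J f ==> adjoin Z J q f"
 by (rule adjoinI[of J f "%_. 0"]) (auto intro: rpoly_const)

lemma adjoin_self: "ideal_on Z J ==> adjoin Z J q q"
 by (rule adjoinI[of J "%_. 0" "%_. 1"]) (auto intro: rpoly_const ideal_onD(2))

lemma adjoin_mult:
 fixes Z :: "'a::euclidean_space set"
 assumes J: "ideal_on Z J" and p: "rpoly p" and g: "rpoly g" and pq: "J (%x. p x * q x)"
  and f: "adjoin Z J p f" and g': "adjoin Z J q g"
 shows "J (%x. f x * g x)"
proof -
 note ideal = ideal_onD[OF J]
 obtain j1 h1 where f_split: "J j1" "rpoly h1" "ALL x:Z. f x = j1 x + h1 x * p x" using f unfolding adjoin_def by blast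
 obtain j2 h2 where g_split: "J j2" "rpoly h2" "ALL x:Z. g x = j2 x + h2 x * q x" using g' unfolding adjoin_def by blast
 have "J (%x. g x * j1 x)" by (rule ideal(3)[OF f_split(1) g])
 moreover have "J (%x. (h1 x * p x) * j2 x)" by (rule ideal(3)[OF g_split(1) rpoly_mult[OF f_split(2) p]])
 moreover have "J (%x. (h1 x * h2 x) * (p x * q x))" by (rule ideal(3)[OF pq rpoly_mult[OF f_split(2) g_split(2)]])
 ultimately have "J (%x. g x * j1 x + ((h1 x * p x) * j2 x + (h1 x * h2 x) * (p x * q x)))"
  by (intro ideal(1))
 then show ?thesis by (rule ideal(4)) (simp add: f_split(3) g_split(3) algebra_simps)
qed

lemma inner_representative:
 fixes Z :: "'a::euclidean_space set"
 assumes "subspace Z"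
 shows "EX y:Z. ALL x:Z. y <.> x = g <.> x"
proof -
 obtain y z where "y : span Z" "!!w. w : span Z ==> orthogonal z w" "g = y + z"
  using orthogonal_subspace_decomp_exists by metis
 then have "y : Z" "ALL x:Z. y <.> x = g <.> x"
  using assms by (auto simp: orthogonal_def inner_add_left span_eq_iff[THEN iffD2])
 then show ?thesis by blast
qed

lemma ideal_linear_forms_subspace:
 assumes J: "ideal_on Z J"
 shows "subspace {y. J (%x. y <.> x)}"
proof -
 note ideal = ideal_onD[OF J]
 show ?thesis
 proof (rule subspaceI)
  show "0 : {y. J (%x. y <.> x)}" using ideal(4)[OF ideal(2)] by simp
  fix y z assume "y : {y. J (%x. y <.> x)}" "z : {y. J (%x. y <.> x)}"
  then have "J (%x. y <.> x + z <.> x)" using ideal(1) by blast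
  then show "y + z : {y. J (%x. y <.> x)}" by (intro CollectI, elim ideal(4)) (simp add: inner_add_left)
 next
  fix c y assume "y : {y. J (%x. y <.> x)}"
  then have "J (%x. c * (y <.> x))" using ideal(3) rpoly_const by blast
  then show "c *R y : {y. J (%x. y <.> x)}" by (intro CollectI, elim ideal(4)) simp
 qed
qed

lemma ideal_contains_linear_forms:
 fixes Z :: "'a::euclidean_space set"
 assumes Z: "subspace Z" and J: "ideal_on Z J" and G: "!!g. g : G ==> J (%x. g <.> x)"
  and no_zero: "!!x. x : Z ==> (!!g. g : G ==> g <.> x = 0) ==> x = 0"
 shows "J (%x. v <.> x)"
proof -
 note ideal = ideal_onD[OF J]
 obtain p where p: "!!g. p g : Z" "!!g x. x : Z ==> p g <.> x = g <.> x"
  using bchoice[of UNIV "%g y. y : Z & (ALL x:Z. y <.> x = g <.> x)"] inner_representative[OF Z] by blast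
 have spanZ: "span Z = Z" using Z by (rule span_eq_iff[THEN iffD2])
 have "span (p ` G) = Z"
 proof (rule ccontr)
  assume "span (p ` G) ~= Z"
  moreover have "span (p ` G) \<subseteq> Z" using p(1) Z by (intro span_minimal) auto
  ultimately have "span (p ` G) \<subset> span Z" unfolding spanZ by blast
  then obtain x where "x ~= 0" "x : span Z" "!!y. y : span (p ` G) ==> orthogonal x y"
   by (rule orthogonal_to_subspace_exists_gen) blast
  then have x: "x : Z" "x ~= 0" "!!g. g : G ==> x <.> p g = 0"
   using spanZ by (auto simp: orthogonal_def span_base)
  then show False using no_zero[of x] p(2)[OF x(1)] by (simp add: inner_commute)
 qed
 moreover have "span (p ` G) \<subseteq> {y. J (%x. y <.> x)}"
 proof (rule span_minimal[OF _ ideal_linear_forms_subspace[OF J]])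
  show "p ` G \<subseteq> {y. J (%x. y <.> x)}" using ideal(4)[OF G] p(2) by auto
 qed
 ultimately have "J (%x. p v <.> x)" using p(1) by blast
 then show ?thesis by (rule ideal(4)) (simp add: p)
qed

lemma rpoly_prod_list: "rpoly (%x::'a::euclidean_space. \<Prod>l\<leftarrow>L. l <.> x)"
 by (induction L) (auto intro: rpoly_intros)

text \<open>If the first product is \<open>l * q\<close>, then a power in \<open>J + (l)\<close> times a power in \<open>J + (q)\<close> lies in \<open>J\<close>.\<close>

lemma ideal_contains_powers:
 fixes Z :: "'a::euclidean_space set"
 assumes Z: "subspace Z" and "ideal_on Z J" and "!!g. g : G ==> J (%x. g <.> x)"
  and "!!L. L : set Ls ==> J (%x. \<Prod>l\<leftarrow>L. l <.> x)"
  and "!!x. x : Z ==> x ~= 0 ==> (!!g. g : G ==> g <.> x = 0) ==> EX L:set Ls. ALL l:set L. l <.> x ~= 0"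
 shows "EX N. J (%x. (v <.> x) ^ N)"
 using assms(2-)
proof (induction "\<Sum>L\<leftarrow>Ls. Suc (length L)" arbitrary: J G Ls rule: less_induct)
 case less
 note J = less.prems(1) and forms = less.prems(2) and prods = less.prems(3) and cover = less.prems(4)
 consider (Nil) "Ls = []" | (empty) Ls' where "Ls = [] # Ls'" | (factor) l L Ls' where "Ls = (l # L) # Ls'"
  by (metis neq_Nil_conv)
 then show ?case
 proof cases
  case Nil
  have "J (%x. v <.> x)" by (rule ideal_contains_linear_forms[OF Z J forms]) (use cover Nil in auto)
  then show ?thesis by (intro exI[of _ 1]) simp
 next
  case empty
  then have "J (%x. (v <.> x) ^ 0)" using prods[of "[]"] by simp
  then show ?thesis by blast
 next
  case factor
  let ?q = "%x. \<Prod>l\<leftarrow>L. l <.> x"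
  have "EX N. adjoin Z J (%x. l <.> x) (%x. (v <.> x) ^ N)"
  proof (rule less.hyps[of Ls' _ "insert l G"])
   show "EX L:set Ls'. ALL l:set L. l <.> x ~= 0" if "x : Z" "x ~= 0" "!!g. g : insert l G ==> g <.> x = 0" for x
    using cover[of x] that factor by fastforce
  qed (use factor forms prods adjoin_self[OF J] in \<open>auto intro: adjoin_superset ideal_on_adjoin[OF J rpoly_inner]\<close>)
  then obtain N1 where N1: "adjoin Z J (%x. l <.> x) (%x. (v <.> x) ^ N1)" ..
  have "EX N. adjoin Z J ?q (%x. (v <.> x) ^ N)"
  proof (rule less.hyps[of "L # Ls'" _ G])
   show "EX M:set (L # Ls'). ALL l:set M. l <.> x ~= 0" if "x : Z" "x ~= 0" "!!g. g : G ==> g <.> x = 0" for x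
    using cover[of x] that factor by fastforce
  qed (use factor forms prods adjoin_self[OF J] in \<open>auto intro: adjoin_superset ideal_on_adjoin[OF J rpoly_prod_list]\<close>)
  then obtain N2 where N2: "adjoin Z J ?q (%x. (v <.> x) ^ N2)" ..
  have "J (%x. (v <.> x) ^ N1 * (v <.> x) ^ N2)"
   by (rule adjoin_mult[OF J rpoly_inner rpoly_power[OF rpoly_inner] _ N1 N2]) (use prods[of "l # L"] factor in simp)
  then show ?thesis by (auto simp flip: power_add)
 qed
qed

definition generated_on :: "'a::euclidean_space set => 'j set => ('j => 'a => real) => ('a => real) => bool" where
 "generated_on Z J g f \<longleftrightarrow> (EX h. (ALL j:J. rpoly (h j)) & (ALL x:Z. f x = (SUM j:J. h j x * g j x)))"

lemma ideal_on_generated: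
 fixes Z :: "'a::euclidean_space set"
 shows "ideal_on Z (generated_on Z J g)"
 unfolding ideal_on_def
proof (intro conjI allI impI)
 fix f f' :: "'a => real" assume "generated_on Z J g f" "generated_on Z J g f'"
 then obtain h h' where "ALL j:J. rpoly (h j)" "ALL x:Z. f x = (SUM j:J. h j x * g j x)"
  "ALL j:J. rpoly (h' j)" "ALL x:Z. f' x = (SUM j:J. h' j x * g j x)" unfolding generated_on_def by blast
 then show "generated_on Z J g (%x. f x + f' x)" unfolding generated_on_def
  by (intro exI[of _ "%j x. h j x + h' j x"]) (auto simp: sum.distrib distrib_right intro: rpoly_add)
next
 show "generated_on Z J g (%_. 0)" unfolding generated_on_def by (rule exI[of _ "%_ _. 0"]) (auto intro: rpoly_const)
next
 fix f k :: "'a => real" assume "generated_on Z J g f" "rpoly k"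
 then obtain h where "ALL j:J. rpoly (h j)" "ALL x:Z. f x = (SUM j:J. h j x * g j x)"
  unfolding generated_on_def by blast
 then show "generated_on Z J g (%x. k x * f x)" unfolding generated_on_def using \<open>rpoly k\<close>
  by (intro exI[of _ "%j x. k x * h j x"]) (auto simp: sum_distrib_left mult.assoc intro: rpoly_mult)
next
 fix f f' :: "'a => real" assume "ALL x:Z. f x = f' x" "generated_on Z J g f"
 then show "generated_on Z J g f'" unfolding generated_on_def by auto
qed

lemmas generated_onD = ideal_onD[OF ideal_on_generated]

text \<open>If every monomial of high degree lies in the ideal generated by \<open>k\<close> forms of positive degree, then
 repeatedly reducing monomials shows that the polynomials of degree at most \<open>D\<close> are spanned by
 \<open>O(D ^ k)\<close> products, so \<open>k\<close> is at least the number of variables.\<close>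

locale primary_forms =
 fixes B :: "'a::euclidean_space set" and J :: "'j set" and g :: "'j => 'a => real" and d :: "'j => nat" and N :: "'a => nat"
 assumes B: "orthonormal B" and J: "finite J" and rpoly_form: "j : J ==> rpoly (g j)" and degree_pos: "j : J ==> d j > 0"
  and form_scale: "j : J ==> x : span B ==> g j (t *R x) = t ^ d j * g j x"
  and power_generated: "b : B ==> generated_on (span B) J g (%x. (b <.> x) ^ N b)"
begin

definition exponents :: "nat => (('a => nat) \<times> ('j => nat)) set" where
 "exponents n = (B \<rightarrow>\<^sub>E {..SUM b:B. N b}) \<times> (J \<rightarrow>\<^sub>E {..n})"

definition product :: "('a => nat) \<times> ('j => nat) => 'a => real" where
 "product p x = monomial_on B (fst p) x * (PROD j:J. g j x ^ snd p j)"

abbreviation product_comb :: "nat => ('a => real) => bool" where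
 "product_comb n \<equiv> lin_comb_on (span B) product (exponents n)"

abbreviation deg :: "('a => nat) => nat" where "deg mu \<equiv> SUM b:B. mu b"

lemma finite_B: "finite B" by (rule orthonormalD(1)[OF B])

lemma finite_exponents: "finite (exponents n)"
 unfolding exponents_def using finite_B J by (auto intro: finite_PiE)

lemma exponents_mono: "n <= n' ==> exponents n \<subseteq> exponents n'"
 unfolding exponents_def by (intro Sigma_mono PiE_mono) auto

lemma product_comb_times_form:
 assumes f: "product_comb n f" and j: "j : J"
 shows "product_comb (Suc n) (%x. f x * g j x)"
proof (rule lin_comb_on_times[OF f])
 fix p assume "p : exponents n"
 let ?p' = "(fst p, (snd p)(j := Suc (snd p j)))"
 have "fst p : B \<rightarrow>\<^sub>E {..SUM b:B. N b}" "snd p : J \<rightarrow>\<^sub>E {..n}"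
  using \<open>p : exponents n\<close> unfolding exponents_def by auto
 moreover from this have "(snd p)(j := Suc (snd p j)) : J \<rightarrow>\<^sub>E {..Suc n}"
  using j by (fastforce simp: PiE_iff extensional_def)
 ultimately have "?p' : exponents (Suc n)" unfolding exponents_def by simp
 then have "product_comb (Suc n) (product ?p')" by (rule lin_comb_on_base[OF finite_exponents])
 moreover have "product ?p' x = product p x * g j x" for x
 proof -
  have "(PROD i:J. g i x ^ snd ?p' i) = g j x ^ Suc (snd p j) * (PROD i:J - {j}. g i x ^ snd p i)"
   by (subst prod.remove[OF J j]) (auto intro!: prod.cong)
  also have "... = g j x * (PROD i:J. g i x ^ snd p i)"
   using prod.remove[OF J j, of "%i. g i x ^ snd p i"] by simp
  finally show ?thesis unfolding product_def by (simp add: mult_ac)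
 qed
 ultimately show "product_comb (Suc n) (%x. product p x * g j x)" by (auto elim: lin_comb_on_cong)
qed

lemma monomial_generated:
 assumes b: "b : B" "N b <= mu b"
 shows "generated_on (span B) J g (monomial_on B mu)"
proof -
 let ?\<nu> = "mu(b := mu b - N b)"
 have "generated_on (span B) J g (%x. monomial_on B ?\<nu> x * (b <.> x) ^ N b)"
  by (rule generated_onD(3)[OF power_generated[OF b(1)] rpoly_monomial_on])
 moreover have "monomial_on B mu x = monomial_on B ?\<nu> x * (b <.> x) ^ N b" for x
 proof -
  have "monomial_on (B - {b}) ?\<nu> x = monomial_on (B - {b}) mu x"
   unfolding monomial_on_def by (rule prod.cong) auto
  moreover have "(b <.> x) ^ mu b = (b <.> x) ^ ?\<nu> b * (b <.> x) ^ N b" using b(2) by (simp flip: power_add)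
  ultimately show ?thesis unfolding monomial_on_split[OF finite_B b(1)] by (simp add: mult_ac)
 qed
 ultimately show ?thesis by (auto elim: generated_onD(4))
qed

lemma generated_homogeneous:
 assumes f: "generated_on (span B) J g f" and hom: "!!t x. x : span B ==> f (t *R x) = t ^ n * f x"
 obtains G c where "!!j mu. j : J ==> mu : G j ==> deg mu + d j = n"
  "!!x. x : span B ==> f x = (SUM j:J. SUM mu:G j. c j mu * (monomial_on B mu x * g j x))"
proof -
 obtain h where h: "!!j. j : J ==> rpoly (h j)" "!!x. x : span B ==> f x = (SUM j:J. h j x * g j x)"
  using f unfolding generated_on_def by blast
 have "EX F c. finite F & (ALL x:span B. h j x = (SUM mu:F. c mu * monomial_on B mu x))" if "j : J" for j
  using rpoly_monomialsE[OF h(1)[OF that] B] by metis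
 then obtain F c where F: "!!j. j : J ==> finite (F j)"
  "!!j x. j : J ==> x : span B ==> h j x = (SUM mu:F j. c j mu * monomial_on B mu x)" by metis
 define G where "G j = {mu:F j. deg mu + d j = n}" for j
 have "f x = (SUM j:J. SUM mu:G j. c j mu * (monomial_on B mu x * g j x))" if x: "x : span B" for x
 proof -
  let ?w = "%(j, mu). c j mu * (monomial_on B mu x * g j x)" and ?d = "%(j, mu). deg mu + d j"
  have "f x = (SUM i:{i:SIGMA j:J. F j. ?d i = n}. ?w i)"
  proof (rule homogeneous_component)
   show "finite (SIGMA j:J. F j)" using J F(1) by simp
   fix t :: real
   have scaled_in_span: "t *R x : span B" using x by (rule span_scale)
   have "t ^ n * f x = (SUM j:J. (SUM mu:F j. c j mu * monomial_on B mu (t *R x)) * g j (t *R x))"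
    unfolding hom[OF x, symmetric] h(2)[OF scaled_in_span] by (rule sum.cong) (auto simp: F(2)[OF _ scaled_in_span])
   also have "... = (SUM j:J. SUM mu:F j. t ^ (deg mu + d j) * (c j mu * (monomial_on B mu x * g j x)))"
    by (rule sum.cong)
     (auto simp: form_scale[OF _ x] monomial_on_scale sum_distrib_left sum_distrib_right power_add mult_ac)
   also have "... = (SUM i:(SIGMA j:J. F j). t ^ ?d i * ?w i)"
    using J F(1) by (subst sum.Sigma) (auto simp: case_prod_beta)
   finally show "t ^ n *R f x = (SUM i:(SIGMA j:J. F j). t ^ ?d i *R ?w i)" by simp
  qed
  also have "{i:SIGMA j:J. F j. ?d i = n} = (SIGMA j:J. G j)" by (auto simp: G_def)
  also have "(SUM i:(SIGMA j:J. G j). ?w i) = (SUM j:J. SUM mu:G j. c j mu * (monomial_on B mu x * g j x))"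
   using J F(1) by (subst sum.Sigma) (auto simp: G_def)
  finally show ?thesis .
 qed
 then show ?thesis using that[of G c] by (simp add: G_def)
qed

lemma monomial_product_comb: "product_comb (deg mu) (monomial_on B mu)"
proof (induction "deg mu" arbitrary: mu rule: less_induct)
 case less
 show ?case
 proof (cases "EX b:B. N b <= mu b")
  case False
  let ?p = "(restrict mu B, restrict (%_. 0) J)"
  have "mu b <= (SUM b:B. N b)" if "b : B" for b
   using that False member_le_sum[of b B N] finite_B by force
  then have "?p : exponents (deg mu)" unfolding exponents_def by auto
  then have "product_comb (deg mu) (product ?p)" by (rule lin_comb_on_base[OF finite_exponents])
  then show ?thesis by (rule lin_comb_on_cong) (simp add: product_def monomial_on_def)
 next
  case True
  then have "generated_on (span B) J g (monomial_on B mu)" using monomial_generated by blast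
  from this monomial_on_scale
  obtain G c where deg_eq: "!!j \<nu>. j : J ==> \<nu> : G j ==> deg \<nu> + d j = deg mu"
   and eq: "!!x. x : span B ==> monomial_on B mu x = (SUM j:J. SUM \<nu>:G j. c j \<nu> * (monomial_on B \<nu> x * g j x))"
   by (rule generated_homogeneous) blast
  have "product_comb (deg mu) (%x. SUM j:J. SUM \<nu>:G j. c j \<nu> * (monomial_on B \<nu> x * g j x))"
  proof (intro lin_comb_on_sum lin_comb_on_scale)
   fix j \<nu> assume j: "j : J" and "\<nu> : G j"
   then have deg_less: "deg \<nu> < deg mu" using degree_pos[OF j] deg_eq by fastforce
   show "product_comb (deg mu) (%x. monomial_on B \<nu> x * g j x)"
    by (rule lin_comb_on_mono[OF product_comb_times_form[OF less[OF deg_less] j] exponents_mono finite_exponents])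
     (use deg_less in simp)
  qed
  then show ?thesis by (rule lin_comb_on_cong) (rule eq)
 qed
qed

lemma card_monomials_le: "Suc D ^ card B <= Suc (SUM b:B. N b) ^ card B * Suc (card B * D) ^ card J"
proof -
 let ?M = "B \<rightarrow>\<^sub>E {..D}"
 have fin: "finite ?M" using finite_B by (auto intro: finite_PiE)
 have "card ?M <= card (exponents (card B * D))"
 proof (rule lin_comb_on_card_le[OF finite_exponents fin])
  fix mu assume "mu : ?M"
  then have "deg mu <= (SUM b:B. D)" by (intro sum_mono) auto
  then show "lin_comb_on (span B) product (exponents (card B * D)) (monomial_on B mu)"
   by (intro lin_comb_on_mono[OF monomial_product_comb exponents_mono finite_exponents]) simp
 next
  fix c mu assume zero: "!!x. x : span B ==> (SUM mu:?M. c mu * monomial_on B mu x) = (0::real)" and mu: "mu : ?M"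
  show "c mu = 0"
  proof (rule monomial_on_independent[OF B fin _ zero mu])
   show "mu = \<nu>" if "mu : ?M" "\<nu> : ?M" "ALL b:B. mu b = \<nu> b" for mu \<nu> using that by (metis PiE_ext)
  qed
 qed
 then show ?thesis using finite_B J by (simp add: card_PiE exponents_def card_cartesian_product)
qed

lemma card_B_le_card_J: "card B <= card J"
proof (rule ccontr)
 let ?s = "card B" and ?k = "card J" and ?N = "Suc (SUM b:B. N b)"
 assume less: "~ ?s <= ?k"
 define D where "D = ?N ^ ?s * Suc ?s ^ ?k"
 have "?N ^ ?s * Suc (?s * D) ^ ?k <= ?N ^ ?s * (Suc ?s * Suc D) ^ ?k"
  by (intro mult_left_mono power_mono) auto
 also have "... = D * Suc D ^ ?k" by (simp only: D_def power_mult_distrib mult.assoc)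
 also have "... < Suc D ^ Suc ?k" by simp
 also have "... <= Suc D ^ ?s" by (rule power_increasing) (use less in auto)
 finally show False using card_monomials_le[of D] by simp
qed

end

lemma dim_le_card_forms:
 fixes Z :: "'a::euclidean_space set" and g :: "'j => 'a => real"
 assumes Z: "subspace Z" and J: "finite J"
  and g: "!!j. j : J ==> rpoly (g j)" "!!j. j : J ==> d j > 0"
   "!!j x t. j : J ==> x : Z ==> g j (t *R x) = t ^ d j * g j x"
  and Ls: "finite \<L>" "!!L. L : \<L> ==> finite L" "!!L. L : \<L> ==> generated_on Z J g (%x. PROD l:L. l <.> x)"
  and cover: "!!x. x : Z ==> x ~= 0 ==> EX L:\<L>. ALL l:L. l <.> x ~= 0"
 shows "dim Z <= card J"
proof -
 obtain B where onb: "orthonormal B" "span B = Z" "card B = dim Z" using orthonormal_basis_exists[OF Z] .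
 have "ALL L:\<L>. EX l. set l = L & distinct l" using Ls(2) finite_distinct_list by blast
 then obtain enum where enum: "!!L. L : \<L> ==> set (enum L) = L & distinct (enum L)" by metis
 obtain Ls' where Ls': "set Ls' = \<L>" using finite_list[OF Ls(1)] by blast
 have "EX N. generated_on Z J g (%x. (v <.> x) ^ N)" for v
 proof (rule ideal_contains_powers[OF Z ideal_on_generated, where G="{}" and Ls="map enum Ls'"])
  fix l assume "l : set (map enum Ls')"
  then obtain L where L: "L : \<L>" "l = enum L" using Ls' by auto
  then have "(\<Prod>l\<leftarrow>l. l <.> x) = (PROD l:L. l <.> x)" for x using enum by (metis prod.distinct_set_conv_list)
  then show "generated_on Z J g (%x. \<Prod>l\<leftarrow>l. l <.> x)" using Ls(3)[OF L(1)] by simp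
 next
  fix x assume "x : Z" "x ~= 0"
  then show "EX L:set (map enum Ls'). ALL l:set L. l <.> x ~= 0"
   using cover enum Ls' by (metis (no_types, lifting) image_eqI set_map)
 qed simp
 then obtain N where "!!v. generated_on Z J g (%x. (v <.> x) ^ N v)" by metis
 then interpret primary_forms B J g d N
  using onb J g by unfold_locales auto
 show ?thesis using card_B_le_card_J onb(3) by simp
qed

section \<open>Tangent fields and the addition theorem\<close>

definition tangent_fields :: "'e::euclidean_space set => 'e set => ('e => 'e) set" where
 "tangent_fields U A = {th. polynomial_function th & (ALL x. th x : U) & (ALL K:A. ALL x. K <.> x = 0 --> K <.> th x = 0)}"

definition arr :: "'e::euclidean_space set => bool" where
 "arr A \<longleftrightarrow> finite A & 0 ~: A & (ALL K:A. ALL L:A. K : span {L} --> K = L)"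

text \<open>A transversal picks one hyperplane out of each class of hyperplanes having the same intersection
 with the kernel of \<open>a\<close>.\<close>

definition transversal :: "'e::euclidean_space set => 'e set => 'e => bool" where
 "transversal A C a \<longleftrightarrow> C \<subseteq> A & (ALL K:A. EX c:C. K : span {a, c}) & (ALL c:C. ALL c':C. c : span {a, c'} --> c = c')"

definition homogeneous_generators ::
 "'e::euclidean_space set => 'e set => 'i set => ('i => nat) => ('i => 'e => 'e) => bool" where
 "homogeneous_generators U A I e th \<longleftrightarrow> finite I &
   (ALL i:I. th i : tangent_fields U A & (ALL t x. th i (t *R x) = t ^ e i *R th i x)) &
   (ALL et:tangent_fields U A. EX f. (ALL i:I. rpoly (f i)) & (ALL x. et x = (SUM i:I. f i x *R th i x)))"

definition free_basis :: "'e::euclidean_space set => 'e set => 'i set => ('i => nat) => ('i => 'e => 'e) => bool" where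
 "free_basis U A I e th \<longleftrightarrow> homogeneous_generators U A I e th &
   (ALL f. (ALL i:I. rpoly (f i)) --> (ALL x. (SUM i:I. f i x *R th i x) = 0) --> (ALL i:I. ALL x. f i x = 0))"

text \<open>A field of this kind takes on \<open>a\<close>, along the kernel of \<open>a\<close>, exactly the value of Terao's polynomial \<open>b\<close>.\<close>

definition unit_on :: "'e::euclidean_space set => 'e set => 'e set => 'e => bool" where
 "unit_on U A C a \<longleftrightarrow> (EX et:tangent_fields U A. ALL y. a <.> y = 0 --> a <.> et y = (PROD K:A - C. K <.> y))"

lemma tangent_fieldsD:
 assumes "th : tangent_fields U A"
 shows "polynomial_function th" "th x : U" "K : A ==> K <.> x = 0 ==> K <.> th x = 0" "rpoly (%x. u <.> th x)"
 using assms unfolding tangent_fields_def polynomial_function_inner_iff by auto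

lemma tangent_fieldsI:
 assumes "!!u. rpoly (%x. u <.> th x)" "!!x. th x : U" "!!K x. K : A ==> K <.> x = 0 ==> K <.> th x = 0"
 shows "th : tangent_fields U A"
 using assms unfolding tangent_fields_def polynomial_function_inner_iff by auto

lemma tangent_fields_add:
 assumes "subspace U" "th : tangent_fields U A" "et : tangent_fields U A"
 shows "(%x. th x + et x) : tangent_fields U A"
 by (rule tangent_fieldsI)
   (use assms in \<open>auto simp: inner_add_right tangent_fieldsD subspace_add intro: rpoly_add\<close>)

lemma tangent_fields_mult:
 assumes "subspace U" "th : tangent_fields U A" "rpoly f"
 shows "(%x. f x *R th x) : tangent_fields U A"
 by (rule tangent_fieldsI)
   (use assms in \<open>auto simp: tangent_fieldsD subspace_scale intro: rpoly_mult\<close>)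

lemma tangent_fields_mult_ext:
 assumes "subspace U" "th : tangent_fields U A" "rpoly f"
  and "!!K x. K : B ==> K ~: A ==> K <.> x = 0 ==> f x = 0"
 shows "(%x. f x *R th x) : tangent_fields U B"
proof (rule tangent_fieldsI)
 fix K x assume "K : B" "K <.> x = 0"
 then show "K <.> f x *R th x = 0"
  using assms tangent_fieldsD(3)[OF assms(2), of K x] by (cases "K : A") auto
qed (use assms in \<open>auto simp: tangent_fieldsD subspace_scale intro: rpoly_mult\<close>)

lemma tangent_fields_antimono: "B \<subseteq> A ==> tangent_fields U A \<subseteq> tangent_fields U B"
 unfolding tangent_fields_def by auto

lemma separating_vector:
 fixes k :: "'e::euclidean_space"
 assumes "k ~: span T"
 shows "EX x. (ALL t:T. t <.> x = 0) & k <.> x ~= 0"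
proof -
 obtain y z where yz: "y : span T" "!!w. w : span T ==> orthogonal z w" "k = y + z"
  using orthogonal_subspace_decomp_exists[of T k] by metis
 have "z ~= 0" using yz assms by auto
 then have "k <.> z ~= 0" using yz by (simp add: inner_add_left orthogonal_def inner_commute[of y])
 moreover have "ALL t:T. t <.> z = 0" using yz(2) by (simp add: orthogonal_def span_base inner_commute)
 ultimately show ?thesis by blast
qed

lemma span_pairE:
 assumes "k : span {a, c}"
 obtains u v where "k = u *R a + v *R (c::'e::euclidean_space)"
proof -
 obtain u where "k - u *R a : span {c}" using assms span_breakdown_eq[of k a "{c}"] by auto
 then obtain v where "k - u *R a = v *R c" by (auto simp: span_singleton)
 then show ?thesis using that[of u v] by (simp add: algebra_simps)
qed

lemma span_pairI: "u *R a + v *R c : span {a, c}"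
 by (intro span_add span_scale span_base) auto

lemma arrD:
 assumes "arr A"
 shows "finite A" "K : A ==> K ~= 0" "K : A ==> L : A ==> K ~= L ==> K ~: span {L}"
 using assms unfolding arr_def by auto

lemma arr_class:
 assumes A: "arr (insert a A)" "a ~: A" and K: "K : A" and c: "c : A" "K : span {a, c}"
 obtains u v where "K = u *R a + v *R c" "v ~= 0" "K ~= c ==> u ~= 0"
proof -
 obtain u v where uv: "K = u *R a + v *R c" using c(2) by (rule span_pairE)
 have "K ~: span {a}" using arrD(3)[OF A(1), of K a] K A(2) by auto
 then have "v ~= 0" using uv by (auto simp: span_singleton)
 moreover have "u ~= 0" if "K ~= c"
 proof
  assume "u = 0"
  then have "K : span {c}" using uv by (auto simp: span_singleton)
  then show False using arrD(3)[OF A(1), of K c] K c that by auto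
 qed
 ultimately show ?thesis using that uv by blast
qed

lemma arr_class_sym:
 assumes A: "arr (insert a A)" "a ~: A" and K: "K : A" and c: "c : A" "K : span {a, c}"
 shows "c : span {a, K}"
proof -
 obtain u v where "K = u *R a + v *R c" "v ~= 0" using arr_class[OF assms] by metis
 then have "c = (- (u / v)) *R a + (1 / v) *R K" by (simp add: algebra_simps)
 then show ?thesis by (metis span_pairI)
qed

lemma span_pair_trans:
 assumes "k : span {a, l}" "l : span {a, m}"
 shows "k : span {a, m}"
proof -
 have "{a, l} \<subseteq> span {a, m}" using assms by (auto intro: span_base)
 then have "span {a, l} \<subseteq> span {a, m}" by (rule span_minimal) simp
 then show ?thesis using assms by blast
qed

lemma transversal_exists:
 assumes A: "arr (insert a A)" "a ~: A"
 shows "EX C. transversal A C a"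
proof -
 define r where "r K = (SOME L. L : A & L : span {a, K})" for K
 have r: "r K : A & r K : span {a, K}" if "K : A" for K
  unfolding r_def by (rule someI[of _ K]) (use that in \<open>auto intro: span_base\<close>)
 have class_eq: "{L. L : A & L : span {a, K}} = {L. L : A & L : span {a, K'}}" if "K : A" "K' : A" "K : span {a, K'}" for K K'
  using arr_class_sym[OF A that] that span_pair_trans by blast
 have r_eq: "r K = r K'" if "K : A" "K' : A" "K : span {a, K'}" for K K'
  unfolding r_def using class_eq[OF that] by (metis (mono_tags, lifting) mem_Collect_eq)
 have "transversal A (r ` A) a"
  unfolding transversal_def
 proof (intro conjI ballI impI)
  show "r ` A \<subseteq> A" using r by auto
  fix K assume K: "K : A"
  show "EX c:r ` A. K : span {a, c}" using r[OF K] arr_class_sym[OF A _ K] K by blast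
 next
  fix c c' assume "c : r ` A" "c' : r ` A" and s: "c : span {a, c'}"
  then obtain K K' where K: "K : A" "c = r K" "K' : A" "c' = r K'" by blast
  have "K : span {a, c}" using r[OF K(1)] arr_class_sym[OF A _ K(1)] K by blast
  then have "K : span {a, K'}" using s r[OF K(3)] K span_pair_trans by metis
  then show "c = c'" using r_eq K by metis
 qed
 then show ?thesis by blast
qed

locale restriction =
 fixes A C :: "'e::euclidean_space set" and a :: 'e
 assumes A: "arr (insert a A)" "a ~: A" and C: "transversal A C a"
begin

abbreviation "H \<equiv> {x. a <.> x = 0}"
abbreviation "b x \<equiv> (PROD K:A - C. K <.> x)"

definition siblings :: "'e => 'e set" where "siblings c = {K:A. K : span {a, c}} - {c}"

lemma finite_A: "finite A" using arrD(1)[OF A(1)] by simp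

lemma C_subset: "C \<subseteq> A" using C by (simp add: transversal_def)

lemma finite_C: "finite C" using C_subset finite_A by (rule finite_subset)

lemma finite_siblings: "finite (siblings c)" using finite_A by (simp add: siblings_def)

lemma siblings_subset: "siblings c \<subseteq> A" by (auto simp: siblings_def)

lemma normal_nonzero: "a ~= 0" using arrD(2)[OF A(1)] by simp

lemma subspace_H: "subspace H" by (simp add: subspace_hyperplane)

lemma not_span_normal: "K : A ==> K ~: span {a}" using arrD(3)[OF A(1), of K a] A(2) by auto

lemma nonzero_on_H: "K : A ==> EX x:H. K <.> x ~= 0" using separating_vector[OF not_span_normal] by auto

lemma b_nonzero: "EX z:H. b z ~= 0"
 by (rule prod_linear_nonzero[OF subspace_H]) (use nonzero_on_H finite_A in auto)

lemma Union_siblings: "(UN c:C. siblings c) = A - C"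
proof (intro equalityI subsetI)
 fix K assume "K : (UN c:C. siblings c)"
 then obtain c where "c : C" "K : A" "K : span {a, c}" "K ~= c" by (auto simp: siblings_def)
 then show "K : A - C" using C unfolding transversal_def by blast
next
 fix K assume "K : A - C"
 then show "K : (UN c:C. siblings c)" using C unfolding transversal_def siblings_def by blast
qed

lemma siblings_not_span:
 assumes c: "c : C" "c' : C" "c ~= c'" and l: "l : siblings c" "l' : siblings c'"
 shows "l ~: span {a, l'}"
proof
 assume "l : span {a, l'}"
 moreover have "c : span {a, l}"
  using arr_class_sym[OF A, of l c] l(1) c(1) C_subset by (auto simp: siblings_def)
 ultimately have "c : span {a, c'}"
  using l(2) span_pair_trans by (metis (mono_tags, lifting) DiffD1 siblings_def mem_Collect_eq)
 then show False using C c unfolding transversal_def by blast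
qed

text \<open>On \<open>H\<close>, \<open>a \<bullet> \<theta>\<close> agrees with \<open>a \<bullet> \<theta> - (a \<bullet> x) q\<close>, where \<open>c \<bullet> \<theta> = (c \<bullet> x) q\<close>, and the latter vanishes on the
 kernel of every sibling of \<open>c\<close>.\<close>

lemma factor_siblings:
 assumes th: "th : tangent_fields U A" and c: "c : C"
 shows "EX g. rpoly g & (ALL x:H. a <.> th x = (PROD K:siblings c. K <.> x) * g x)"
proof -
 have c_in_A: "c : A" using c C_subset by blast
 obtain q where q: "rpoly q" "ALL x:UNIV. c <.> th x = (c <.> x) * q x"
  using rpoly_divide_linear[OF tangent_fieldsD(4)[OF th] subspace_UNIV, of c c] tangent_fieldsD(3)[OF th c_in_A] by auto
 let ?f = "%x. a <.> th x - (a <.> x) * q x"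
 have "EX g. rpoly g & (ALL x:UNIV. ?f x = (PROD K:siblings c. K <.> x) * g x)"
 proof (rule rpoly_divide_by_prod[OF subspace_UNIV finite_siblings])
  show "rpoly ?f" by (intro rpoly_intros tangent_fieldsD(4)[OF th] q)
  fix K x assume K: "K : siblings c" and K_x: "K <.> x = 0"
  then have K_sibling: "K : A" "K : span {a, c}" "K ~= c" by (auto simp: siblings_def)
  obtain u v where uv: "K = u *R a + v *R c" "u ~= 0" using arr_class[OF A K_sibling(1) c_in_A K_sibling(2)] K_sibling(3) by metis
  have "u * (a <.> th x) + v * (c <.> th x) = 0"
   using tangent_fieldsD(3)[OF th K_sibling(1) K_x] uv(1) by (simp add: inner_add_left)
  moreover have "u * (a <.> x) + v * (c <.> x) = 0" using K_x uv(1) by (simp add: inner_add_left)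
  ultimately have "u * (a <.> th x) = u * ((a <.> x) * q x)" using q(2)
   by (metis (no_types, opaque_lifting) UNIV_I add_right_cancel distrib_right mult.assoc mult_zero_left)
  then show "?f x = 0" using uv(2) by simp
 next
  fix K L assume "K : siblings c" "L : siblings c" "K ~= L"
  then have "L ~: span {K}" using arrD(3)[OF A(1), of L K] by (auto simp: siblings_def)
  then show "EX x:UNIV. K <.> x = 0 & L <.> x ~= 0" using separating_vector[of L "{K}"] by auto
 qed
 then obtain g where "rpoly g" "ALL x. ?f x = (PROD K:siblings c. K <.> x) * g x" by auto
 then show ?thesis by (intro exI[of _ g]) (metis (mono_tags, lifting) diff_zero mem_Collect_eq mult_zero_left)
qed

lemma factor_Union_siblings:
 assumes th: "th : tangent_fields U A" and F: "finite F" "F \<subseteq> C"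
 shows "EX g. rpoly g & (ALL x:H. a <.> th x = (PROD K:(UN c:F. siblings c). K <.> x) * g x)"
 using F
proof (induction F rule: finite_induct)
 case empty
 show ?case by (rule exI[of _ "%x. a <.> th x"]) (simp add: tangent_fieldsD(4)[OF th])
next
 case (insert c F)
 let ?F = "UN c:F. siblings c"
 obtain g1 where g1: "rpoly g1" "ALL x:H. a <.> th x = (PROD K:?F. K <.> x) * g1 x" using insert by auto
 obtain g2 where g2: "rpoly g2" "ALL x:H. a <.> th x = (PROD K:siblings c. K <.> x) * g2 x"
  using factor_siblings[OF th] insert.prems by blast
 have not_span: "l ~: span {a, l'}" if "l : ?F" "l' : siblings c" for l l'
  using siblings_not_span[of _ c l l'] insert.prems insert.hyps that by blast
 have "EX g. rpoly g & (ALL x:H. a <.> th x = (PROD K:?F Un siblings c. K <.> x) * g x)"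
 proof (rule rpoly_divide_coprime[OF subspace_H _ finite_siblings _ g1(1) _ g2(1)])
  show "finite ?F" using insert.hyps finite_siblings by auto
  show "?F Int siblings c = {}"
  proof (rule ccontr)
   assume "?F Int siblings c ~= {}"
   then obtain l where "l : ?F" "l : siblings c" by blast
   from not_span[OF this] show False by (auto intro: span_base)
  qed
  show "EX x:H. l' <.> x = 0 & l <.> x ~= 0" if "l : ?F" "l' : siblings c" for l l'
   using separating_vector[OF not_span[OF that]] by auto
  show "EX x:H. l <.> x ~= 0" if "l : siblings c" for l using nonzero_on_H that siblings_subset by blast
 qed (use g1 g2 in auto)
 then show ?case by (simp add: Un_commute)
qed

lemma tangent_field_factor:
 assumes "th : tangent_fields U A"
 shows "EX g. rpoly g & (ALL x. a <.> x = 0 --> a <.> th x = b x * g x)"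
 using factor_Union_siblings[OF assms finite_C subset_refl] by (simp add: Union_siblings)

end

lemma degree_of_factor:
 fixes a :: "'e::euclidean_space"
 assumes L: "finite L" "!!l. l : L ==> l ~: span {a}" and j: "rpoly j"
  and eq: "!!x. a <.> x = 0 ==> f x = (PROD l:L. l <.> x) * j x"
  and hom: "!!t x. f (t *R x) = t ^ e * f x" and x: "a <.> x = 0"
 shows "e < card L ==> j x = 0" "card L <= e ==> j (t *R x) = t ^ (e - card L) * j x"
proof -
 let ?H = "{x. a <.> x = 0}" and ?d = "card L"
 let ?b = "%x. PROD l:L. l <.> x"
 have H: "subspace ?H" by (simp add: subspace_hyperplane)
 have "EX z:?H. ?b z ~= 0"
 proof (rule prod_linear_nonzero[OF H L(1)])
  fix l assume "l : L"
  then show "EX x:?H. l <.> x ~= 0" using separating_vector[OF L(2)] by auto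
 qed
 then obtain z where z: "z : ?H" "?b z ~= 0" by blast
 have scaled: "t ^ ?d * j (t *R x) = t ^ e * j x" for t
 proof (rule rpoly_cancel[where b="?b", OF rpoly_prod_inner _ _ H _ z])
  have bl: "bounded_linear (%x::'e. t *R x)" by (rule bounded_linear_scaleR_right)
  show "rpoly (%x. t ^ ?d * j (t *R x))" by (intro rpoly_mult rpoly_const rpoly_compose_linear[OF j bl])
  show "rpoly (%x. t ^ e * j x)" by (intro rpoly_mult rpoly_const j)
  fix y assume y: "y : ?H"
  have "?b (t *R y) = t ^ ?d * ?b y" by (simp add: prod.distrib)
  moreover have "f (t *R y) = ?b (t *R y) * j (t *R y)" "f y = ?b y * j y" using y by (intro eq; simp)+
  ultimately show "?b y * (t ^ ?d * j (t *R y)) = ?b y * (t ^ e * j y)" using hom[of t y] by (auto simp: mult_ac)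
 qed (use x in auto)
 obtain p where p: "ALL t. j (0 + t *R x) = poly p t" using rpoly_line[OF j] by blast
 have "poly (Polynomial.monom 1 ?d * p) t = poly (Polynomial.monom (j x) e) t" for t
  using scaled[of t] p by (simp add: poly_monom mult.commute)
 then have poly_eq: "Polynomial.monom 1 ?d * p = Polynomial.monom (j x) e" using poly_eq_poly_eq_iff by blast
 show "j x = 0" if "e < ?d"
  using arg_cong[OF poly_eq, of "%p. coeff p e"] that by (simp add: coeff_monom_mult)
 show "j (t *R x) = t ^ (e - ?d) * j x" if "?d <= e"
 proof -
  have "Polynomial.monom 1 ?d * p = Polynomial.monom 1 ?d * Polynomial.monom (j x) (e - ?d)"
   using poly_eq that by (simp add: mult_monom)
  then have "p = Polynomial.monom (j x) (e - ?d)" by simp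
  then show ?thesis using p by (simp add: poly_monom mult.commute)
 qed
qed

lemma free_basisD:
 assumes "free_basis U A I e th"
 shows "finite I" "i : I ==> th i : tangent_fields U A" "i : I ==> th i (t *R x) = t ^ e i *R th i x"
  "et : tangent_fields U A ==> EX f. (ALL i:I. rpoly (f i)) & (ALL x. et x = (SUM i:I. f i x *R th i x))"
  "(!!i. i : I ==> rpoly (f i)) ==> (!!x. (SUM i:I. f i x *R th i x) = 0) ==> i : I ==> f i x = 0"
proof -
 note basis = assms[unfolded free_basis_def homogeneous_generators_def]
 show "finite I" "i : I ==> th i : tangent_fields U A" "i : I ==> th i (t *R x) = t ^ e i *R th i x"
  using basis by simp_all
 show "et : tangent_fields U A ==> EX f. (ALL i:I. rpoly (f i)) & (ALL x. et x = (SUM i:I. f i x *R th i x))"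
  using basis by simp
 show "(!!i. i : I ==> rpoly (f i)) ==> (!!x. (SUM i:I. f i x *R th i x) = 0) ==> i : I ==> f i x = 0"
  using basis[THEN conjunct2, rule_format, of f i x] by blast
qed

locale addition = restriction A C a
 for A C :: "'e::euclidean_space set" and a :: 'e +
 fixes U :: "'e set" and I :: "'i set" and e :: "'i => nat" and th :: "'i => 'e => 'e" and d :: nat
 assumes U: "subspace U" and basis: "free_basis U A I e th" and d: "d = card (A - C)"
begin

lemma finite_I: "finite I" by (rule free_basisD(1)[OF basis])

definition quotients :: "('i => 'e => real) => bool" where
 "quotients j \<longleftrightarrow> (ALL i:I. rpoly (j i) & (ALL x. a <.> x = 0 --> a <.> th i x = b x * j i x & (e i < d --> j i x = 0) &
   (d <= e i --> (ALL t. j i (t *R x) = t ^ (e i - d) * j i x))))"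

lemma quotientsD:
 assumes "quotients j" "i : I"
 shows "rpoly (j i)" "a <.> x = 0 ==> a <.> th i x = b x * j i x" "a <.> x = 0 ==> e i < d ==> j i x = 0"
  "a <.> x = 0 ==> d <= e i ==> j i (t *R x) = t ^ (e i - d) * j i x"
 using assms unfolding quotients_def by simp_all

lemma quotients_exist: "EX j. quotients j"
proof -
 have "ALL i:I. EX g. rpoly g & (ALL x. a <.> x = 0 --> a <.> th i x = b x * g x)"
  using tangent_field_factor[OF free_basisD(2)[OF basis]] by blast
 then obtain j where j: "!!i. i : I ==> rpoly (j i)" "!!i x. i : I ==> a <.> x = 0 ==> a <.> th i x = b x * j i x"
  by metis
 have fin: "finite (A - C)" and not_span: "!!l. l : A - C ==> l ~: span {a}" using finite_A not_span_normal by auto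
 have hom: "a <.> th i (t *R x) = t ^ e i * (a <.> th i x)" if "i : I" for i t x
  using free_basisD(3)[OF basis that] by simp
 have "quotients j"
  unfolding quotients_def
 proof (intro ballI conjI allI impI)
  fix i x t assume i: "i : I" and x: "a <.> x = 0"
  note degree = degree_of_factor[OF fin not_span j(1)[OF i] j(2)[OF i] hom[OF i] x]
  show "j i x = 0" if "e i < d" using degree(1) that d by simp
  show "j i (t *R x) = t ^ (e i - d) * j i x" if "d <= e i" using degree(2) that d by simp
 qed (use j in auto)
 then show ?thesis by blast
qed

lemma combination_on_H:
 assumes j: "quotients j" and f: "!!i. i : I ==> rpoly (f i)" "!!x. et x = (SUM i:I. f i x *R th i x)"
  and q: "rpoly q" "!!x. a <.> x = 0 ==> a <.> et x = b x * q x" and x: "a <.> x = 0"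
 shows "(SUM i:I. f i x * j i x) = q x"
proof -
 obtain z where z: "z : H" "b z ~= 0" using b_nonzero by blast
 show ?thesis
 proof (rule rpoly_cancel[where b="b", OF rpoly_prod_inner _ _ subspace_H _ z])
  show "rpoly (%x. SUM i:I. f i x * j i x)" by (intro rpoly_sum rpoly_mult f quotientsD(1)[OF j])
  fix y assume "y : H"
  then have y: "a <.> y = 0" by simp
  have "b y * (SUM i:I. f i y * j i y) = (SUM i:I. f i y * (a <.> th i y))"
   by (simp add: sum_distrib_left quotientsD(2)[OF j _ y] mult_ac)
  also have "... = a <.> et y" unfolding f(2) by (simp add: inner_sum_right)
  finally show "b y * (SUM i:I. f i y * j i y) = b y * q y" using q(2)[OF y] by simp
 qed (use x q in auto)
qed

definition pivot :: "('i => 'e => real) => 'i => bool" where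
 "pivot j i \<longleftrightarrow> quotients j & i : I & e i = d & j i 0 ~= 0"

lemma unit_imp_pivot:
 assumes "unit_on U A C a"
 obtains j i where "pivot j i"
proof -
 obtain et where et: "et : tangent_fields U A" "!!x. a <.> x = 0 ==> a <.> et x = b x"
  using assms unfolding unit_on_def by blast
 obtain j where j: "quotients j" using quotients_exist by blast
 obtain f where f: "!!i. i : I ==> rpoly (f i)" "!!x. et x = (SUM i:I. f i x *R th i x)"
  using free_basisD(4)[OF basis et(1)] by blast
 have "(SUM i:I. f i 0 * j i 0) = 1"
  by (rule combination_on_H[OF j f rpoly_const]) (use et(2) in auto)
 then have "EX i:I. f i 0 * j i 0 ~= 0" using sum.neutral[of I "%i. f i 0 * j i 0"] by fastforce
 then obtain i where i: "i : I" "j i 0 ~= 0" by auto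
 have "~ e i < d" using quotientsD(3)[OF j i(1), of 0] i(2) by auto
 moreover have "~ d < e i" using quotientsD(4)[OF j i(1), of 0 0] i(2) by (auto simp: power_0_left)
 ultimately show ?thesis using that j i unfolding pivot_def by auto
qed

lemma pivot_imp_unit:
 assumes "pivot j i"
 shows "unit_on U A C a"
 unfolding unit_on_def
proof (intro bexI allI impI)
 have j: "quotients j" and i: "i : I" "e i = d" "j i 0 ~= 0" using assms by (auto simp: pivot_def)
 show "(%x. (1 / j i 0) *R th i x) : tangent_fields U A"
  by (intro tangent_fields_mult[OF U] free_basisD(2)[OF basis] i rpoly_const)
 fix y assume y: "a <.> y = 0"
 have "j i 0 = j i y" using quotientsD(4)[OF j i(1) y, of 0] i by simp
 then show "a <.> (1 / j i 0) *R th i y = b y" using quotientsD(2)[OF j i(1) y] i by simp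
qed

text \<open>The local field at \<open>x\<close>, multiplied by the hyperplanes missing \<open>x\<close>, becomes a global one.\<close>

lemma missing_hyperplanes_generated:
 assumes j: "quotients j" and Ip: "Ip \<subseteq> I" "!!i y. i : I - Ip ==> y : Z ==> j i y = 0"
  and Z: "Z \<subseteq> H" and loc: "unit_on U {K:A. K <.> x = 0} {K:C. K <.> x = 0} a"
 shows "generated_on Z Ip j (%y. PROD K:{K:C. K <.> x ~= 0}. K <.> y)"
proof -
 let ?q = "%y. PROD K:{K:C. K <.> x ~= 0}. K <.> y"
 have diff_eq: "{K:A. K <.> x = 0} - {K:C. K <.> x = 0} = {K:A - C. K <.> x = 0}" by auto
 obtain et where et: "et : tangent_fields U {K:A. K <.> x = 0}"
  "!!y. a <.> y = 0 ==> a <.> et y = (PROD K:{K:A - C. K <.> x = 0}. K <.> y)" using loc unfolding unit_on_def diff_eq by blast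
 define r where "r y = (PROD K:{K:A. K <.> x ~= 0}. K <.> y)" for y
 have global: "(%y. r y *R et y) : tangent_fields U A"
 proof (rule tangent_fields_mult_ext[OF U et(1)])
  show "rpoly r" unfolding r_def by (rule rpoly_prod_inner)
  show "r y = 0" if "K : A" "K ~: {K : A. K <.> x = 0}" "K <.> y = 0" for K y
   unfolding r_def using that finite_A by (intro prod_zero) auto
 qed
 have on_H: "a <.> r y *R et y = b y * ?q y" if y: "a <.> y = 0" for y
 proof -
  have "{K:A. K <.> x ~= 0} Un {K:A - C. K <.> x = 0} = (A - C) Un {K:C. K <.> x ~= 0}"
   using C unfolding transversal_def by auto
  then have "r y * (PROD K:{K:A - C. K <.> x = 0}. K <.> y) = b y * ?q y"
   unfolding r_def using finite_A finite_C by (subst (1 2) prod.union_disjoint[symmetric]) auto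
  then show ?thesis using et(2)[OF y] by simp
 qed
 obtain f where f: "!!i. i : I ==> rpoly (f i)" "!!x. r x *R et x = (SUM i:I. f i x *R th i x)"
  using free_basisD(4)[OF basis global] by blast
 have "?q y = (SUM i:Ip. f i y * j i y)" if y: "y : Z" for y
 proof -
  have "?q y = (SUM i:I. f i y * j i y)"
   by (rule combination_on_H[OF j f rpoly_prod_inner on_H, symmetric]) (use y Z in auto)
  also have "... = (SUM i:Ip. f i y * j i y)" by (rule sum.mono_neutral_right[OF finite_I]) (use Ip y in auto)
  finally show ?thesis .
 qed
 then show ?thesis unfolding generated_on_def by (intro exI[of _ f]) (use f Ip in auto)
qed

lemma local_to_global:
 assumes W: "subspace W" and few: "card {i:I. e i > d} < dim {x:W. a <.> x = 0}"
  and loc: "!!x. x : W ==> a <.> x = 0 ==> x ~= 0 ==> unit_on U {K:A. K <.> x = 0} {K:C. K <.> x = 0} a"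
 shows "unit_on U A C a"
proof -
 obtain j where j: "quotients j" using quotients_exist by blast
 have "EX i. pivot j i"
 proof (rule ccontr)
  assume no_pivot: "~ ?thesis"
  let ?Z = "{x:W. a <.> x = 0}" and ?I = "{i:I. e i > d}" and ?L = "%x. {K:C. K <.> x ~= 0}"
  have vanish: "j i x = 0" if i: "i : I - ?I" and x: "x : ?Z" for i x
  proof (cases "e i = d")
   case True
   then have "j i 0 = j i x" using quotientsD(4)[OF j, of i x 0] i x by simp
   then show ?thesis using no_pivot j i True by (auto simp: pivot_def)
  next
   case False
   then show ?thesis using quotientsD(3)[OF j] i x by auto
  qed
  have "dim ?Z <= card ?I"
  proof (rule dim_le_card_forms[where g=j and d="%i. e i - d" and \<L>="?L ` (?Z - {0})"])
   show "subspace ?Z" by (rule subspace_kernel_on[OF W])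
   show "finite (?L ` (?Z - {0}))" by (rule finite_subset[of _ "Pow C"]) (use finite_C in auto)
   show "generated_on ?Z ?I j (%x. PROD l:L. l <.> x)" if L: "L : ?L ` (?Z - {0})" for L
   proof -
    obtain x where "x : ?Z" "x ~= 0" "L = ?L x" using L by blast
    then show ?thesis by (auto intro!: missing_hyperplanes_generated[OF j _ vanish] loc)
   qed
  qed (use quotientsD[OF j] finite_I finite_C in auto)
  then show False using few by simp
 qed
 then show ?thesis using pivot_imp_unit by blast
qed

end

locale pivoted_addition = addition A C a U I e th d
 for A C :: "'e::euclidean_space set" and a :: 'e and U :: "'e set"
  and I :: "'i set" and e :: "'i => nat" and th :: "'i => 'e => 'e" and d :: nat +
 fixes j :: "'i => 'e => real" and i0 :: 'i
 assumes pivot: "pivot j i0"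
begin

lemma quotients_j: "quotients j" and i0_in_I: "i0 : I" and e_i0: "e i0 = d" and pivot_nonzero: "j i0 0 ~= 0"
 using pivot by (auto simp: pivot_def)

definition proj :: "'e => 'e" where "proj x = x - ((a <.> x) / (a <.> a)) *R a"

definition coeff_on_H :: "'i => 'e => real" where "coeff_on_H i x = j i (proj x) / j i0 0"

definition new_basis :: "'i => 'e => 'e" where
 "new_basis i x = (if i = i0 then (a <.> x) *R th i0 x else th i x - coeff_on_H i x *R th i0 x)"

lemma proj_in_H: "a <.> proj x = 0" using normal_nonzero by (simp add: proj_def inner_diff_right)

lemma bounded_linear_proj: "bounded_linear proj"
proof -
 have "bounded_linear (%x. x - (((1 / (a <.> a)) *R a) <.> x) *R a)"
  by (intro bounded_linear_sub bounded_linear_ident bounded_linear_scaleR_const bounded_linear_inner_right)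
 then show ?thesis unfolding proj_def[abs_def] by simp
qed

lemma rpoly_coeff_on_H:
 assumes "i : I"
 shows "rpoly (coeff_on_H i)"
proof -
 have "rpoly (%x. j i (proj x) * (1 / j i0 0))"
  by (intro rpoly_mult rpoly_const rpoly_compose_linear[OF quotientsD(1)[OF quotients_j assms] bounded_linear_proj])
 then show ?thesis by (simp add: coeff_on_H_def[abs_def])
qed

lemma coeff_on_H_eq: "a <.> x = 0 ==> j i0 0 * coeff_on_H i x = j i x"
 using pivot_nonzero by (simp add: coeff_on_H_def proj_def)

lemma pivot_constant: "a <.> x = 0 ==> j i0 x = j i0 0"
 using quotientsD(4)[OF quotients_j i0_in_I, of x 0] e_i0 by simp

lemma new_basis_tangent:
 assumes i: "i : I"
 shows "new_basis i : tangent_fields U (insert a A)"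
proof -
 have "new_basis i : tangent_fields U A"
 proof (cases "i = i0")
  case True
  then have "new_basis i = (%x. (a <.> x) *R th i0 x)" by (auto simp: new_basis_def)
  then show ?thesis using tangent_fields_mult[OF U free_basisD(2)[OF basis i0_in_I] rpoly_inner] by simp
 next
  case False
  have "(%x. th i x + (- coeff_on_H i x) *R th i0 x) : tangent_fields U A"
   by (intro tangent_fields_add[OF U] tangent_fields_mult[OF U] free_basisD(2)[OF basis] i i0_in_I
     real_polynomial_function_minus rpoly_coeff_on_H)
  then show ?thesis using False by (simp add: new_basis_def[abs_def])
 qed
 moreover have "a <.> new_basis i x = 0" if x: "a <.> x = 0" for x
  using quotientsD(2)[OF quotients_j i x] quotientsD(2)[OF quotients_j i0_in_I x] pivot_constant[OF x] coeff_on_H_eq[OF x, of i] x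
  by (auto simp: new_basis_def inner_diff_right mult.commute)
 ultimately show ?thesis unfolding tangent_fields_def by auto
qed

lemma new_basis_scale:
 assumes i: "i : I"
 shows "new_basis i (t *R x) = t ^ (e(i0 := Suc d)) i *R new_basis i x"
proof -
 have proj_scale: "proj (t *R x) = t *R proj x" by (simp add: proj_def algebra_simps)
 consider (pivot) "i = i0" | (below) "i ~= i0" "e i < d" | (above) "i ~= i0" "d <= e i" by linarith
 then show ?thesis
 proof cases
  case pivot
  then show ?thesis using free_basisD(3)[OF basis i0_in_I] e_i0 by (simp add: new_basis_def mult_ac)
 next
  case below
  then have "coeff_on_H i y = 0" for y using quotientsD(3)[OF quotients_j i proj_in_H] by (simp add: coeff_on_H_def)
  then show ?thesis using below free_basisD(3)[OF basis i] by (simp add: new_basis_def)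
 next
  case above
  have "coeff_on_H i (t *R x) = t ^ (e i - d) * coeff_on_H i x"
   using quotientsD(4)[OF quotients_j i proj_in_H] above by (simp add: coeff_on_H_def proj_scale)
  moreover have "t ^ e i = t ^ (e i - d) * t ^ d" using above by (simp flip: power_add)
  ultimately show ?thesis using above free_basisD(3)[OF basis i] free_basisD(3)[OF basis i0_in_I] e_i0
   by (simp add: new_basis_def algebra_simps)
 qed
qed

lemma new_basis_sum:
 "(SUM i:I. h i *R new_basis i x) = (SUM i:I. (if i = i0 then (a <.> x) * h i0 - (SUM i:I - {i0}. h i * coeff_on_H i x) else h i) *R th i x)"
proof -
 have "(SUM i:I. h i *R new_basis i x) = h i0 *R new_basis i0 x + (SUM i:I - {i0}. h i *R new_basis i x)"
  by (rule sum.remove[OF finite_I i0_in_I])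
 also have "(SUM i:I - {i0}. h i *R new_basis i x) = (SUM i:I - {i0}. h i *R th i x - (h i * coeff_on_H i x) *R th i0 x)"
  by (rule sum.cong) (auto simp: new_basis_def scaleR_diff_right)
 also have "... = (SUM i:I - {i0}. h i *R th i x) - (SUM i:I - {i0}. h i * coeff_on_H i x) *R th i0 x"
  by (simp add: sum_subtractf scaleR_sum_left)
 also have "h i0 *R new_basis i0 x = ((a <.> x) * h i0) *R th i0 x" by (simp add: new_basis_def mult.commute)
 finally show ?thesis by (subst (2) sum.remove[OF finite_I i0_in_I]) (simp add: scaleR_diff_left)
qed

lemma new_basis_generates:
 assumes et: "et : tangent_fields U (insert a A)"
 shows "EX f. (ALL i:I. rpoly (f i)) & (ALL x. et x = (SUM i:I. f i x *R new_basis i x))"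
proof -
 obtain f where f: "!!i. i : I ==> rpoly (f i)" "!!x. et x = (SUM i:I. f i x *R th i x)"
  using free_basisD(4)[OF basis] tangent_fields_antimono[of A "insert a A"] et by blast
 define h where "h x = f i0 x + (SUM i:I - {i0}. f i x * coeff_on_H i x)" for x
 have rpoly_h: "rpoly h" unfolding h_def by (intro rpoly_add rpoly_sum rpoly_mult f rpoly_coeff_on_H i0_in_I) auto
 have "h x = 0" if x: "a <.> x = 0" for x
 proof -
  have "0 = (SUM i:I. f i x * j i x)"
   by (rule combination_on_H[OF quotients_j f rpoly_const, symmetric]) (use tangent_fieldsD(3)[OF et] x in auto)
  also have "... = f i0 x * j i0 x + (SUM i:I - {i0}. f i x * j i x)" by (rule sum.remove[OF finite_I i0_in_I])
  also have "(SUM i:I - {i0}. f i x * j i x) = j i0 0 * (SUM i:I - {i0}. f i x * coeff_on_H i x)"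
   by (simp add: coeff_on_H_eq[OF x, symmetric] sum_distrib_left mult_ac)
  also have "f i0 x * j i0 x + ... = j i0 0 * h x"
   by (simp add: h_def pivot_constant[OF x] distrib_left mult_ac)
  finally show ?thesis using pivot_nonzero by simp
 qed
 then obtain h' where h': "rpoly h'" "!!x. h x = (a <.> x) * h' x"
  using rpoly_divide_linear[OF rpoly_h subspace_UNIV, of a] by blast
 let ?f = "%i. if i = i0 then h' else f i"
 have "et x = (SUM i:I. ?f i x *R new_basis i x)" for x
 proof -
  have "(SUM i:I - {i0}. ?f i x * coeff_on_H i x) = (SUM i:I - {i0}. f i x * coeff_on_H i x)" by (rule sum.cong) auto
  moreover have "(a <.> x) * h' x - (SUM i:I - {i0}. f i x * coeff_on_H i x) = f i0 x" by (simp add: h_def flip: h'(2))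
  ultimately show ?thesis unfolding new_basis_sum f(2) by (intro sum.cong) auto
 qed
 then show ?thesis using f(1) h'(1) by (intro exI[of _ ?f]) auto
qed

lemma new_basis_independent:
 assumes f: "!!i. i : I ==> rpoly (f i)" and zero: "!!x. (SUM i:I. f i x *R new_basis i x) = 0" and i: "i : I"
 shows "f i x = 0"
proof -
 let ?h = "%i x. if i = i0 then (a <.> x) * f i0 x - (SUM i:I - {i0}. f i x * coeff_on_H i x) else f i x"
 have h: "?h i x = 0" if "i : I" for i x
 proof (rule free_basisD(5)[OF basis _ _ that])
  have "rpoly (%x. (a <.> x) * f i0 x - (SUM i:I - {i0}. f i x * coeff_on_H i x))"
   by (intro real_polynomial_function_diff rpoly_sum rpoly_mult rpoly_inner rpoly_coeff_on_H) (use f i0_in_I in auto)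
  then show "rpoly (?h i)" if "i : I" for i using f that by (cases "i = i0") auto
  show "(SUM i:I. ?h i x *R th i x) = 0" for x using zero[of x] unfolding new_basis_sum .
 qed
 show ?thesis
 proof (cases "i = i0")
  case False
  then show ?thesis using h[OF i, of x] by simp
 next
  case True
  have "f i x = 0" if "i : I - {i0}" for i x using h[of i x] that by auto
  then have "(a <.> y) * f i0 y = 0" for y using h[OF i0_in_I, of y] by simp
  then have "f i0 x = 0"
   by (intro rpoly_mult_eq_0[OF rpoly_inner _ subspace_UNIV, of "f i0" a a]) (use f i0_in_I normal_nonzero in auto)
  then show ?thesis using True by simp
 qed
qed

lemma free_basis_new: "free_basis U (insert a A) I (e(i0 := Suc d)) new_basis"
 unfolding free_basis_def homogeneous_generators_def
 using finite_I new_basis_tangent new_basis_scale new_basis_generates new_basis_independent by blast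

end

context addition
begin

theorem free_basis_add:
 assumes "unit_on U A C a"
 obtains i th' where "i : I" "e i = d" "free_basis U (insert a A) I (e(i := Suc d)) th'"
proof -
 obtain j i where "pivot j i" using unit_imp_pivot[OF assms] .
 then interpret pivoted_addition A C a U I e th d j i by unfold_locales
 show ?thesis using that[OF i0_in_I e_i0 free_basis_new] .
qed

end

section \<open>Finite root systems\<close>

lemma nonneg_combination_zero:
 fixes T :: "'v::euclidean_space set"
 assumes T: "finite T" and c: "!!t. t : T ==> c <.> t > 0" and w: "!!t. t : T ==> w t >= 0"
  and zero: "(SUM t:T. w t *R t) = 0" and t: "t : T"
 shows "w t = 0"
proof -
 have "(SUM t:T. w t * (c <.> t)) = 0" using arg_cong[OF zero, of "%x. c <.> x"] by (simp add: inner_sum_right)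
 then have "w t * (c <.> t) = 0"
  using T c w t by (subst (asm) sum_nonneg_eq_0_iff) (auto intro: mult_nonneg_nonneg less_imp_le)
 then show ?thesis using c[OF t] by simp
qed

lemma obtuse_independent:
 fixes T :: "'v::euclidean_space set"
 assumes T: "finite T" and obtuse: "!!s t. s : T ==> t : T ==> s ~= t ==> s <.> t <= 0"
  and c: "!!t. t : T ==> c <.> t > 0"
 shows "independent T"
proof
 assume "dependent T"
 then obtain u where u: "EX v:T. u v ~= 0" "(SUM v:T. u v *R v) = 0" using dependent_finite[OF T] by blast
 let ?p = "%v. max 0 (u v)" and ?n = "%v. max 0 (- u v)"
 define x where "x = (SUM v:T. ?p v *R v)"
 define y where "y = (SUM v:T. ?n v *R v)"
 have "x - y = (SUM v:T. u v *R v)"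
  unfolding x_def y_def sum_subtractf[symmetric] by (intro sum.cong) (auto simp: max_def)
 then have xy: "x = y" using u by simp
 have "x <.> y <= 0" unfolding x_def y_def inner_sum_left inner_sum_right
 proof (intro sum_nonpos)
  fix v w assume "v : T" "w : T"
  then have "?p v * ?n w * (v <.> w) <= 0"
   using obtuse[of v w] by (cases "v = w") (auto simp: max_def mult_nonneg_nonpos mult_nonpos_nonpos)
  then show "?p v *R v <.> ?n w *R w <= 0" by (simp add: mult_ac)
 qed
 then have "x = 0" using xy by (metis inner_ge_zero inner_eq_zero_iff order_antisym)
 then have "?p v = 0 & ?n v = 0" if "v : T" for v
  using nonneg_combination_zero[OF T c _ _ that, of ?p] nonneg_combination_zero[OF T c _ _ that, of ?n] xy
  unfolding x_def y_def by auto
 then show False using u(1) by (force simp: max_def split: if_splits)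
qed

lemma refl_root_inner: "refl_root a x <.> y = x <.> y - 2 * (x <.> a) / (a <.> a) * (a <.> y)"
 by (simp add: refl_root_def inner_diff_left)

lemma refl_root_isometry: "refl_root a x <.> refl_root a y = x <.> y"
proof (cases "a = 0")
 case False
 then show ?thesis by (simp add: refl_root_def inner_diff_left inner_diff_right inner_commute field_simps)
qed (simp add: refl_root_def)

lemma refl_root_refl_root [simp]: "refl_root a (refl_root a x) = x"
proof (cases "a = 0")
 case False
 then have "a <.> a ~= 0" by simp
 then show ?thesis by (simp add: refl_root_def inner_diff_left diff_divide_distrib algebra_simps flip: scaleR_left.add)
qed (simp add: refl_root_def)

lemma refl_root_adjoint: "refl_root a x <.> y = x <.> refl_root a y"
 by (metis refl_root_isometry refl_root_refl_root)

lemma refl_root_self: "a ~= 0 ==> refl_root a a = - a"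
 by (simp add: refl_root_def algebra_simps scaleR_2)

lemma linear_refl_root: "linear (refl_root a)"
 by (rule linearI) (simp_all add: refl_root_def inner_add_left add_divide_distrib algebra_simps)

inductive_set conic_span :: "'v::real_vector set => 'v set" for X where
 conic_0: "0 : conic_span X"
| conic_step: "x : X ==> t >= 0 ==> y : conic_span X ==> t *R x + y : conic_span X"

lemma conic_base: "x : X ==> x : conic_span X"
 using conic_step[of x X 1 0, OF _ _ conic_0] by simp

lemma conic_add: "x : conic_span X ==> y : conic_span X ==> x + y : conic_span X"
 by (induction x rule: conic_span.induct) (auto simp: add.assoc intro: conic_step)

lemma conic_scale: "x : conic_span X ==> t >= 0 ==> t *R x : conic_span X"
proof (induction x rule: conic_span.induct)
 case (conic_step x s y)
 then show ?case using conic_span.conic_step[of x X "t * s" "t *R y"] by (simp add: scaleR_add_right)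
qed (simp add: conic_0)

lemma conic_sum: "(!!i. i : I ==> f i : conic_span X) ==> (SUM i:I. f i) : conic_span X"
 by (induction I rule: infinite_finite_induct) (auto intro: conic_0 conic_add)

lemma conic_mono:
 assumes "linear f" "!!x. x : X ==> f x : conic_span Y" "x : conic_span X"
 shows "f x : conic_span Y"
 using assms(3)
proof (induction x rule: conic_span.induct)
 case conic_0
 then show ?case using assms(1) by (simp add: linear_0 conic_span.conic_0)
next
 case (conic_step x t y)
 then show ?case using assms(1,2) by (simp add: linear_add linear_scale conic_add conic_scale)
qed

lemma conic_nonneg: "x : conic_span X ==> (!!y. y : X ==> f y >= 0) ==> linear f ==> f x >= (0::real)"
 by (induction x rule: conic_span.induct) (auto simp: linear_0 linear_add linear_scale)

definition order_ideal_in :: "'v::real_vector set => 'v set => bool" where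
 "order_ideal_in P J \<longleftrightarrow> J \<subseteq> P & (ALL be:J. ALL ga:P. be - ga : conic_span P --> ga : J)"

locale root_sys =
 fixes Ph :: "(real^'n) set" and c :: "real^'n"
 assumes fin: "finite Ph" and nz: "0 ~: Ph"
  and refl: "a : Ph ==> b : Ph ==> refl_root a b : Ph"
  and int: "a : Ph ==> b : Ph ==> 2 * (b <.> a) / (a <.> a) : \<int>"
  and red: "a : Ph ==> t *R a : Ph ==> t = 1 \<or> t = -1"
  and reg: "a : Ph ==> c <.> a ~= 0"
begin

definition pos :: "(real^'n) set" where "pos = {al:Ph. c <.> al > 0}"

definition base :: "(real^'n) set" where "base = {al:pos. ~ (EX be:pos. EX ga:pos. al = be + ga)}"

definition ht :: "real^'n => real" where "ht x = (SUM be:pos. (x <.> be) / (be <.> be))"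

definition level :: "nat => (real^'n) set" where "level t = {be:pos. ht be = real t}"

lemma sub_root_sys:
 assumes "Ps \<subseteq> Ph" "!!a b. a : Ps ==> b : Ps ==> refl_root a b : Ps" "!!a. a : Ps ==> c' <.> a ~= 0"
 shows "root_sys Ps c'"
proof
 show "finite Ps" using assms(1) fin by (rule finite_subset)
 show "t = 1 \<or> t = - 1" if "a : Ps" "t *R a : Ps" for a t using red that assms(1) by blast
 show "2 * (b <.> a) / (a <.> a) : \<int>" if "a : Ps" "b : Ps" for a b using int[of a b] that assms(1) by blast
qed (use nz assms in auto)

lemma root_nz: "a : Ph ==> a ~= 0" "a : Ph ==> a <.> a > 0" using nz by auto

lemma neg: "a : Ph ==> - a : Ph" using refl[of a a] root_nz by (simp add: refl_root_self)

lemma neg_iff [simp]: "- a : Ph \<longleftrightarrow> a : Ph" using neg[of a] neg[of "- a"] by auto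

lemma pos_root: "a : pos ==> a : Ph" by (simp add: pos_def)

lemma finite_pos: "finite pos" using fin by (simp add: pos_def)

lemma pos_or_neg: "a : Ph ==> a : pos \<or> - a : pos"
 using reg[of a] by (auto simp: pos_def)

lemma not_pos_neg: "a : pos ==> - a ~: pos" by (simp add: pos_def)

lemma proportional_eq:
 assumes "a : pos" "b : pos" "a = t *R b"
 shows "a = b"
 using assms red[of b t] not_pos_neg[of b] by (auto simp: pos_def)

lemma root_diff:
 assumes a: "a : Ph" and b: "b : Ph" and ab: "a <.> b > 0" "a ~= b"
 shows "a - b : Ph"
proof -
 have norm_a: "a <.> a > 0" and norm_b: "b <.> b > 0" using a b root_nz by auto
 obtain m n :: int where m: "2 * (a <.> b) / (b <.> b) = m" and n: "2 * (a <.> b) / (a <.> a) = n"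
  using int[OF b a] int[OF a b] by (metis Ints_cases inner_commute)
 have "real_of_int m > 0" "real_of_int n > 0" unfolding m[symmetric] n[symmetric] using norm_a norm_b ab by simp_all
 then have mn: "m >= 1" "n >= 1" by auto
 show ?thesis
 proof (cases "m = 1 \<or> n = 1")
  case True
  then show ?thesis
  proof
   assume "m = 1"
   then have "refl_root b a = a - b" unfolding refl_root_def m by simp
   then show ?thesis using refl[OF b a] by simp
  next
   assume "n = 1"
   then have "refl_root a b = b - a" unfolding refl_root_def inner_commute[of b a] n by simp
   then have "- (a - b) : Ph" using refl[OF a b] by simp
   then show ?thesis by (simp only: neg_iff)
  qed
 next
  case False
  then have "real_of_int m >= 2" "real_of_int n >= 2" using mn by auto
  then have "a <.> b >= b <.> b" "a <.> b >= a <.> a"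
   unfolding m[symmetric] n[symmetric] using norm_a norm_b by (simp_all add: field_simps)
  then have "(a - b) <.> (a - b) <= 0" by (simp add: inner_diff_left inner_diff_right inner_commute)
  then have "a = b" by (metis inner_ge_zero inner_eq_zero_iff order_antisym right_minus_eq)
  then show ?thesis using ab by simp
 qed
qed

lemma base_pos: "s : base ==> s : pos" by (simp add: base_def)

lemma finite_base: "finite base" using finite_pos by (simp add: base_def)

lemma base_obtuse:
 assumes "s : base" "t : base" "s ~= t"
 shows "s <.> t <= 0"
proof (rule ccontr)
 assume "~ s <.> t <= 0"
 then have d: "s - t : Ph" using root_diff assms base_pos pos_root by simp
 show False
 proof (cases "s - t : pos")
  case True
  then have "s = (s - t) + t" "s - t : pos" "t : pos" using assms base_pos by auto
  then show False using assms(1) unfolding base_def by blast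
 next
  case False
  then have "t - s : pos" using pos_or_neg[OF d] by simp
  moreover have "t = (t - s) + s" "s : pos" using assms base_pos by auto
  ultimately show False using assms(2) unfolding base_def by blast
 qed
qed

lemma base_independent: "independent base"
 by (rule obtuse_independent[OF finite_base base_obtuse, of c]) (auto simp: base_def pos_def)

lemma base_coeffs_unique:
 assumes "(SUM s:base. u s *R s) = (SUM s:base. w s *R s)" "s : base"
 shows "u s = w s"
proof -
 have "(SUM s:base. (u s - w s) *R s) = 0" using assms(1) by (simp add: scaleR_diff_left sum_subtractf)
 then have "u s - w s = 0"
  using independentD[OF base_independent finite_base subset_refl, of "%s. u s - w s" s] assms(2) by simp
 then show ?thesis by simp
qed

lemma pos_combination:
 assumes "p : pos"
 shows "EX n::(real^'n) => nat. p = (SUM s:base. real (n s) *R s)"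
 using assms
proof (induction "card {q:pos. c <.> q < c <.> p}" arbitrary: p rule: less_induct)
 case less
 show ?case
 proof (cases "p : base")
  case True
  have "p = (SUM s:base. real (if s = p then 1 else 0) *R s)"
   using True finite_base by (simp add: if_distrib[of real] if_distrib[of "%u. u *R _"] sum.delta cong: if_cong)
  then show ?thesis by (rule exI[of _ "%s. if s = p then 1 else 0"])
 next
  case False
  then obtain q r where qr: "q : pos" "r : pos" "p = q + r" using less.prems unfolding base_def by blast
  have below: "c <.> q < c <.> p" "c <.> r < c <.> p" using qr by (auto simp: pos_def inner_add_right)
  have card_q: "card {q':pos. c <.> q' < c <.> q} < card {q:pos. c <.> q < c <.> p}"
   by (rule psubset_card_mono) (use finite_pos below qr in auto)
  have card_r: "card {q':pos. c <.> q' < c <.> r} < card {q:pos. c <.> q < c <.> p}"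
   by (rule psubset_card_mono) (use finite_pos below qr in auto)
  obtain n :: "(real^'n) => nat" where "q = (SUM s:base. real (n s) *R s)"
   using less.hyps[OF card_q qr(1)] by blast
  moreover obtain m :: "(real^'n) => nat" where "r = (SUM s:base. real (m s) *R s)"
   using less.hyps[OF card_r qr(2)] by blast
  ultimately have "p = (SUM s:base. real (n s + m s) *R s)" using qr by (simp add: scaleR_add_left sum.distrib)
  then show ?thesis by (rule exI[of _ "%s. n s + m s"])
 qed
qed

lemma pos_in_span_base:
 assumes "p : pos"
 shows "p : span base"
proof -
 obtain n where n: "p = (SUM s:base. real (n s) *R s)" using pos_combination[OF assms] by blast
 show ?thesis unfolding n by (intro span_sum span_scale span_base)
qed

lemma root_in_span_base: "p : Ph ==> p : span base"
 using pos_or_neg[of p] pos_in_span_base[of p] pos_in_span_base[of "- p"] span_neg[of "- p"] by auto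

lemma span_base_eq: "span base = span Ph"
proof
 show "span base \<subseteq> span Ph" by (rule span_mono) (auto simp: base_def pos_def)
 show "span Ph \<subseteq> span base" by (rule span_minimal) (use root_in_span_base in auto)
qed

lemma card_base: "card base = dim Ph"
 by (metis base_independent dim_eq_card_independent dim_span span_base_eq)

lemma base_refl_pos:
 assumes s: "s : base" and b: "b : pos" "b ~= s"
 shows "refl_root s b : pos"
proof (rule ccontr)
 assume n: "refl_root s b ~: pos"
 have sPh: "s : Ph" using s base_pos pos_root by blast
 obtain n where n': "b = (SUM s:base. real (n s) *R s)" using pos_combination[OF b(1)] by blast
 have "EX t:base. t ~= s & n t > 0"
 proof (rule ccontr)
  assume "~ ?thesis"
  then have "b = (SUM t:base. if t = s then real (n s) *R s else 0)"
   unfolding n' by (intro sum.cong) auto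
  then have "b = real (n s) *R s" using s finite_base by (simp add: sum.delta)
  then show False using proportional_eq[OF b(1) base_pos[OF s]] b(2) by blast
 qed
 then obtain t where t: "t : base" "t ~= s" "n t > 0" by blast
 let ?k = "2 * (b <.> s) / (s <.> s)"
 have "refl_root s b : Ph" using refl[OF sPh] b(1) pos_root by blast
 then have "- refl_root s b : pos" using n pos_or_neg by blast
 then obtain m where m: "- refl_root s b = (SUM s:base. real (m s) *R s)" using pos_combination by blast
 have "(SUM u:base. (if u = s then ?k else 0) *R u) = ?k *R s"
  using s finite_base by (simp add: if_distrib[of "%u. u *R _"] sum.delta cong: if_cong)
 then have "(SUM u:base. (if u = s then ?k else 0) *R u) = b - refl_root s b" by (simp add: refl_root_def)
 also have "... = b + (- refl_root s b)" by simp
 also have "... = (SUM u:base. (real (n u) + real (m u)) *R u)"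
  unfolding m by (subst (1) n') (simp add: scaleR_add_left sum.distrib)
 finally have "(if t = s then ?k else 0) = real (n t) + real (m t)"
  using base_coeffs_unique[of "%u. if u = s then ?k else 0" "%u. real (n u) + real (m u)" t] t(1) by simp
 then show False using t by simp
qed

lemma linear_ht: "linear ht"
 by (rule linearI) (simp_all add: ht_def inner_add_left add_divide_distrib sum.distrib sum_distrib_left)

lemma ht_base:
 assumes s: "s : base"
 shows "ht s = 1"
proof -
 let ?w = "%b. (s <.> b) / (b <.> b)"
 have sPh: "s : Ph" "s ~= 0" using s base_pos pos_root root_nz by blast+
 have "(SUM b:pos - {s}. ?w b) = (SUM b:pos - {s}. - ?w b)"
 proof (rule sum.reindex_bij_witness[of _ "refl_root s" "refl_root s"])
  fix b assume b: "b : pos - {s}"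
  show "refl_root s (refl_root s b) = b" by simp
  show "refl_root s b : pos - {s}"
  proof -
   have "refl_root s b ~= s"
   proof
    assume "refl_root s b = s"
    then have "b = - s" by (metis refl_root_refl_root refl_root_self sPh(2))
    then show False using b not_pos_neg[OF base_pos[OF s]] by auto
   qed
   then show ?thesis using base_refl_pos[OF s] b by auto
  qed
  then show "refl_root s (refl_root s b) = b" "refl_root s b : pos - {s}" by auto
  have "s <.> refl_root s b = - (s <.> b)" using refl_root_adjoint[of s s b] refl_root_self[OF sPh(2)] by simp
  then show "- ?w (refl_root s b) = ?w b" by (simp add: refl_root_isometry)
 qed
 then have "(SUM b:pos - {s}. ?w b) = 0" by (simp add: sum_negf)
 moreover have "ht s = ?w s + (SUM b:pos - {s}. ?w b)"
  unfolding ht_def by (rule sum.remove[OF finite_pos base_pos[OF s]])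
 ultimately show ?thesis using sPh by simp
qed

lemma ht_pos:
 assumes "p : pos"
 shows "EX t>=1. ht p = real t"
proof -
 obtain n where n: "p = (SUM s:base. real (n s) *R s)" using pos_combination[OF assms] by blast
 have "ht p = (SUM s:base. real (n s) * ht s)"
  by (subst n) (simp add: linear_sum[OF linear_ht] linear_scale[OF linear_ht])
 also have "... = real (SUM s:base. n s)" by (simp add: ht_base)
 finally have h: "ht p = real (SUM s:base. n s)" .
 have "(SUM s:base. n s) ~= 0"
 proof
  assume "(SUM s:base. n s) = 0"
  then have "p = 0" using n finite_base by simp
  then show False using assms pos_root root_nz by blast
 qed
 then show ?thesis using h by (intro exI[of _ "SUM s:base. n s"]) auto
qed

lemma ht_pos_ge1: "p : pos ==> ht p >= 1" using ht_pos[of p] by auto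

lemma ht_neg: "ht (- x) = - ht x" using linear_neg[OF linear_ht] by simp

lemma ht_root: "a : Ph ==> \<bar>ht a\<bar> >= 1"
 using pos_or_neg[of a] ht_pos_ge1[of a] ht_pos_ge1[of "- a"] by (auto simp: ht_neg)

lemma ht_conic: "x : conic_span pos ==> ht x >= 0"
 by (rule conic_nonneg[where f=ht, OF _ _ linear_ht]) (use ht_pos_ge1 in force)+

lemma nonbase_diff:
 assumes p: "p : pos" "p ~: base"
 shows "EX s:base. p - s : pos"
proof -
 obtain n where n: "p = (SUM s:base. real (n s) *R s)" using pos_combination[OF p(1)] by blast
 have "0 < p <.> p" using p pos_root root_nz by blast
 also have "p <.> p = (SUM s:base. real (n s) * (p <.> s))" by (subst (2) n) (simp add: inner_sum_right)
 finally have "EX s:base. real (n s) * (p <.> s) > 0" by (metis (no_types, lifting) not_less sum_nonpos)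
 then obtain s where s: "s : base" "p <.> s > 0" by (metis mult_nonneg_nonpos not_less of_nat_0_le_iff)
 have sp: "s : pos" using s base_pos by blast
 have d: "p - s : Ph" using root_diff[of p s] s p sp pos_root by blast
 have "p - s : pos"
 proof (rule ccontr)
  assume "p - s ~: pos"
  then have "s - p : pos" using pos_or_neg[OF d] by simp
  then have "s = p + (s - p)" "s - p : pos" by auto
  then show False using s(1) p(1) unfolding base_def by blast
 qed
 then show ?thesis using s by blast
qed

lemma base_iff_level: "base = level 1"
proof (intro equalityI subsetI)
 fix p assume "p : level 1"
 then have p: "p : pos" "ht p = 1" by (auto simp: level_def)
 show "p : base"
 proof (rule ccontr)
  assume "p ~: base"
  then obtain s where s: "s : base" "p - s : pos" using nonbase_diff p by blast
  have "ht p = ht (p - s) + ht s" using linear_diff[OF linear_ht] by simp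
  then show False using ht_pos_ge1[OF s(2)] ht_base[OF s(1)] p by simp
 qed
qed (auto simp: level_def ht_base base_pos)

lemma level_obtuse:
 assumes "a : level t" "b : level t" "a ~= b"
 shows "a <.> b <= 0"
proof (rule ccontr)
 assume "~ a <.> b <= 0"
 then have "a - b : Ph" using root_diff assms pos_root by (auto simp: level_def)
 moreover have "ht (a - b) = 0" using assms linear_diff[OF linear_ht] by (simp add: level_def)
 ultimately show False using ht_root by fastforce
qed

lemma level_independent: "independent (level t)"
 by (rule obtuse_independent[OF _ level_obtuse, of _ _ c]) (auto simp: level_def pos_def fin)

lemma finite_level: "finite (level t)" using finite_pos by (simp add: level_def)

lemma card_level_le: "card (level t) <= dim Ph"
proof -
 have "card (level t) = dim (level t)" using dim_eq_card_independent[OF level_independent] by simp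
 also have "... <= dim Ph" by (rule dim_subset) (auto simp: level_def pos_def)
 finally show ?thesis .
qed

lemma pos_cases_level: "p : pos ==> EX t>=1. p : level t"
 using ht_pos[of p] by (auto simp: level_def)

lemma base_nonempty:
 assumes "Ph ~= {}"
 shows "base ~= {}"
proof
 assume "base = {}"
 then have "Ph \<subseteq> {0}" using root_in_span_base by auto
 then show False using assms nz by blast
qed

lemma levelD: "p : level t ==> p : pos" "p : level t ==> ht p = real t"
 by (auto simp: level_def)

lemma level_disjoint: "p : level s ==> p : level t ==> s = t" by (simp add: level_def)

lemma level_SucE:
 assumes p: "p : level (Suc n)" and n: "n >= 1"
 obtains s where "s : base" "p - s : level n"
proof -
 have "p ~: base" using levelD(2)[OF p] n ht_base[of p] by auto
 then obtain s where s: "s : base" "p - s : pos" using nonbase_diff levelD(1)[OF p] by blast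
 moreover have "ht (p - s) = real n" using linear_diff[OF linear_ht, of p s] ht_base[OF s(1)] levelD(2)[OF p] by simp
 ultimately show ?thesis using that by (simp add: level_def)
qed

lemma level2E:
 assumes p: "p : level 2"
 obtains s t where "s : base" "t : base" "s ~= t" "p = s + t"
proof -
 obtain s where s: "s : base" "p - s : base"
  using level_SucE[of p 1] p by (auto simp: base_iff_level numeral_2_eq_2)
 have "s ~= p - s"
 proof
  assume "s = p - s"
  then have "p = 2 *R s" by (simp add: scaleR_2 algebra_simps)
  then have "2 *R s : Ph" using levelD(1)[OF p] pos_root by simp
  then show False using red[of s 2] s base_pos pos_root by auto
 qed
 then show ?thesis using that[of s "p - s"] s by simp
qed

lemma level_nonempty:
 assumes "level t ~= {}" "1 <= k" "k <= t"
 shows "level k ~= {}"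
 using assms(3,2,1)
proof (induction rule: inc_induct)
 case (step n)
 then obtain q where "q : level (Suc n)" by auto
 then show ?case using step.prems by (auto elim: level_SucE)
qed

lemma base_cos_le:
 assumes s: "s : base" "t : base" "s ~= t" "s <.> t ~= 0"
 shows "(s <.> t) / (norm s * norm t) <= - 1/2"
proof -
 have st: "s : Ph" "t : Ph" using s base_pos pos_root by auto
 obtain m n :: int where m: "2 * (s <.> t) / (t <.> t) = m" and n: "2 * (s <.> t) / (s <.> s) = n"
  using int[OF st(2) st(1)] int[OF st(1) st(2)] by (metis Ints_cases inner_commute)
 define x where "x = (s <.> t) / (norm s * norm t)"
 have neg: "s <.> t < 0" using base_obtuse[OF s(1-3)] s(4) by simp
 have square: "4 * x\<^sup>2 = real_of_int (m * n)"
  unfolding of_int_mult m[symmetric] n[symmetric] x_def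
  by (simp add: power2_eq_square dot_square_norm field_simps)
 have x0: "x < 0" unfolding x_def using neg st root_nz by (simp add: divide_neg_pos)
 then have "4 * x\<^sup>2 > 0" by simp
 then have "real_of_int (m * n) > 0" unfolding square .
 then have "m * n >= 1" by (simp only: of_int_0_less_iff)
 then have "real_of_int (m * n) >= 1" by (simp only: of_int_1_le_iff)
 then have "(1/2)\<^sup>2 <= (- x)\<^sup>2" using square by (simp add: power_divide)
 then have "1/2 <= - x" using x0 by (intro power2_le_imp_le[of "1/2" "- x"]) auto
 then show ?thesis unfolding x_def by linarith
qed

lemma base_cos_sum:
 assumes T: "T \<subseteq> base" "T ~= {}"
 shows "(SUM s:T. real (card {t:T - {s}. s <.> t ~= 0})) < 2 * real (card T)"
proof -
 have finT: "finite T" using T finite_base finite_subset by blast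
 let ?k = "%s t. (s <.> t) / (norm s * norm t)"
 define u where "u = (SUM s:T. (1 / norm s) *R s)"
 have norm_pos: "norm s > 0" if "s : T" for s using that T base_pos pos_root root_nz by auto
 have "u ~= 0"
 proof
  assume "u = 0"
  moreover have "independent T" using base_independent T independent_mono by blast
  ultimately have "1 / norm s = 0" if "s : T" for s
   using independentD[OF _ finT subset_refl, of "%s. 1 / norm s" s] that by (simp add: u_def)
  then show False using T norm_pos by fastforce
 qed
 then have "0 < u <.> u" by simp
 also have "u <.> u = (SUM s:T. SUM t:T. ?k s t)" unfolding u_def inner_sum_left inner_sum_right
  by (simp add: inner_commute mult.commute)
 also have "... <= (SUM s:T. 1 - real (card {t:T - {s}. s <.> t ~= 0}) / 2)"
 proof (rule sum_mono)
  fix s assume s: "s : T"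
  have "(SUM t:T. ?k s t) = ?k s s + (SUM t:T - {s}. ?k s t)" by (rule sum.remove[OF finT s])
  also have "?k s s = 1" using norm_pos[OF s] by (simp add: dot_square_norm power2_eq_square)
  also have "(SUM t:T - {s}. ?k s t) = (SUM t:{t:T - {s}. s <.> t ~= 0}. ?k s t)"
   by (rule sum.mono_neutral_right) (use finT in auto)
  also have "... <= (SUM t:{t:T - {s}. s <.> t ~= 0}. - 1/2)"
   by (rule sum_mono) (rule base_cos_le, use s T in auto)
  finally show "(SUM t:T. ?k s t) <= 1 - real (card {t:T - {s}. s <.> t ~= 0}) / 2" by simp
 qed
 also have "... = real (card T) - (SUM s:T. real (card {t:T - {s}. s <.> t ~= 0})) / 2"
  by (simp add: sum_subtractf sum_divide_distrib)
 finally show ?thesis by simp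
qed

lemma base_leaf:
 assumes T: "T \<subseteq> base" "T ~= {}"
 shows "EX s:T. card {t:T - {s}. s <.> t ~= 0} <= 1"
proof (rule ccontr)
 assume "~ ?thesis"
 then have "(SUM s:T. 2) <= (SUM s:T. real (card {t:T - {s}. s <.> t ~= 0}))" by (intro sum_mono) force
 then show False using base_cos_sum[OF T] by simp
qed

definition edges :: "((real^'n) \<times> (real^'n)) set" where
 "edges = Sigma base (%s. {t:base - {s}. s <.> t ~= 0})"

lemma finite_edges: "finite edges" unfolding edges_def using finite_base by auto

lemma card_edges:
 assumes "Ph ~= {}"
 shows "card edges < 2 * dim Ph"
proof -
 have "real (card edges) = (SUM s:base. real (card {t:base - {s}. s <.> t ~= 0}))"
  unfolding edges_def by (subst card_SigmaI) (use finite_base in auto)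
 then show ?thesis using base_cos_sum[OF subset_refl base_nonempty[OF assms]] card_base by linarith
qed

lemma level2_edge:
 assumes p: "p : level 2"
 obtains s t where "(s, t) : edges" "(t, s) : edges" "s ~= t" "p = s + t"
proof -
 obtain s t where st: "s : base" "t : base" "s ~= t" "p = s + t" using level2E[OF p] .
 have "s <.> t ~= 0"
 proof
  assume "s <.> t = 0"
  then have "refl_root t p = s - t" using root_nz(1)[OF pos_root[OF base_pos[OF st(2)]]]
   by (simp add: refl_root_def st(4) inner_add_left algebra_simps scaleR_2)
  then have "s - t : Ph" using refl[of t p] levelD(1)[OF p] st(2) base_pos pos_root by metis
  moreover have "ht (s - t) = 0" using st ht_base linear_diff[OF linear_ht] by simp
  ultimately show False using ht_root by fastforce
 qed
 then show ?thesis using that[of s t] st by (auto simp: edges_def inner_commute)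
qed

lemma card_level2_less:
 assumes "Ph ~= {}"
 shows "card (level 2) < dim Ph"
proof -
 let ?f = "%p. {q:edges. fst q + snd q = p}"
 have fin: "finite (?f p)" for p using finite_edges by auto
 have "2 <= card (?f p)" if p: "p : level 2" for p
 proof -
  obtain s t where "(s, t) : edges" "(t, s) : edges" "s ~= t" "p = s + t" using level2_edge[OF p] .
  then have "{(s, t), (t, s)} \<subseteq> ?f p" "card {(s, t), (t, s)} = 2" by (auto simp: add.commute)
  then show ?thesis using card_mono[OF fin, of "{(s, t), (t, s)}" p] by linarith
 qed
 then have "(SUM p:level 2. 2) <= (SUM p:level 2. card (?f p))" by (intro sum_mono)
 also have "... = card (UN p:level 2. ?f p)"
  by (subst card_UN_disjoint) (use finite_level fin in auto)
 also have "... <= card edges" by (rule card_mono[OF finite_edges]) auto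
 finally show ?thesis using card_edges[OF assms] by simp
qed

text \<open>If a level \<open>t \<ge> 3\<close> had full rank, it would be a base of the root system of all roots in its lattice.
 Heights with respect to that base are \<open>1 / t\<close> times the old heights, but twice a height is an integer.\<close>

definition lattice_roots :: "(real^'n) set => (real^'n) set" where
 "lattice_roots T = {be:Ph. EX n. be = (SUM ta:T. real_of_int (n ta) *R ta)}"

lemma lattice_roots_root_sys: "root_sys (lattice_roots T) c"
proof (rule sub_root_sys)
 show "lattice_roots T \<subseteq> Ph" by (auto simp: lattice_roots_def)
 show "c <.> a ~= 0" if "a : lattice_roots T" for a using that reg by (auto simp: lattice_roots_def)
 fix a b assume a: "a : lattice_roots T" and b: "b : lattice_roots T"
 then have ab: "a : Ph" "b : Ph" by (auto simp: lattice_roots_def)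
 obtain n m where nm: "a = (SUM ta:T. real_of_int (n ta) *R ta)" "b = (SUM ta:T. real_of_int (m ta) *R ta)"
  using a b unfolding lattice_roots_def by blast
 obtain k :: int where k: "2 * (b <.> a) / (a <.> a) = k" using int[OF ab] by (metis Ints_cases)
 have "refl_root a b = b - real_of_int k *R a" by (simp add: refl_root_def k)
 also have "... = (SUM ta:T. real_of_int (m ta - k * n ta) *R ta)"
  by (subst nm(1), subst nm(2)) (simp add: scaleR_sum_right scaleR_diff_left sum_subtractf)
 finally have "EX n. refl_root a b = (SUM ta:T. real_of_int (n ta) *R ta)"
  by (rule exI[of _ "%ta. m ta - k * n ta"])
 then show "refl_root a b : lattice_roots T" using refl[OF ab] by (simp add: lattice_roots_def)
qed

lemma lattice_pos: "root_sys.pos (lattice_roots T) c = lattice_roots T Int pos"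
 unfolding root_sys.pos_def[OF lattice_roots_root_sys] pos_def by (auto simp: lattice_roots_def)

lemma ht_lattice_ge:
 assumes be: "be : lattice_roots (level t) Int pos"
 shows "ht be >= real t"
proof -
 obtain n where n: "be = (SUM ta:level t. real_of_int (n ta) *R ta)" using be unfolding lattice_roots_def by blast
 have "ht be = (SUM ta:level t. real_of_int (n ta) * ht ta)"
  by (subst n) (simp add: linear_sum[OF linear_ht] linear_scale[OF linear_ht])
 also have "... = (SUM ta:level t. real_of_int (n ta) * real t)" by (rule sum.cong) (auto simp: level_def)
 finally have h: "ht be = real_of_int (SUM ta:level t. n ta) * real t" by (simp add: sum_distrib_right)
 have "ht be > 0" using ht_pos_ge1[of be] be by simp
 then have "real_of_int (SUM ta:level t. n ta) > 0" unfolding h by (metis mult_nonpos_nonneg not_less of_nat_0_le_iff)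
 then have "(SUM ta:level t. n ta) >= 1" by (simp only: of_int_0_less_iff)
 then have "1 * real t <= real_of_int (SUM ta:level t. n ta) * real t" by (intro mult_right_mono) linarith+
 then show ?thesis using h by simp
qed

lemma level_subset_lattice_base:
 assumes t: "t >= 1"
 shows "level t \<subseteq> root_sys.base (lattice_roots (level t)) c"
proof
 interpret Q: root_sys "lattice_roots (level t)" c by (rule lattice_roots_root_sys)
 fix ta assume ta: "ta : level t"
 have "ta = (SUM si:level t. real_of_int (if si = ta then 1 else 0) *R si)"
  using ta finite_level by (simp add: if_distrib[of real_of_int] if_distrib[of "%u. u *R _"] sum.delta cong: if_cong)
 then have "EX n. ta = (SUM ta:level t. real_of_int (n ta) *R ta)"
  by (rule exI[of _ "%si. if si = ta then 1 else 0"])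
 then have "ta : lattice_roots (level t)" using levelD(1)[OF ta] pos_root unfolding lattice_roots_def by blast
 then have "ta : Q.pos" using levelD(1)[OF ta] by (simp add: lattice_pos)
 moreover have False if "be : Q.pos" "ga : Q.pos" "ta = be + ga" for be ga
  using ht_lattice_ge[of be t] ht_lattice_ge[of ga t] that levelD(2)[OF ta] t linear_add[OF linear_ht, of be ga]
  unfolding lattice_pos by simp
 ultimately show "ta : Q.base" unfolding Q.base_def by blast
qed

lemma lattice_ht:
 assumes t: "t >= 1" and x: "x : span (level t)"
 shows "root_sys.ht (lattice_roots (level t)) c x = ht x / real t"
proof -
 interpret Q: root_sys "lattice_roots (level t)" c by (rule lattice_roots_root_sys)
 have "linear (%x. ht x / real t)" using linear_ht by (simp add: linear_iff add_divide_distrib)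
 moreover have "Q.ht ta = ht ta / real t" if "ta : level t" for ta
  using Q.ht_base level_subset_lattice_base[OF t] that t levelD(2)[OF that] by auto
 ultimately show ?thesis using linear_eq_on_span[OF Q.linear_ht _ _ x] by simp
qed

lemma span_full_level:
 assumes "card (level t) = dim Ph"
 shows "span (level t) = span Ph"
proof -
 have "span (level t) \<subseteq> span Ph" by (rule span_mono) (auto simp: level_def pos_def)
 moreover have "dim (span Ph) <= dim (span (level t))" using assms dim_eq_card_independent[OF level_independent] by simp
 ultimately show ?thesis using subspace_dim_equal[of "span (level t)" "span Ph"] by simp
qed

lemma card_level_less:
 assumes nonempty: "Ph ~= {}" and t: "t >= 2"
 shows "card (level t) < dim Ph"
proof (rule ccontr)
 assume not_less: "~ ?thesis"
 then have span: "span (level t) = span Ph" using card_level_le[of t] by (intro span_full_level) simp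
 have "t ~= 2" using not_less card_level2_less[OF nonempty] by blast
 then have t_ge_3: "t >= 3" using t by simp
 interpret Q: root_sys "lattice_roots (level t)" c by (rule lattice_roots_root_sys)
 obtain s where s: "s : base" using base_nonempty[OF nonempty] by blast
 then have "s : span (level t)" unfolding span by (intro span_base) (auto simp: base_def pos_def)
 then have "Q.ht s = 1 / real t" using lattice_ht[of t s] t ht_base[OF s] by simp
 moreover have "(SUM be:Q.pos. 2 * (s <.> be) / (be <.> be)) : \<int>"
  by (intro Ints_sum int) (use lattice_pos pos_root s base_pos in auto)
 moreover have "(SUM be:Q.pos. 2 * (s <.> be) / (be <.> be)) = 2 * Q.ht s"
  unfolding Q.ht_def by (simp add: sum_distrib_left)
 ultimately obtain k :: int where k: "2 / real t = k" by (metis Ints_cases times_divide_eq_right mult.right_neutral)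
 have "real_of_int k > 0" "real_of_int k < 1" unfolding k[symmetric] using t_ge_3 by auto
 then show False by simp
qed

lemma order_ideal_inD:
 assumes "order_ideal_in pos J"
 shows "J \<subseteq> pos" "be : J ==> ga : pos ==> be - ga : conic_span pos ==> ga : J"
 using assms unfolding order_ideal_in_def by auto

end

text \<open>In rank two there is a single root of each height above one, so an ideal is determined by its size.\<close>

locale rank2_root_sys = root_sys Ph c for Ph :: "(real^'n) set" and c +
 assumes rank2: "dim Ph = 2"
begin

lemma Ph_nonempty: "Ph ~= {}" using rank2 by auto

lemma card_level_1: "card (level 1) = 2" using card_base rank2 by (simp add: base_iff_level)

lemma level_unique:
 assumes "p : level t" "q : level t" "t >= 2"
 shows "p = q"
proof -
 have "card (level t) <= 1" using card_level_less[OF Ph_nonempty assms(3)] rank2 by simp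
 then show ?thesis using assms finite_level card_le_Suc0_iff_eq by (metis One_nat_def)
qed

lemma level2_diff_conic:
 assumes p: "p : level 2" and q: "q : pos" "ht q < 2"
 shows "p - q : conic_span pos"
proof -
 obtain s t where st: "s : base" "t : base" "s ~= t" "p = s + t" using level2E[OF p] .
 then have "base = {s, t}"
  using card_level_1 finite_base by (intro card_seteq[symmetric]) (auto simp: base_iff_level)
 moreover obtain n where "ht q = real n" "n >= 1" using ht_pos q by blast
 then have "q : base" using q by (simp add: base_iff_level level_def)
 ultimately show ?thesis using st base_pos by (auto intro: conic_base)
qed

lemma level_diff_conic:
 assumes "p : level t" "t >= 2" "q : pos" "ht q < ht p"
 shows "p - q : conic_span pos"
 using assms(2,1,3,4)
proof (induction t arbitrary: p q rule: dec_induct)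
 case base
 then show ?case using level2_diff_conic levelD by auto
next
 case (step n)
 obtain s where s: "s : base" "p - s : level n" using level_SucE[OF step.prems(1)] step.hyps by auto
 have conic_s: "s : conic_span pos" using s base_pos conic_base by blast
 obtain k where k: "ht q = real k" "k >= 1" using ht_pos step.prems by blast
 show ?case
 proof (cases "k = n")
  case True
  then have "q = p - s" using level_unique[OF _ s(2) step.hyps(1)] step.prems k by (simp add: level_def)
  then show ?thesis using conic_s by simp
 next
  case False
  then have "ht q < ht (p - s)" using step.prems k levelD(2)[OF s(2)] levelD(2)[of p "Suc n"] by simp
  then have "(p - s - q) + s : conic_span pos" using step.IH[OF s(2) step.prems(2)] conic_s by (intro conic_add)
  then show ?thesis by (simp add: algebra_simps)
 qed
qed

lemma card_below:
 assumes "level n ~= {}" "n >= 2"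
 shows "card {q:pos. ht q < real n} = n"
proof -
 have "{q:pos. ht q < real n} = (UN k:{1..<n}. level k)"
  using pos_cases_level by (fastforce simp: level_def)
 also have "card ... = (SUM k:{1..<n}. card (level k))"
  by (intro card_UN_disjoint ballI impI) (auto simp: finite_level dest: level_disjoint)
 also have "... = card (level 1) + (SUM k:{2..<n}. card (level k))"
  using assms sum.atLeast_Suc_lessThan[of 1 n "%k. card (level k)"] by (simp add: numeral_2_eq_2)
 also have "(SUM k:{2..<n}. card (level k)) = (SUM k:{2..<n}. 1)"
 proof (rule sum.cong)
  fix k assume k: "k : {2..<n}"
  have "level k ~= {}" using level_nonempty[OF assms(1)] k by auto
  then have "card (level k) >= 1" using finite_level by (simp add: Suc_le_eq card_gt_0_iff)
  moreover have "card (level k) <= 1" using card_level_less[OF Ph_nonempty, of k] k rank2 by simp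
  ultimately show "card (level k) = 1" by simp
 qed simp
 finally show ?thesis using card_level_1 assms(2) by simp
qed

context
 fixes J :: "(real^'n) set" and a :: "real^'n"
 assumes J: "order_ideal_in pos J" and aJ: "order_ideal_in pos (insert a J)" and a: "a : pos" "a ~: J"
begin

lemma ideal_ht_le:
 assumes q: "q : J" and n: "a : level n" and k: "q : level k" "k >= 1"
 shows "k < n \<or> (k = 1 & n = 1)"
proof -
 have "n >= 1" using ht_pos_ge1[OF a(1)] levelD(2)[OF n] by simp
 have "k <= n"
 proof (rule ccontr)
  assume "~ k <= n"
  then have "q - a : conic_span pos"
   using level_diff_conic[OF k(1) _ a(1)] \<open>n >= 1\<close> levelD(2)[OF n] levelD(2)[OF k(1)] by simp
  then show False using order_ideal_inD(2)[OF J q a(1)] a(2) by blast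
 qed
 moreover have "k = 1" if "k = n" using level_unique[of q n a] k n that q a(2) by fastforce
 ultimately show ?thesis by fastforce
qed

lemma ideal_eq_below:
 assumes n: "a : level n" "n >= 2"
 shows "J = {q:pos. ht q < real n}"
proof (intro equalityI subsetI)
 fix q assume q: "q : J"
 then have "q : pos" using order_ideal_inD(1)[OF J] by blast
 then obtain k where "q : level k" "k >= 1" using pos_cases_level by blast
 then show "q : {q:pos. ht q < real n}" using ideal_ht_le[OF q n(1)] n(2) \<open>q : pos\<close> levelD(2) by fastforce
next
 fix q assume "q : {q:pos. ht q < real n}"
 then have "q : pos" "a - q : conic_span pos" "q ~= a" using level_diff_conic[OF n] levelD(2)[OF n(1)] by auto
 then show "q : J" using order_ideal_inD(2)[OF aJ, of a q] by auto
qed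

lemma ideal_card_le_1:
 assumes n: "a : level 1"
 shows "card J <= 1"
proof -
 have "J \<subseteq> level 1 - {a}"
 proof
  fix q assume q: "q : J"
  then obtain k where k: "q : level k" "k >= 1" using pos_cases_level order_ideal_inD(1)[OF J] by blast
  then show "q : level 1 - {a}" using ideal_ht_le[OF q n k] q a(2) by auto
 qed
 then have "card J <= card (level 1 - {a})" using finite_level by (intro card_mono) auto
 also have "... = 1" using n card_level_1 finite_level by simp
 finally show ?thesis .
qed

lemma rank2_ideal_card: "J ~= {} ==> real (card J) = ht a" "J = {} ==> ht a = 1"
proof -
 obtain n where n: "a : level n" "n >= 1" using pos_cases_level[OF a(1)] by blast
 have big: "card J = n" if "n >= 2" using card_below[OF _ that] ideal_eq_below[OF n(1) that] n(1) by auto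
 have small: "n = 1" if "~ n >= 2" using that n by simp
 show "real (card J) = ht a" if "J ~= {}"
 proof (cases "n >= 2")
  case False
  have "finite J" using order_ideal_inD(1)[OF J] finite_pos finite_subset by blast
  then have "card J >= 1" using that by (simp add: Suc_le_eq card_gt_0_iff)
  then show ?thesis using ideal_card_le_1 n small[OF False] levelD(2)[OF n(1)] by simp
 qed (use big levelD(2)[OF n(1)] in simp)
 show "ht a = 1" if "J = {}" using big small that levelD(2)[OF n(1)] by fastforce
qed

end

end

section \<open>Affine roots and intersection counts\<close>

lemma inner_values_exist:
 fixes u w :: "'v::euclidean_space"
 assumes "u ~= 0" "w ~: span {u}"
 shows "EX v. u <.> v = s & w <.> v = t"
proof -
 obtain x where x: "u <.> x = 0" "w <.> x ~= 0" using separating_vector[OF assms(2)] by auto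
 have "u ~: span {w}"
 proof
  assume "u : span {w}"
  then obtain k where k: "u = k *R w" by (auto simp: span_singleton)
  then have "k ~= 0" using assms by auto
  then have "w = (1 / k) *R u" using k by simp
  then have "w : span {u}" using span_singleton by blast
  then show False using assms by simp
 qed
 then obtain y where y: "w <.> y = 0" "u <.> y ~= 0" using separating_vector[of u "{w}"] by auto
 let ?v = "(t / (w <.> x)) *R x + (s / (u <.> y)) *R y"
 have "u <.> ?v = s & w <.> ?v = t" using x y by (simp add: inner_add_right)
 then show ?thesis by blast
qed

lemma sum_even_eq_twice:
 fixes g :: "'v::real_vector => real"
 assumes X: "finite X" "!!x. x : X ==> - x : X" and g: "!!x. g (- x) = g x"
  and Y: "Y \<subseteq> X" "!!x. x : X ==> g x ~= 0 ==> x : Y \<longleftrightarrow> - x ~: Y"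
 shows "(SUM x:X. g x) = 2 * (SUM x:Y. g x)"
proof -
 let ?i = "%x. if x : Y then (1::real) else 0"
 have "(SUM x:X. g x) = (SUM x:X. ?i x * g x + ?i (- x) * g x)"
  by (rule sum.cong) (use Y(2) in force)+
 also have "... = (SUM x:X. ?i x * g x) + (SUM x:X. ?i (- x) * g x)" by (rule sum.distrib)
 also have "(SUM x:X. ?i (- x) * g x) = (SUM x:X. ?i x * g x)"
  by (rule sum.reindex_bij_witness[of _ uminus uminus]) (use X g in auto)
 also have "(SUM x:X. ?i x * g x) = (SUM x:Y. g x)"
  using X(1) Y(1) by (intro sum.mono_neutral_cong_right) auto
 finally show ?thesis by simp
qed

definition proj_coeff :: "'v::real_inner => 'v => real" where
 "proj_coeff x y = (x <.> y) / (y <.> y)"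

lemma proj_coeff_minus [simp]: "proj_coeff (- x) y = - proj_coeff x y" "proj_coeff x (- y) = - proj_coeff x y"
 by (simp_all add: proj_coeff_def)

lemma proj_coeff_self [simp]: "x ~= 0 ==> proj_coeff x x = 1"
 by (simp add: proj_coeff_def)

lemma refl_root_proj_coeff: "refl_root a x = x - (2 * proj_coeff x a) *R a"
 by (simp add: refl_root_def proj_coeff_def)

lemma proj_coeff_refl_root:
 assumes "a ~= 0"
 shows "proj_coeff a (refl_root a x) = - proj_coeff a x" "proj_coeff (refl_root a x) a = - proj_coeff x a"
proof -
 have "refl_root a x <.> a = - (x <.> a)" using refl_root_adjoint[of a x a] refl_root_self[OF assms] by simp
 then show "proj_coeff (refl_root a x) a = - proj_coeff x a" "proj_coeff a (refl_root a x) = - proj_coeff a x"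
  by (simp_all add: proj_coeff_def refl_root_isometry inner_commute[of a "refl_root a x"] inner_commute[of x a])
qed

locale affine_sys = root_sys Ph c for Ph :: "(real^'n) set" and c +
 assumes small: "a : Ph ==> \<bar>c <.> a\<bar> < 1"
begin

definition apos :: "((real^'n) \<times> real) set" where
 "apos = {f. fst f : Ph & snd f : \<int> & c <.> fst f + snd f > 0}"

definition lift :: "real^'n => real^'n => (real^'n) \<times> real" where
 "lift v be = (be, - (be <.> v))"

lemma linear_lift: "linear (lift v)"
 by (rule linearI) (simp_all add: lift_def inner_add_left)

lemma apos_int_iff:
 "(be, real_of_int k) : apos \<longleftrightarrow> be : Ph & (k >= 1 \<or> (k = 0 & be : pos))"
proof -
 have "c <.> be + real_of_int k > 0 \<longleftrightarrow> k >= 1 \<or> (k = 0 & c <.> be > 0)" if b: "be : Ph"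
 proof -
  have bound: "- 1 < c <.> be" "c <.> be < 1" using small[OF b] by auto
  consider (pos) "k >= 1" | (zero) "k = 0" | (neg) "k <= -1" by linarith
  then show ?thesis
  proof cases
   case pos
   then have "real_of_int k >= 1" by simp
   then show ?thesis using pos bound by linarith
  next
   case neg
   then have "real_of_int k <= -1" by linarith
   then show ?thesis using neg bound by linarith
  qed simp
 qed
 then show ?thesis by (auto simp: apos_def pos_def)
qed

lemma aposE:
 assumes "f : apos"
 obtains be k where "f = (be, real_of_int k)" "be : Ph" "k >= 1 \<or> (k = 0 & be : pos)"
proof -
 obtain k where k: "snd f = real_of_int k" using assms by (auto simp: apos_def elim: Ints_cases)
 have "f = (fst f, real_of_int k)" using k by (metis prod.collapse)
 then show ?thesis using assms apos_int_iff[of "fst f" k] that by metis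
qed

lemma apos_snd_nonneg: "f : apos ==> snd f >= 0"
 by (elim aposE) auto

lemma apos_nz: "f : apos ==> fst f ~= 0" "f : apos ==> f ~= 0"
 using root_nz by (auto simp: apos_def)

lemma apos_proportional:
 assumes "f : apos" "g : apos" "f = t *R g"
 shows "f = g"
proof -
 have "t = 1 \<or> t = -1" using red[of "fst g" t] assms by (auto simp: apos_def)
 moreover have "t ~= -1"
 proof
  assume "t = -1"
  then show False using assms by (simp add: apos_def)
 qed
 ultimately show ?thesis using assms by simp
qed

definition local_roots :: "(real^'n) set => real^'n => (real^'n) set" where
 "local_roots L v = {ga:Ph. ga : L & ga <.> v : \<int>}"

lemma local_root_sys:
 assumes "subspace L"
 shows "root_sys (local_roots L v) (c - v)"
proof (rule sub_root_sys)
 show "local_roots L v \<subseteq> Ph" by (auto simp: local_roots_def)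
 fix a b assume a: "a : local_roots L v" and b: "b : local_roots L v"
 note ab = a[unfolded local_roots_def] b[unfolded local_roots_def]
 have k: "2 * (b <.> a) / (a <.> a) : \<int>" using int[of a b] ab by simp
 have "refl_root a b : L" unfolding refl_root_def using ab assms by (auto intro!: subspace_diff subspace_scale)
 moreover have "refl_root a b <.> v : \<int>"
  unfolding refl_root_inner using ab by (intro Ints_diff Ints_mult[OF k]) auto
 ultimately show "refl_root a b : local_roots L v" using ab refl by (auto simp: local_roots_def)
next
 fix a assume "a : local_roots L v"
 then obtain k :: int where a: "a : Ph" and k: "a <.> v = k" by (auto simp: local_roots_def elim: Ints_cases)
 show "(c - v) <.> a ~= 0"
 proof
  assume "(c - v) <.> a = 0"
  then have c_a: "c <.> a = k" using k by (simp add: inner_diff_left inner_commute[of v])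
  then have "\<bar>real_of_int k\<bar> < 1" using small[of a] a by simp
  then have "k = 0" by linarith
  then show False using reg[of a] a c_a by simp
 qed
qed

lemma local_pos_iff:
 assumes "subspace L"
 shows "ga : root_sys.pos (local_roots L v) (c - v) \<longleftrightarrow> ga : L & lift v ga : apos"
 unfolding root_sys.pos_def[OF local_root_sys[OF assms]]
 by (auto simp: local_roots_def apos_def lift_def inner_diff_left inner_commute[of v] minus_in_Ints_iff)

lemma local_ideal:
 assumes L: "subspace L" and B: "order_ideal_in apos B"
 shows "order_ideal_in (root_sys.pos (local_roots L v) (c - v)) {ga:L. lift v ga : B}"
 unfolding order_ideal_in_def
proof (intro conjI subsetI ballI impI)
 have "B \<subseteq> apos" using B by (simp add: order_ideal_in_def)
 then show "ga : root_sys.pos (local_roots L v) (c - v)" if "ga : {ga:L. lift v ga : B}" for ga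
  using that by (auto simp: local_pos_iff[OF L])
 fix be ga assume b: "be : {ga:L. lift v ga : B}" and g: "ga : root_sys.pos (local_roots L v) (c - v)"
  and c: "be - ga : conic_span (root_sys.pos (local_roots L v) (c - v))"
 have "lift v (be - ga) : conic_span apos"
  by (rule conic_mono[OF linear_lift _ c]) (auto simp: local_pos_iff[OF L] intro: conic_base)
 then have "lift v be - lift v ga : conic_span apos" using linear_diff[OF linear_lift] by metis
 then show "ga : {ga:L. lift v ga : B}"
  using B b g unfolding order_ideal_in_def by (auto simp: local_pos_iff[OF L])
qed

lemma nonparallel_in_pencil:
 assumes a: "a : apos" and b: "b : apos" "fst b ~: span {fst a}" and f: "f : apos" "f : span {a, b}" "f ~= a"
 shows "fst f ~: span {fst a}" "b : span {a, f}"
proof -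
 obtain p q where pq: "f = p *R a + q *R b" using f(2) by (rule span_pairE)
 have q: "q ~= 0"
 proof
  assume "q = 0"
  then show False using apos_proportional[OF f(1) a, of p] pq f(3) by simp
 qed
 show "fst f ~: span {fst a}"
 proof
  assume "fst f : span {fst a}"
  then obtain k where "p *R fst a + q *R fst b = k *R fst a" using pq by (auto simp: span_singleton)
  then have "q *R fst b = (k - p) *R fst a" by (simp add: algebra_simps)
  then have "fst b = (1 / q) *R ((k - p) *R fst a)" using q by (metis divideR_right inverse_eq_divide scaleR_left_imp_eq)
  then have "fst b = ((k - p) / q) *R fst a" by simp
  then show False using b span_singleton by blast
 qed
 have "b = (- (p / q)) *R a + (1 / q) *R f" using pq q by (simp add: scaleR_add_right)
 then show "b : span {a, f}" using span_pairI by metis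
qed

end

locale affine_pencil = affine_sys Ph c for Ph :: "(real^'n) set" and c +
 fixes a b :: "(real^'n) \<times> real" and v :: "real^'n"
 assumes a: "a : apos" and b: "b : apos" "fst b ~: span {fst a}"
  and v: "fst a <.> v = - snd a" "fst b <.> v = - snd b"
begin

definition plane :: "(real^'n) set" where "plane = span {fst a, fst b}"

lemma lift_ab: "lift v (fst a) = a" "lift v (fst b) = b" using v by (auto simp: lift_def prod_eq_iff)

lemma inj_lift: "inj_on (lift v) X" by (auto simp: inj_on_def lift_def)

lemma lift_in_span_iff: "lift v ga : span {a, b} \<longleftrightarrow> ga : plane"
proof
 assume "lift v ga : span {a, b}"
 then obtain p q where "lift v ga = p *R a + q *R b" by (rule span_pairE)
 then have "ga = p *R fst a + q *R fst b" by (auto simp: lift_def prod_eq_iff)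
 then show "ga : plane" unfolding plane_def using span_pairI by metis
next
 assume "ga : plane"
 then obtain p q where "ga = p *R fst a + q *R fst b" unfolding plane_def by (rule span_pairE)
 then have "lift v ga = p *R a + q *R b"
  by (simp add: linear_add[OF linear_lift] linear_scale[OF linear_lift] lift_ab)
 then show "lift v ga : span {a, b}" using span_pairI by metis
qed

lemma lift_fst:
 assumes "f : span {a, b}"
 shows "lift v (fst f) = f"
proof -
 obtain p q where "f = p *R a + q *R b" using assms by (rule span_pairE)
 then show ?thesis by (simp add: lift_def prod_eq_iff inner_add_left v)
qed

lemma lift_image: "lift v ` {ga:plane. lift v ga : X} = X Int span {a, b}"
proof (intro equalityI subsetI)
 fix f assume "f : X Int span {a, b}"
 then have "f = lift v (fst f)" "fst f : {ga:plane. lift v ga : X}"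
  using lift_fst[of f] lift_in_span_iff[of "fst f"] by auto
 then show "f : lift v ` {ga:plane. lift v ga : X}" by (rule image_eqI)
qed (use lift_in_span_iff in auto)

lemma subspace_plane: "subspace plane" by (simp add: plane_def)

interpretation Q: root_sys "local_roots plane v" "c - v" by (rule local_root_sys[OF subspace_plane])

lemma Q_pos: "Q.pos = {ga:plane. lift v ga : apos}" using local_pos_iff[OF subspace_plane] by auto

lemma ab_pos: "fst a : Q.pos" "fst b : Q.pos"
 using a b unfolding Q_pos by (simp_all add: lift_ab) (simp_all add: plane_def span_base)

lemma dim_local_roots: "dim (local_roots plane v) = 2"
proof -
 have "dim (local_roots plane v) <= dim {fst a, fst b}"
  using dim_subset[of "local_roots plane v" plane] unfolding plane_def by (simp add: local_roots_def subset_iff)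
 also have "... <= 2" by (rule order_trans[OF dim_le_card']) (auto simp: card_insert_if)
 finally have "dim (local_roots plane v) <= 2" .
 moreover have "independent {fst b, fst a}" using b apos_nz[OF a] by (simp add: independent_insert)
 moreover have "fst b ~= fst a" using b(2) by (metis singletonI span_base)
 moreover have "{fst b, fst a} \<subseteq> local_roots plane v" using ab_pos Q.pos_root by blast
 ultimately show ?thesis using independent_card_le_dim[of "{fst b, fst a}" "local_roots plane v"] by simp
qed

interpretation Q: rank2_root_sys "local_roots plane v" "c - v" by unfold_locales (rule dim_local_roots)

lemma finite_pencil: "finite (apos Int span {a, b})"
 unfolding lift_image[symmetric] Q_pos[symmetric] using Q.finite_pos by simp

lemma pencil_sum:
 assumes B: "order_ideal_in apos B" and aB: "a ~: B" "order_ideal_in apos (insert a B)"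
 shows "(SUM f:apos Int span {a, b} - {a}. proj_coeff (fst a) (fst f)) =
  (if B Int span {a, b} = {} then 0 else real (card (B Int span {a, b})) - 1)"
proof -
 let ?J = "{ga:plane. lift v ga : B}"
 have "insert (fst a) ?J = {ga:plane. lift v ga : insert a B}"
  using lift_ab(1) by (auto simp: plane_def span_base) (auto simp: lift_def)
 then have "order_ideal_in Q.pos (insert (fst a) ?J)" using local_ideal[OF subspace_plane aB(2), of v] by simp
 moreover have "fst a ~: ?J" using aB(1) lift_ab(1) by auto
 ultimately have card_J: "?J ~= {} ==> real (card ?J) = Q.ht (fst a)" "?J = {} ==> Q.ht (fst a) = 1"
  using Q.rank2_ideal_card[OF local_ideal[OF subspace_plane B] _ ab_pos(1)] by blast+
 have "apos Int span {a, b} - {a} = lift v ` (Q.pos - {fst a})"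
  unfolding image_set_diff[OF inj_lift[of UNIV]] Q_pos lift_image using lift_ab(1) by simp
 then have "(SUM f:apos Int span {a, b} - {a}. proj_coeff (fst a) (fst f)) = (SUM ga:Q.pos - {fst a}. proj_coeff (fst a) ga)"
  by (simp only: sum.reindex[OF inj_lift] o_def) (simp add: lift_def)
 also have "... = Q.ht (fst a) - 1"
  unfolding Q.ht_def proj_coeff_def[symmetric]
  using sum.remove[OF Q.finite_pos ab_pos(1), of "proj_coeff (fst a)"] apos_nz[OF a] by simp
 also have "... = (if B Int span {a, b} = {} then 0 else real (card (B Int span {a, b})) - 1)"
  using card_J inj_lift unfolding lift_image[symmetric] by (auto simp: card_image)
 finally show ?thesis .
qed

end

context affine_sys
begin

definition arefl :: "(real^'n) \<times> real => (real^'n) \<times> real => (real^'n) \<times> real" where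
 "arefl a f = f - (2 * proj_coeff (fst f) (fst a)) *R a"

definition inversions :: "(real^'n) \<times> real => ((real^'n) \<times> real) set" where
 "inversions a = {f:apos. arefl a f ~: apos & fst f ~: span {fst a}}"

lemma fst_arefl: "fst (arefl a f) = refl_root (fst a) (fst f)"
 by (simp add: arefl_def refl_root_proj_coeff)

lemma arefl_arefl: "fst a ~= 0 ==> arefl a (arefl a f) = f"
 unfolding arefl_def[of a "arefl a f"] fst_arefl by (simp add: proj_coeff_refl_root) (simp add: arefl_def)

text \<open>The affine reflection pairs off the roots of the pencil that are not inversions, with opposite weights.\<close>

lemma pencil_sum_inversions:
 assumes a: "a : apos" and b: "b : apos" "fst b ~: span {fst a}" and fin: "finite (apos Int span {a, b})"
 shows "(SUM f:apos Int span {a, b} - {a}. proj_coeff (fst a) (fst f)) =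
  (SUM f:inversions a Int span {a, b}. proj_coeff (fst a) (fst f))"
proof -
 let ?Y = "apos Int span {a, b}" and ?w = "%f. proj_coeff (fst a) (fst f)"
 let ?Z = "{f:?Y. f ~= a & arefl a f : apos}"
 have a0: "fst a ~= 0" using apos_nz a by blast
 have arefl_a: "arefl a a = - a" using a0 by (simp add: arefl_def scaleR_2)
 have "- a ~: apos" using a by (auto simp: apos_def)
 then have inv: "inversions a Int span {a, b} = (?Y - {a}) - ?Z"
  using nonparallel_in_pencil(1)[OF a b] by (auto simp: inversions_def span_base)
 have "(SUM f:?Z. ?w f) = (SUM f:?Z. - ?w f)"
 proof (rule sum.reindex_bij_witness[of _ "arefl a" "arefl a"])
  fix f assume f: "f : ?Z"
  show r: "arefl a (arefl a f) = f" by (rule arefl_arefl[OF a0])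
  then show "arefl a (arefl a f) = f" .
  have "arefl a f : span {a, b}" unfolding arefl_def using f by (intro span_diff span_scale) (auto intro: span_base)
  moreover have "arefl a f ~= a" using r arefl_a f \<open>- a ~: apos\<close> by auto
  ultimately show "arefl a f : ?Z" using f r by auto
  then show "arefl a f : ?Z" .
  show "- ?w (arefl a f) = ?w f" by (simp add: fst_arefl proj_coeff_refl_root[OF a0])
 qed
 then have "(SUM f:?Z. ?w f) = 0" by (simp add: sum_negf)
 moreover have "(SUM f:?Y - {a}. ?w f) = (SUM f:(?Y - {a}) - ?Z. ?w f) + (SUM f:?Z. ?w f)"
  by (rule sum.subset_diff) (use fin in auto)
 ultimately show ?thesis using inv by simp
qed

definition pencil :: "(real^'n) \<times> real => (real^'n) \<times> real => ((real^'n) \<times> real) set" where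
 "pencil a f = span {a, f} Int apos - {a}"

lemma pencil_self: "f : apos ==> fst f ~: span {fst a} ==> f : pencil a f"
 by (auto simp: pencil_def span_base)

lemma pencil_eq:
 assumes a: "a : apos" and f: "f : apos" "fst f ~: span {fst a}" and g: "g : pencil a f"
 shows "pencil a g = pencil a f"
proof -
 have g': "g : apos" "g : span {a, f}" "g ~= a" using g by (auto simp: pencil_def)
 have "f : span {a, g}" by (rule nonparallel_in_pencil(2)[OF a f g'])
 then have "span {a, g} = span {a, f}" using g'(2) by (intro equalityI; metis span_pair_trans subsetI)
 then show ?thesis by (simp add: pencil_def)
qed

lemma pencil_inversions_sum:
 assumes B: "order_ideal_in apos B" and aB: "a : apos" "a ~: B" "order_ideal_in apos (insert a B)"
  and b: "b : apos" "fst b ~: span {fst a}"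
 shows "(SUM f:inversions a Int pencil a b. proj_coeff (fst a) (fst f)) =
  (if B Int span {a, b} = {} then 0 else real (card (B Int span {a, b})) - 1)"
proof -
 obtain v where v: "fst a <.> v = - snd a" "fst b <.> v = - snd b"
  using inner_values_exist[OF apos_nz(1)[OF aB(1)] b(2)] by blast
 interpret affine_pencil Ph c a b v using aB(1) b v by unfold_locales auto
 have "a ~: inversions a" by (auto simp: inversions_def span_base)
 then have "inversions a Int pencil a b = inversions a Int span {a, b}" by (auto simp: pencil_def inversions_def)
 then show ?thesis using pencil_sum_inversions[OF aB(1) b finite_pencil] pencil_sum[OF B aB(2,3)] by simp
qed

context
 fixes B C :: "((real^'n) \<times> real) set" and a :: "(real^'n) \<times> real"
 assumes B: "order_ideal_in apos B" "finite B" and a: "a : apos" "a ~: B" "order_ideal_in apos (insert a B)"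
  and C: "transversal {f:B. fst f ~: span {fst a}} C a"
begin

abbreviation "nonparallel \<equiv> {f:B. fst f ~: span {fst a}}"

lemma B_subset: "B \<subseteq> apos" using B by (simp add: order_ideal_in_def)

lemma C_nonparallel: "C \<subseteq> nonparallel" using C by (auto simp: transversal_def)

lemma pencil_transversal:
 assumes b: "b : apos" "fst b ~: span {fst a}" and g: "g : nonparallel" "g : pencil a b"
 obtains k where "nonparallel Int pencil a b Int C = {k}"
proof -
 obtain k where k: "k : C" "g : span {a, k}" using C g(1) unfolding transversal_def by blast
 have k_nonparallel: "k : apos" "fst k ~: span {fst a}" "k : nonparallel" using k C_nonparallel B_subset by auto
 have "k : span {a, g}" using nonparallel_in_pencil(2)[OF a(1) k_nonparallel(1,2) _ k(2)] g B_subset by (auto simp: pencil_def)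
 moreover have "k ~= a" using k_nonparallel by (auto simp: span_base)
 ultimately have k_in: "k : pencil a b" using pencil_eq[OF a(1) b g(2)] k_nonparallel by (auto simp: pencil_def)
 have pencil_k: "pencil a k = pencil a b" using pencil_eq[OF a(1) b k_in] .
 have "nonparallel Int pencil a b Int C = {k}"
 proof (intro equalityI subsetI)
  fix l assume l: "l : nonparallel Int pencil a b Int C"
  then have "l : span {a, k}" using pencil_k by (auto simp: pencil_def)
  then show "l : {k}" using C l k unfolding transversal_def by blast
 qed (use k_in k_nonparallel k in auto)
 then show ?thesis using that by blast
qed

lemma pencil_count:
 assumes b: "b : apos" "fst b ~: span {fst a}"
 shows "real (card (nonparallel Int pencil a b - C)) = (SUM f:inversions a Int pencil a b. proj_coeff (fst a) (fst f))"
proof -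
 have B_pencil: "B Int span {a, b} = nonparallel Int pencil a b"
  using B_subset a(2) nonparallel_in_pencil(1)[OF a(1) b] by (auto simp: pencil_def)
 have fin: "finite (nonparallel Int pencil a b)" using B(2) by simp
 show ?thesis
 proof (cases "nonparallel Int pencil a b = {}")
  case True
  then show ?thesis using pencil_inversions_sum[OF B(1) a b] B_pencil by simp
 next
  case False
  then obtain k where k: "nonparallel Int pencil a b Int C = {k}" using pencil_transversal[OF b] by blast
  have "card (nonparallel Int pencil a b - C) = card (nonparallel Int pencil a b) - 1"
   using card_Diff_subset_Int[of "nonparallel Int pencil a b" C] k by simp
  moreover have "card (nonparallel Int pencil a b) >= 1" using fin False by (simp add: Suc_le_eq card_gt_0_iff)
  ultimately show ?thesis using pencil_inversions_sum[OF B(1) a b] False B_pencil by (simp add: of_nat_diff)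
 qed
qed

lemma nonparallel_count:
 assumes fin: "finite (inversions a)"
 shows "real (card (nonparallel - C)) = (SUM f:inversions a. proj_coeff (fst a) (fst f))"
proof -
 let ?N = "nonparallel Un inversions a" and ?w = "%f. proj_coeff (fst a) (fst f)"
 let ?K = "pencil a ` ?N"
 have N: "f : apos" "fst f ~: span {fst a}" if "f : ?N" for f using that B_subset by (auto simp: inversions_def)
 have finK: "finite ?K" using B fin by simp
 have disj: "X Int Y = {}" if XY: "X : ?K" "Y : ?K" "X ~= Y" for X Y
 proof (rule ccontr)
  assume "X Int Y ~= {}"
  then obtain g where g: "g : X" "g : Y" by blast
  obtain f f' where f: "f : ?N" "X = pencil a f" "f' : ?N" "Y = pencil a f'" using XY(1,2) by blast
  have "pencil a g = X" "pencil a g = Y" using pencil_eq[OF a(1) N[OF f(1)]] pencil_eq[OF a(1) N[OF f(3)]] f g by blast+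
  then show False using XY(3) by simp
 qed
 have self: "f : pencil a f" if "f : ?N" for f using pencil_self[OF N[OF that]] .
 have inv_cover: "inversions a = (UN X:?K. inversions a Int X)" using self by blast
 have nonparallel_cover: "nonparallel - C = (UN X:?K. nonparallel Int X - C)" using self by blast
 have "(SUM f:inversions a. ?w f) = (SUM X:?K. SUM f:inversions a Int X. ?w f)"
  by (subst inv_cover, rule sum.UNION_disjoint) (use finK fin disj in auto)
 also have "... = (SUM X:?K. real (card (nonparallel Int X - C)))" using pencil_count[OF N] by (intro sum.cong) auto
 also have "... = real (card (nonparallel - C))"
  by (subst nonparallel_cover, subst card_UN_disjoint) (use finK B(2) disj in auto)
 finally show ?thesis by simp
qed

end

definition cox :: "real^'n => real" where
 "cox al = (SUM be:pos. 2 * proj_coeff al be * proj_coeff be al)"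

definition cartan :: "real^'n => real^'n => int" where
 "cartan al be = \<lfloor>2 * proj_coeff be al\<rfloor>"

definition first_level :: "real^'n => int" where
 "first_level be = (if be : pos then 0 else 1)"

abbreviation nonproportional :: "real^'n => (real^'n) set" where
 "nonproportional al \<equiv> Ph - {al, - al}"

lemma refl_root_minus: "refl_root al (- x) = - refl_root al x"
 using linear_neg[OF linear_refl_root] by blast

lemma apos_iff_first_level: "(be, real_of_int k) : apos \<longleftrightarrow> be : Ph & first_level be <= k"
 unfolding apos_int_iff first_level_def by auto

lemma first_level_neg: "be : Ph ==> first_level (- be) = 1 - first_level be"
 using pos_or_neg[of be] not_pos_neg[of be] by (auto simp: first_level_def)

context
 fixes al :: "real^'n"
 assumes al: "al : Ph"
begin

lemma of_int_cartan: "be : Ph ==> real_of_int (cartan al be) = 2 * proj_coeff be al"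
 using int[OF al, of be] by (simp add: cartan_def proj_coeff_def)

lemma cartan_pos_iff:
 assumes "be : Ph"
 shows "cartan al be > 0 \<longleftrightarrow> be <.> al > 0"
proof -
 have "cartan al be > 0 \<longleftrightarrow> real_of_int (cartan al be) > 0" by simp
 also have "... \<longleftrightarrow> be <.> al > 0"
  unfolding of_int_cartan[OF assms] using root_nz(2)[OF al] by (simp add: proj_coeff_def zero_less_divide_iff del: inner_gt_zero_iff)
 finally show ?thesis .
qed

lemma not_span_iff:
 assumes "be : Ph"
 shows "be ~: span {al} \<longleftrightarrow> be : nonproportional al"
proof -
 have "al : span {al}" "- al : span {al}" by (auto intro: span_neg span_base)
 moreover have "be = al \<or> be = - al" if span: "be : span {al}"
 proof -
  obtain t where "be = t *R al" using span by (auto simp: span_singleton)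
  then show ?thesis using red[OF al, of t] assms by auto
 qed
 ultimately show ?thesis using assms by auto
qed

lemma refl_root_neg:
 assumes "al : pos" "be : Ph" "be <.> al > 0" "be ~: pos"
 shows "refl_root al be ~: pos"
proof -
 have "c <.> be <= 0" "c <.> al > 0" using assms by (auto simp: pos_def)
 moreover have "2 * (be <.> al) / (al <.> al) > 0" using assms(3) root_nz[OF al] by simp
 ultimately have "c <.> be - 2 * (be <.> al) / (al <.> al) * (c <.> al) <= 0" by (smt (verit) mult_pos_pos)
 then show ?thesis by (simp add: pos_def refl_root_def inner_diff_right)
qed

lemma inversions_iff:
 assumes be: "be : nonproportional al"
 shows "(be, real_of_int k) : inversions (al, real_of_int M) \<longleftrightarrow>
  k : {first_level be..<cartan al be * M + first_level (refl_root al be)}"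
proof -
 have bePh: "be : Ph" using be by simp
 have "arefl (al, real_of_int M) (be, real_of_int k) = (refl_root al be, real_of_int (k - cartan al be * M))"
  using of_int_cartan[OF bePh] by (simp add: arefl_def refl_root_proj_coeff)
 then show ?thesis
  using be bePh not_span_iff[OF bePh] refl[OF al bePh]
  by (auto simp: inversions_def apos_iff_first_level simp del: of_int_diff of_int_mult)
qed

lemma inversions_eq:
 "inversions (al, real_of_int M) = (%(be, k). (be, real_of_int k)) `
  (SIGMA be:nonproportional al. {first_level be..<cartan al be * M + first_level (refl_root al be)})"
proof (intro equalityI subsetI)
 fix f assume f: "f : inversions (al, real_of_int M)"
 then have "f : apos" by (simp add: inversions_def)
 then obtain be k where be: "f = (be, real_of_int k)" "be : Ph" by (rule aposE)
 then have "be : nonproportional al" using f not_span_iff[OF be(2)] by (simp add: inversions_def)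
 then show "f : (%(be, k). (be, real_of_int k)) `
   (SIGMA be:nonproportional al. {first_level be..<cartan al be * M + first_level (refl_root al be)})"
  using inversions_iff f be by (intro image_eqI[of _ _ "(be, k)"]) auto
next
 fix f assume "f : (%(be, k). (be, real_of_int k)) `
  (SIGMA be:nonproportional al. {first_level be..<cartan al be * M + first_level (refl_root al be)})"
 then show "f : inversions (al, real_of_int M)"
  by (elim imageE SigmaE) (simp only: case_prod_conv inversions_iff)
qed

lemma finite_inversions: "finite (inversions (al, real_of_int M))"
 unfolding inversions_eq using fin by auto

definition surplus :: "int => real^'n => int" where
 "surplus M be = cartan al be * M + first_level (refl_root al be) - first_level be"

lemma surplus_neg:
 assumes "be : Ph"
 shows "surplus M (- be) = - surplus M be"
proof -
 have "real_of_int (cartan al (- be)) = real_of_int (- cartan al be)" using of_int_cartan[of be] of_int_cartan[of "- be"] assms by simp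
 then have "cartan al (- be) = - cartan al be" by (simp only: of_int_eq_iff)
 then show ?thesis
  using first_level_neg[OF assms] first_level_neg[OF refl[OF al assms]] by (simp add: surplus_def refl_root_minus)
qed

lemma surplus_nonneg:
 assumes a: "(al, real_of_int M) : apos" and be: "be : Ph" "be <.> al > 0"
 shows "surplus M be >= 0"
proof -
 have cartan: "cartan al be >= 1" using cartan_pos_iff[OF be(1)] be(2) by simp
 have first: "first_level x = 0 \<or> first_level x = 1" for x by (simp add: first_level_def)
 consider (pos) "M >= 1" | (zero) "M = 0" "al : pos" using a apos_int_iff by auto
 then show ?thesis
 proof cases
  case pos
  then have "cartan al be * M >= 1" using cartan by (metis mult_mono' mult_1 zero_le_one)
  then show ?thesis using first[of be] first[of "refl_root al be"] by (auto simp: surplus_def)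
 next
  case zero
  then show ?thesis using refl_root_neg[OF _ be] by (auto simp: surplus_def first_level_def)
 qed
qed

abbreviation "acute \<equiv> {be:nonproportional al. be <.> al > 0}"

lemma inversions_sum_acute:
 assumes a: "(al, real_of_int M) : apos"
 shows "(SUM f:inversions (al, real_of_int M). proj_coeff al (fst f)) =
  (SUM be:acute. proj_coeff al be * real_of_int (surplus M be))"
proof -
 let ?w = "proj_coeff al" and ?N = "nonproportional al"
 let ?K = "%be. {first_level be..<cartan al be * M + first_level (refl_root al be)}"
 have "inj_on (%(be, k). (be, real_of_int k)) (Sigma ?N ?K)" by (auto simp: inj_on_def)
 then have "(SUM f:inversions (al, real_of_int M). ?w (fst f)) = (SUM (be, k):Sigma ?N ?K. ?w be)"
  unfolding inversions_eq by (subst sum.reindex) (auto intro!: sum.cong)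
 also have "... = (SUM be:?N. SUM k:?K be. ?w be)" by (rule sum.Sigma[symmetric]) (use fin in auto)
 also have "... = (SUM be:?N. real (nat (surplus M be)) * ?w be)" by (simp add: surplus_def algebra_simps)
 also have "... = (SUM be:acute. ?w be * real_of_int (surplus M be))"
 proof (rule sum.mono_neutral_cong_right)
  show "ALL be:?N - acute. real (nat (surplus M be)) * ?w be = 0"
  proof
   fix be assume be: "be : ?N - acute"
   show "real (nat (surplus M be)) * ?w be = 0"
   proof (cases "be <.> al = 0")
    case False
    then have "surplus M (- be) >= 0" using be by (intro surplus_nonneg[OF a]) auto
    then show ?thesis using surplus_neg[of be M] be by simp
   qed (simp add: proj_coeff_def inner_commute)
  qed
 qed (use fin surplus_nonneg[OF a] in auto)
 finally show ?thesis .
qed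

lemma sum_first_level_refl_root:
 "(SUM be:acute. proj_coeff al be * real_of_int (first_level (refl_root al be))) =
  (SUM be:acute. proj_coeff al be * real_of_int (1 - first_level be))"
proof (rule sum.reindex_bij_witness[of _ "%x. - refl_root al x" "%x. - refl_root al x"])
 have al0: "al ~= 0" using root_nz[OF al] by blast
 have inv: "- refl_root al (- refl_root al be) = be" for be by (simp add: refl_root_minus)
 fix be assume be: "be : acute"
 then have bePh: "be : Ph" by simp
 show "- refl_root al (- refl_root al be) = be" "- refl_root al (- refl_root al be) = be" by (rule inv)+
 have "- refl_root al be ~= al" "- refl_root al be ~= - al"
  using inv[of be] refl_root_self[OF al0] be refl_root_minus[of al al] by auto
 moreover have "refl_root al be <.> al = - (be <.> al)" using refl_root_adjoint[of al be al] refl_root_self[OF al0] by simp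
 ultimately show "- refl_root al be : acute" "- refl_root al be : acute" using be refl[OF al bePh] by auto
 show "proj_coeff al (- refl_root al be) * real_of_int (1 - first_level (- refl_root al be)) =
  proj_coeff al be * real_of_int (first_level (refl_root al be))"
  using first_level_neg[OF refl[OF al bePh]] by (simp add: proj_coeff_refl_root[OF al0])
qed

lemma sum_acute_eq_sum_pos:
 fixes g :: "real^'n => real"
 assumes even: "!!x. x : Ph ==> g (- x) = g x" and zero: "!!x. x <.> al = 0 ==> g x = 0"
 shows "(SUM be:acute. g be) = (SUM be:pos - {al, - al}. g be)"
proof -
 let ?N = "nonproportional al" and ?P = "pos - {al, - al}"
 define g' where "g' x = (if x : Ph then g x else 0)" for x
 have even': "g' (- x) = g' x" for x using even by (simp add: g'_def)
 have "(SUM x:?N. g' x) = 2 * (SUM x:acute. g' x)"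
 proof (rule sum_even_eq_twice[where g=g', OF _ _ even'])
  fix x assume x: "x : ?N" "g' x ~= 0"
  then have "x <.> al ~= 0" using zero by (auto simp: g'_def)
  then show "x : acute \<longleftrightarrow> - x ~: acute" using x by auto
 qed (use fin in auto)
 moreover have "(SUM x:?N. g' x) = 2 * (SUM x:?P. g' x)"
 proof (rule sum_even_eq_twice[where g=g', OF _ _ even'])
  fix x assume x: "x : ?N" "g' x ~= 0"
  then show "x : ?P \<longleftrightarrow> - x ~: ?P" using pos_or_neg[of x] not_pos_neg[of x] by auto
 qed (use fin pos_root in auto)
 moreover have "(SUM x:acute. g' x) = (SUM x:acute. g x)" "(SUM x:?P. g' x) = (SUM x:?P. g x)"
  by (rule sum.cong, auto simp: g'_def pos_root)+
 ultimately show ?thesis by simp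
qed

lemma sum_pos_remove:
 fixes g :: "real^'n => real"
 shows "(SUM be:pos - {al, - al}. g be) = (SUM be:pos. g be) - (if al : pos then g al else g (- al))"
proof -
 define p where "p = (if al : pos then al else - al)"
 have "p : pos" "pos - {al, - al} = pos - {p}"
  using pos_or_neg[OF al] not_pos_neg[of al] not_pos_neg[of "- al"] by (auto simp: p_def)
 then show ?thesis using sum.remove[OF finite_pos, of p g] by (auto simp: p_def)
qed

lemma inversions_sum:
 assumes a: "(al, real_of_int M) : apos"
 shows "(SUM f:inversions (al, real_of_int M). proj_coeff al (fst f)) =
  real_of_int M * (cox al - 2) + ht al - (if al : pos then 1 else -1)"
proof -
 let ?w = "proj_coeff al" and ?P = "pos - {al, - al}"
 have al0: "al ~= 0" using root_nz[OF al] by blast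
 have weight_zero: "?w x = 0" if "x <.> al = 0" for x using that by (simp add: proj_coeff_def inner_commute)
 have "(SUM f:inversions (al, real_of_int M). ?w (fst f)) =
  (SUM be:acute. real_of_int M * (2 * ?w be * proj_coeff be al)) +
  ((SUM be:acute. ?w be * real_of_int (first_level (refl_root al be))) - (SUM be:acute. ?w be * real_of_int (first_level be)))"
  unfolding inversions_sum_acute[OF a] sum_subtractf[symmetric] sum.distrib[symmetric]
  by (rule sum.cong) (auto simp: surplus_def of_int_cartan algebra_simps)
 also have "... = (SUM be:acute. real_of_int M * (2 * ?w be * proj_coeff be al)) +
  (SUM be:acute. ?w be * (1 - 2 * real_of_int (first_level be)))"
  unfolding sum_first_level_refl_root by (simp add: sum_subtractf[symmetric] algebra_simps)
 also have "(SUM be:acute. real_of_int M * (2 * ?w be * proj_coeff be al)) = real_of_int M * (cox al - 2)"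
 proof -
  have "(SUM be:acute. 2 * ?w be * proj_coeff be al) = (SUM be:?P. 2 * ?w be * proj_coeff be al)"
   by (rule sum_acute_eq_sum_pos) (auto simp: weight_zero)
  then show ?thesis using al0 unfolding sum_pos_remove cox_def by (simp flip: sum_distrib_left)
 qed
 also have "(SUM be:acute. ?w be * (1 - 2 * real_of_int (first_level be))) = ht al - (if al : pos then 1 else -1)"
 proof -
  have "(SUM be:acute. ?w be * (1 - 2 * real_of_int (first_level be))) = (SUM be:?P. ?w be * (1 - 2 * real_of_int (first_level be)))"
   by (rule sum_acute_eq_sum_pos) (auto simp: weight_zero first_level_neg algebra_simps)
  also have "... = (SUM be:?P. ?w be)" by (rule sum.cong) (auto simp: first_level_def)
  finally show ?thesis using al0 unfolding sum_pos_remove ht_def proj_coeff_def[symmetric] by simp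
 qed
 finally show ?thesis by simp
qed

end

lemma nonparallel_card:
 assumes B: "order_ideal_in apos B" "finite B"
  and a: "(al, real_of_int M) : apos" "(al, real_of_int M) ~: B" "order_ideal_in apos (insert (al, real_of_int M) B)"
  and C: "transversal {f:B. fst f ~: span {al}} C (al, real_of_int M)"
 shows "real (card ({f:B. fst f ~: span {al}} - C)) = real_of_int M * (cox al - 2) + ht al - (if al : pos then 1 else -1)"
proof -
 have al: "al : Ph" using a(1) by (simp add: apos_int_iff)
 show ?thesis using nonparallel_count[OF B a _ finite_inversions[OF al]] C inversions_sum[OF al a(1)] by simp
qed

end

section \<open>Ideal arrangements\<close>

definition emb :: "real^'n => (real^'n) \<times> real" where "emb x = (x, 0)"

lemma emb_simps [simp]: "fst (emb x) = x" "snd (emb x) = 0" "emb x <.> y = x <.> fst y" "y <.> emb x = fst y <.> x"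
 "emb x = emb z \<longleftrightarrow> x = z"
 by (auto simp: emb_def inner_prod_def)

lemma linear_emb: "linear emb"
 by (rule linearI) (simp_all add: emb_def)

lemma inj_emb: "inj_on emb X"
 by (auto simp: inj_on_def)

lemma tangent_fields_mono_range: "U \<subseteq> U' ==> tangent_fields U A \<subseteq> tangent_fields U' A"
 unfolding tangent_fields_def by auto

lemma unit_on_mono: "unit_on U A C a ==> U \<subseteq> U' ==> unit_on U' A C a"
 unfolding unit_on_def using tangent_fields_mono_range by blast

lemma dim_kernel_ge:
 fixes W :: "'e::euclidean_space set"
 assumes W: "subspace W"
 shows "dim W <= dim {x:W. k <.> x = 0} + 1"
proof (cases "ALL x:W. k <.> x = 0")
 case True
 then have "{x:W. k <.> x = 0} = W" by auto
 then show ?thesis by simp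
next
 case False
 let ?Z = "{x:W. k <.> x = 0}"
 obtain w where w: "w : W" "k <.> w ~= 0" using False by blast
 have "W \<subseteq> span (insert w ?Z)"
 proof
  fix x assume x: "x : W"
  let ?t = "(k <.> x) / (k <.> w)"
  have "x - ?t *R w : ?Z" using x w W by (auto simp: subspace_diff subspace_scale inner_diff_right)
  then have "x - ?t *R w : span (insert w ?Z)" by (intro span_base) auto
  moreover have "?t *R w : span (insert w ?Z)" by (intro span_scale span_base) auto
  ultimately have "(x - ?t *R w) + ?t *R w : span (insert w ?Z)" by (rule span_add)
  then show "x : span (insert w ?Z)" by simp
 qed
 then have "dim W <= dim (insert w ?Z)" using dim_subset[of W "span (insert w ?Z)"] by simp
 also have "... <= dim ?Z + 1" by (simp add: dim_insert)
 finally show ?thesis .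
qed

lemma constant_basis:
 fixes U :: "'e::euclidean_space set"
 assumes U: "subspace U" and A: "!!K u. K : A ==> u : U ==> K <.> u = 0"
 shows "EX (I::nat set) th. free_basis U A I (%_. 0) th & card I = dim U"
proof -
 let ?I = "{0..<dim U}"
 obtain f where f: "!!i. i : ?I ==> f i : U" "!!i j. i : ?I ==> j : ?I ==> f i <.> f j = (if i = j then 1 else 0)"
  "!!x. x : U ==> (SUM i:?I. (f i <.> x) *R f i) = x" using orthonormal_family_exists[OF U, of ?I] by auto
 have "free_basis U A ?I (%_. 0) (%i x. f i)"
  unfolding free_basis_def homogeneous_generators_def
 proof (intro conjI ballI allI impI)
  fix i assume "i : ?I"
  then have "f i : U" by (rule f)
  then show "(%x. f i) : tangent_fields U A" using A by (intro tangent_fieldsI) (auto intro: rpoly_const)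
 next
  fix et assume et: "et : tangent_fields U A"
  show "EX g. (ALL i:?I. rpoly (g i)) & (ALL x. et x = (SUM i:?I. g i x *R f i))"
   by (rule exI[of _ "%i x. f i <.> et x"]) (simp add: tangent_fieldsD(4)[OF et] f(3)[OF tangent_fieldsD(2)[OF et]])
 next
  fix g i x assume zero: "ALL x. (SUM i:?I. g i x *R f i) = 0" and i: "i : ?I"
  have "0 = f i <.> (SUM j:?I. g j x *R f j)" using zero by simp
  also have "... = (SUM j:?I. if j = i then g i x else 0)"
   unfolding inner_sum_right by (rule sum.cong) (use f(2)[OF i] in auto)
  also have "... = g i x" using i by simp
  finally show "g i x = 0" by simp
 qed simp_all
 then show ?thesis by (intro exI[of _ ?I]) auto
qed

lemma card_exponents_update:
 assumes "finite I" "i : I" "e i = d"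
 shows "card {k:I. s <= (e(i := Suc d)) k} = card {k:I. s <= e k} + (if s = Suc d then 1 else 0)"
proof (cases "s = Suc d")
 case True
 then have "{k:I. s <= (e(i := Suc d)) k} = insert i {k:I. s <= e k}" using assms by auto
 then show ?thesis using True assms by simp
next
 case False
 then have "{k:I. s <= (e(i := Suc d)) k} = {k:I. s <= e k}" using assms by auto
 then show ?thesis using False by simp
qed

lemma transversal_local:
 assumes A: "arr (insert a A)" "a ~: A" and C: "transversal A C a" and x: "a <.> x = 0"
 shows "transversal {K:A. K <.> x = 0} {K:C. K <.> x = 0} a"
proof -
 have CA: "C \<subseteq> A" using C by (simp add: transversal_def)
 have "EX c:{K:C. K <.> x = 0}. K : span {a, c}" if K: "K : A" "K <.> x = 0" for K
 proof -
  obtain c where c: "c : C" "K : span {a, c}" using C K unfolding transversal_def by blast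
  have "c : span {a, K}" using arr_class_sym[OF A K(1) _ c(2)] c CA by blast
  then obtain u v where "c = u *R a + v *R K" by (rule span_pairE)
  then have "c <.> x = 0" using x K by (simp add: inner_add_left)
  then show ?thesis using c by blast
 qed
 then show ?thesis using C unfolding transversal_def by blast
qed

context affine_sys
begin

definition stage :: "real => (real^'n) set => ((real^'n) \<times> real) set" where
 "stage M Th = {f:apos. snd f < M \<or> (snd f = M & fst f : Th)}"

definition lower :: "(real^'n) set => bool" where
 "lower Th \<longleftrightarrow> Th \<subseteq> Ph & (ALL be:Th. ALL ga:Ph. be - ga : conic_span pos --> ga : Th)"

lemma conic_apos:
 assumes "f : conic_span apos"
 shows "snd f >= 0 & (snd f = 0 --> fst f : conic_span pos)"
 using assms
proof (induction f rule: conic_span.induct)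
 case conic_0
 then show ?case by (simp add: conic_span.conic_0)
next
 case (conic_step f t g)
 have s: "snd f >= 0" using apos_snd_nonneg conic_step by blast
 have snd_nonneg: "snd (t *R f + g) >= 0" using s conic_step by simp
 have "fst (t *R f + g) : conic_span pos" if "snd (t *R f + g) = 0"
 proof -
  have "t * snd f >= 0" using s conic_step by simp
  moreover have "snd g >= 0" "t * snd f + snd g = 0" using that conic_step by auto
  ultimately have "snd g = 0" and snd_tf_zero: "t * snd f = 0" by linarith+
  then have g_conic: "fst g : conic_span pos" using conic_step by blast
  show ?thesis
  proof (cases "t = 0")
   case True
   then show ?thesis using g_conic by simp
  next
   case False
   then have "snd f = 0" using snd_tf_zero by simp
   then have "fst f : pos" using conic_step(1) by (auto simp: apos_def pos_def)
   then show ?thesis using g_conic conic_step by (simp add: conic_span.conic_step)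
  qed
 qed
 then show ?case using snd_nonneg by blast
qed

lemma stage_ideal:
 assumes Th: "lower Th"
 shows "order_ideal_in apos (stage M Th)"
 unfolding order_ideal_in_def
proof (intro conjI ballI impI)
 show "stage M Th \<subseteq> apos" by (auto simp: stage_def)
 fix f g assume f: "f : stage M Th" and g: "g : apos" and c: "f - g : conic_span apos"
 have snd_le: "snd g <= snd f" "snd f = snd g ==> fst f - fst g : conic_span pos" using conic_apos[OF c] by auto
 show "g : stage M Th"
 proof (cases "snd g < M")
  case False
  then have e: "snd g = M" "snd f = M" "fst f : Th" using f snd_le(1) by (auto simp: stage_def)
  then have "fst f - fst g : conic_span pos" using snd_le(2) by simp
  then have "fst g : Th" using Th e(3) g unfolding lower_def apos_def by blast
  then show ?thesis using g e by (simp add: stage_def)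
 qed (use g in \<open>simp add: stage_def\<close>)
qed

lemma insert_stage: "(al, M) : apos ==> insert (al, M) (stage M Th) = stage M (insert al Th)"
 by (auto simp: stage_def)

lemma lower_ideal:
 assumes "order_ideal_in pos J"
 shows "lower (J Un uminus ` pos)"
 unfolding lower_def
proof (intro conjI ballI impI)
 show "J Un uminus ` pos \<subseteq> Ph" using assms pos_root by (auto simp: order_ideal_in_def)
 fix be ga assume b: "be : J Un uminus ` pos" and g: "ga : Ph" and c: "be - ga : conic_span pos"
 show "ga : J Un uminus ` pos"
 proof (cases "ga : pos")
  case True
  have "c <.> (be - ga) >= 0"
   by (rule conic_nonneg[where f="%x. c <.> x", OF c]) (auto simp: pos_def bounded_linear.linear[OF bounded_linear_inner_right])
  then have "c <.> be > 0" using True by (simp add: inner_diff_right pos_def)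
  then have "be : J" using b by (auto simp: pos_def)
  then show ?thesis using assms True c unfolding order_ideal_in_def by blast
 next
  case False
  then have "- ga : pos" using pos_or_neg[OF g] by blast
  then show ?thesis by (metis UnI2 imageI minus_minus)
 qed
qed

lemma stage_zero:
 assumes "J \<subseteq> pos"
 shows "stage 0 (J Un uminus ` pos) = emb ` J"
proof (intro equalityI subsetI)
 fix f assume f: "f : stage 0 (J Un uminus ` pos)"
 then have f': "f : apos" "snd f = 0" "fst f : J Un uminus ` pos" using apos_snd_nonneg[of f] by (auto simp: stage_def)
 then have "fst f : pos" by (auto simp: apos_def pos_def)
 then have "fst f : J" using f'(3) not_pos_neg by fastforce
 moreover have "f = emb (fst f)" using f'(2) by (simp add: emb_def prod_eq_iff)
 ultimately show "f : emb ` J" by blast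
next
 fix f assume "f : emb ` J"
 then show "f : stage 0 (J Un uminus ` pos)" using assms by (auto simp: stage_def emb_def apos_def pos_def)
qed

end

context root_sys
begin

lemma normalize_exists: "EX c'. affine_sys Ph c' & root_sys.pos Ph c' = pos"
proof -
 define B where "B = 1 + (SUM be:Ph. \<bar>c <.> be\<bar>)"
 have B_ge_1: "B >= 1" unfolding B_def by (simp add: sum_nonneg)
 have bounded: "\<bar>c <.> a\<bar> < B" if "a : Ph" for a
  unfolding B_def using member_le_sum[of a Ph "%be. \<bar>c <.> be\<bar>"] that fin by auto
 interpret N: root_sys Ph "(1 / B) *R c"
 proof (rule sub_root_sys)
  show "((1 / B) *R c) <.> a ~= 0" if "a : Ph" for a using reg[OF that] B_ge_1 by simp
 qed (simp_all add: refl)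
 have "affine_sys Ph ((1 / B) *R c)"
  by unfold_locales (use bounded B_ge_1 in \<open>auto simp: field_simps\<close>)
 moreover have "N.pos = pos" unfolding N.pos_def pos_def using B_ge_1 by (auto simp: zero_less_divide_iff)
 ultimately show ?thesis by blast
qed

lemma pos_nonproportional:
 assumes "a : pos" "b : pos" "a ~= b"
 shows "a ~: span {b}"
 using proportional_eq[OF assms(1,2)] assms(3) by (auto simp: span_singleton)

lemma arr_emb:
 assumes "J \<subseteq> pos"
 shows "arr (emb ` J)"
 unfolding arr_def
proof (intro conjI ballI impI)
 show "finite (emb ` J)" using assms finite_pos finite_subset by blast
 show "0 ~: emb ` J" using assms pos_root root_nz by (force simp: emb_def zero_prod_def)
 fix K L assume "K : emb ` J" "L : emb ` J" "K : span {L}"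
 then obtain a b t where ab: "K = emb a" "L = emb b" "a : J" "b : J" "emb a = t *R emb b" by (auto simp: span_singleton)
 then have "a = t *R b" by (simp add: emb_def)
 moreover have "a : pos" "b : pos" using ab(3,4) assms by auto
 ultimately have "a = b" using proportional_eq by blast
 then show "K = L" using ab(1,2) by simp
qed

definition ideal_step :: "(real^'n) set => real^'n => bool" where
 "ideal_step J a \<longleftrightarrow> order_ideal_in pos J & a : pos & a ~: J & order_ideal_in pos (insert a J)"

lemma ideal_stepD:
 assumes "ideal_step J a"
 shows "order_ideal_in pos J" "a : pos" "a ~: J" "order_ideal_in pos (insert a J)" "J \<subseteq> pos"
 using assms unfolding ideal_step_def order_ideal_in_def by auto

lemma arr_ideal_step:
 assumes "ideal_step J a"
 shows "arr (insert (emb a) (emb ` J))" "emb a ~: emb ` J"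
 using arr_emb[of "insert a J"] ideal_stepD[OF assms] by auto

lemma central_count:
 assumes J: "ideal_step J a" and C: "transversal (emb ` J) C (emb a)"
 shows "real (card (emb ` J - C)) = ht a - 1"
proof -
 obtain c' where c': "affine_sys Ph c'" "root_sys.pos Ph c' = pos" using normalize_exists by blast
 interpret N: affine_sys Ph c' by (rule c'(1))
 have P: "N.pos = pos" by (rule c'(2))
 have H: "N.ht = ht" unfolding N.ht_def[abs_def] ht_def[abs_def] P ..
 note a = ideal_stepD[OF J]
 let ?a = "(a, real_of_int 0)"
 have emb_a: "emb a = ?a" by (simp add: emb_def)
 have a_apos: "?a : N.apos" unfolding N.apos_int_iff using a P pos_root by simp
 have ideal: "order_ideal_in N.apos (emb ` X)" if "order_ideal_in pos X" for X
  using N.stage_ideal[OF N.lower_ideal, of X 0] that N.stage_zero[of X] order_ideal_inD(1)[OF that] P by simp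
 have "x ~: span {a}" if "x : J" for x using pos_nonproportional[of x a] that a by blast
 then have nonpar: "{f:emb ` J. fst f ~: span {a}} = emb ` J" by auto
 have "real (card ({f:emb ` J. fst f ~: span {a}} - C)) = real_of_int 0 * (N.cox a - 2) + N.ht a - (if a : N.pos then 1 else -1)"
 proof (rule N.nonparallel_card[OF ideal[OF a(1)] _ a_apos])
  show "finite (emb ` J)" using a(5) finite_pos finite_subset by blast
  show "?a ~: emb ` J" using arr_ideal_step(2)[OF J] emb_a by simp
  show "order_ideal_in N.apos (insert ?a (emb ` J))" using ideal[OF a(4)] emb_a by simp
  show "transversal {f:emb ` J. fst f ~: span {a}} C ?a" using C unfolding nonpar emb_a .
 qed
 then show ?thesis unfolding nonpar using a(2) P H by simp
qed

definition ideal_exponents :: "(real^'n) set => bool" where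
 "ideal_exponents J \<longleftrightarrow> (EX (I::nat set) e th. free_basis (emb ` span Ph) (emb ` J) I e th & card I = dim Ph &
   (ALL t>=1. card {i:I. e i >= t} = card (J Int level t)))"

definition ideal_units :: bool where
 "ideal_units \<longleftrightarrow> (ALL J a C. ideal_step J a -->
   transversal (emb ` J) C (emb a) --> unit_on (emb ` span Ph) (emb ` J) C (emb a))"

lemma subspace_emb_span: "subspace (emb ` span Ph)"
 by (rule linear_subspace_image[OF linear_emb]) simp

lemma dim_emb_span: "dim (emb ` span Ph) = dim Ph"
 using dim_image_eq[OF linear_emb inj_emb, of "span Ph"] by simp

lemma fundamental_coweight:
 assumes s: "s : base"
 shows "EX w:span Ph. s <.> w = 1 & (ALL t:base - {s}. t <.> w = 0)"
proof -
 have not_span: "s ~: span (base - {s})" using base_independent s unfolding dependent_def by blast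
 obtain y z where yz: "y : span (base - {s})" "!!w. w : span (base - {s}) ==> orthogonal z w" "s = y + z"
  using orthogonal_subspace_decomp_exists[of "base - {s}" s] by metis
 have z_nonzero: "z ~= 0" using yz not_span by auto
 have "y <.> z = 0" using yz(1,2) by (simp add: orthogonal_def inner_commute)
 then have s_z: "s <.> z = z <.> z" using yz(3) by (simp add: inner_add_left)
 have "y : span base" using yz(1) span_mono[of "base - {s}" base] by blast
 then have "s - y : span base" using s span_base[of s base] by (intro span_diff)
 then have "z : span Ph" using yz(3) by (simp add: span_base_eq)
 then have "(1 / (z <.> z)) *R z : span Ph" by (rule span_scale)
 moreover have "t <.> z = 0" if "t : base - {s}" for t using yz(2)[OF span_base[OF that]] by (simp add: orthogonal_def inner_commute)
 ultimately show ?thesis using s_z z_nonzero by (intro bexI[of _ "(1 / (z <.> z)) *R z"]) auto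
qed

lemma coweight_vanishes:
 assumes J: "ideal_step J a" and a: "a : base" and w: "!!s. s : base - {a} ==> s <.> w = 0" and be: "be : J"
 shows "be <.> w = 0"
proof -
 obtain n where n: "be = (SUM s:base. real (n s) *R s)" using pos_combination be ideal_stepD(5)[OF J] by blast
 have "n a = 0"
 proof (rule ccontr)
  assume "n a ~= 0"
  have "be - a = (SUM s:base. real (n s) *R s) - (SUM s:base. (if s = a then 1 else 0) *R s)"
   using a finite_base n by (simp add: if_distrib[of "%u. u *R _"] sum.delta cong: if_cong)
  also have "... = (SUM s:base. (real (n s) - (if s = a then 1 else 0)) *R s)"
   by (simp only: scaleR_diff_left sum_subtractf)
  also have "... : conic_span pos"
   by (intro conic_sum conic_scale conic_base base_pos) (use \<open>n a ~= 0\<close> in auto)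
  finally show False using order_ideal_inD(2)[OF ideal_stepD(1)[OF J] be] ideal_stepD(2,3)[OF J] by blast
 qed
 then have vanish: "real (n s) * (s <.> w) = 0" if "s : base" for s using w that by (cases "s = a") auto
 have "be <.> w = (SUM s:base. real (n s) * (s <.> w))" by (subst n) (simp add: inner_sum_left)
 also have "... = 0" using vanish by (intro sum.neutral) blast
 finally show ?thesis .
qed

lemma central_unit_base:
 assumes J: "ideal_step J a" and C: "transversal (emb ` J) C (emb a)" and a: "a : base"
 shows "unit_on (emb ` span Ph) (emb ` J) C (emb a)"
proof -
 obtain w where w: "w : span Ph" "a <.> w = 1" "!!s. s : base - {a} ==> s <.> w = 0" using fundamental_coweight[OF a] by blast
 have "card (emb ` J - C) = 0" using central_count[OF J C] ht_base[OF a] by simp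
 moreover have "finite (emb ` J)" using arrD(1)[OF arr_ideal_step(1)[OF J]] by simp
 ultimately have "emb ` J - C = {}" by simp
 then have "(PROD K:emb ` J - C. K <.> y) = 1" for y by (simp only: prod.empty)
 moreover have "(%x. emb w) : tangent_fields (emb ` span Ph) (emb ` J)"
  by (rule tangent_fieldsI) (use w coweight_vanishes[OF J a w(3)] in \<open>auto intro: rpoly_const\<close>)
 ultimately show ?thesis unfolding unit_on_def using w by (intro bexI[of _ "%x. emb w"]) auto
qed

lemma ideal_restrict:
 assumes Ps: "Ps \<subseteq> Ph" "root_sys Ps c" and X: "order_ideal_in pos X"
 shows "order_ideal_in (root_sys.pos Ps c) (X Int Ps)"
 unfolding order_ideal_in_def
proof (intro conjI ballI impI)
 interpret Q: root_sys Ps c by (rule Ps(2))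
 have Q_pos: "Q.pos = pos Int Ps" unfolding Q.pos_def pos_def using Ps(1) by blast
 show "X Int Ps \<subseteq> Q.pos" using order_ideal_inD(1)[OF X] Q_pos by blast
 fix be ga assume be: "be : X Int Ps" "ga : Q.pos" and conic: "be - ga : conic_span Q.pos"
 have "be - ga : conic_span pos"
  by (rule conic_mono[OF linear_ident _ conic, of pos]) (use Q_pos conic_base in blast)
 then show "ga : X Int Ps" using order_ideal_inD(2)[OF X, of be ga] be Q_pos by blast
qed

lemma ideal_step_restrict:
 assumes Ps: "Ps \<subseteq> Ph" "root_sys Ps c" and J: "ideal_step J a" and a: "a : Ps"
 shows "root_sys.ideal_step Ps c (J Int Ps) a"
proof -
 interpret Q: root_sys Ps c by (rule Ps(2))
 have "insert a J Int Ps = insert a (J Int Ps)" using a by auto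
 then have "order_ideal_in Q.pos (insert a (J Int Ps))" using ideal_restrict[OF Ps ideal_stepD(4)[OF J]] by simp
 then show ?thesis
  using ideal_restrict[OF Ps ideal_stepD(1)[OF J]] ideal_stepD(3)[OF J] Q.order_ideal_inD(1)
  unfolding Q.ideal_step_def by blast
qed

lemma root_sys_perp: "root_sys {be:Ph. be <.> v = 0} c"
 by (rule sub_root_sys) (auto simp: reg refl refl_root_inner)

lemma perp_psubset:
 assumes "v : span Ph" "v ~= 0"
 shows "{be:Ph. be <.> v = 0} \<subset> Ph"
proof -
 have "{be:Ph. be <.> v = 0} ~= Ph"
 proof
  assume "{be:Ph. be <.> v = 0} = Ph"
  then have "Ph \<subseteq> {y. v <.> y = 0}" by (auto simp: inner_commute)
  then have "span Ph \<subseteq> {y. v <.> y = 0}" by (rule span_minimal) (rule subspace_hyperplane)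
  then show False using assms by auto
 qed
 then show ?thesis by blast
qed

lemma central_unit_local:
 assumes IH: "!!Ps. Ps \<subset> Ph ==> root_sys Ps c ==> root_sys.ideal_units Ps c"
  and J: "ideal_step J a" and C: "transversal (emb ` J) C (emb a)"
  and x: "x : emb ` span Ph" "emb a <.> x = 0" "x ~= 0"
 shows "unit_on (emb ` span Ph) {K:emb ` J. K <.> x = 0} {K:C. K <.> x = 0} (emb a)"
proof -
 obtain v where v: "v : span Ph" "x = emb v" "v ~= 0" using x by (auto simp: emb_def zero_prod_def)
 define Ps where "Ps = {be:Ph. be <.> v = 0}"
 have Ps_psubset: "Ps \<subset> Ph" unfolding Ps_def by (rule perp_psubset[OF v(1,3)])
 interpret Q: root_sys Ps c unfolding Ps_def by (rule root_sys_perp)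
 have "a : Ps" using x v ideal_stepD(2)[OF J] pos_root by (simp add: Ps_def)
 then have "Q.ideal_step (J Int Ps) a" using ideal_step_restrict[OF _ Q.root_sys_axioms J] Ps_psubset by blast
 moreover have local: "{K:emb ` J. K <.> x = 0} = emb ` (J Int Ps)"
  using v ideal_stepD(5)[OF J] pos_root by (auto simp: Ps_def)
 moreover have "transversal (emb ` (J Int Ps)) {K:C. K <.> x = 0} (emb a)"
  using transversal_local[OF arr_ideal_step[OF J] C x(2)] unfolding local .
 ultimately have "unit_on (emb ` span Ps) {K:emb ` J. K <.> x = 0} {K:C. K <.> x = 0} (emb a)"
  using IH[OF Ps_psubset Q.root_sys_axioms] unfolding Q.ideal_units_def by simp
 moreover have "emb ` span Ps \<subseteq> emb ` span Ph" using span_mono[of Ps Ph] Ps_psubset by blast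
 ultimately show ?thesis by (rule unit_on_mono)
qed

lemma card_ideal_level_less:
 assumes J: "ideal_step J a" and t: "ht a = real t" "t >= 2"
 shows "card (J Int level t) < dim {x:emb ` span Ph. emb a <.> x = 0}"
proof -
 have "card (insert a (J Int level t)) <= card (level t)"
  using ideal_stepD[OF J] t finite_level by (intro card_mono) (auto simp: level_def)
 then have "card (J Int level t) + 1 <= card (level t)" using ideal_stepD(3)[OF J] finite_level by simp
 moreover have "card (level t) < dim Ph" using card_level_less[OF _ t(2)] ideal_stepD(2)[OF J] pos_root by blast
 moreover have "dim Ph <= dim {x:emb ` span Ph. emb a <.> x = 0} + 1"
  using dim_kernel_ge[OF subspace_emb_span, of "emb a"] unfolding dim_emb_span .
 ultimately show ?thesis by linarith
qed

lemma central_unit: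
 assumes IH: "!!Ps. Ps \<subset> Ph ==> root_sys Ps c ==> root_sys.ideal_units Ps c"
  and ex: "ideal_exponents J" and J: "ideal_step J a" and C: "transversal (emb ` J) C (emb a)"
 shows "unit_on (emb ` span Ph) (emb ` J) C (emb a)"
proof -
 obtain t where t: "t >= 1" "ht a = real t" using ht_pos[OF ideal_stepD(2)[OF J]] by blast
 show ?thesis
 proof (cases "t = 1")
  case True
  then have "a : base" using t ideal_stepD(2)[OF J] by (simp add: base_iff_level level_def)
  then show ?thesis using central_unit_base[OF J C] by blast
 next
  case False
  have card: "card (emb ` J - C) = t - 1" using central_count[OF J C] t by linarith
  obtain I :: "nat set" and e th where basis: "free_basis (emb ` span Ph) (emb ` J) I e th"
   and levels: "!!t. t >= 1 ==> card {i:I. e i >= t} = card (J Int level t)" using ex unfolding ideal_exponents_def by blast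
  interpret addition "emb ` J" C "emb a" "emb ` span Ph" I e th "t - 1"
   by unfold_locales (use subspace_emb_span arr_ideal_step[OF J] C basis card in auto)
  have "{i:I. t - 1 < e i} = {i:I. t <= e i}" using t by auto
  then have "card {i:I. t - 1 < e i} < dim {x:emb ` span Ph. emb a <.> x = 0}"
   using levels[OF t(1)] card_ideal_level_less[OF J t(2)] t(1) False by simp
  then show ?thesis by (rule local_to_global[OF subspace_emb_span]) (rule central_unit_local[OF IH J C])
 qed
qed

lemma ideal_exponents_insert:
 assumes ex: "ideal_exponents J" and J: "ideal_step J a"
  and unit: "!!C. transversal (emb ` J) C (emb a) ==> unit_on (emb ` span Ph) (emb ` J) C (emb a)"
 shows "ideal_exponents (insert a J)"
proof -
 obtain t where t: "ht a = real (Suc t)" using ht_pos[OF ideal_stepD(2)[OF J]] by (metis Suc_le_D One_nat_def)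
 obtain C where C: "transversal (emb ` J) C (emb a)" using transversal_exists[OF arr_ideal_step[OF J]] by blast
 have card: "card (emb ` J - C) = t" using central_count[OF J C] t by simp
 obtain I :: "nat set" and e th where basis: "free_basis (emb ` span Ph) (emb ` J) I e th" and dim_basis: "card I = dim Ph"
  and levels: "!!t. t >= 1 ==> card {i:I. e i >= t} = card (J Int level t)" using ex unfolding ideal_exponents_def by blast
 interpret addition "emb ` J" C "emb a" "emb ` span Ph" I e th t
  by unfold_locales (use subspace_emb_span arr_ideal_step[OF J] C basis card in auto)
 obtain i th' where i: "i : I" "e i = t" "free_basis (emb ` span Ph) (insert (emb a) (emb ` J)) I (e(i := Suc t)) th'"
  using free_basis_add[OF unit[OF C]] .
 have "card {k:I. s <= (e(i := Suc t)) k} = card (insert a J Int level s)" if s: "s >= 1" for s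
 proof -
  have "insert a J Int level s = (if s = Suc t then insert a (J Int level s) else J Int level s)"
   using t ideal_stepD(2)[OF J] by (auto simp: level_def)
  then show ?thesis
   using card_exponents_update[OF finite_I i(1), of e t s] i(2) levels[OF s] ideal_stepD(3)[OF J] finite_level by simp
 qed
 then show ?thesis unfolding ideal_exponents_def using i(3) dim_basis
  by (intro exI[of _ I] exI[of _ "e(i := Suc t)"] exI[of _ th']) simp
qed

lemma ideal_exponents_empty: "ideal_exponents {}"
proof -
 obtain I :: "nat set" and th where "free_basis (emb ` span Ph) (emb ` {}) I (%_. 0) th" "card I = dim (emb ` span Ph)"
  using constant_basis[OF subspace_emb_span, of "emb ` {}"] by auto
 then show ?thesis unfolding ideal_exponents_def dim_emb_span
  by (intro exI[of _ I] exI[of _ "%_. 0"] exI[of _ th]) auto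
qed

lemma conic_ht_zero:
 assumes "x : conic_span pos"
 shows "ht x = 0 ==> x = 0"
 using assms
proof (induction x rule: conic_span.induct)
 case (conic_step x t y)
 have ht_x: "ht x >= 1" and ht_y: "ht y >= 0" using ht_pos_ge1 ht_conic conic_step by blast+
 have "t * ht x + ht y = 0"
  using conic_step(5) by (simp add: linear_add[OF linear_ht] linear_scale[OF linear_ht])
 moreover have "t * ht x >= 0" using ht_x conic_step(2) by simp
 ultimately have "t * ht x = 0" "ht y = 0" using ht_y by linarith+
 then show ?case using ht_x conic_step(4) by auto
qed simp

lemma remove_highest:
 assumes closed: "ALL be:J. ALL ga:Q. be - ga : conic_span pos --> ga : J"
  and X: "X \<subseteq> J" "finite X" "X ~= {}" "!!x y. x : X ==> y : J - X ==> ht y <= ht x"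
 shows "EX al:X. ALL be:J - {al}. ALL ga:Q. be - ga : conic_span pos --> ga : J - {al}"
proof -
 have "Max (ht ` X) : ht ` X" by (rule Max_in) (use X in auto)
 then obtain al where al: "al : X" "ht al = Max (ht ` X)" by auto
 have highest: "ht be <= ht al" if "be : J" for be
 proof (cases "be : X")
  case True
  then show ?thesis unfolding al(2) using X(2) by simp
 next
  case False
  then show ?thesis using X(4)[OF al(1)] that by blast
 qed
 have "ga ~= al" if be: "be : J - {al}" "be - ga : conic_span pos" for be ga
 proof
  assume ga: "ga = al"
  then have "ht (be - ga) <= 0" using highest[of be] be linear_diff[OF linear_ht, of be ga] by simp
  then have "be - ga = 0" using conic_ht_zero[OF be(2)] ht_conic[OF be(2)] by simp
  then show False using ga be(1) by simp
 qed
 then show ?thesis using al(1) closed by blast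
qed

lemma ideal_remove_max:
 assumes J: "order_ideal_in pos J" "J ~= {}"
 shows "EX a:J. order_ideal_in pos (J - {a})"
proof -
 have Jp: "J \<subseteq> pos" "finite J" using order_ideal_inD(1)[OF J(1)] finite_pos finite_subset by auto
 have "EX a:J. ALL be:J - {a}. ALL ga:pos. be - ga : conic_span pos --> ga : J - {a}"
  by (rule remove_highest) (use J Jp in \<open>auto simp: order_ideal_in_def\<close>)
 then show ?thesis using Jp unfolding order_ideal_in_def by blast
qed

end

theorem ideal_arrangements_free:
 assumes "root_sys Ph c"
 shows "root_sys.ideal_units Ph c & (ALL J. order_ideal_in (root_sys.pos Ph c) J --> root_sys.ideal_exponents Ph c J)"
 using assms
proof (induction "card Ph" arbitrary: Ph rule: less_induct)
 case less
 interpret root_sys Ph c by (rule less.prems)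
 have IH: "root_sys.ideal_units Ps c" if "Ps \<subset> Ph" "root_sys Ps c" for Ps
  using less.hyps[OF psubset_card_mono[OF fin that(1)] that(2)] by blast
 have ex: "ideal_exponents J" if "order_ideal_in pos J" for J
  using that
 proof (induction "card J" arbitrary: J)
  case 0
  then have "J = {}" using order_ideal_inD(1)[OF 0(2)] finite_pos finite_subset by fastforce
  then show ?case using ideal_exponents_empty by simp
 next
  case (Suc n)
  then have "J ~= {}" by auto
  then obtain a where a: "a : J" "order_ideal_in pos (J - {a})" using ideal_remove_max[OF Suc(3)] by blast
  then have "ideal_step (J - {a}) a"
   using Suc(3) order_ideal_inD(1)[OF Suc(3)] by (auto simp: ideal_step_def insert_absorb)
  moreover have "ideal_exponents (J - {a})" using Suc(1)[OF _ a(2)] Suc(2) a(1) card.infinite by fastforce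
  ultimately have "ideal_exponents (insert a (J - {a}))"
   by (intro ideal_exponents_insert central_unit[OF IH])
  then show ?case using a(1) by (simp add: insert_absorb)
 qed
 have "ideal_units" unfolding ideal_units_def using central_unit[OF IH ex] ideal_stepD(1) by blast
 then show ?case using ex by blast
qed

section \<open>Evaluating polynomial functions at complex points\<close>

definition re_vec :: "complex^'n => real^'n" where "re_vec z = (\<chi> i. Re (z $ i))"
definition im_vec :: "complex^'n => real^'n" where "im_vec z = (\<chi> i. Im (z $ i))"

definition line_poly :: "(real^'n => real) => complex^'n => complex poly => bool" where
 "line_poly f z p \<longleftrightarrow> (ALL t. complex_of_real (f (re_vec z + t *R im_vec z)) = poly p (complex_of_real t))"

definition cev :: "(real^'n => real) => complex^'n => complex" where
 "cev f z = poly (SOME p. line_poly f z p) \<i>"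

definition cvec :: "real^'n => complex^'n" where "cvec x = (\<chi> i. complex_of_real (x $ i))"

definition cdot :: "real^'n => complex^'n => complex" where
 "cdot a z = (SUM i:UNIV. complex_of_real (a $ i) * z $ i)"

definition cev_field :: "(real^'n => real^'n) => complex^'n => complex^'n" where
 "cev_field et z = (\<chi> i. cev (%v. et v $ i) z)"

definition cmap :: "(real^'n => real^'n) => complex^'n => complex^'n" where
 "cmap T z = (\<chi> i. Complex (T (re_vec z) $ i) (T (im_vec z) $ i))"

lemma line_poly_exists:
 assumes "rpoly f"
 shows "EX p. line_poly f z p"
 using assms unfolding line_poly_def
proof (induction f rule: real_polynomial_function.induct)
 case (linear f)
 then have "ALL t. complex_of_real (f (re_vec z + t *R im_vec z)) = poly [:complex_of_real (f (re_vec z)), complex_of_real (f (im_vec z)):] (complex_of_real t)"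
  by (simp add: bounded_linear.linear linear_add linear_scale)
 then show ?case by (rule exI)
next
 case (const c)
 have "ALL t::real. complex_of_real c = poly [:complex_of_real c:] (complex_of_real t)" by simp
 then show ?case by (rule exI)
next
 case (add f g)
 then obtain p q where "ALL t. complex_of_real (f (re_vec z + t *R im_vec z)) = poly p (complex_of_real t)"
  "ALL t. complex_of_real (g (re_vec z + t *R im_vec z)) = poly q (complex_of_real t)" by blast
 then have "ALL t. complex_of_real (f (re_vec z + t *R im_vec z) + g (re_vec z + t *R im_vec z)) = poly (p + q) (complex_of_real t)" by simp
 then show ?case by (rule exI)
next
 case (mult f g)
 then obtain p q where "ALL t. complex_of_real (f (re_vec z + t *R im_vec z)) = poly p (complex_of_real t)"
  "ALL t. complex_of_real (g (re_vec z + t *R im_vec z)) = poly q (complex_of_real t)" by blast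
 then have "ALL t. complex_of_real (f (re_vec z + t *R im_vec z) * g (re_vec z + t *R im_vec z)) = poly (p * q) (complex_of_real t)" by simp
 then show ?case by (rule exI)
qed

lemma line_poly_unique:
 assumes "line_poly f z p" "line_poly f z q"
 shows "p = q"
proof (rule ccontr)
 assume "p ~= q"
 then have "finite {x. poly (p - q) x = 0}" by (intro poly_roots_finite) simp
 moreover have "range complex_of_real \<subseteq> {x. poly (p - q) x = 0}"
  using assms unfolding line_poly_def by auto
 ultimately have "finite (range complex_of_real)" by (rule rev_finite_subset)
 moreover have "inj complex_of_real" by (simp add: inj_def)
 ultimately show False using infinite_UNIV_char_0 finite_imageD by blast
qed

lemma cev_eq:
 assumes "line_poly f z p"
 shows "cev f z = poly p \<i>"
proof -
 have "line_poly f z (SOME p. line_poly f z p)" using assms by (rule someI)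
 then have "(SOME p. line_poly f z p) = p" using assms by (rule line_poly_unique)
 then show ?thesis by (simp add: cev_def)
qed

lemma cev_add: "rpoly f ==> rpoly g ==> cev (%x. f x + g x) z = cev f z + cev g z"
proof -
 assume "rpoly f" "rpoly g"
 then obtain p q where pq: "line_poly f z p" "line_poly g z q" using line_poly_exists by metis
 then have "line_poly (%x. f x + g x) z (p + q)" by (simp add: line_poly_def)
 from cev_eq[OF this] show ?thesis using cev_eq[OF pq(1)] cev_eq[OF pq(2)] by simp
qed

lemma cev_mult: "rpoly f ==> rpoly g ==> cev (%x. f x * g x) z = cev f z * cev g z"
proof -
 assume "rpoly f" "rpoly g"
 then obtain p q where pq: "line_poly f z p" "line_poly g z q" using line_poly_exists by metis
 then have "line_poly (%x. f x * g x) z (p * q)" by (simp add: line_poly_def)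
 from cev_eq[OF this] show ?thesis using cev_eq[OF pq(1)] cev_eq[OF pq(2)] by simp
qed

lemma cev_const: "cev (%x. c) z = complex_of_real c"
proof -
 have "line_poly (%x. c) z [:complex_of_real c:]" by (simp add: line_poly_def)
 then show ?thesis using cev_eq by fastforce
qed

lemma cev_sum: "(!!i. i : I ==> rpoly (f i)) ==> cev (%x. SUM i:I. f i x) z = (SUM i:I. cev (f i) z)"
proof (induction I rule: infinite_finite_induct)
 case (insert a I)
 then show ?case using cev_add[of "f a" "%x. SUM i:I. f i x" z] by (simp add: rpoly_sum)
qed (simp_all add: cev_const)

lemma cev_prod: "(!!i. i : I ==> rpoly (f i)) ==> cev (%x. PROD i:I. f i x) z = (PROD i:I. cev (f i) z)"
proof (induction I rule: infinite_finite_induct)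
 case (insert a I)
 then show ?case using cev_mult[of "f a" "%x. PROD i:I. f i x" z] by (simp add: rpoly_prod)
qed (simp_all add: cev_const)

lemma cev_power: "rpoly f ==> cev (%x. f x ^ n) z = cev f z ^ n"
proof (induction n)
 case (Suc n)
 then show ?case using cev_mult[of f "%x. f x ^ n" z] by (simp add: rpoly_power)
qed (simp add: cev_const)

lemma cev_inner: "cev (%x. a <.> x) z = cdot a z"
proof -
 have "line_poly (%x. a <.> x) z [:complex_of_real (a <.> re_vec z), complex_of_real (a <.> im_vec z):]"
  by (simp add: line_poly_def inner_add_right)
 then have "cev (%x. a <.> x) z = complex_of_real (a <.> re_vec z) + \<i> * complex_of_real (a <.> im_vec z)"
  using cev_eq by fastforce
 also have "... = (SUM i:UNIV. complex_of_real (a $ i) * z $ i)"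
  by (simp add: inner_vec_def re_vec_def im_vec_def sum_distrib_left flip: sum.distrib)
    (intro sum.cong refl, simp add: complex_eq_iff)
 finally show ?thesis by (simp add: cdot_def)
qed

lemma rpoly_component:
 assumes "polynomial_function (et :: real^'n => real^'n)"
 shows "rpoly (%v. et v $ i)" "rpoly (%v. a <.> et v)"
proof -
 show "rpoly (%v. a <.> et v)" for a using assms by (simp add: polynomial_function_inner_iff)
 from this[of "axis i 1"] show "rpoly (%v. et v $ i)" by (simp add: inner_axis inner_commute[of "axis i 1"])
qed

lemma cev_field_sum_scale:
 assumes f: "!!i. i : I ==> rpoly (f i)" and th: "!!i. i : I ==> polynomial_function (th i)"
 shows "cev_field (%v. SUM i:I. f i v *R th i v) z = (SUM i:I. cev (f i) z *s cev_field (th i) z)"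
proof -
 have "cev (%v. (SUM i:I. f i v *R th i v) $ k) z = (SUM i:I. cev (f i) z * cev (%v. th i v $ k) z)" for k
 proof -
  have "cev (%v. (SUM i:I. f i v *R th i v) $ k) z = cev (%v. SUM i:I. f i v * th i v $ k) z" by simp
  also have "... = (SUM i:I. cev (%v. f i v * th i v $ k) z)" by (rule cev_sum) (intro rpoly_mult f rpoly_component th)
  also have "... = (SUM i:I. cev (f i) z * cev (%v. th i v $ k) z)"
   by (intro sum.cong refl cev_mult f rpoly_component th)
  finally show ?thesis .
 qed
 then show ?thesis by (simp add: vec_eq_iff cev_field_def)
qed

lemma re_im_cmap: "re_vec (cmap T z) = T (re_vec z)" "im_vec (cmap T z) = T (im_vec z)"
 by (simp_all add: cmap_def re_vec_def im_vec_def vec_eq_iff)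

lemma cev_comp_linear:
 assumes "linear T"
 shows "cev (%v. f (T v)) z = cev f (cmap T z)"
 unfolding cev_def line_poly_def re_im_cmap using assms by (simp add: linear_add linear_scale)

lemma linear_component:
 assumes "linear (T :: real^'n => real^'m)"
 shows "T x $ i = (SUM j:UNIV. T (axis j 1) $ i * x $ j)"
 using matrix_works[OF assms[unfolded linear_matrix_vector_mul_eq[symmetric]], of x] by (simp add: matrix_vector_mult_def matrix_def vec_eq_iff)

lemma cmap_component:
 assumes T: "linear T"
 shows "cmap T z $ i = (SUM j:UNIV. complex_of_real (T (axis j 1) $ i) * z $ j)"
 using linear_component[OF T, of "re_vec z" i] linear_component[OF T, of "im_vec z" i]
 by (simp add: cmap_def complex_eq_iff re_vec_def im_vec_def)

lemma cev_field_comp_left: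
 assumes T: "linear T" and et: "polynomial_function et"
 shows "cev_field (%v. T (et v)) z = cmap T (cev_field et z)"
proof -
 have "cev (%v. T (et v) $ i) z = (SUM j:UNIV. complex_of_real (T (axis j 1) $ i) * cev (%v. et v $ j) z)" for i
 proof -
  have "cev (%v. T (et v) $ i) z = cev (%v. SUM j:UNIV. T (axis j 1) $ i * et v $ j) z"
   by (rule arg_cong[where f="%f. cev f z"], rule ext, rule linear_component[OF T])
  also have "... = (SUM j:UNIV. cev (%v. T (axis j 1) $ i * et v $ j) z)"
   by (rule cev_sum) (intro rpoly_mult rpoly_const rpoly_component et)
  also have "... = (SUM j:UNIV. complex_of_real (T (axis j 1) $ i) * cev (%v. et v $ j) z)"
   by (intro sum.cong refl) (simp add: cev_mult[OF rpoly_const rpoly_component(1)[OF et]] cev_const)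
  finally show ?thesis .
 qed
 then show ?thesis by (simp add: vec_eq_iff cmap_component[OF T] cev_field_def)
qed

lemma cev_field_comp_right:
 assumes "linear T"
 shows "cev_field (%v. et (T v)) z = cev_field et (cmap T z)"
 unfolding cev_field_def vec_eq_iff by (simp add: cev_comp_linear[OF assms, of "%v. et v $ i" z for i])

lemma cdot_scale: "cdot a (k *s z) = k * cdot a z"
 by (simp add: cdot_def sum_distrib_left mult_ac)

lemma cev_monomial_on: "cev (monomial_on B mu) z = (PROD b:B. cdot b z ^ mu b)"
 unfolding monomial_on_def[abs_def]
 by (subst cev_prod) (auto simp: cev_power[OF rpoly_inner] cev_inner intro: rpoly_power rpoly_inner)

lemma cev_homogeneous:
 assumes f: "rpoly f" and hom: "!!t x. f (t *R x) = t ^ e * f x"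
 shows "cev f (k *s z) = k ^ e * cev f z"
proof -
 obtain F c where F: "finite F" "!!mu. mu : F ==> (SUM b:Basis. mu b) = e" "!!x. f x = (SUM mu:F. c mu * monomial_on Basis mu x)"
  using homogeneous_monomialsE[OF f orthonormal_Basis hom] by (metis UNIV_I span_Basis)
 have cev_f: "cev f w = (SUM mu:F. complex_of_real (c mu) * (PROD b:Basis. cdot b w ^ mu b))" for w
 proof -
  have "cev f w = cev (%x. SUM mu:F. c mu * monomial_on Basis mu x) w" using F(3) by presburger
  also have "... = (SUM mu:F. cev (%x. c mu * monomial_on Basis mu x) w)"
   by (rule cev_sum) (intro rpoly_mult rpoly_const rpoly_monomial_on)
  also have "... = (SUM mu:F. complex_of_real (c mu) * (PROD b:Basis. cdot b w ^ mu b))"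
   by (intro sum.cong refl) (simp add: cev_mult[OF rpoly_const rpoly_monomial_on] cev_const cev_monomial_on)
  finally show ?thesis .
 qed
 have "(PROD b:Basis. cdot b (k *s z) ^ mu b) = k ^ e * (PROD b:Basis. cdot b z ^ mu b)" if "mu : F" for mu
  using F(2)[OF that] by (simp add: cdot_scale power_mult_distrib prod.distrib flip: power_sum)
 then show ?thesis unfolding cev_f by (simp add: sum_distrib_left mult_ac)
qed

lemma cev_field_homogeneous:
 assumes et: "polynomial_function et" and hom: "!!t x. et (t *R x) = t ^ e *R et x"
 shows "cev_field et (k *s z) = k ^ e *s cev_field et z"
proof -
 have "cev (%v. et v $ i) (k *s z) = k ^ e * cev (%v. et v $ i) z" for i
  by (rule cev_homogeneous[OF rpoly_component(1)[OF et]]) (simp add: hom)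
 then show ?thesis by (simp add: cev_field_def vec_eq_iff)
qed

definition independent_family :: "'i set => ('i => 'f::field^'n) => bool" where
 "independent_family I u \<longleftrightarrow> finite I & inj_on u I & vec.independent (u ` I)"

lemma independent_familyD:
 assumes u: "independent_family I u" and zero: "(SUM i:I. c i *s u i) = 0" and i: "i : I"
 shows "c i = 0"
proof -
 have I: "finite I" "inj_on u I" "vec.independent (u ` I)" using u by (auto simp: independent_family_def)
 let ?c = "%v. c (the_inv_into I u v)"
 have "(SUM v:u ` I. ?c v *s v) = (SUM i:I. c i *s u i)"
  unfolding sum.reindex[OF I(2)] o_def by (intro sum.cong) (simp_all add: the_inv_into_f_f[OF I(2)])
 then have "?c (u i) = 0"
  using vec.independentD[OF I(3) finite_imageI[OF I(1)] subset_refl, of ?c "u i"] zero i by simp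
 then show ?thesis by (simp add: the_inv_into_f_f[OF I(2) i])
qed

lemma independent_family_span:
 assumes u: "independent_family I u" and x: "x : vec.span (u ` I)"
 obtains c where "x = (SUM i:I. c i *s u i)"
proof -
 have I: "finite I" "inj_on u I" using u by (auto simp: independent_family_def)
 obtain c where "x = (SUM v:u ` I. c v *s v)" using x unfolding vec.span_finite[OF finite_imageI[OF I(1)]] by blast
 then show ?thesis using that[of "%i. c (u i)"] by (simp add: sum.reindex[OF I(2)])
qed

lemma span_family_sum: "J \<subseteq> I ==> (SUM i:J. c i *s u i) : vec.span (u ` I)"
 by (intro vec.span_sum vec.span_scale vec.span_base) auto

lemma spanning_family_independent:
 assumes I: "finite I" "card I <= card S" and S: "vec.independent S" "S \<subseteq> vec.span (u ` I)"
 shows "independent_family I u"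
proof -
 have "card S <= card (u ` I)" using vec.independent_span_bound[OF finite_imageI[OF I(1)] S] by blast
 then have card: "card (u ` I) = card I" "card (u ` I) <= card S" using card_image_le[OF I(1), of u] I(2) by linarith+
 have "card S <= vec.dim (vec.span (u ` I))" using vec.independent_card_le_dim[OF S(2,1)] .
 then have "vec.independent (u ` I)"
  using I(1) card(2) by (intro vec.card_le_dim_spanning[where V="vec.span (u ` I)"]) (auto simp: vec.span_superset)
 then show ?thesis unfolding independent_family_def using I(1) eq_card_imp_inj_on[OF I(1) card(1)] by blast
qed

lemma independent_eigenvalue_count:
 fixes u w :: "'i => complex^'n"
 assumes g: "!!c v. g (SUM i:I. c i *s v i) = (SUM i:I. c i *s g (v i))"
  and u: "independent_family I u" "!!i. i : I ==> g (u i) = l i *s u i"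
  and w: "independent_family I w" "!!i. i : I ==> g (w i) = m i *s w i"
  and span: "!!i. i : I ==> u i : vec.span (w ` I)"
 shows "card {i:I. l i = k} <= card {i:I. m i = k}"
proof -
 let ?I = "{i:I. l i = k}" and ?J = "{i:I. m i = k}"
 have I: "finite I" "inj_on u I" "vec.independent (u ` I)" using u(1) by (auto simp: independent_family_def)
 have "u i : vec.span (w ` ?J)" if i: "i : ?I" for i
 proof -
  obtain b where b: "u i = (SUM j:I. b j *s w j)" using independent_family_span[OF w(1) span] i by blast
  have "b j = 0" if j: "j : I - ?J" for j
  proof -
   have "(SUM j:I. (b j * k) *s w j) = k *s u i"
    unfolding b by (simp add: vec.scale_sum_right vector_smult_assoc mult.commute)
   also have "... = g (u i)" using u(2) i by simp
   also have "... = (SUM j:I. (b j * m j) *s w j)"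
    unfolding b g by (intro sum.cong refl) (simp add: w(2) vector_smult_assoc)
   finally have "(SUM j:I. (b j * (k - m j)) *s w j) = 0"
    by (simp add: right_diff_distrib vec.scale_left_diff_distrib sum_subtractf)
   then have "b j * (k - m j) = 0" using independent_familyD[OF w(1), of "%j. b j * (k - m j)"] j by blast
   then show ?thesis using j by auto
  qed
  then have "u i = (SUM j:?J. b j *s w j)" unfolding b using I(1) by (intro sum.mono_neutral_right) auto
  then show ?thesis using span_family_sum[of ?J ?J b w] by simp
 qed
 moreover have "vec.independent (u ` ?I)" by (rule vec.independent_mono[OF I(3)]) auto
 ultimately have "card (u ` ?I) <= card (w ` ?J)" using I(1) by (intro vec.independent_span_bound[THEN conjunct2]) auto
 also have "... <= card ?J" using I(1) by (intro card_image_le) simp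
 finally show ?thesis using card_image[OF inj_on_subset[OF I(2)], of ?I] by auto
qed

section \<open>A regular eigenvector of a Coxeter element\<close>

fun cox_elt :: "(real^'n) list => real^'n => real^'n" where
 "cox_elt [] x = x"
| "cox_elt (s # l) x = refl_root s (cox_elt l x)"

lemma linear_cox_elt: "linear (cox_elt l)"
proof (induction l)
 case Nil
 then show ?case by (simp add: linear_iff)
next
 case (Cons s l)
 have "linear (refl_root s \<circ> cox_elt l)" by (rule linear_compose[OF Cons linear_refl_root])
 then show ?case by (simp add: o_def cox_elt.simps(2)[abs_def])
qed

lemma cox_elt_append: "cox_elt (l @ m) x = cox_elt l (cox_elt m x)"
 by (induction l) auto

lemma cox_elt_rev: "cox_elt (rev l) (cox_elt l x) = x"
 by (induction l) (auto simp: cox_elt_append)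

lemma cox_elt_rev': "cox_elt l (cox_elt (rev l) x) = x"
 using cox_elt_rev[of "rev l"] by simp

lemma cox_elt_adjoint: "cox_elt l x <.> y = x <.> cox_elt (rev l) y"
 by (induction l arbitrary: y) (auto simp: cox_elt_append refl_root_adjoint)

lemma cox_elt_diff_span: "cox_elt l x - x : span (set l)"
proof (induction l)
 case Nil
 then show ?case by (simp add: span_zero)
next
 case (Cons s l)
 have "cox_elt (s # l) x - x = (cox_elt l x - x) - (2 * (cox_elt l x <.> s) / (s <.> s)) *R s"
  by (simp add: refl_root_def)
 also have "... : span (set (s # l))"
 proof (rule span_diff)
  show "cox_elt l x - x : span (set (s # l))" using Cons span_mono[of "set l" "set (s # l)"] by auto
 qed (auto intro: span_scale span_base)
 finally show ?case .
qed

lemma cox_elt_fixed: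
 assumes "cox_elt l x = x" "independent (set l)" "distinct l" "s : set l"
 shows "s <.> x = 0"
 using assms
proof (induction l)
 case (Cons t l)
 let ?y = "cox_elt l x" and ?k = "2 * (cox_elt l x <.> t) / (t <.> t)"
 have t0: "t ~= 0" using Cons.prems(2) dependent_zero by auto
 have "?y - ?k *R t = x" using Cons.prems(1) by (simp add: refl_root_def)
 then have "?k *R t = ?y - x" by (simp add: algebra_simps)
 then have multiple_in_span: "?k *R t : span (set l)" using cox_elt_diff_span[of l x] by simp
 have t_notin_span: "t ~: span (set l)" using Cons.prems(2,3) by (simp add: independent_insert)
 have k0: "?k = 0"
 proof (rule ccontr)
  assume "?k ~= 0"
  then have "t = (1 / ?k) *R (?k *R t)" by simp
  then show False using multiple_in_span t_notin_span span_scale by metis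
 qed
 have y_eq_x: "?y = x" using \<open>?y - ?k *R t = x\<close> unfolding k0 by simp
 then have t_x_zero: "t <.> x = 0" using k0 t0 by (simp add: inner_commute)
 have "independent (set l)" using Cons.prems(2) independent_mono[of "set (t # l)" "set l"] by auto
 then show ?case using Cons.IH[OF y_eq_x] Cons.prems(3,4) t_x_zero by auto
qed simp

lemma sphere_minimizer:
 fixes W :: "'a::euclidean_space => 'b::real_inner"
 assumes W: "linear W" and L: "subspace L" and x: "x : L" "x ~= 0"
 obtains x0 where "x0 : L" "x0 <.> x0 = 1" "!!x. x : L ==> (W x0 <.> W x0) * (x <.> x) <= W x <.> W x"
proof -
 let ?K = "sphere 0 1 Int L"
 have unit: "(1 / norm x) *R x : ?K" if "x : L" "x ~= 0" for x using that L by (simp add: subspace_scale)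
 have "compact ?K" using L by (intro compact_Int_closed closed_subspace) auto
 moreover have "?K ~= {}" using unit[OF x] by blast
 moreover have "continuous_on ?K (%x. W x <.> W x)"
  by (intro continuous_intros linear_continuous_on) (simp_all add: W linear_conv_bounded_linear[symmetric])
 ultimately obtain x0 where x0: "x0 : ?K" "!!x. x : ?K ==> W x0 <.> W x0 <= W x <.> W x"
  using continuous_attains_inf[of ?K "%x. W x <.> W x"] by blast
 have "(W x0 <.> W x0) * (x <.> x) <= W x <.> W x" if x: "x : L" for x
 proof (cases "x = 0")
  case False
  have "W x0 <.> W x0 <= W ((1 / norm x) *R x) <.> W ((1 / norm x) *R x)" using x0(2)[OF unit[OF x False]] .
  also have "... = (W x <.> W x) / (x <.> x)"
   using False by (simp add: linear_scale[OF W] dot_square_norm[of x] power2_eq_square)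
  finally show ?thesis using False by (simp add: pos_le_divide_eq)
 qed simp
 then show ?thesis using that x0(1) by (auto simp: dot_square_norm)
qed

lemma minimizer_stationary:
 fixes W :: "'a::euclidean_space => 'b::real_inner"
 assumes W: "linear W" and L: "subspace L" and m: "!!x. x : L ==> m * (x <.> x) <= W x <.> W x"
  and x: "x : L" "W x <.> W x = m * (x <.> x)" and y: "y : L"
 shows "W x <.> W y = m * (x <.> y)"
proof -
 define A where "A = 2 * (W x <.> W y - m * (x <.> y))"
 define D where "D = W y <.> W y - m * (y <.> y)"
 have D: "D >= 0" using m[OF y] by (simp add: D_def)
 have square: "(p + t *R q) <.> (p + t *R q) = p <.> p + 2 * t * (p <.> q) + t\<^sup>2 * (q <.> q)" for p q :: "'c::real_inner" and t
  by (simp add: inner_add_left inner_add_right inner_commute[of q p] power2_eq_square distrib_left)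
 have nonneg: "t * A + t\<^sup>2 * D >= 0" for t
 proof -
  have "m * ((x + t *R y) <.> (x + t *R y)) <= W (x + t *R y) <.> W (x + t *R y)"
   using L x y by (intro m subspace_add subspace_scale)
  then have "m * (x <.> x + 2 * t * (x <.> y) + t\<^sup>2 * (y <.> y)) <= m * (x <.> x) + 2 * t * (W x <.> W y) + t\<^sup>2 * (W y <.> W y)"
   by (simp only: linear_add[OF W] linear_scale[OF W] square x(2))
  then show ?thesis by (simp add: A_def D_def algebra_simps)
 qed
 define k where "k = A / (D + 1)"
 have A: "A = k * (D + 1)" using D by (simp add: k_def)
 have "- k * A + (- k)\<^sup>2 * D = - (k * k)" unfolding A power2_eq_square by algebra
 then have "k * k <= 0" using nonneg[of "- k"] by simp
 then have "A = 0" using A zero_le_square[of k] by (metis antisym mult_eq_0_iff)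
 then show ?thesis by (simp add: A_def)
qed

lemma obtuse_abs_sum_le:
 fixes u :: "'a => 'b::real_inner"
 assumes obtuse: "!!s t. s : S ==> t : S ==> s ~= t ==> u s <.> u t <= 0"
 shows "(SUM s:S. \<bar>k s\<bar> *R u s) <.> (SUM s:S. \<bar>k s\<bar> *R u s) <= (SUM s:S. k s *R u s) <.> (SUM s:S. k s *R u s)"
proof -
 have "(SUM t:S. SUM s:S. \<bar>k s\<bar> * \<bar>k t\<bar> * (u s <.> u t)) <= (SUM t:S. SUM s:S. k s * k t * (u s <.> u t))"
 proof (intro sum_mono)
  fix s t assume st: "t : S" "s : S"
  show "\<bar>k s\<bar> * \<bar>k t\<bar> * (u s <.> u t) <= k s * k t * (u s <.> u t)"
  proof (cases "s = t")
   case False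
   have "k s * k t <= \<bar>k s\<bar> * \<bar>k t\<bar>" by (metis abs_ge_self abs_mult)
   then show ?thesis using obtuse[OF st(2,1) False] by (rule mult_right_mono_neg)
  qed simp
 qed
 then show ?thesis unfolding inner_sum_right inner_sum_left by (simp add: mult_ac)
qed

text \<open>Replacing the coordinates of a minimizer of \<open>\<parallel>\<Sum> x\<^sub>s u\<^sub>s\<parallel>\<close> by their absolute values yields a minimizer again.\<close>

lemma nonneg_eigenvector:
 fixes S :: "'a::euclidean_space set" and u :: "'a => 'b::real_inner"
 assumes S: "independent S" "finite S" "S ~= {}" and obtuse: "!!s t. s : S ==> t : S ==> s ~= t ==> u s <.> u t <= 0"
 shows "EX a m. (ALL s. a s >= 0) & (EX s:S. a s ~= 0) & (ALL t:S. (SUM s:S. a s * (u s <.> u t)) = m * a t)"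
proof -
 let ?L = "span S"
 have "card S = dim ?L" using dim_eq_card_independent[OF S(1)] by simp
 then obtain g where g: "!!s. s : S ==> g s : ?L" "!!s t. s : S ==> t : S ==> g s <.> g t = (if s = t then 1 else 0)"
  "!!x. x : ?L ==> (SUM s:S. (g s <.> x) *R g s) = x" using orthonormal_family_exists[OF subspace_span S(2)] by blast
 define W where "W x = (SUM s:S. (g s <.> x) *R u s)" for x
 have W: "linear W"
  by (rule linearI) (simp_all add: W_def inner_add_right scaleR_add_left sum.distrib scaleR_sum_right)
 have square: "x <.> x = (SUM s:S. (g s <.> x)\<^sup>2)" if "x : ?L" for x
  using arg_cong[OF g(3)[OF that], of "%y. y <.> x"] by (simp add: inner_sum_left power2_eq_square)
 obtain r where r: "r : S" "r ~= 0" using S(1,3) dependent_zero by fastforce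
 obtain x0 where x0: "x0 : ?L" "x0 <.> x0 = 1" and m: "!!x. x : ?L ==> (W x0 <.> W x0) * (x <.> x) <= W x <.> W x"
  using sphere_minimizer[OF W subspace_span span_base[OF r(1)] r(2)] by blast
 define a where "a s = \<bar>g s <.> x0\<bar>" for s
 define x1 where "x1 = (SUM s:S. a s *R g s)"
 have x1: "x1 : ?L" unfolding x1_def by (intro span_sum span_scale g)
 have g_x1: "g t <.> x1 = a t" if t: "t : S" for t
  using t S(2) unfolding x1_def inner_sum_right inner_scaleR_right
  by (subst sum.cong[OF refl, of _ _ "%s. if s = t then a t else 0"]) (auto simp: g(2))
 have x1_unit: "x1 <.> x1 = 1"
  using square[OF x1] square[OF x0(1)] x0(2) by (simp add: g_x1 a_def)
 have W_x1: "W x1 = (SUM s:S. a s *R u s)" unfolding W_def by (intro sum.cong refl) (simp add: g_x1)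
 have "W x1 <.> W x1 <= W x0 <.> W x0"
  using obtuse_abs_sum_le[OF obtuse, where k="%s. g s <.> x0"] by (simp add: W_x1 a_def) (simp add: W_def)
 then have stationary: "W x1 <.> W y = (W x0 <.> W x0) * (x1 <.> y)" if "y : ?L" for y
  using m[OF x1] x1_unit by (intro minimizer_stationary[OF W subspace_span m x1 _ that]) auto
 have W_g: "W (g t) = u t" if t: "t : S" for t
  using t S(2) unfolding W_def by (subst sum.cong[OF refl, of _ _ "%s. if s = t then u t else 0"]) (auto simp: g(2))
 have "(SUM s:S. a s * (u s <.> u t)) = (W x0 <.> W x0) * a t" if t: "t : S" for t
 proof -
  have "(SUM s:S. a s * (u s <.> u t)) = W x1 <.> W (g t)" by (simp add: W_x1 W_g[OF t] inner_sum_left)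
  also have "... = (W x0 <.> W x0) * a t" by (simp add: stationary[OF g(1)[OF t]] g_x1[OF t] inner_commute[of x1])
  finally show ?thesis .
 qed
 moreover have "EX s:S. a s ~= 0" using x1_unit unfolding x1_def by (intro ccontr[of "EX s:S. a s ~= 0"]) simp
 ultimately show ?thesis by (intro exI[of _ a] exI[of _ "W x0 <.> W x0"]) (auto simp: a_def)
qed

context root_sys
begin

lemma cox_elt_root: "set l \<subseteq> Ph ==> be : Ph ==> cox_elt l be : Ph"
 by (induction l) (auto intro: refl)

lemma cox_elt_inversion:
 assumes "set l \<subseteq> base" "be : pos" "cox_elt l be ~: pos"
 shows "EX l1 s l2. l = l1 @ s # l2 & cox_elt l2 be = s"
 using assms
proof (induction l)
 case (Cons s l)
 show ?case
 proof (cases "cox_elt l be : pos")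
  case True
  then have "cox_elt l be = s" using base_refl_pos[of s "cox_elt l be"] Cons.prems by auto
  then show ?thesis by (intro exI[of _ "[]"]) auto
 next
  case False
  then obtain l1 t l2 where "l = l1 @ t # l2" "cox_elt l2 be = t" using Cons by auto
  then show ?thesis by (intro exI[of _ "s # l1"] exI[of _ t] exI[of _ l2]) auto
 qed
qed simp

definition gauge :: "(real^'n => nat) => (real^'n) set => (real^'n => int) => bool" where
 "gauge rk T \<phi> \<longleftrightarrow> (ALL s:T. ALL t:T. s <.> t ~= 0 --> rk t < rk s --> \<phi> t = \<phi> s + 1)"

lemma gauge_extend:
 assumes \<phi>: "gauge rk (T - {s}) \<phi>" and T: "finite T" "s : T" and leaf: "card {t:T - {s}. s <.> t ~= 0} <= 1"
 shows "EX k. gauge rk T (\<phi>(s := k))"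
proof -
 let ?N = "{t:T - {s}. s <.> t ~= 0}"
 obtain k where k: "!!t. t : ?N ==> rk t < rk s ==> \<phi> t = k + 1" "!!t. t : ?N ==> rk s < rk t ==> k = \<phi> t + 1"
 proof (cases "?N = {}")
  case True
  then show ?thesis using that[of 0] by blast
 next
  case False
  then obtain t where t: "t : ?N" by blast
  have N: "u = t" if "u : ?N" for u using that t leaf card_le_Suc0_iff_eq[of ?N] T(1) by auto
  show ?thesis by (rule that[of "if rk t < rk s then \<phi> t - 1 else \<phi> t + 1"]) (use N in fastforce)+
 qed
 have "gauge rk T (\<phi>(s := k))"
  unfolding gauge_def
 proof (intro ballI impI)
  fix u t assume ut: "u : T" "t : T" "u <.> t ~= 0" "rk t < rk u"
  then consider "u = s" "t : ?N" | "t = s" "u : ?N" | "u : T - {s}" "t : T - {s}"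
   by (cases "u = s"; cases "t = s"; auto simp: inner_commute)
  then show "(\<phi>(s := k)) t = (\<phi>(s := k)) u + 1"
   by cases (use k ut \<phi> in \<open>auto simp: gauge_def\<close>)
 qed
 then show ?thesis by blast
qed

lemma base_gauge:
 assumes "T \<subseteq> base"
 shows "EX \<phi>. gauge rk T \<phi>"
 using assms
proof (induction "card T" arbitrary: T)
 case 0
 then have "T = {}" using finite_base finite_subset by fastforce
 then show ?case by (simp add: gauge_def)
next
 case (Suc n)
 then have T: "finite T" "T ~= {}" using finite_base finite_subset by auto
 obtain s where s: "s : T" "card {t:T - {s}. s <.> t ~= 0} <= 1" using base_leaf[OF Suc.prems T(2)] by blast
 have "n = card (T - {s})" using Suc.hyps(2) s(1) T by simp
 then obtain \<phi> where "gauge rk (T - {s}) \<phi>" using Suc.hyps(1)[of "T - {s}"] Suc.prems by blast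
 then show ?case using gauge_extend[OF _ T(1) s] by blast
qed

lemma no_mixed_root:
 assumes s: "s : base" "s ~: Z" and Z: "Z \<subseteq> base" and q: "q : pos" "q : span Z" "q + s : Ph" "q <.> s = 0"
 shows False
proof -
 obtain w where w: "s <.> w = 1" "!!t. t : base - {s} ==> t <.> w = 0" using fundamental_coweight[OF s(1)] by blast
 have "q <.> w = 0" using orthogonal_to_span[OF q(2), of w] w(2) s(2) Z by (auto simp: orthogonal_def inner_commute)
 have s_root: "s <.> s > 0" "s : Ph" using s base_pos pos_root root_nz by blast+
 have "refl_root s (q + s) = q - s"
  using q(4) s_root by (simp add: refl_root_def inner_add_left algebra_simps scaleR_2)
 then have r: "q - s : Ph" using refl[OF s_root(2) q(3)] by simp
 show False
 proof (cases "q - s : pos")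
  case True
  then obtain n where n: "q - s = (SUM t:base. real (n t) *R t)" using pos_combination by blast
  have "t <.> w >= 0" if "t : base" for t using w that by (cases "t = s") auto
  then have "(SUM t:base. real (n t) * (t <.> w)) >= 0" by (intro sum_nonneg mult_nonneg_nonneg) auto
  moreover have "(q - s) <.> w = (SUM t:base. real (n t) * (t <.> w))" unfolding n by (simp add: inner_sum_left)
  ultimately show False using w \<open>q <.> w = 0\<close> by (simp add: inner_diff_left)
 next
  case False
  then have "s - q : pos" using pos_or_neg[OF r] by simp
  then have "s = q + (s - q)" "s - q : pos" by auto
  then show False using s q(1) unfolding base_def by blast
 qed
qed

context
 fixes X :: "(real^'n) set"
 assumes X: "X \<subseteq> base" and orth: "!!s t. s : X ==> t : base - X ==> s <.> t = 0"
begin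

lemma orthogonal_spans:
 assumes x: "x : span X" and y: "y : span (base - X)"
 shows "x <.> y = 0"
proof -
 have "orthogonal y s" if "s : X" for s
  using orthogonal_to_span[OF y, of s] orth[OF that] by (auto simp: orthogonal_def inner_commute)
 then show ?thesis using orthogonal_to_span[OF x, of y] by (auto simp: orthogonal_def inner_commute)
qed

lemma level_in_span: "p : level t ==> p : span X \<or> p : span (base - X)"
proof (induction t arbitrary: p)
 case 0
 then show ?case using ht_pos_ge1[of p] by (simp add: level_def)
next
 case (Suc t)
 show ?case
 proof (cases "t >= 1")
  case False
  then have "t = 0" by simp
  then have "p : base" using Suc.prems by (simp add: base_iff_level)
  then show ?thesis using X span_base[of p X] span_base[of p "base - X"] by blast
 next
  case True
  then obtain s where s: "s : base" "p - s : level t" using level_SucE[OF Suc.prems] by blast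
  have pos: "p - s : pos" "(p - s) + s : Ph" using levelD(1)[OF s(2)] levelD(1)[OF Suc.prems] pos_root by simp_all
  have same_side: "p - s : span Z" if Z: "Z : {X, base - X}" "s : Z" for Z
  proof (rule ccontr)
   assume "p - s ~: span Z"
   then have other: "p - s : span (base - Z)" using Suc.IH[OF s(2)] Z X by (auto simp: double_diff)
   have "(p - s) <.> s = 0"
    using orthogonal_spans[of s "p - s"] orthogonal_spans[of "p - s" s] other Z X span_base[OF Z(2)]
    by (auto simp: double_diff inner_commute)
   then show False using no_mixed_root[OF s(1) _ _ pos(1) other pos(2)] Z(2) by auto
  qed
  have "p : span Z" if Z: "Z : {X, base - X}" "s : Z" for Z
   using span_add[OF same_side[OF Z] span_base[OF Z(2)]] by simp
  then show ?thesis using s(1) by blast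
 qed
qed

lemma root_in_span:
 assumes "be : Ph"
 shows "be : span X \<or> be : span (base - X)"
proof -
 have "p : span X \<or> p : span (base - X)" if "p : pos" for p using pos_cases_level[OF that] level_in_span by blast
 then show ?thesis using pos_or_neg[OF assms] span_neg[of "- be" X] span_neg[of "- be" "base - X"] by auto
qed

lemma base_connected:
 assumes irr: "irreducible_root_system Ph" and nonempty: "X ~= {}"
 shows "X = base"
proof (rule ccontr)
 assume "X ~= base"
 then have Y: "base - X ~= {}" using X by blast
 let ?A = "Ph Int span X" and ?B = "Ph Int span (base - X)"
 have "?A ~= {}" "?B ~= {}"
  using nonempty Y X base_pos pos_root span_base[of _ X] span_base[of _ "base - X"] by blast+
 moreover have "?A Un ?B = Ph" using root_in_span by blast
 moreover have "?A Int ?B = {}" using orthogonal_spans root_nz by fastforce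
 moreover have "ALL a:?A. ALL b:?B. a <.> b = 0" using orthogonal_spans by blast
 ultimately show False using irr unfolding irreducible_root_system_def by metis
qed

end

lemma sgn_base:
 assumes "s : base"
 shows "s ~= 0" "sgn s <.> sgn s = 1" "t : base ==> s ~= t ==> sgn s <.> sgn t <= 0"
proof -
 show "s ~= 0" using assms base_pos pos_root root_nz(1)[of s] by blast
 then show "sgn s <.> sgn s = 1" by (simp add: dot_square_norm norm_sgn)
 show "sgn s <.> sgn t <= 0" if "t : base" "s ~= t"
  using base_obtuse[OF assms that] by (simp add: sgn_div_norm mult_nonneg_nonpos)
qed

lemma base_gram_eigenvalue_pos:
 assumes eig: "!!t. t : base ==> (SUM s:base. a s * (sgn s <.> sgn t)) = m * a t" and s: "s : base" "a s ~= 0"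
 shows "m > 0"
proof -
 define x where "x = (SUM s:base. a s *R sgn s)"
 have "x = (SUM s:base. (a s / norm s) *R s)" by (simp add: x_def sgn_div_norm divide_inverse mult.commute)
 then have "x ~= 0"
  using independentD[OF base_independent finite_base subset_refl, of "%s. a s / norm s" s] s sgn_base(1)[OF s(1)] by auto
 then have "0 < x <.> x" by simp
 also have "x <.> x = (SUM t:base. a t * (SUM s:base. a s * (sgn s <.> sgn t)))"
  unfolding x_def inner_sum_right by (simp add: inner_sum_left)
 also have "... = m * (SUM t:base. (a t)\<^sup>2)"
  unfolding sum_distrib_left[of m] by (intro sum.cong HOL.refl) (simp add: eig power2_eq_square)
 finally show ?thesis by (smt (verit) mult_nonpos_nonneg sum_nonneg zero_le_power2)
qed

lemma perron_frobenius_unit: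
 assumes irr: "irreducible_root_system Ph"
 obtains a m where "!!s. s : base ==> a s > 0" "0 < m" "m <= 1"
  "!!t. t : base ==> (SUM s:base - {t}. - (sgn s <.> sgn t) * a s) = (1 - m) * a t"
proof -
 have nonempty: "Ph ~= {}" using irr unfolding irreducible_root_system_def by blast
 obtain a m where a_nonneg: "!!s. a s >= 0" and s1: "EX s:base. a s ~= 0"
  and eig: "!!t. t : base ==> (SUM s:base. a s * (sgn s <.> sgn t)) = m * a t"
  using nonneg_eigenvector[OF base_independent finite_base base_nonempty[OF nonempty], where u=sgn, OF sgn_base(3)] by blast
 obtain s1 where s1: "s1 : base" "a s1 > 0" using s1 a_nonneg by (metis less_le)
 have off: "(SUM s:base - {t}. - (sgn s <.> sgn t) * a s) = (1 - m) * a t" if t: "t : base" for t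
 proof -
  have "m * a t = a t * (sgn t <.> sgn t) + (SUM s:base - {t}. a s * (sgn s <.> sgn t))"
   using eig[OF t] sum.remove[OF finite_base t, of "%s. a s * (sgn s <.> sgn t)"] by simp
  then show ?thesis using sgn_base(2)[OF t] by (simp add: sum_negf algebra_simps)
 qed
 have "0 <= (SUM s:base - {s1}. - (sgn s <.> sgn s1) * a s)"
  by (intro sum_nonneg mult_nonneg_nonneg a_nonneg) (use sgn_base(3)[OF _ s1(1)] in auto)
 then have m1: "m <= 1" using off[OF s1(1)] s1(2) by (simp add: zero_le_mult_iff)
 have m0: "m > 0" by (rule base_gram_eigenvalue_pos[OF eig s1(1)]) (use s1(2) in auto)
 have "{s:base. a s > 0} = base"
 proof (rule base_connected[OF _ _ irr])
  fix s t assume s: "s : {s:base. a s > 0}" and t: "t : base - {s:base. a s > 0}"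
  have "a t = 0" using t a_nonneg[of t] by auto
  then have "(SUM s:base - {t}. - (sgn s <.> sgn t) * a s) = 0" using off[of t] t by simp
  then have "ALL s:base - {t}. - (sgn s <.> sgn t) * a s = 0"
   by (subst sum_nonneg_eq_0_iff[symmetric]) (use finite_base a_nonneg sgn_base(3) t in \<open>auto intro!: mult_nonpos_nonneg\<close>)
  then have "sgn s <.> sgn t = 0" using s t by fastforce
  then show "s <.> t = 0" using sgn_base(1) s t by (auto simp: sgn_div_norm)
 qed (use s1 in auto)
 then show ?thesis using that[of a m] m0 m1 off by blast
qed

lemma perron_frobenius_base:
 assumes irr: "irreducible_root_system Ph"
 obtains y ka where "!!s. s : base ==> y s > 0" "0 <= ka" "ka < (2::real)"
  "!!t. t : base ==> (SUM s:base - {t}. - (2 * proj_coeff s t) * y s) = ka * y t"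
proof -
 obtain a m where a: "!!s. s : base ==> a s > 0" and m: "0 < m" "m <= 1"
  and off: "!!t. t : base ==> (SUM s:base - {t}. - (sgn s <.> sgn t) * a s) = (1 - m) * a t"
  using perron_frobenius_unit[OF irr] by blast
 have pos: "norm s > 0" if "s : base" for s using that base_pos pos_root root_nz(1)[of s] by auto
 show ?thesis
 proof (rule that[of "%s. a s / norm s" "2 * (1 - m)"])
  fix t assume t: "t : base"
  have "(SUM s:base - {t}. - (2 * proj_coeff s t) * (a s / norm s)) = (SUM s:base - {t}. (2 / norm t) * (- (sgn s <.> sgn t) * a s))"
   using pos[OF t] by (intro sum.cong HOL.refl) (simp add: proj_coeff_def sgn_div_norm dot_square_norm[of t] power2_eq_square divide_inverse)
  also have "... = (2 / norm t) * ((1 - m) * a t)" unfolding sum_distrib_left[symmetric] off[OF t] ..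
  finally show "(SUM s:base - {t}. - (2 * proj_coeff s t) * (a s / norm s)) = 2 * (1 - m) * (a t / norm t)" by simp
 qed (use a pos m in auto)
qed

end

lemma cdot_Complex: "cdot a z = Complex (a <.> re_vec z) (a <.> im_vec z)"
 by (simp add: cdot_def complex_eq_iff inner_vec_def re_vec_def im_vec_def)

lemma cdot_cmap_adjoint:
 assumes "!!x. a <.> T x = b <.> x"
 shows "cdot a (cmap T z) = cdot b z"
 by (simp only: cdot_Complex re_im_cmap assms)

lemma cdot_cvec: "cdot a (cvec x) = complex_of_real (a <.> x)"
 by (simp add: cdot_def cvec_def inner_vec_def)

lemma cdot_add: "cdot a (z + w) = cdot a z + cdot a w"
 by (simp add: cdot_def distrib_left sum.distrib)

lemma cdot_sum: "cdot a (SUM i:I. z i) = (SUM i:I. cdot a (z i))"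
 by (induction I rule: infinite_finite_induct) (simp_all add: cdot_add, simp_all add: cdot_def)

lemma cmap_sum_scale:
 assumes "linear T"
 shows "cmap T (SUM i:I. c i *s v i) = (SUM i:I. c i *s cmap T (v i))"
proof -
 have "(SUM j:UNIV. complex_of_real (T (axis j 1) $ k) * (SUM i:I. c i * v i $ j)) = (SUM i:I. c i * (SUM j:UNIV. complex_of_real (T (axis j 1) $ k) * v i $ j))" for k
  unfolding sum_distrib_left by (subst sum.swap) (intro sum.cong refl, simp add: mult_ac)
 then show ?thesis by (simp add: vec_eq_iff cmap_component[OF assms])
qed

lemma cmap_compose: "cmap S (cmap T z) = cmap (%x. S (T x)) z"
 by (simp add: cmap_def[of S] cmap_def[of "%x. S (T x)"] re_im_cmap)

lemma cmap_id: "(!!x. T x = x) ==> cmap T z = z"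
 by (simp add: cmap_def vec_eq_iff re_vec_def im_vec_def)

lemma cmap_refl_root: "cmap (refl_root s) w = w - (2 * cdot s w / complex_of_real (s <.> s)) *s cvec s"
proof (rule vec_eq_iff[THEN iffD2], rule allI)
 fix i
 have C: "Complex (p - 2 * a / d * c) (q - 2 * b / d * c) = Complex p q - (2 * Complex a b / complex_of_real d) * complex_of_real c"
  for p q a b c d
  by (rule complex_eqI) (simp_all add: Re_divide_of_real Im_divide_of_real)
 have R: "refl_root s x $ i = x $ i - 2 * (s <.> x) / (s <.> s) * s $ i" for x
  unfolding refl_root_def inner_commute[of x s] by simp
 have component_w: "Complex (re_vec w $ i) (im_vec w $ i) = w $ i" by (simp add: re_vec_def im_vec_def)
 have "cmap (refl_root s) w $ i = Complex (re_vec w $ i - 2 * (s <.> re_vec w) / (s <.> s) * s $ i) (im_vec w $ i - 2 * (s <.> im_vec w) / (s <.> s) * s $ i)"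
  unfolding cmap_def vec_lambda_beta R ..
 also have "... = w $ i - (2 * cdot s w / complex_of_real (s <.> s)) * complex_of_real (s $ i)"
  unfolding C component_w cdot_Complex ..
 finally show "cmap (refl_root s) w $ i = (w - (2 * cdot s w / complex_of_real (s <.> s)) *s cvec s) $ i"
  unfolding cvec_def vector_minus_component vector_smult_component vec_lambda_beta .
qed

lemma linear_funpow: "linear (f :: 'a::real_vector => 'a) ==> linear (f ^^ k)"
proof (induction k)
 case 0
 then show ?case by (simp add: linear_iff)
next
 case (Suc k)
 then show ?case using linear_compose[of "f ^^ k" f] by (simp add: o_def)
qed

context root_sys
begin

lemma cox_elt_finite_order:
 assumes l: "set l \<subseteq> Ph"
 shows "EX N>0. ALL x:span Ph. (cox_elt l ^^ N) x = x"
proof -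
 let ?c = "cox_elt l"
 have orbit_in_Ph: "(?c ^^ k) be : Ph" if "be : Ph" for k be
  by (induction k) (auto intro: cox_elt_root[OF l] that)
 have injc: "inj ?c" by (rule inj_on_inverseI[of _ "cox_elt (rev l)"]) (simp add: cox_elt_rev)
 let ?F = "%k. restrict (?c ^^ k) Ph"
 have "range ?F \<subseteq> (\<Pi>\<^sub>E be\<in>Ph. Ph)" using orbit_in_Ph by auto
 then have "finite (range ?F)" using finite_PiE[OF fin, of "%_. Ph"] fin finite_subset by blast
 then have "~ inj ?F" using range_inj_infinite by blast
 then obtain i j where ij: "?F i = ?F j" "i < j" unfolding inj_on_def by (metis linorder_neqE_nat)
 have "(?c ^^ (j - i)) be = be" if b: "be : Ph" for be
 proof -
  have "(?c ^^ i) be = (?c ^^ j) be" using fun_cong[OF ij(1), of be] b by simp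
  also have "... = (?c ^^ (i + (j - i))) be" using ij(2) by simp
  also have "... = (?c ^^ i) ((?c ^^ (j - i)) be)" by (simp only: funpow_add o_apply)
  finally show ?thesis using inj_fn[OF injc, of i] by (metis injD)
 qed
 then have "(?c ^^ (j - i)) x = id x" if "x : span Ph" for x
  by (intro linear_eq_on_span[OF linear_funpow[OF linear_cox_elt] linear_id _ that]) simp
 then show ?thesis using ij(2) by (intro exI[of _ "j - i"]) auto
qed

lemma cox_elt_orbit_sum:
 assumes ds: "distinct ds" "set ds = base" and be: "be : Ph" and N: "(cox_elt ds ^^ N) be = be"
 shows "(SUM k<N. (cox_elt ds ^^ k) be) = 0"
proof -
 let ?c = "cox_elt ds"
 have dsP: "set ds \<subseteq> Ph" using ds(2) base_pos pos_root by blast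
 define S where "S = (SUM k<N. (?c ^^ k) be)"
 have "?c S = (SUM k<N. (?c ^^ Suc k) be)" unfolding S_def using linear_sum[OF linear_cox_elt] by simp
 also have "... = S + (?c ^^ N) be - be"
  unfolding S_def using sum.lessThan_Suc[of "%k. (?c ^^ k) be" N] sum.lessThan_Suc_shift[of "%k. (?c ^^ k) be" N]
  by (simp add: algebra_simps)
 finally have "?c S = S" using N by simp
 then have base_orth: "orthogonal S s" if "s : base" for s
  using cox_elt_fixed[OF _ _ ds(1), of S s] base_independent ds(2) that by (simp add: orthogonal_def inner_commute)
 have "(?c ^^ k) be : Ph" for k by (induction k) (auto intro: cox_elt_root[OF dsP] be)
 then have "S : span base" unfolding S_def by (intro span_sum root_in_span_base)
 then have "orthogonal S S" using base_orth by (rule orthogonal_to_span)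
 then show ?thesis by (simp add: S_def orthogonal_self)
qed

lemma cox_elt_orbit:
 assumes ds: "distinct ds" "set ds = base" and be: "be : Ph"
 shows "EX k. (cox_elt ds ^^ k) be : pos & (cox_elt ds ^^ Suc k) be ~: pos"
proof (rule ccontr)
 assume contra: "~ ?thesis"
 let ?x = "%k. (cox_elt ds ^^ k) be"
 have dsP: "set ds \<subseteq> Ph" using ds(2) base_pos pos_root by blast
 obtain N where N: "N > 0" "?x N = be" using cox_elt_finite_order[OF dsP] be span_base by blast
 have root: "?x k : Ph" for k by (induction k) (auto intro: cox_elt_root[OF dsP] be)
 have stays_pos: "?x (k + j) : pos" if "?x k : pos" for k j using contra that by (induction j) auto
 have periodic: "?x (k + N * j) = ?x k" for k j
  using funpow_mod_eq[OF N(2), of k] funpow_mod_eq[OF N(2), of "k + N * j"] by simp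
 have sum_ht: "(SUM k<N. ht (?x k)) = 0"
  using linear_sum[OF linear_ht, of ?x "{..<N}"] cox_elt_orbit_sum[OF ds be N(2)] linear_0[OF linear_ht] by simp
 show False
 proof (cases "EX k. ?x k : pos")
  case True
  then obtain k where k: "?x k : pos" by blast
  have "?x j : pos" for j
  proof -
   have "k <= j + N * k" using N(1) by (metis le_add2 mult_le_mono1 nat_mult_1 order_trans Suc_leI One_nat_def)
   then have "?x (j + N * k) : pos" using stays_pos[OF k, of "j + N * k - k"] by simp
   then show ?thesis using periodic by simp
  qed
  then have "(SUM k<N. ht (?x k)) > 0" using ht_pos_ge1 N(1) by (intro sum_pos) (auto intro: less_le_trans[OF zero_less_one])
  then show False using sum_ht by simp
 next
  case False
  have "- ht (?x k) > 0" for k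
   using pos_or_neg[OF root[of k]] False ht_pos_ge1[of "- ?x k"] by (auto simp: ht_neg)
  then have "(SUM k<N. - ht (?x k)) > 0" using N(1) by (intro sum_pos) auto
  then show False using sum_ht by (simp add: sum_negf)
 qed
qed

lemma takeWhile_rank:
 assumes "distinct ds" "ds = p @ s # q"
 shows "length (takeWhile (%u. u ~= s) ds) = length p"
proof -
 have "s ~: set p" using assms by auto
 then show ?thesis using assms(2) by (subst assms(2), subst takeWhile_append2) auto
qed

lemma list_gauge:
 assumes ds: "distinct ds" "set ds = base"
 obtains \<phi> :: "real^'n => int"
 where "!!p s q t r. ds = p @ s # q @ t # r ==> s <.> t ~= 0 ==> \<phi> s = \<phi> t + 1"
proof -
 define rk where "rk s = length (takeWhile (%u. u ~= s) ds)" for s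
 obtain \<phi> where \<phi>: "gauge rk base \<phi>" using base_gauge[OF subset_refl] by blast
 have "\<phi> s = \<phi> t + 1" if d: "ds = p @ s # q @ t # r" and "s <.> t ~= 0" for p s q t r
 proof -
  have "rk s < rk t"
   unfolding rk_def using takeWhile_rank[OF ds(1) d] takeWhile_rank[OF ds(1), of "p @ s # q" t r] d by simp
  moreover have "s : base" "t : base" using d ds(2) by auto
  ultimately show ?thesis using \<phi> that(2) by (simp add: gauge_def inner_commute)
 qed
 then show ?thesis using that by blast
qed

end

text \<open>\<open>Z l\<close> is the image of \<open>z = \<Sum> x\<^sub>s s\<close> under the product of the reflections in \<open>l\<close>, a final segment of \<open>ds\<close>: the
 phases of \<open>x\<close> are chosen such that each reflection just multiplies the coefficient of its own root by \<open>\<mu>\<close>.\<close>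

locale coxeter_eigenvector = root_sys Ph c for Ph :: "(real^'n) set" and c +
 fixes ds :: "(real^'n) list" and y :: "real^'n => real" and ka :: real and \<phi> :: "real^'n => int"
 assumes ds: "distinct ds" "set ds = base" and y: "s : base ==> y s > 0" and ka: "0 <= ka" "ka < 2"
  and eig: "t : base ==> (SUM s:base - {t}. - (2 * proj_coeff s t) * y s) = ka * y t"
  and gauge: "ds = p @ s # q @ t # r ==> s <.> t ~= 0 ==> \<phi> s = \<phi> t + 1"
begin

definition angle :: real where "angle = arccos (ka / 2)"

definition mu :: complex where "mu = cis (2 * angle)"

definition x :: "real^'n => complex" where "x s = cis (angle * real_of_int (\<phi> s)) * complex_of_real (y s)"

definition Z :: "(real^'n) list => complex^'n" where
 "Z l = (SUM s:base. ((if s : set l then mu else 1) * x s) *s cvec s)"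

lemma cos_angle: "cos angle = ka / 2" unfolding angle_def using ka by (intro cos_arccos) auto

lemma norm_mu: "norm mu = 1" by (simp add: mu_def)

lemma mu_nonzero: "mu ~= 0" by (simp add: mu_def)

lemma mu_neq_1: "mu ~= 1"
proof
 assume "mu = 1"
 then have "cos (2 * angle) = 1" by (simp add: mu_def complex_eq_iff)
 then have "sin angle = 0" by (simp add: cos_double_sin)
 moreover have "0 < angle" "angle < pi"
  unfolding angle_def using ka arccos_less_arccos[of "ka / 2" 1] arccos_less_arccos[of "- 1" "ka / 2"] by simp_all
 then have "sin angle > 0" by (rule sin_gt_zero)
 ultimately show False by simp
qed

lemma one_plus_mu: "1 + mu = cis angle * complex_of_real ka"
proof -
 have "ka = 2 * cos angle" using cos_angle by simp
 then show ?thesis by (simp add: mu_def complex_eq_iff cos_double_cos sin_double power2_eq_square)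
qed

lemma neighbour_coefficient:
 assumes d: "ds = pre @ t # l" and s: "s : base - {t}" "s <.> t ~= 0"
 shows "(if s : set l then mu else 1) * x s = cis angle * cis (angle * real_of_int (\<phi> t)) * complex_of_real (y s)"
proof -
 have disj: "set pre Int set l = {}" using ds(1) d by auto
 consider (before) "s : set pre" | (after) "s : set l" using s d ds(2) by auto
 then show ?thesis
 proof cases
  case before
  then obtain p q where "pre = p @ s # q" using split_list[of s pre] by blast
  then have "\<phi> s = \<phi> t + 1" using gauge[of p s q t l] d s by simp
  moreover have "s ~: set l" using before disj by blast
  ultimately show ?thesis by (simp add: x_def cis_mult distrib_left add.commute)
 next
  case after
  then obtain p q where "l = p @ s # q" using split_list[of s l] by blast
  then have "\<phi> t = \<phi> s + 1" using gauge[of pre t p s q] d s by (simp add: inner_commute)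
  then show ?thesis using after by (simp add: x_def mu_def cis_mult distrib_left mult.assoc[symmetric] add.commute)
 qed
qed

lemma cdot_Z:
 assumes d: "ds = pre @ t # l"
 shows "2 * cdot t (Z l) / complex_of_real (t <.> t) = (1 - mu) * x t"
proof -
 let ?k = "%s. (if s : set l then mu else 1) * x s" and ?K = "%s. complex_of_real (2 * proj_coeff s t)"
 have t: "t : base" "t ~: set l" using d ds by auto
 have t0: "t ~= 0" using t base_pos pos_root root_nz by blast
 have "2 * cdot t (Z l) / complex_of_real (t <.> t) = (SUM s:base. ?k s * ?K s)"
  unfolding Z_def cdot_sum cdot_scale cdot_cvec sum_distrib_left sum_divide_distrib
  by (intro sum.cong HOL.refl) (simp add: proj_coeff_def inner_commute)
 also have "... = ?k t * ?K t + (SUM s:base - {t}. ?k s * ?K s)" by (rule sum.remove[OF finite_base t(1)])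
 also have "?k t * ?K t = 2 * x t" using t t0 by simp
 also have "(SUM s:base - {t}. ?k s * ?K s) =
  - (SUM s:base - {t}. cis angle * cis (angle * real_of_int (\<phi> t)) * complex_of_real (- (2 * proj_coeff s t) * y s))"
  unfolding sum_negf[symmetric]
 proof (rule sum.cong[OF HOL.refl])
  fix s assume s: "s : base - {t}"
  show "?k s * ?K s = - (cis angle * cis (angle * real_of_int (\<phi> t)) * complex_of_real (- (2 * proj_coeff s t) * y s))"
  proof (cases "s <.> t = 0")
   case False
   then show ?thesis unfolding neighbour_coefficient[OF d s False] by simp
  qed (simp add: proj_coeff_def)
 qed
 also have "(SUM s:base - {t}. cis angle * cis (angle * real_of_int (\<phi> t)) * complex_of_real (- (2 * proj_coeff s t) * y s)) = (1 + mu) * x t"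
  unfolding sum_distrib_left[symmetric] of_real_sum[symmetric] eig[OF t(1)] by (simp add: one_plus_mu x_def)
 finally show ?thesis by (simp add: algebra_simps)
qed

lemma Z_Cons:
 assumes t: "t : base" "t ~: set l"
 shows "Z (t # l) = Z l + ((mu - 1) * x t) *s cvec t"
proof -
 have "(SUM s:base - {t}. ((if s : set (t # l) then mu else 1) * x s) *s cvec s) =
  (SUM s:base - {t}. ((if s : set l then mu else 1) * x s) *s cvec s)" by (intro sum.cong HOL.refl) auto
 then show ?thesis
  unfolding Z_def sum.remove[OF finite_base t(1)] using t(2) by (simp add: vec_eq_iff algebra_simps)
qed

lemma cmap_suffix:
 assumes "ds = pre @ l"
 shows "cmap (cox_elt l) (Z []) = Z l"
 using assms
proof (induction l arbitrary: pre)
 case Nil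
 then show ?case by (simp add: cmap_id)
next
 case (Cons t l)
 have "cmap (cox_elt (t # l)) (Z []) = cmap (refl_root t) (cmap (cox_elt l) (Z []))"
  unfolding cmap_compose by (rule arg_cong[where f="%f. cmap f _"]) (simp add: fun_eq_iff)
 also have "cmap (cox_elt l) (Z []) = Z l" using Cons.IH[of "pre @ [t]"] Cons.prems by simp
 also have "cmap (refl_root t) (Z l) = Z l + ((mu - 1) * x t) *s cvec t"
  unfolding cmap_refl_root cdot_Z[OF Cons.prems] by (simp add: vec_eq_iff algebra_simps)
 also have "... = Z (t # l)" by (rule Z_Cons[symmetric]) (use Cons.prems ds in auto)
 finally show ?case .
qed

lemma cmap_eigen: "cmap (cox_elt ds) (Z []) = mu *s Z []"
proof -
 have "cmap (cox_elt ds) (Z []) = Z ds" using cmap_suffix[of "[]" ds] by simp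
 also have "... = mu *s Z []"
  unfolding Z_def vec.scale_sum_right by (intro sum.cong HOL.refl) (simp add: ds(2) vector_smult_assoc)
 finally show ?thesis .
qed

lemma inversion_regular:
 assumes be: "be : pos" "cox_elt ds be ~: pos"
 shows "cdot be (Z []) ~= 0"
proof -
 obtain l1 s l2 where l: "ds = l1 @ s # l2" "cox_elt l2 be = s" using cox_elt_inversion[OF _ be] ds(2) by blast
 have s: "s : base" using l ds(2) by auto
 have "be = cox_elt (rev l2) s" using l(2) cox_elt_rev by metis
 then have "s <.> cox_elt l2 v = be <.> v" for v using cox_elt_adjoint[of "rev l2" s v] by simp
 then have "cdot s (cmap (cox_elt l2) (Z [])) = cdot be (Z [])" by (rule cdot_cmap_adjoint)
 then have "cdot be (Z []) = cdot s (Z l2)" using cmap_suffix[of "l1 @ [s]" l2] l(1) by simp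
 moreover have "x s ~= 0" using y[OF s] by (simp add: x_def)
 then have "cdot s (Z l2) ~= 0" using cdot_Z[OF l(1)] mu_neq_1 by auto
 ultimately show ?thesis by simp
qed

lemma cdot_cox_elt_zero:
 assumes "cdot be (Z []) = 0"
 shows "cdot (cox_elt ds be) (Z []) = 0"
proof -
 have "cox_elt ds be <.> cox_elt ds v = be <.> v" for v by (simp add: cox_elt_adjoint cox_elt_rev)
 then have "cdot (cox_elt ds be) (cmap (cox_elt ds) (Z [])) = cdot be (Z [])" by (rule cdot_cmap_adjoint)
 then show ?thesis using assms mu_nonzero by (simp add: cmap_eigen cdot_scale)
qed

lemma regular:
 assumes be: "be : Ph"
 shows "cdot be (Z []) ~= 0"
proof
 assume be0: "cdot be (Z []) = 0"
 have "cdot ((cox_elt ds ^^ k) be) (Z []) = 0" for k by (induction k) (auto simp: be0 cdot_cox_elt_zero)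
 moreover obtain k where "(cox_elt ds ^^ k) be : pos" "cox_elt ds ((cox_elt ds ^^ k) be) ~: pos"
  using cox_elt_orbit[OF ds be] by auto
 ultimately show False using inversion_regular by blast
qed

end

context root_sys
begin

theorem regular_eigenvector:
 assumes irr: "irreducible_root_system Ph" and ds: "distinct ds" "set ds = base"
 shows "EX mu z. mu ~= 1 & norm mu = 1 & cmap (cox_elt ds) z = mu *s z & (ALL be:Ph. cdot be z ~= 0)"
proof -
 obtain y ka where "!!s. s : base ==> y s > 0" "0 <= ka" "ka < (2::real)"
  "!!t. t : base ==> (SUM s:base - {t}. - (2 * proj_coeff s t) * y s) = ka * y t"
  using perron_frobenius_base[OF irr] by blast
 moreover obtain \<phi> :: "real^'n => int"
  where "!!p s q t r. ds = p @ s # q @ t # r ==> s <.> t ~= 0 ==> \<phi> s = \<phi> t + 1" using list_gauge[OF ds] by blast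
 ultimately interpret coxeter_eigenvector Ph c ds y ka \<phi> using ds by unfold_locales
 show ?thesis using mu_neq_1 norm_mu cmap_eigen regular by blast
qed

lemma card_root_le:
 assumes ds: "distinct ds" "set ds = base" and n: "n > 0" "!!x. x : span Ph ==> (cox_elt ds ^^ n) x = x"
 shows "card Ph <= card base * n"
proof -
 let ?c = "cox_elt ds"
 let ?g = "%(k, j). (?c ^^ k) (cox_elt (rev (drop (Suc j) ds)) (ds ! j))"
 have roots: "set ds \<subseteq> Ph" using ds(2) base_pos pos_root by blast
 have "Ph \<subseteq> ?g ` ({..<n} \<times> {..<length ds})"
 proof
  fix be assume b: "be : Ph"
  obtain k where k: "(?c ^^ k) be : pos" "?c ((?c ^^ k) be) ~: pos" using cox_elt_orbit[OF ds b] by auto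
  then obtain l1 s l2 where l: "ds = l1 @ s # l2" "cox_elt l2 ((?c ^^ k) be) = s"
   using cox_elt_inversion[OF _ k] ds(2) by blast
  let ?ga = "(?c ^^ k) be"
  have g: "?ga = cox_elt (rev (drop (Suc (length l1)) ds)) (ds ! length l1)"
   using l cox_elt_rev[of l2 ?ga] by simp
  have periodic: "(?c ^^ (n * q)) be = be" for q
   using funpow_mod_eq[OF n(2)[OF span_base[OF b]], of "n * q"] by simp
  have orbit_in_Ph: "(?c ^^ i) be : Ph" for i by (induction i) (auto intro: cox_elt_root[OF roots] b)
  define m where "m = n * k - k"
  have m_k: "m + k = n * k" using n(1) by (simp add: m_def)
  have b1: "(?c ^^ m) ?ga = be" using periodic[of k] m_k by (metis funpow_add o_apply)
  have "(?c ^^ m) ?ga = (?c ^^ (m mod n)) ?ga"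
   using funpow_mod_eq[OF n(2)[OF span_base[OF orbit_in_Ph[of k]]], of m] by simp
  then have "be = ?g (m mod n, length l1)" using b1 g by simp
  then show "be : ?g ` ({..<n} \<times> {..<length ds})" using n(1) l(1) by (intro image_eqI[of _ _ "(m mod n, length l1)"]) auto
 qed
 then have "card Ph <= card (?g ` ({..<n} \<times> {..<length ds}))" by (intro card_mono) auto
 also have "... <= card ({..<n} \<times> {..<length ds})" by (rule card_image_le) auto
 also have "... = card base * n" using ds distinct_card[of ds] by simp
 finally show ?thesis .
qed

end

section \<open>The duality of heights\<close>

lemma cev_scaled_poly:
 assumes "rpoly F"
 shows "EX p. (ALL s::real. cev F (complex_of_real s *s z) = poly p (complex_of_real s)) & coeff p 0 = complex_of_real (F 0)"
 using assms
proof (induction F rule: real_polynomial_function.induct)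
 case (linear f)
 have "f x = adjoint f 1 <.> x" for x
  using adjoint_works[OF bounded_linear.linear[OF linear], of x 1] by (simp add: inner_commute)
 then have f: "f = (%x. adjoint f 1 <.> x)" by auto
 show ?case by (subst (1 2) f, unfold cev_inner cdot_scale, intro exI[of _ "[:0, cdot (adjoint f 1) z:]"]) simp
next
 case (const c)
 show ?case unfolding cev_const by (intro exI[of _ "[:complex_of_real c:]"]) simp
next
 case (add f g)
 then obtain p q where "ALL s. cev f (complex_of_real s *s z) = poly p (complex_of_real s)" "coeff p 0 = complex_of_real (f 0)"
  "ALL s. cev g (complex_of_real s *s z) = poly q (complex_of_real s)" "coeff q 0 = complex_of_real (g 0)" by blast
 then show ?case unfolding cev_add[OF add.hyps] by (intro exI[of _ "p + q"]) simp
next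
 case (mult f g)
 then obtain p q where "ALL s. cev f (complex_of_real s *s z) = poly p (complex_of_real s)" "coeff p 0 = complex_of_real (f 0)"
  "ALL s. cev g (complex_of_real s *s z) = poly q (complex_of_real s)" "coeff q 0 = complex_of_real (g 0)" by blast
 then show ?case unfolding cev_mult[OF mult.hyps] by (intro exI[of _ "p * q"]) (simp add: coeff_mult_0)
qed

definition vanishing_comb :: "'i set => ('i => 'a::euclidean_space => 'a) => ('a => 'a) => bool" where
 "vanishing_comb I th et \<longleftrightarrow>
   (EX F. (ALL j:I. rpoly (F j) & F j 0 = 0) & (ALL x. et x = (SUM j:I. F j x *R th j x)))"

lemma vanishing_combI:
 "(!!j. j : I ==> rpoly (F j)) ==> (!!j. j : I ==> F j 0 = 0) ==> (!!x. et x = (SUM j:I. F j x *R th j x)) ==> vanishing_comb I th et"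
 unfolding vanishing_comb_def by (intro exI[of _ F]) auto

lemma vanishing_combE:
 assumes "vanishing_comb I th et"
 obtains F where "!!j. j : I ==> rpoly (F j)" "!!j. j : I ==> F j 0 = 0" "et = (%x. SUM j:I. F j x *R th j x)"
 using assms unfolding vanishing_comb_def by (auto simp: fun_eq_iff)

lemma vanishing_comb_zero: "vanishing_comb I th (%x. 0)"
 by (rule vanishing_combI[of _ "%_ _. 0"]) (simp_all add: rpoly_const)

lemma vanishing_comb_add:
 assumes "vanishing_comb I th et" "vanishing_comb I th et'"
 shows "vanishing_comb I th (%x. et x + et' x)"
proof -
 obtain F where F: "!!j. j : I ==> rpoly (F j)" "!!j. j : I ==> F j 0 = 0" "et = (%x. SUM j:I. F j x *R th j x)"
  using vanishing_combE[OF assms(1)] by blast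
 obtain G where G: "!!j. j : I ==> rpoly (G j)" "!!j. j : I ==> G j 0 = 0" "et' = (%x. SUM j:I. G j x *R th j x)"
  using vanishing_combE[OF assms(2)] by blast
 show ?thesis
  by (rule vanishing_combI[of _ "%j x. F j x + G j x"]) (simp_all add: F G rpoly_add scaleR_add_left sum.distrib)
qed

lemma vanishing_comb_sum:
 "(!!k. k : K ==> vanishing_comb I th (et k)) ==> vanishing_comb I th (%x. SUM k:K. et k x)"
 by (induction K rule: infinite_finite_induct) (auto intro: vanishing_comb_zero vanishing_comb_add)

lemma vanishing_comb_scale_inner:
 assumes "!!j. j : I ==> rpoly (f j)"
 shows "vanishing_comb I th (%x. (a <.> x) *R (SUM j:I. f j x *R th j x))"
 by (rule vanishing_combI[of _ "%j x. (a <.> x) * f j x"]) (simp_all add: assms rpoly_mult rpoly_inner scaleR_sum_right)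

text \<open>Comparing the terms of degree \<open>d\<close> in a real scaling parameter: the generators of degree at least \<open>d\<close> drop out
 because their coefficients vanish at the origin.\<close>

lemma homogeneous_combination:
 assumes I: "finite I" and et: "polynomial_function et" "!!t x. et (t *R x) = t ^ d *R et x"
  and th: "!!j. j : I ==> polynomial_function (th j)" "!!j t x. j : I ==> th j (t *R x) = t ^ e j *R th j x"
  and comb: "vanishing_comb I th et"
 obtains c where "cev_field et z = (SUM j:{j:I. e j < d}. c j *s cev_field (th j) z)"
proof -
 obtain F where F: "!!j. j : I ==> rpoly (F j)" "!!j. j : I ==> F j 0 = 0" "et = (%x. SUM j:I. F j x *R th j x)"
  using vanishing_combE[OF comb] by blast
 have "ALL j:I. EX p. (ALL s::real. cev (F j) (complex_of_real s *s z) = poly p (complex_of_real s)) & coeff p 0 = 0"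
  using cev_scaled_poly[OF F(1)] F(2) by (metis of_real_0)
 then obtain p where p: "!!j s. j : I ==> cev (F j) (complex_of_real s *s z) = poly (p j) (complex_of_real s)"
  "!!j. j : I ==> coeff (p j) 0 = 0" by metis
 let ?P = "SIGMA j:I. {..degree (p j)}"
 let ?w = "%(j, k). coeff (p j) k *s cev_field (th j) z"
 have "s ^ d *R cev_field et z = (SUM q:?P. s ^ (snd q + e (fst q)) *R ?w q)" for s
 proof -
  have "s ^ d *R cev_field et z = cev_field et (complex_of_real s *s z)"
   by (simp add: cev_field_homogeneous[OF et] vec_eq_iff scaleR_conv_of_real[where 'a=complex])
  also have "... = (SUM j:I. cev (F j) (complex_of_real s *s z) *s cev_field (th j) (complex_of_real s *s z))"
   unfolding F(3) by (rule cev_field_sum_scale[OF F(1) th(1)])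
  also have "... = (SUM j:I. SUM k<=degree (p j). s ^ (k + e j) *R ?w (j, k))"
   by (intro sum.cong refl) (simp add: p(1) cev_field_homogeneous[OF th] poly_altdef vec_eq_iff sum_distrib_right sum_distrib_left
     scaleR_conv_of_real[where 'a=complex] power_add mult_ac)
  finally show ?thesis using I by (simp add: sum.Sigma case_prod_unfold)
 qed
 then have "cev_field et z = (SUM q:{q:?P. snd q + e (fst q) = d}. ?w q)" using I by (intro homogeneous_component) auto
 also have "... = (SUM j:{j:I. e j < d}. coeff (p j) (d - e j) *s cev_field (th j) z)"
  by (rule sum.reindex_bij_witness_not_neutral[where i="%j. (j, d - e j)" and j=fst
    and S'="{q:?P. snd q = 0}" and T'="{j:I. degree (p j) < d - e j}"])
   (use I p(2) in \<open>auto simp: not_less coeff_eq_0 intro: gr0I\<close>)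
 finally show ?thesis by (rule that)
qed

lemma restrict_field:
 fixes th :: "(real^'n) \<times> real => (real^'n) \<times> real"
 assumes th: "th : tangent_fields (emb ` W) (emb ` J)"
 shows "(%v. fst (th (emb v))) : tangent_fields W J"
proof (rule tangent_fieldsI)
 show "rpoly (%x. u <.> fst (th (emb x)))" for u
  using rpoly_compose_linear[OF tangent_fieldsD(4)[OF th, of "emb u"] linear_conv_bounded_linear[THEN iffD1, OF linear_emb]] by simp
 show "fst (th (emb x)) : W" for x using tangent_fieldsD(2)[OF th, of "emb x"] by auto
 show "K <.> fst (th (emb x)) = 0" if "K : J" "K <.> x = 0" for K x
  using tangent_fieldsD(3)[OF th, of "emb K" "emb x"] that by simp
qed

lemma extend_field:
 fixes et :: "real^'n => real^'n"
 assumes et: "et : tangent_fields W J"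
 shows "(%x. emb (et (fst x))) : tangent_fields (emb ` W) (emb ` J)"
proof (rule tangent_fieldsI)
 show "rpoly (%x::(real^'n) \<times> real. u <.> emb (et (fst x)))" for u
  using rpoly_compose_linear[OF tangent_fieldsD(4)[OF et, of "fst u"] bounded_linear_fst] by simp
 show "emb (et (fst x)) : emb ` W" for x using tangent_fieldsD(2)[OF et] by blast
 show "K <.> emb (et (fst x)) = 0" if "K : emb ` J" "K <.> x = 0" for K x
  using that tangent_fieldsD(3)[OF et] by auto
qed

lemma free_basis_restrict:
 fixes W :: "(real^'n) set"
 assumes fb: "free_basis (emb ` W) (emb ` J) I e th"
 shows "homogeneous_generators W J I e (%i v. fst (th i (emb v)))"
 unfolding homogeneous_generators_def
proof (intro conjI ballI allI)
 note basis = free_basisD[OF fb]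
 show "finite I" by (rule basis(1))
 show "(%v. fst (th i (emb v))) : tangent_fields W J" if "i : I" for i by (rule restrict_field[OF basis(2)[OF that]])
 show "fst (th i (emb (t *R x))) = t ^ e i *R fst (th i (emb x))" if "i : I" for i t x
  using basis(3)[OF that, of t "emb x"] linear_scale[OF linear_emb, of t x] by simp
 fix et assume "et : tangent_fields W J"
 from basis(4)[OF extend_field[OF this]] obtain f
  where f: "ALL i:I. rpoly (f i)" "!!x. emb (et (fst x)) = (SUM i:I. f i x *R th i x)" by blast
 have "et v = (SUM i:I. f i (emb v) *R fst (th i (emb v)))" for v
  using arg_cong[OF f(2)[of "emb v"], of fst] by (simp add: fst_sum)
 moreover have "ALL i:I. rpoly (%v. f i (emb v))"
  using rpoly_compose_linear[OF _ linear_conv_bounded_linear[THEN iffD1, OF linear_emb]] f(1) by blast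
 ultimately show "EX g. (ALL i:I. rpoly (g i)) & (ALL v. et v = (SUM i:I. g i v *R fst (th i (emb v))))"
  by (intro exI[of _ "%i v. f i (emb v)"]) simp
qed

lemma field_divide_linear:
 fixes \<delta> :: "'a::euclidean_space => 'a"
 assumes Z: "subspace Z" and \<delta>: "!!u. rpoly (%v. u <.> \<delta> v)" "!!v. \<delta> v : Z" "!!v. a <.> v = 0 ==> \<delta> v = 0"
 obtains et where "!!u. rpoly (%v. u <.> et v)" "!!v. et v : Z" "!!v. \<delta> v = (a <.> v) *R et v"
proof -
 have "EX g. rpoly g & (ALL v. u <.> \<delta> v = (a <.> v) * g v)" for u
  using rpoly_divide_linear[OF \<delta>(1)[of u] subspace_UNIV, of a] \<delta>(3) by simp
 then obtain g where g: "!!u. rpoly (g u)" "!!u v. u <.> \<delta> v = (a <.> v) * g u v" by metis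
 obtain B where B: "orthonormal B" "span B = Z" using orthonormal_basis_exists[OF Z] by metis
 show ?thesis
 proof (rule that[of "%v. SUM b:B. g b v *R b"])
  show "rpoly (%v. u <.> (SUM b:B. g b v *R b))" for u
   unfolding inner_sum_right inner_scaleR_right by (intro rpoly_intros g)
  show "(SUM b:B. g b v *R b) : Z" for v unfolding B(2)[symmetric] by (intro span_sum span_scale span_base)
  show "\<delta> v = (a <.> v) *R (SUM b:B. g b v *R b)" for v
   using orthonormal_expand[OF B(1), of "\<delta> v"] \<delta>(2)[of v] B(2) by (simp add: g(2) scaleR_sum_right)
 qed
qed

lemma quotient_field_tangent:
 fixes et :: "'a::euclidean_space => 'a"
 assumes et: "!!u. rpoly (%v. u <.> et v)" and a: "a ~: span {K}" and zero: "!!v. K <.> v = 0 ==> K <.> ((a <.> v) *R et v) = 0"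
  and x: "K <.> x = 0"
 shows "K <.> et x = 0"
proof -
 obtain w where "K <.> w = 0" "a <.> w ~= 0" using separating_vector[OF a] by auto
 then show ?thesis
  by (intro rpoly_mult_eq_0[OF rpoly_inner[of a] et[of K] subspace_hyperplane[of K]]) (use zero x in auto)
qed

definition act :: "(real^'n) list => (real^'n => real^'n) => real^'n => real^'n" where
 "act l et v = cox_elt l (et (cox_elt (rev l) v))"

lemma act_append: "act (l @ m) et = act l (act m et)"
 by (simp add: act_def fun_eq_iff cox_elt_append)

context root_sys
begin

abbreviation "D \<equiv> tangent_fields (span Ph) Ph"

definition generators :: "'i set => ('i => nat) => ('i => real^'n => real^'n) => bool" where
 "generators I e th \<longleftrightarrow> homogeneous_generators (span Ph) Ph I e th & card I = dim Ph"

lemma generatorsD: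
 assumes "generators I e th"
 shows "finite I" "card I = dim Ph" "i : I ==> th i : D" "i : I ==> th i (t *R x) = t ^ e i *R th i x"
  "et : D ==> EX f. (ALL i:I. rpoly (f i)) & (ALL x. et x = (SUM i:I. f i x *R th i x))"
 using assms unfolding generators_def homogeneous_generators_def by simp_all

lemma generators_exist: "EX (I::nat set) e th. generators I e th & (ALL t>=1. card {i:I. e i >= t} = card (level t))"
proof -
 have id: "order_ideal_in pos pos" unfolding order_ideal_in_def by blast
 have "ideal_exponents pos" using ideal_arrangements_free[OF root_sys_axioms] id by blast
 then obtain I :: "nat set" and e th where b: "free_basis (emb ` span Ph) (emb ` pos) I e th" "card I = dim Ph"
  and levels: "ALL t>=1. card {i:I. e i >= t} = card (pos Int level t)" unfolding ideal_exponents_def by blast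
 have "K <.> et x = 0" if K: "K : Ph" "K <.> x = 0" and et: "et : tangent_fields (span Ph) pos" for K et x
  using tangent_fieldsD(3)[OF et, of K x] tangent_fieldsD(3)[OF et, of "- K" x] pos_or_neg[OF K(1)] K(2) by auto
 then have "tangent_fields (span Ph) pos \<subseteq> D" by (auto intro!: tangent_fieldsI dest: tangent_fieldsD(2,4))
 moreover have "D \<subseteq> tangent_fields (span Ph) pos" by (rule tangent_fields_antimono) (use pos_root in blast)
 ultimately have D: "tangent_fields (span Ph) pos = D" by blast
 have "generators I e (%i v. fst (th i (emb v)))"
  using free_basis_restrict[OF b(1)] b(2) by (simp add: generators_def homogeneous_generators_def D)
 moreover have "pos Int level t = level t" for t by (auto simp: level_def)
 ultimately show ?thesis using levels by (intro exI[of _ I] exI[of _ e] exI) auto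
qed

lemma act_field:
 assumes l: "set l \<subseteq> Ph" and et: "et : D"
 shows "act l et : D"
proof (rule tangent_fieldsI)
 have bl: "bounded_linear (cox_elt l)" for l :: "(real^'n) list" using linear_cox_elt by (simp add: linear_conv_bounded_linear)
 show "rpoly (%x. u <.> act l et x)" for u
  using rpoly_compose_linear[OF tangent_fieldsD(4)[OF et, of "cox_elt (rev l) u"] bl[of "rev l"]] cox_elt_adjoint[of "rev l" u]
  by (simp add: act_def)
 show "act l et x : span Ph" for x
 proof -
  let ?y = "et (cox_elt (rev l) x)"
  have "cox_elt l ?y - ?y : span Ph" using cox_elt_diff_span[of l ?y] span_mono[OF l] by blast
  then have "(cox_elt l ?y - ?y) + ?y : span Ph" using tangent_fieldsD(2)[OF et] by (intro span_add) auto
  then show ?thesis by (simp add: act_def)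
 qed
 fix K x assume K: "K : Ph" "K <.> x = 0"
 have "cox_elt (rev l) K : Ph" using cox_elt_root[of "rev l" K] l K by simp
 moreover have "cox_elt (rev l) K <.> cox_elt (rev l) x = 0" using cox_elt_adjoint[of "rev l" K "cox_elt (rev l) x"] cox_elt_rev'[of l x] K by simp
 ultimately have "cox_elt (rev l) K <.> et (cox_elt (rev l) x) = 0" using tangent_fieldsD(3)[OF et] by blast
 then show "K <.> act l et x = 0" using cox_elt_adjoint[of "rev l" K] by (simp add: act_def)
qed

lemma reflection_quotient_tangent:
 assumes a: "al : Ph" and et: "et : D" and et': "!!u. rpoly (%v. u <.> et' v)"
  and eq: "!!v. et v - act [al] et v = (al <.> v) *R et' v" and x: "al <.> x = 0"
 shows "al <.> et' x = 0"
proof -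
 let ?s = "refl_root al"
 have al: "al ~= 0" "al <.> al > 0" using a root_nz by auto
 obtain q where q: "rpoly q" "!!v. al <.> et v = (al <.> v) * q v"
  using rpoly_divide_linear[OF tangent_fieldsD(4)[OF et, of al] subspace_UNIV, of al] tangent_fieldsD(3)[OF et a] by auto
 have bl: "bounded_linear ?s" using linear_refl_root by (simp add: linear_conv_bounded_linear)
 have refl_al: "al <.> ?s w = - (al <.> w)" for w using al by (simp add: refl_root_def inner_diff_right inner_commute[of w])
 have "(al <.> v) * (al <.> et' v) = (al <.> v) * (q v - q (?s v))" for v
 proof -
  have "(al <.> v) * (al <.> et' v) = al <.> (et v - act [al] et v)" by (simp add: eq)
  also have "... = al <.> et v + al <.> et (?s v)" by (simp add: act_def inner_diff_right refl_al)
  also have "... = (al <.> v) * (q v - q (?s v))" unfolding q(2) refl_al by (simp add: right_diff_distrib)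
  finally show ?thesis .
 qed
 then have "al <.> et' x = q x - q (?s x)"
  by (intro rpoly_cancel[OF rpoly_inner[of al] et'[of al] _ subspace_UNIV, where z=al])
   (use al in \<open>auto intro!: real_polynomial_function_diff q(1) rpoly_compose_linear[OF q(1) bl]\<close>)
 then show ?thesis using x by (simp add: refl_root_def inner_commute[of x])
qed

lemma reflection_difference:
 assumes a: "al : Ph" and et: "et : D"
 obtains et' where "et' : D" "!!v. et v - act [al] et v = (al <.> v) *R et' v"
proof -
 have A: "act [al] et : D" using act_field[of "[al]" et] a et by simp
 have fixed: "refl_root al v = v" if "al <.> v = 0" for v using that by (simp add: refl_root_def inner_commute[of v])
 obtain et' where et': "!!u. rpoly (%v. u <.> et' v)" "!!v. et' v : span Ph" "!!v. et v - act [al] et v = (al <.> v) *R et' v"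
 proof (rule field_divide_linear[of "span Ph" "%v. et v - act [al] et v" al])
  show "rpoly (%v. u <.> (et v - act [al] et v))" for u
   unfolding inner_diff_right by (intro real_polynomial_function_diff tangent_fieldsD(4)[OF et] tangent_fieldsD(4)[OF A])
  show "et v - act [al] et v : span Ph" for v using tangent_fieldsD(2)[OF et] tangent_fieldsD(2)[OF A] by (intro span_diff)
  show "et v - act [al] et v = 0" if "al <.> v = 0" for v
   using tangent_fieldsD(3)[OF et a that] fixed[OF that] fixed[of "et v"] by (simp add: act_def)
 qed auto
 have "et' : D"
 proof (rule tangent_fieldsI[OF et'(1,2)])
  fix K x assume K: "K : Ph" "K <.> x = 0"
  show "K <.> et' x = 0"
  proof (cases "al : span {K}")
   case True
   then obtain k where k: "al = k *R K" by (auto simp: span_singleton)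
   then have "al <.> x = 0" "k ~= 0" using K(2) root_nz(1)[OF a] by auto
   then show ?thesis using reflection_quotient_tangent[OF a et et'(1,3), of x] k by simp
  next
   case False
   then show ?thesis
   proof (rule quotient_field_tangent[OF et'(1) _ _ K(2)])
    show "K <.> ((al <.> v) *R et' v) = 0" if "K <.> v = 0" for v
     unfolding et'(3)[symmetric] inner_diff_right using tangent_fieldsD(3)[OF et K(1) that] tangent_fieldsD(3)[OF A K(1) that] by simp
   qed
  qed
 qed
 then show ?thesis using that et'(3) by blast
qed

lemma act_difference:
 assumes G: "generators I e th" and l: "set l \<subseteq> Ph" and et: "et : D"
 shows "vanishing_comb I th (%v. et v - act l et v)"
 using l
proof (induction l)
 case Nil
 show ?case using vanishing_comb_zero by (simp add: act_def)
next
 case (Cons a l)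
 then have a: "a : Ph" "set l \<subseteq> Ph" by auto
 obtain et' where et': "et' : D" "!!v. act l et v - act [a] (act l et) v = (a <.> v) *R et' v"
  using reflection_difference[OF a(1) act_field[OF a(2) et]] by blast
 obtain f where f: "!!i. i : I ==> rpoly (f i)" "!!x. et' x = (SUM i:I. f i x *R th i x)"
  using generatorsD(5)[OF G et'(1)] by blast
 have "(a <.> v) *R (SUM i:I. f i v *R th i v) = act l et v - act (a # l) et v" for v
  using act_append[of "[a]" l et] et'(2)[of v] f(2)[of v] by simp
 then have eq: "et v - act (a # l) et v = (et v - act l et v) + (a <.> v) *R (SUM i:I. f i v *R th i v)" for v by simp
 show ?case unfolding eq by (rule vanishing_comb_add[OF Cons.IH[OF a(2)] vanishing_comb_scale_inner[OF f(1)]])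
qed

lemma cox_elt_id_extend:
 assumes l: "set l \<subseteq> Ph" and N: "!!x. x : span Ph ==> (cox_elt l ^^ N) x = x"
 shows "(cox_elt l ^^ N) x = x"
proof -
 obtain y z where yz: "y : span Ph" "!!w. w : span Ph ==> orthogonal z w" "x = y + z"
  using orthogonal_subspace_decomp_exists[of Ph x] by metis
 have "cox_elt m z = z" if "set m \<subseteq> Ph" for m
  using that
 proof (induction m)
  case (Cons a m)
  then have "z <.> a = 0" using yz(2)[OF span_base[of a Ph]] by (simp add: orthogonal_def)
  then show ?case using Cons by (simp add: refl_root_def)
 qed simp
 then have "cox_elt l z = z" using l by blast
 then have "(cox_elt l ^^ N) z = z" by (induction N) auto
 then show ?thesis using N[OF yz(1)] yz(3) linear_add[OF linear_funpow[OF linear_cox_elt]] by metis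
qed

end

definition cnjv :: "complex^'n => complex^'n" where "cnjv w = (\<chi> i. cnj (w $ i))"

lemma cnjv_cvec: "cnjv (cvec x) = cvec x" by (simp add: cnjv_def cvec_def vec_eq_iff)

lemma cnjv_span:
 fixes x :: "complex^'n"
 shows "x : vec.span S ==> cnjv x : vec.span (cnjv ` S)"
proof (induction rule: vec.span_induct_alt)
 case base
 have "cnjv (0 :: complex^'n) = 0" by (simp add: cnjv_def vec_eq_iff)
 then show ?case by (simp add: vec.span_zero)
next
 case (step c x y)
 have "cnjv (c *s x + y) = cnj c *s cnjv x + cnjv y" by (simp add: cnjv_def vec_eq_iff)
 then show ?case using step by (auto intro: vec.span_add vec.span_scale vec.span_base)
qed

lemma cmap_cnjv:
 assumes "linear T"
 shows "cmap T (cnjv w) = cnjv (cmap T w)"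
 by (simp add: vec_eq_iff cmap_component[OF assms] cnjv_def)

lemma fiber_sum_eq:
 fixes f :: "nat => nat"
 assumes I: "finite I" and eq: "!!k. card {i:I. a i = k} = card {i:I. b i = k}"
 shows "(SUM i:I. f (a i)) = (SUM i:I. f (b i))"
proof -
 have "image_mset a (mset_set I) = image_mset b (mset_set I)"
  by (rule multiset_eqI) (simp add: count_image_mset_eq_card_vimage[OF I] eq)
 then have "sum_mset (image_mset f (image_mset a (mset_set I))) = sum_mset (image_mset f (image_mset b (mset_set I)))" by simp
 then show ?thesis by (simp add: sum_unfold_sum_mset image_mset.compositionality o_def)
qed

lemma cev_field_const: "cev_field (%v. w) z = cvec w"
 by (simp add: cev_field_def cev_const cvec_def)

lemma cev_field_scale:
 assumes "rpoly f" "polynomial_function th"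
 shows "cev_field (%v. f v *R th v) z = cev f z *s cev_field th z"
 using cev_field_sum_scale[of "{()}" "%_. f" "%_. th" z] assms by simp

lemma cev_field_add:
 assumes "polynomial_function th" "polynomial_function et"
 shows "cev_field (%v. th v + et v) z = cev_field th z + cev_field et z"
 by (simp add: cev_field_def vec_eq_iff cev_add[OF rpoly_component(1)[OF assms(1)] rpoly_component(1)[OF assms(2)]])

lemma cmap_funpow_eigen:
 assumes "linear T" "cmap T z = mu *s z"
 shows "cmap (T ^^ k) z = mu ^ k *s z"
proof (induction k)
 case 0
 show ?case by (simp add: cmap_id)
next
 case (Suc k)
 have "cmap (T ^^ Suc k) z = cmap T (cmap (T ^^ k) z)" unfolding cmap_compose by (simp add: o_def)
 also have "... = cmap T (mu ^ k *s z)" by (simp only: Suc)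
 also have "... = mu ^ k *s cmap T z" using cmap_sum_scale[OF assms(1), of "%_. mu ^ k" "%_. z" "{()}"] by simp
 finally show ?case by (simp add: assms(2) vector_smult_assoc mult.commute o_def)
qed

lemma cdot_orthonormal_sum:
 assumes B: "orthonormal B" and a: "a : B"
 shows "cdot a (SUM b:B. c b *s cvec b) = c a"
proof -
 have "cdot a (SUM b:B. c b *s cvec b) = (SUM b:B. c b * complex_of_real (a <.> b))" by (simp add: cdot_sum cdot_scale cdot_cvec)
 also have "... = (SUM b:B. if b = a then c a else 0)"
  by (intro sum.cong refl) (simp add: orthonormalD(2)[OF B a])
 finally show ?thesis using a orthonormalD(1)[OF B] by simp
qed

lemma orthonormal_cvec_independent:
 assumes B: "orthonormal B"
 shows "independent_family B cvec"
proof -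
 have inj: "inj_on cvec B" by (auto simp: inj_on_def cvec_def vec_eq_iff)
 have "c (cvec a) = 0" if "(SUM v:cvec ` B. c v *s v) = 0" "a : B" for c a
  using cdot_orthonormal_sum[OF B that(2), of "c o cvec"] that(1) cdot_scale[of a 0 0] by (simp add: sum.reindex[OF inj])
 then have "vec.independent (cvec ` B)"
  using orthonormalD(1)[OF B] by (intro vec.independent_if_scalars_zero) auto
 then show ?thesis using inj orthonormalD(1)[OF B] by (simp add: independent_family_def)
qed

lemma cdot_zero_on_span:
 assumes B: "orthonormal B" and x: "x : vec.span (cvec ` B)" and zero: "!!b. b : B ==> cdot b x = 0"
 shows "x = 0"
proof -
 obtain d where d: "x = (SUM b:B. d b *s cvec b)" using independent_family_span[OF orthonormal_cvec_independent[OF B] x] .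
 have "d a = 0" if "a : B" for a using cdot_orthonormal_sum[OF B that] zero[OF that] d by simp
 then show ?thesis by (simp add: d)
qed

context root_sys
begin

lemma regular_values_span:
 assumes G: "generators I e th" and z: "!!be. be : Ph ==> cdot be z ~= 0" and w: "w : span Ph"
 shows "cvec w : vec.span ((%i. cev_field (th i) z) ` I)"
proof -
 let ?Q = "%v::real^'n. PROD be:Ph. be <.> v"
 have "(%v. ?Q v *R w) : D"
 proof (rule tangent_fieldsI)
  show "rpoly (%v. u <.> (?Q v *R w))" for u
   unfolding inner_scaleR_right by (intro rpoly_mult rpoly_const rpoly_prod_inner)
  show "?Q x *R w : span Ph" for x using w by (rule span_scale)
  show "K <.> (?Q x *R w) = 0" if "K : Ph" "K <.> x = 0" for K x
   using that fin by (auto simp: prod_zero_iff)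
 qed
 from generatorsD(5)[OF G this] obtain f where f: "ALL i:I. rpoly (f i)" "ALL x. ?Q x *R w = (SUM i:I. f i x *R th i x)" by blast
 have poly_const: "polynomial_function (%v. w)" by (simp add: polynomial_function_inner_iff rpoly_const)
 have "cev ?Q z *s cvec w = cev_field (%v. ?Q v *R w) z"
  using cev_field_scale[OF rpoly_prod_inner poly_const, of Ph z] by (simp add: cev_field_const)
 also have "... = cev_field (%v. SUM i:I. f i v *R th i v) z" using f(2) by simp
 also have "... = (SUM i:I. cev (f i) z *s cev_field (th i) z)"
  by (rule cev_field_sum_scale) (use f(1) tangent_fieldsD(1)[OF generatorsD(3)[OF G]] in auto)
 finally have "cev ?Q z *s cvec w = (SUM i:I. cev (f i) z *s cev_field (th i) z)" .
 then have "cev ?Q z *s cvec w : vec.span ((%i. cev_field (th i) z) ` I)" by (simp add: span_family_sum[OF subset_refl])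
 moreover have "cev ?Q z = (PROD be:Ph. cdot be z)"
  by (subst cev_prod) (auto simp: cev_inner intro: rpoly_inner)
 then have "cev ?Q z ~= 0" using z fin by simp
 ultimately show ?thesis using vec.span_scale[of "cev ?Q z *s cvec w" _ "1 / cev ?Q z"] by (simp add: vector_smult_assoc)
qed

end

text \<open>Averaging the generators over the cyclic group of \<open>cox_elt ds\<close> makes them equivariant; their values at a regular
 eigenvector are then eigenvectors whose eigenvalues are powers of \<open>mu\<close>.\<close>

locale regular_element = root_sys Ph c for Ph :: "(real^'n) set" and c +
 fixes ds :: "(real^'n) list" and I :: "'i set" and e th and N :: nat and mu :: complex and z :: "complex^'n"
 assumes generators: "generators I e th" and ds_roots: "set ds \<subseteq> Ph"
  and N: "N > 0" "(cox_elt ds ^^ N) x = x"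
  and eigen: "cmap (cox_elt ds) z = mu *s z" and regular: "be : Ph ==> cdot be z ~= 0"
begin

lemmas finite_I = generatorsD(1)[OF generators] and card_I = generatorsD(2)[OF generators]
 and th_field = generatorsD(3)[OF generators] and th_homogeneous = generatorsD(4)[OF generators]

definition iterate :: "nat => (real^'n) list" where "iterate k = concat (replicate k ds)"

lemma iterate_simps: "iterate 0 = []" "iterate (Suc k) = ds @ iterate k" by (simp_all add: iterate_def)

lemma iterate_roots: "set (iterate k) \<subseteq> Ph" using ds_roots by (auto simp: iterate_def)

lemma cox_elt_iterate: "cox_elt (iterate k) x = (cox_elt ds ^^ k) x"
 by (induction k) (auto simp: iterate_simps cox_elt_append)

lemma act_iterate_N: "act (iterate N) et = et"
proof
 fix v
 have "cox_elt (rev (iterate N)) v = v" using cox_elt_rev[of "iterate N" v] by (simp add: cox_elt_iterate N(2))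
 then show "act (iterate N) et v = et v" by (simp add: act_def cox_elt_iterate N(2))
qed

definition symmetrized :: "'i => real^'n => real^'n" where
 "symmetrized i v = (SUM k<N. act (iterate k) (th i) v)"

lemma act_iterate_field: "i : I ==> act (iterate k) (th i) : D"
 by (rule act_field[OF iterate_roots th_field])

lemma symmetrized_field:
 assumes "i : I"
 shows "symmetrized i : D"
proof (rule tangent_fieldsI)
 note field = act_iterate_field[OF assms]
 show "rpoly (%x. u <.> symmetrized i x)" for u
  unfolding symmetrized_def inner_sum_right by (intro rpoly_sum tangent_fieldsD(4)[OF field])
 show "symmetrized i x : span Ph" for x unfolding symmetrized_def by (intro span_sum tangent_fieldsD(2)[OF field])
 show "K <.> symmetrized i x = 0" if "K : Ph" "K <.> x = 0" for K x
  unfolding symmetrized_def inner_sum_right using tangent_fieldsD(3)[OF field that] by simp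
qed

lemma symmetrized_homogeneous: "i : I ==> symmetrized i (t *R x) = t ^ e i *R symmetrized i x"
 unfolding symmetrized_def scaleR_sum_right
 by (intro sum.cong HOL.refl) (simp add: act_def linear_scale[OF linear_cox_elt] th_homogeneous)

lemma symmetrized_equivariant: "cox_elt ds (symmetrized i v) = symmetrized i (cox_elt ds v)"
proof -
 let ?a = "%k. act (iterate k) (th i) (cox_elt ds v)"
 have "cox_elt ds (act (iterate k) (th i) v) = ?a (Suc k)" for k
  by (simp add: iterate_simps act_append) (simp add: act_def[of ds] cox_elt_rev)
 then have "cox_elt ds (symmetrized i v) = (SUM k<N. ?a (Suc k))"
  unfolding symmetrized_def linear_sum[OF linear_cox_elt] by simp
 also have "... = (SUM k<N. ?a k) + ?a N - ?a 0"
  using sum.lessThan_Suc[of ?a N] sum.lessThan_Suc_shift[of ?a N] by (simp add: algebra_simps)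
 also have "?a N = ?a 0" by (simp add: act_iterate_N) (simp add: act_def iterate_simps)
 finally show ?thesis by (simp add: symmetrized_def)
qed

lemma symmetrized_difference:
 assumes "i : I"
 shows "vanishing_comb I th (%v. real N *R th i v - symmetrized i v)"
proof -
 have "real N *R th i v - symmetrized i v = (SUM k<N. th i v - act (iterate k) (th i) v)" for v
  by (simp add: symmetrized_def sum_subtractf sum_constant_scaleR del: sum_constant)
 then show ?thesis
  using vanishing_comb_sum[of "{..<N}", OF act_difference[OF generators iterate_roots th_field[OF assms]]] by simp
qed

definition eigenvector :: "'i => complex^'n" where "eigenvector i = cev_field (symmetrized i) z"

lemma cmap_eigenvector:
 assumes i: "i : I"
 shows "cmap (cox_elt ds) (eigenvector i) = mu ^ e i *s eigenvector i"
proof -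
 note poly = tangent_fieldsD(1)[OF symmetrized_field[OF i]]
 have "cmap (cox_elt ds) (eigenvector i) = cev_field (%v. cox_elt ds (symmetrized i v)) z"
  unfolding eigenvector_def by (rule cev_field_comp_left[OF linear_cox_elt poly, symmetric])
 also have "... = cev_field (symmetrized i) (mu *s z)"
  unfolding symmetrized_equivariant cev_field_comp_right[OF linear_cox_elt] eigen ..
 also have "... = mu ^ e i *s eigenvector i"
  unfolding eigenvector_def by (rule cev_field_homogeneous[OF poly symmetrized_homogeneous[OF i]])
 finally show ?thesis .
qed

lemma eigenvector_in_span:
 assumes i: "i : I" and B: "orthonormal B" "span B = span Ph"
 shows "eigenvector i : vec.span (cvec ` B)"
proof -
 have "symmetrized i = (%v. SUM b:B. (b <.> symmetrized i v) *R b)"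
  using orthonormal_expand[OF B(1)] tangent_fieldsD(2)[OF symmetrized_field[OF i]] B(2) by simp
 then have "eigenvector i = cev_field (%v. SUM b:B. (b <.> symmetrized i v) *R b) z" unfolding eigenvector_def by simp
 also have "... = (SUM b:B. cev (%v. b <.> symmetrized i v) z *s cev_field (%v. b) z)"
  by (rule cev_field_sum_scale)
   (simp_all add: tangent_fieldsD(4)[OF symmetrized_field[OF i]] polynomial_function_inner_iff rpoly_const)
 finally show ?thesis by (simp add: cev_field_const span_family_sum[OF subset_refl])
qed

lemma generator_value_in_span:
 assumes "i : I"
 shows "cev_field (th i) z : vec.span (eigenvector ` I)"
 using assms
proof (induction "e i" arbitrary: i rule: less_induct)
 case less
 note th = th_field[OF less.prems] and sym = symmetrized_field[OF less.prems]
 define et where "et v = real N *R th i v + (-1) *R symmetrized i v" for v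
 have poly: "polynomial_function (%v. real N *R th i v)" "polynomial_function (%v. (-1) *R symmetrized i v)"
  using tangent_fieldsD(4)[OF th] tangent_fieldsD(4)[OF sym] unfolding polynomial_function_inner_iff inner_scaleR_right
  by (auto intro!: rpoly_mult rpoly_const)
 have et_z: "cev_field et z = of_nat N *s cev_field (th i) z + (-1) *s eigenvector i"
  unfolding et_def eigenvector_def cev_field_add[OF poly] cev_field_scale[OF rpoly_const tangent_fieldsD(1)[OF th]]
   cev_field_scale[OF rpoly_const tangent_fieldsD(1)[OF sym]] cev_const by simp
 obtain c where c: "cev_field et z = (SUM j:{j:I. e j < e i}. c j *s cev_field (th j) z)"
 proof (rule homogeneous_combination[OF finite_I])
  show "polynomial_function et" unfolding et_def using poly by (rule polynomial_function_add)
  show "et (t *R x) = t ^ e i *R et x" for t x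
   by (simp add: et_def th_homogeneous[OF less.prems] symmetrized_homogeneous[OF less.prems] scaleR_diff_right)
  show "vanishing_comb I th et" using symmetrized_difference[OF less.prems] by (simp add: et_def[abs_def])
 qed (use tangent_fieldsD(1)[OF th_field] th_homogeneous in auto)
 have "cev_field et z : vec.span (eigenvector ` I)"
  unfolding c by (intro vec.span_sum vec.span_scale) (use less.hyps in auto)
 then have "cev_field et z + eigenvector i : vec.span (eigenvector ` I)"
  using less.prems by (intro vec.span_add) (auto intro: vec.span_base)
 moreover have "cev_field et z + eigenvector i = of_nat N *s cev_field (th i) z" unfolding et_z by (simp add: vec_eq_iff)
 ultimately have "(1 / of_nat N) *s (of_nat N *s cev_field (th i) z) : vec.span (eigenvector ` I)" by (metis vec.span_scale)
 then show ?case using N(1) by (simp add: vector_smult_assoc)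
qed

lemma cvec_in_eigenvector_span:
 assumes "w : span Ph"
 shows "cvec w : vec.span (eigenvector ` I)"
proof -
 have "vec.span ((%i. cev_field (th i) z) ` I) \<subseteq> vec.span (eigenvector ` I)"
  by (rule vec.span_minimal) (use generator_value_in_span in auto)
 then show ?thesis using regular_values_span[OF generators regular assms] by blast
qed

lemma spanning_independent:
 assumes "!!w. w : span Ph ==> cvec w : vec.span (u ` I)"
 shows "independent_family I u"
proof -
 obtain B where B: "orthonormal B" "span B = span Ph" "card B = dim (span Ph)" using orthonormal_basis_exists[OF subspace_span] .
 have cvec: "inj_on cvec B" "vec.independent (cvec ` B)"
  using orthonormal_cvec_independent[OF B(1)] by (auto simp: independent_family_def)
 show ?thesis
 proof (rule spanning_family_independent[OF finite_I _ cvec(2)])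
  show "card I <= card (cvec ` B)" using card_I B(3) by (simp add: card_image[OF cvec(1)])
  show "cvec ` B \<subseteq> vec.span (u ` I)" using assms B(2) span_base by blast
 qed
qed

lemma eigenvector_independent: "independent_family I eigenvector"
 by (rule spanning_independent[OF cvec_in_eigenvector_span])

lemma cvec_in_conj_span: "w : span Ph ==> cvec w : vec.span ((%i. cnjv (eigenvector i)) ` I)"
 using cnjv_span[OF cvec_in_eigenvector_span] by (simp add: cnjv_cvec image_image)

lemma span_conj_eigenvectors:
 assumes i: "i : I"
 shows "eigenvector i : vec.span ((%i. cnjv (eigenvector i)) ` I)" "cnjv (eigenvector i) : vec.span (eigenvector ` I)"
proof -
 obtain B where B: "orthonormal B" "span B = span Ph" "card B = dim (span Ph)" using orthonormal_basis_exists[OF subspace_span] .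
 have "vec.span (cvec ` B) \<subseteq> vec.span (eigenvector ` I)" "vec.span (cvec ` B) \<subseteq> vec.span ((%i. cnjv (eigenvector i)) ` I)"
  by (rule vec.span_minimal; use cvec_in_eigenvector_span cvec_in_conj_span B(2) span_base in blast)+
 moreover have "cnjv (eigenvector i) : vec.span (cvec ` B)"
  using cnjv_span[OF eigenvector_in_span[OF i B(1,2)]] by (simp add: image_image cnjv_cvec)
 ultimately show "eigenvector i : vec.span ((%i. cnjv (eigenvector i)) ` I)" "cnjv (eigenvector i) : vec.span (eigenvector ` I)"
  using eigenvector_in_span[OF i B(1,2)] by auto
qed

lemma card_conj_eigenvalues: "card {i:I. mu ^ e i = k} = card {i:I. cnj mu ^ e i = k}"
proof -
 have conj: "cmap (cox_elt ds) (cnjv (eigenvector i)) = cnj mu ^ e i *s cnjv (eigenvector i)" if i: "i : I" for i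
 proof -
  have "cmap (cox_elt ds) (cnjv (eigenvector i)) = cnjv (mu ^ e i *s eigenvector i)"
   unfolding cmap_cnjv[OF linear_cox_elt] cmap_eigenvector[OF i] ..
  then show ?thesis by (simp add: cnjv_def vec_eq_iff)
 qed
 note conj_independent = spanning_independent[OF cvec_in_conj_span]
 show ?thesis
 proof (rule antisym)
  show "card {i:I. mu ^ e i = k} <= card {i:I. cnj mu ^ e i = k}"
   by (rule independent_eigenvalue_count[OF cmap_sum_scale[OF linear_cox_elt] eigenvector_independent cmap_eigenvector
     conj_independent conj span_conj_eigenvectors(1)])
  show "card {i:I. cnj mu ^ e i = k} <= card {i:I. mu ^ e i = k}"
   by (rule independent_eigenvalue_count[OF cmap_sum_scale[OF linear_cox_elt] conj_independent conj
     eigenvector_independent cmap_eigenvector span_conj_eigenvectors(2)])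
 qed
qed

lemma eigenvalue_power:
 assumes "!!x. (cox_elt ds ^^ k) x = x" and be: "be : Ph"
 shows "mu ^ k = 1"
proof -
 have "cmap (cox_elt ds ^^ k) z = z" by (rule cmap_id) (rule assms(1))
 then have "mu ^ k *s z = z" using cmap_funpow_eigen[OF linear_cox_elt eigen] by simp
 then have "mu ^ k * cdot be z = cdot be z" by (metis cdot_scale)
 then show ?thesis using regular[OF be] by simp
qed

end

lemma order_of_root_of_unity:
 fixes mu :: complex
 assumes "N > 0" "mu ^ N = 1" "mu ~= 1"
 shows "EX n>=2. ALL k. mu ^ k = 1 \<longleftrightarrow> n dvd k"
proof -
 define n where "n = (LEAST n. n > 0 & mu ^ n = 1)"
 have n: "n > 0" "mu ^ n = 1" using LeastI[of "%n. n > 0 & mu ^ n = 1" N] assms unfolding n_def by auto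
 have least: "n <= k" if "k > 0" "mu ^ k = 1" for k unfolding n_def using that by (intro Least_le) auto
 have "n dvd k" if k: "mu ^ k = 1" for k
 proof -
  have "mu ^ k = mu ^ (n * (k div n) + k mod n)" by simp
  then have "mu ^ (k mod n) = 1" using n(2) k by (simp only: power_add power_mult) simp
  then show ?thesis using least[of "k mod n"] n(1) by (metis mod_less_divisor not_le dvd_eq_mod_eq_0 gr0I)
 qed
 moreover have "mu ^ k = 1" if "n dvd k" for k using that n(2) by (auto simp: power_mult elim!: dvdE)
 moreover have "n ~= 1" using n(2) assms(3) by auto
 ultimately show ?thesis using n(1) by (intro exI[of _ n]) auto
qed

lemma power_eq_iff_mod:
 fixes mu :: complex
 assumes mu: "!!k. mu ^ k = 1 \<longleftrightarrow> n dvd k" "mu ~= 0"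
 shows "mu ^ a = mu ^ b \<longleftrightarrow> a mod n = b mod n"
proof (induction a b rule: linorder_wlog)
 case (le a b)
 then have "mu ^ b = mu ^ a * mu ^ (b - a)" by (simp flip: power_add)
 then have "mu ^ a = mu ^ b \<longleftrightarrow> mu ^ (b - a) = 1" using mu(2) by auto
 then show ?case using mod_eq_dvd_iff_nat[OF le, of n] by (auto simp: mu(1))
qed auto

lemma conj_residues:
 fixes mu :: complex
 assumes mu: "!!k. mu ^ k = 1 \<longleftrightarrow> n dvd k" "norm mu = 1" and n: "n > 0"
  and conj: "!!k. card {i:I. mu ^ e i = k} = card {i:I. cnj mu ^ e i = k}" and e: "!!i. i : I ==> ~ n dvd e i"
 shows "card {i:I. e i mod n = k} = card {i:I. n - e i mod n = k}"
proof (cases "0 < k & k < n")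
 case True
 have mu0: "mu ~= 0" and unit: "cnj mu * mu = 1" using mu(2) complex_norm_square[of mu] by (auto simp: mult.commute)
 have "e i mod n = k \<longleftrightarrow> mu ^ e i = mu ^ k" for i using power_eq_iff_mod[OF mu(1) mu0, of "e i" k] True by simp
 moreover have "n - e i mod n = k \<longleftrightarrow> cnj mu ^ e i = mu ^ k" for i
 proof -
  have "cnj mu ^ e i = mu ^ k \<longleftrightarrow> cnj mu ^ e i * mu ^ e i = mu ^ k * mu ^ e i" using mu0 by simp
  also have "... \<longleftrightarrow> mu ^ (k + e i) = 1" using unit by (auto simp: power_add simp flip: power_mult_distrib)
  also have "... \<longleftrightarrow> n dvd k + e i mod n" unfolding mu(1) by (simp add: dvd_eq_mod_eq_0 mod_simps)
  also have "... \<longleftrightarrow> k + e i mod n = n"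
  proof
   assume "n dvd k + e i mod n"
   then obtain q where q: "k + e i mod n = n * q" by (auto elim: dvdE)
   have "n * q < n * 2" using q True mod_less_divisor[OF n, of "e i"] by linarith
   moreover have "q ~= 0" using q True by (cases q) auto
   ultimately show "k + e i mod n = n" using q by (simp add: less_2_cases_iff)
  qed simp
  finally show ?thesis using True mod_less_divisor[OF n, of "e i"] by auto
 qed
 ultimately show ?thesis using conj by simp
next
 case False
 have "0 < e i mod n" "e i mod n < n" if "i : I" for i using e[OF that] n by (auto simp: dvd_eq_mod_eq_0)
 then have "{i:I. e i mod n = k} = {}" "{i:I. n - e i mod n = k} = {}" using False by fastforce+
 then show ?thesis by (simp only:)
qed

lemma sum_eq_sum_card_ge:
 fixes e :: "'i => nat"
 assumes I: "finite I" and T: "!!i. i : I ==> e i <= T"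
 shows "(SUM i:I. e i) = (SUM t:{1..T}. card {i:I. e i >= t})"
proof -
 have "(SUM i:I. e i) = (SUM i:I. card {t:{1..T}. t <= e i})"
 proof (rule sum.cong[OF refl])
  fix i assume "i : I"
  then have "{t:{1..T}. t <= e i} = {1..e i}" using T by force
  then show "e i = card {t:{1..T}. t <= e i}" by simp
 qed
 also have "... = (SUM t:{1..T}. card {i:I. e i >= t})"
  using sum_multicount_gen[of I "{1..T}" "%i t. t <= e i" "%t. card {i:I. t <= e i}"] I by simp
 finally show ?thesis .
qed

context root_sys
begin

lemma card_root: "card Ph = 2 * card pos"
proof -
 have "Ph = pos Un uminus ` pos"
 proof
  show "Ph \<subseteq> pos Un uminus ` pos"
  proof
   fix x assume "x : Ph"
   then show "x : pos Un uminus ` pos" using pos_or_neg[of x] by (metis Un_iff add.inverse_inverse image_eqI)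
  qed
  show "pos Un uminus ` pos \<subseteq> Ph" using pos_root neg by blast
 qed
 moreover have "pos Int uminus ` pos = {}" using not_pos_neg by fastforce
 moreover have "card (uminus ` pos) = card pos" by (rule card_image) simp
 ultimately show ?thesis using card_Un_disjoint[OF finite_pos finite_imageI[OF finite_pos]] by (metis mult_2)
qed

lemma card_pos_levels:
 assumes T: "!!t. t > T ==> level t = {}"
 shows "card pos = (SUM t:{1..T}. card (level t))"
proof -
 have "pos = (UN t:{1..T}. level t)"
 proof (intro equalityI subsetI)
  fix p assume "p : pos"
  then obtain t where t: "t >= 1" "p : level t" using pos_cases_level by blast
  then have "t <= T" using T[of t] by (auto simp: not_less[symmetric])
  then show "p : (UN t:{1..T}. level t)" using t by auto
 qed (auto dest: levelD)
 moreover have "ALL s:{1..T}. ALL t:{1..T}. s ~= t --> level s Int level t = {}" using level_disjoint by blast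
 ultimately show ?thesis using card_UN_disjoint[of "{1..T}" level] finite_level by simp
qed

end

locale regular_coxeter = regular_element Ph c ds I e th N mu z
 for Ph :: "(real^'n) set" and c ds and I :: "'i set" and e th N mu z +
 fixes n :: nat
 assumes ds: "distinct ds" "set ds = base" and norm_mu: "norm mu = 1"
  and n: "n >= 2" "mu ^ k = 1 \<longleftrightarrow> n dvd k" and card_level: "t >= 1 ==> card (level t) = card {i:I. e i >= t}"
begin

lemma exponent_not_dvd:
 assumes i: "i : I"
 shows "~ n dvd e i"
proof
 assume "n dvd e i"
 then have "cmap (cox_elt ds) (eigenvector i) = eigenvector i" using cmap_eigenvector[OF i] n(2)[of "e i"] by simp
 then have "cox_elt ds (re_vec (eigenvector i)) = re_vec (eigenvector i)" "cox_elt ds (im_vec (eigenvector i)) = im_vec (eigenvector i)"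
  by (metis re_im_cmap)+
 then have "s <.> re_vec (eigenvector i) = 0" "s <.> im_vec (eigenvector i) = 0" if "s : base" for s
  using cox_elt_fixed[of ds _ s] base_independent ds that by simp_all
 then have "cdot s (eigenvector i) = 0" if "s : base" for s using that by (simp add: cdot_Complex complex_eq_iff)
 then have "span base \<subseteq> {x. cdot x (eigenvector i) = 0}"
  by (intro span_minimal) (auto simp: subspace_def cdot_Complex complex_eq_iff inner_add_left)
 moreover obtain B where B: "orthonormal B" "span B = span Ph" "card B = dim (span Ph)" using orthonormal_basis_exists[OF subspace_span] .
 ultimately have "eigenvector i = 0"
  by (intro cdot_zero_on_span[OF B(1) eigenvector_in_span[OF i B(1,2)]]) (use span_base_eq span_base in blast)
 then have "0 : eigenvector ` I" using i by (metis image_eqI)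
 then show False using eigenvector_independent vec.dependent_zero by (auto simp: independent_family_def)
qed

lemma cox_elt_n: "(cox_elt ds ^^ n) x = x"
proof (rule cox_elt_id_extend[OF ds_roots])
 fix x assume "x : span Ph"
 then obtain b where b: "cvec x = (SUM i:I. b i *s eigenvector i)"
  using independent_family_span[OF eigenvector_independent cvec_in_eigenvector_span] by blast
 have fixed: "cmap (cox_elt ds ^^ n) (eigenvector i) = eigenvector i" if "i : I" for i
  using cmap_funpow_eigen[OF linear_cox_elt cmap_eigenvector[OF that], of n] n(2)[of "e i * n"] by (simp add: power_mult)
 have "cmap (cox_elt ds ^^ n) (cvec x) = (SUM i:I. b i *s cmap (cox_elt ds ^^ n) (eigenvector i))"
  unfolding b by (rule cmap_sum_scale[OF linear_funpow[OF linear_cox_elt]])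
 also have "... = cvec x" unfolding b by (intro sum.cong HOL.refl) (simp add: fixed)
 finally have "re_vec (cmap (cox_elt ds ^^ n) (cvec x)) = re_vec (cvec x)" by simp
 moreover have "re_vec (cvec x) = x" by (simp add: re_vec_def cvec_def vec_eq_iff)
 ultimately show "(cox_elt ds ^^ n) x = x" by (simp add: re_im_cmap)
qed

lemma residues_symmetric: "card {i:I. e i mod n = k} = card {i:I. n - e i mod n = k}"
 by (rule conj_residues[OF n(2) norm_mu _ card_conj_eigenvalues exponent_not_dvd]) (use n(1) in simp)

lemma residues_sum: "2 * (SUM i:I. e i mod n) = n * dim Ph"
proof -
 have "(SUM i:I. e i mod n) + (SUM i:I. n - e i mod n) = (SUM i:I. n)"
  unfolding sum.distrib[symmetric] using n(1) by (intro sum.cong HOL.refl) (simp add: less_imp_le)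
 then show ?thesis using fiber_sum_eq[OF finite_I residues_symmetric, of "%x. x"] card_I by (simp add: mult.commute)
qed

lemma card_pos_exponents: "card pos = (SUM i:I. e i)"
proof -
 let ?T = "Max (insert 0 (e ` I))"
 have T: "e i <= ?T" if "i : I" for i using finite_I that by simp
 have "level t = {}" if t: "t > ?T" for t
 proof -
  have "{i:I. e i >= t} = {}" using T t by fastforce
  then have "card (level t) = 0" using card_level[of t] t by (metis One_nat_def Suc_leI card.empty gr_zeroI not_less_zero)
  then show ?thesis using finite_level by simp
 qed
 then have "card pos = (SUM t:{1..?T}. card (level t))" by (rule card_pos_levels)
 also have "... = (SUM t:{1..?T}. card {i:I. e i >= t})" by (intro sum.cong HOL.refl card_level) simp
 finally show ?thesis using sum_eq_sum_card_ge[OF finite_I T] by simp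
qed

text \<open>Every root lies in an orbit through one of the at most \<open>dim Ph\<close> inversions of \<open>cox_elt ds\<close>, which bounds the sum of the
 exponents by the sum of their residues.\<close>

lemma exponent_residue: "i : I ==> e i mod n = e i"
proof (rule ccontr)
 assume i: "i : I" "e i mod n ~= e i"
 then have "e i mod n < e i" using mod_less_eq_dividend[of "e i" n] by linarith
 then have "(SUM i:I. e i mod n) < (SUM i:I. e i)" using finite_I i(1) by (intro sum_strict_mono_ex1) auto
 moreover have "2 * card pos <= n * dim Ph"
  using card_root_le[OF ds _ cox_elt_n] n(1) card_root card_base by (simp add: mult.commute)
 ultimately show False using residues_sum card_pos_exponents by simp
qed

lemma card_pos_order: "2 * card pos = n * dim Ph"
 using residues_sum card_pos_exponents exponent_residue by simp

lemma exponent_less: "i : I ==> e i < n"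
 using exponent_residue[of i] n(1) mod_less_divisor[of n "e i"] by simp

lemma level_empty:
 assumes "t >= n"
 shows "level t = {}"
proof -
 have "{i:I. e i >= t} = {}" using exponent_less assms by fastforce
 then have "card (level t) = 0" using card_level[of t] assms n(1) by (simp only: card.empty)
 then show ?thesis using finite_level by simp
qed

lemma level_dual:
 assumes t: "t >= 1" "t <= n"
 shows "card (level t) + card (level (n + 1 - t)) = dim Ph"
proof -
 let ?f = "%k. if n + 1 - t <= k then 1 else 0 :: nat"
 have residue: "e i mod n = e i" "0 < e i" "e i < n" if "i : I" for i
  using exponent_residue[OF that] exponent_less[OF that] exponent_not_dvd[OF that] by (auto intro: gr0I)
 have "card (level (n + 1 - t)) = (SUM i:I. ?f (e i mod n))"
  using card_level[of "n + 1 - t"] t finite_I residue(1) by (simp add: sum.If_cases Int_def cong: conj_cong)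
 also have "... = (SUM i:I. ?f (n - e i mod n))" by (rule fiber_sum_eq[OF finite_I residues_symmetric])
 also have "... = (SUM i:I. if t <= e i then 0 else 1)"
  using residue t by (intro sum.cong HOL.refl) (auto simp: not_le)
 finally have "card (level (n + 1 - t)) = (SUM i:I. if t <= e i then 0 else 1)" .
 moreover have "card (level t) = (SUM i:I. if t <= e i then 1 else 0)"
  using card_level[OF t(1)] finite_I by (simp add: sum.If_cases Int_def)
 ultimately have "card (level t) + card (level (n + 1 - t)) = (SUM i:I. (if t <= e i then 1 else 0) + (if t <= e i then 0 else 1))"
  by (simp only: sum.distrib)
 also have "... = (SUM i:I. 1)" by (intro sum.cong HOL.refl) simp
 finally show ?thesis using card_I by simp
qed

end

context root_sys
begin

theorem height_duality:
 assumes irr: "irreducible_root_system Ph" and ds: "distinct ds" "set ds = base"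
 shows "EX n>=2. (ALL x. (cox_elt ds ^^ n) x = x) & (ALL k>0. (ALL x. (cox_elt ds ^^ k) x = x) --> n <= k) &
  2 * card pos = n * dim Ph & (ALL t>=n. level t = {}) &
  (ALL t>=1. t <= n --> card (level t) + card (level (n + 1 - t)) = dim Ph)"
proof -
 obtain be where be: "be : Ph" using irr unfolding irreducible_root_system_def by blast
 have roots: "set ds \<subseteq> Ph" using ds(2) base_pos pos_root by blast
 obtain mu z where mu: "mu ~= 1" "norm mu = 1" and z: "cmap (cox_elt ds) z = mu *s z" "!!be. be : Ph ==> cdot be z ~= 0"
  using regular_eigenvector[OF irr ds] by blast
 obtain N where N: "N > 0" "!!x. x : span Ph ==> (cox_elt ds ^^ N) x = x" using cox_elt_finite_order[OF roots] by blast
 obtain I :: "nat set" and e th where G: "generators I e th" "!!t. t >= 1 ==> card {i:I. e i >= t} = card (level t)"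
  using generators_exist by blast
 interpret regular_element Ph c ds I e th N mu z
  using G(1) roots N(1) cox_elt_id_extend[OF roots N(2)] z by unfold_locales
 obtain n where n: "n >= 2" "!!k. mu ^ k = 1 \<longleftrightarrow> n dvd k"
  using order_of_root_of_unity[OF N(1) eigenvalue_power[OF cox_elt_id_extend[OF roots N(2)] be] mu(1)] by blast
 interpret regular_coxeter Ph c ds I e th N mu z n using ds mu(2) n G(2) by unfold_locales simp_all
 have "n <= k" if "k > 0" "!!x. (cox_elt ds ^^ k) x = x" for k
  using eigenvalue_power[OF that(2) be] that(1) by (auto simp: n(2) intro: dvd_imp_le)
 then show ?thesis using n(1) cox_elt_n card_pos_order level_empty level_dual by (intro exI[of _ n]) blast
qed

lemma irreducible_constant:
 assumes irr: "irreducible_root_system Ph"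
  and eq: "!!al be. al : Ph ==> be : Ph ==> al <.> be ~= 0 ==> f al = f be" and ab: "al : Ph" "be : Ph"
 shows "f al = f be"
proof (rule ccontr)
 assume distinct_values: "f al ~= f be"
 let ?A = "{ga:Ph. f ga = f al}" and ?B = "{ga:Ph. f ga ~= f al}"
 have "?A ~= {} & ?B ~= {} & ?A Un ?B = Ph & ?A Int ?B = {} & (ALL a:?A. ALL b:?B. a <.> b = 0)"
 proof (intro conjI)
  show "?A ~= {}" "?B ~= {}" using ab distinct_values by auto
  show "?A Un ?B = Ph" "?A Int ?B = {}" by auto
  show "ALL a:?A. ALL b:?B. a <.> b = 0"
  proof (intro ballI)
   fix a b assume "a : ?A" "b : ?B"
   then show "a <.> b = 0" using eq[of a b] by (cases "a <.> b = 0") auto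
  qed
 qed
 then have "EX A B. A ~= {} & B ~= {} & A Un B = Ph & A Int B = {} & (ALL a:A. ALL b:B. a <.> b = 0)"
  by (intro exI)
 then show False using irr unfolding irreducible_root_system_def by (elim conjE notE)
qed

definition root_operator :: "real^'n => real^'n" where
 "root_operator x = (SUM be:Ph. proj_coeff x be *R be)"

lemma linear_root_operator: "linear root_operator"
 by (rule linearI)
  (simp_all add: root_operator_def proj_coeff_def inner_add_left add_divide_distrib scaleR_add_left sum.distrib scaleR_sum_right)

lemma root_operator_selfadjoint: "root_operator x <.> y = x <.> root_operator y"
 unfolding root_operator_def inner_sum_left inner_sum_right
 by (intro sum.cong HOL.refl) (simp add: proj_coeff_def inner_commute[of _ y])

lemma root_operator_refl_root:
 assumes ga: "ga : Ph"
 shows "root_operator (refl_root ga x) = refl_root ga (root_operator x)"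
proof -
 have bij: "bij_betw (refl_root ga) Ph Ph"
  by (rule bij_betw_byWitness[where f'="refl_root ga"]) (use refl[OF ga] in auto)
 have "root_operator (refl_root ga x) = (SUM be:Ph. proj_coeff (refl_root ga x) (refl_root ga be) *R refl_root ga be)"
  unfolding root_operator_def by (rule sum.reindex_bij_betw[OF bij, symmetric])
 also have "... = refl_root ga (root_operator x)"
  by (simp add: root_operator_def proj_coeff_def refl_root_isometry linear_sum[OF linear_refl_root] linear_scale[OF linear_refl_root])
 finally show ?thesis .
qed

lemma root_operator_root:
 assumes "ga : Ph"
 shows "root_operator ga = proj_coeff (root_operator ga) ga *R ga"
proof -
 have "refl_root ga (root_operator ga) = - root_operator ga"
  using root_operator_refl_root[OF assms, of ga] refl_root_self[of ga] root_nz[OF assms] linear_neg[OF linear_root_operator] by simp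
 then have "2 *R root_operator ga = 2 *R (proj_coeff (root_operator ga) ga *R ga)"
  by (simp add: refl_root_proj_coeff scaleR_2 algebra_simps)
 then show ?thesis by (simp only: scaleR_cancel_left) simp
qed

lemma root_operator_scalar:
 assumes irr: "irreducible_root_system Ph" and al: "al : Ph" and x: "x : span Ph"
 shows "root_operator x = proj_coeff (root_operator al) al *R x"
proof (rule linear_eq_on_span[OF linear_root_operator _ _ x])
 let ?h = "%ga. proj_coeff (root_operator ga) ga"
 show "linear (%x. ?h al *R x)" by (rule linear_compose_scale_right) (simp add: linear_ident)
 fix ga assume ga: "ga : Ph"
 have "?h ga = ?h al"
 proof (rule irreducible_constant[OF irr _ ga al])
  fix be ga assume bg: "be : Ph" "ga : Ph" "be <.> ga ~= 0"
  have "?h be * (be <.> ga) = ?h ga * (be <.> ga)"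
   using root_operator_selfadjoint[of be ga] root_operator_root[OF bg(1)] root_operator_root[OF bg(2)]
   by (metis inner_scaleR_left inner_scaleR_right)
  then show "?h be = ?h ga" using bg(3) by simp
 qed
 then show "root_operator ga = ?h al *R ga" using root_operator_root[OF ga] by simp
qed

lemma root_operator_trace:
 assumes B: "orthonormal B" "span B = span Ph"
 shows "(SUM b:B. root_operator b <.> b) = real (card Ph)"
proof -
 have "(SUM b:B. root_operator b <.> b) = (SUM be:Ph. SUM b:B. (b <.> be)\<^sup>2 / (be <.> be))"
  unfolding root_operator_def inner_sum_left
  by (subst sum.swap) (simp add: proj_coeff_def power2_eq_square inner_commute)
 also have "... = (SUM be:Ph. 1)"
 proof (rule sum.cong[OF HOL.refl])
  fix be assume be: "be : Ph"
  have "(SUM b:B. (b <.> be)\<^sup>2) = (SUM b:B. (b <.> be) *R b) <.> be" unfolding inner_sum_left by (simp add: power2_eq_square)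
  also have "... = be <.> be" using orthonormal_expand[OF B(1), of be] B(2) span_base[OF be] by simp
  finally show "(SUM b:B. (b <.> be)\<^sup>2 / (be <.> be)) = 1" using root_nz[OF be] by (simp flip: sum_divide_distrib)
 qed
 finally show ?thesis by simp
qed

lemma root_form_trace:
 assumes irr: "irreducible_root_system Ph" and al: "al : Ph"
 shows "(SUM be:Ph. proj_coeff al be * proj_coeff be al) * real (dim Ph) = real (card Ph)"
proof -
 obtain B where B: "orthonormal B" "span B = span Ph" "card B = dim (span Ph)" using orthonormal_basis_exists[OF subspace_span] .
 let ?h = "proj_coeff (root_operator al) al"
 have "(SUM b:B. root_operator b <.> b) = (SUM b:B. ?h)"
 proof (rule sum.cong[OF HOL.refl])
  fix b assume b: "b : B"
  then have "root_operator b = ?h *R b" using root_operator_scalar[OF irr al, of b] B(2) span_base by blast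
  then show "root_operator b <.> b = ?h" using orthonormalD(2)[OF B(1) b b] by simp
 qed
 moreover have "?h = (SUM be:Ph. proj_coeff al be * proj_coeff be al)"
  by (simp add: root_operator_def[of al] proj_coeff_def[of _ al] inner_sum_left sum_divide_distrib)
 ultimately show ?thesis using root_operator_trace[OF B(1,2)] B(3) by (simp add: mult.commute)
qed

end

context affine_sys
begin

lemma cox_eq:
 assumes irr: "irreducible_root_system Ph" and n: "2 * card pos = n * dim Ph" and a: "al : Ph"
 shows "cox al = real n"
proof -
 let ?g = "%be. proj_coeff al be * proj_coeff be al"
 have "(SUM be:Ph. ?g be) = 2 * (SUM be:pos. ?g be)"
 proof (rule sum_even_eq_twice[OF fin])
  show "- x : Ph" if "x : Ph" for x using neg that by blast
  show "pos \<subseteq> Ph" using pos_root by blast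
  show "x : pos \<longleftrightarrow> - x ~: pos" if "x : Ph" for x using pos_or_neg[OF that] not_pos_neg[of x] by blast
 qed simp
 also have "... = cox al" by (simp add: cox_def sum_distrib_left mult.assoc)
 finally have "cox al * real (dim Ph) = real (n * dim Ph)" using root_form_trace[OF irr a] card_root n by simp
 moreover have "dim Ph ~= 0" using a root_nz by (auto simp: dim_eq_0)
 ultimately show ?thesis by simp
qed

end

section \<open>Affine stages\<close>

definition delta :: "(real^'n) \<times> real" where "delta = (0, 1)"

lemma delta_inner: "delta <.> x = snd x" "x <.> delta = snd x"
 by (simp_all add: delta_def inner_prod_def)

definition component :: "'a::real_inner set => 'a => 'a set" where
 "component S a = {x. (a, x) : {(x, y). x : S & y : S & x <.> y ~= 0}\<^sup>*}"

lemma component_self: "a : component S a" by (simp add: component_def)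

lemma component_subset: "a : S ==> component S a \<subseteq> S"
 by (auto simp: component_def elim: rtranclE)

lemma component_extend: "x : component S a ==> a : S ==> y : S ==> x <.> y ~= 0 ==> y : component S a"
 using component_subset[of a S] unfolding component_def by (auto intro: rtrancl.rtrancl_into_rtrancl)

lemma component_least:
 assumes x: "x : component S a" and T: "a : T" "!!x y. x : T ==> x : component S a ==> y : component S a ==> x <.> y ~= 0 ==> y : T"
 shows "x : T"
 using x[unfolded component_def mem_Collect_eq]
proof (induction rule: rtrancl_induct)
 case (step y z)
 then have "y : component S a" "z : component S a" unfolding component_def by (auto intro: rtrancl_into_rtrancl)
 then show ?case using T(2)[OF step.IH] step.hyps(2) by auto
qed (rule T(1))

lemma component_irreducible: "irreducible_root_system (component S a)"
 unfolding irreducible_root_system_def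
proof (intro conjI notI)
 let ?X = "component S a"
 show "?X = {} ==> False" using component_self[of a S] by simp
 assume "EX A B. A ~= {} & B ~= {} & A Un B = ?X & A Int B = {} & (ALL a:A. ALL b:B. a <.> b = 0)"
 then obtain A B where AB: "A ~= {}" "B ~= {}" "A Un B = ?X" "A Int B = {}" and orth: "ALL a:A. ALL b:B. a <.> b = 0" by blast
 have "T = ?X" if T: "a : T" "T = A \<or> T = B" for T
 proof
  show "T \<subseteq> ?X" using T AB by blast
  have "y : T" if "x : T" "y : ?X" "x <.> y ~= 0" for x y using that T(2) AB(3) orth inner_commute[of x y] by auto
  then show "?X \<subseteq> T" using component_least[of _ S a T, OF _ T(1)] by blast
 qed
 moreover have "a : A \<or> a : B" using AB(3) component_self[of a S] by blast
 ultimately show False using AB by blast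
qed

lemma component_refl_root:
 assumes S: "a : S" "!!x y. x : S ==> y : S ==> refl_root x y : S" and xy: "x : component S a" "y : component S a"
 shows "refl_root x y : component S a"
proof (cases "x <.> y = 0")
 case True
 then show ?thesis using xy(2) by (simp add: refl_root_def inner_commute[of y])
next
 case False
 then have "x ~= 0" by auto
 then have "x <.> refl_root x y ~= 0" using False by (simp add: refl_root_def inner_diff_right inner_commute[of y])
 moreover have "refl_root x y : S" using component_subset[OF S(1)] xy S(2) by blast
 ultimately show ?thesis using component_extend[OF xy(1) S(1)] by blast
qed

lemma transversal_Int_saturated:
 assumes "transversal A C a" "B \<subseteq> A" "!!K L. K : B ==> L : A ==> K : span {a, L} ==> L : B"
 shows "transversal B (C Int B) a"
proof -
 have "EX c:C Int B. K : span {a, c}" if K: "K : B" for K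
 proof -
  obtain c where "c : C" "K : span {a, c}" "c : A" using assms(1,2) K unfolding transversal_def by blast
  then show ?thesis using assms(3)[OF K] by blast
 qed
 then show ?thesis using assms(1) unfolding transversal_def by blast
qed

lemma transversal_pencil_card:
 assumes C: "transversal A C a" and B: "B \<subseteq> A" "finite B" "B ~= {}"
  and sat: "!!K L. K : B ==> L : A ==> K : span {a, L} ==> L : B"
  and pencil: "!!K L. K : B ==> L : B ==> K : span {a, L}"
 shows "card (B - C) + 1 = card B"
proof -
 have CB: "transversal B (C Int B) a" by (rule transversal_Int_saturated[OF C B(1) sat])
 obtain c where c: "c : C Int B" using CB B(3) unfolding transversal_def by blast
 then have "C Int B = {c}" using CB pencil unfolding transversal_def by blast
 then have "B - C = B - {c}" by blast
 then show ?thesis using B(2) c card_Suc_Diff1[OF B(2), of c] by simp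
qed

lemma transversal_linear_image:
 assumes f: "linear f" "inj f"
 shows "transversal (f ` A) (f ` C) (f a) \<longleftrightarrow> transversal A C a"
proof -
 have "f K : span {f a, f L} \<longleftrightarrow> K : span {a, L}" for K L
  using linear_span_image[OF f(1), of "{a, L}"] inj_image_mem_iff[OF f(2)] by simp
 then show ?thesis unfolding transversal_def by (simp add: inj_image_subset_iff[OF f(2)] inj_eq[OF f(2)])
qed

lemma unit_on_orthogonal_extension:
 assumes unit: "unit_on U A C a" and U: "U \<subseteq> U'" and R: "A Int R = {}" "!!K u. K : R ==> u : U ==> K <.> u = 0"
 shows "unit_on U' (A Un R) (C Un R) a"
proof -
 obtain et where et: "et : tangent_fields U A" "ALL y. a <.> y = 0 --> a <.> et y = (PROD K:A - C. K <.> y)"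
  using unit unfolding unit_on_def by blast
 have "et : tangent_fields U' (A Un R)"
  by (rule tangent_fieldsI[OF tangent_fieldsD(4)[OF et(1)]]) (use tangent_fieldsD(2,3)[OF et(1)] U R(2) in blast)+
 moreover have "(A Un R) - (C Un R) = A - C" using R(1) by blast
 ultimately show ?thesis unfolding unit_on_def using et(2) by auto
qed

context root_sys
begin

lemma conic_span_neg_pos:
 assumes "p : pos" "q : pos"
 shows "p - (- q) : conic_span pos"
 using conic_add[OF conic_base[OF assms(1)] conic_base[OF assms(2)]] by simp

end

context affine_sys
begin

definition aarr :: "nat => (real^'n) set => ((real^'n) \<times> real) set" where
 "aarr M Th = insert delta (stage (real M) Th)"

definition lower_step :: "(real^'n) set => real^'n => nat => bool" where
 "lower_step Th al M \<longleftrightarrow> lower Th & al : Ph & al ~: Th & lower (insert al Th) & (al, real M) : apos"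

lemma lower_stepD:
 assumes "lower_step Th al M"
 shows "lower Th" "al : Ph" "al ~: Th" "lower (insert al Th)" "(al, real M) : apos"
 using assms by (auto simp: lower_step_def)

definition affine_units :: bool where
 "affine_units \<longleftrightarrow> (ALL M Th al C. lower_step Th al M --> transversal (aarr M Th) C (al, real M) -->
   unit_on (emb ` span Ph) (aarr M Th) C (al, real M))"

definition exponent_pattern :: "nat => nat => (real^'n) set => 'i set => ('i => nat) => bool" where
 "exponent_pattern h M Th I e \<longleftrightarrow>
   (Th \<subseteq> uminus ` pos --> (ALL t>=1. card {i:I. e i + t <= M * h} = card ((pos - uminus ` Th) Int level t)) & (ALL i:I. e i <= M * h)) &
   (uminus ` pos \<subseteq> Th --> (ALL t>=1. card {i:I. M * h + t <= e i} = card (Th Int level t)) & (ALL i:I. M * h <= e i))"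

lemma exponent_pattern_neg:
 assumes "exponent_pattern h M Th I e" "Th \<subseteq> uminus ` pos"
 shows "t >= 1 ==> card {i:I. e i + t <= M * h} = card ((pos - uminus ` Th) Int level t)" "i : I ==> e i <= M * h"
 using assms unfolding exponent_pattern_def by blast+

lemma exponent_pattern_pos:
 assumes "exponent_pattern h M Th I e" "uminus ` pos \<subseteq> Th"
 shows "t >= 1 ==> card {i:I. M * h + t <= e i} = card (Th Int level t)" "i : I ==> M * h <= e i"
 using assms unfolding exponent_pattern_def by blast+

definition affine_exponents :: "nat => nat => (real^'n) set => bool" where
 "affine_exponents h M Th \<longleftrightarrow> (EX (I::nat set) e th. free_basis (emb ` span Ph) (aarr M Th) I e th & card I = dim Ph &
   exponent_pattern h M Th I e)"

lemma apos_natE: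
 assumes "f : apos"
 obtains be k where "f = (be, real k)" "be : Ph" "k >= 1 \<or> (k = 0 & be : pos)"
proof -
 obtain be k where k: "f = (be, real_of_int k)" "be : Ph" "k >= 1 \<or> (k = 0 & be : pos)" using aposE[OF assms] by blast
 have "f = (be, real (nat k))" using k by auto
 moreover have "nat k >= 1 \<or> (nat k = 0 & be : pos)" using k(3) by auto
 ultimately show ?thesis using that k(2) by blast
qed

lemma apos_nat_iff: "(be, real k) : apos \<longleftrightarrow> be : Ph & (k >= 1 \<or> be : pos)"
 using apos_int_iff[of be "int k"] by auto

lemma finite_stage: "finite (stage (real M) Th)"
proof -
 have "stage (real M) Th \<subseteq> (%(be, k). (be, real k)) ` (Ph \<times> {..M})"
 proof
  fix f assume f: "f : stage (real M) Th"
  then obtain be k where "f = (be, real k)" "be : Ph" unfolding stage_def by (auto elim: apos_natE)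
  then show "f : (%(be, k). (be, real k)) ` (Ph \<times> {..M})" using f by (auto simp: stage_def intro!: image_eqI[of _ _ "(be, k)"])
 qed
 then show ?thesis using fin by (meson finite_SigmaI finite_atMost finite_imageI finite_subset)
qed

lemma stage_apos: "stage M Th \<subseteq> apos" by (auto simp: stage_def)

lemma delta_notin_span: "f : apos ==> delta ~: span {f}" "f : apos ==> f ~: span {delta}"
proof -
 assume f: "f : apos"
 show "f ~: span {delta}" using apos_nz(1)[OF f] by (auto simp: span_singleton delta_def)
 show "delta ~: span {f}"
 proof
  assume "delta : span {f}"
  then obtain k where "delta = k *R f" by (auto simp: span_singleton)
  then have "k *R fst f = 0" "k * snd f = 1" by (auto simp: delta_def prod_eq_iff)
  then show False using apos_nz(1)[OF f] by auto
 qed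
qed

lemma arr_aarr:
 assumes "(al, real M) : apos"
 shows "arr (insert (al, real M) (aarr M Th))"
proof -
 define S where "S = insert (al, real M) (stage (real M) Th)"
 have S: "S \<subseteq> apos" using assms stage_apos[of "real M" Th] by (auto simp: S_def)
 have "insert (al, real M) (aarr M Th) = insert delta S" by (auto simp: aarr_def S_def)
 moreover have "arr (insert delta S)"
  unfolding arr_def
 proof (intro conjI ballI impI)
  show "finite (insert delta S)" using finite_stage[of M Th] by (simp add: S_def)
  have "(delta::(real^'n) \<times> real) ~= 0" by (simp add: delta_def prod_eq_iff)
  moreover have "0 ~: apos" using apos_nz(2)[of 0] by auto
  ultimately show "0 ~: insert delta S" using S by auto
  fix K L assume K: "K : insert delta S" and L: "L : insert delta S" and KL: "K : span {L}"
  have "K = L" if "K : apos" "L : apos" using apos_proportional[OF that] KL by (auto simp: span_singleton)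
  then show "K = L" using K L KL S delta_notin_span[of K] delta_notin_span[of L] by blast
 qed
 ultimately show ?thesis by simp
qed

lemma not_aarr: "(al, real M) : apos ==> al ~: Th ==> (al, real M) ~: aarr M Th"
 using apos_nz(1)[of "(al, real M)"] by (auto simp: aarr_def stage_def delta_def)

lemma lower_cases:
 assumes "lower Th"
 shows "Th \<subseteq> uminus ` pos \<or> uminus ` pos \<subseteq> Th"
proof (cases "Th Int pos = {}")
 case True
 have "x : uminus ` pos" if "x : Th" for x
 proof -
  have "x : Ph" "x ~: pos" using that True assms by (auto simp: lower_def)
  then have "- x : pos" using pos_or_neg by blast
  then show ?thesis by (intro image_eqI[of _ _ "- x"]) auto
 qed
 then show ?thesis by blast
next
 case False
 then obtain p where p: "p : Th" "p : pos" by blast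
 have "- q : Th" if q: "q : pos" for q
  using assms p conic_span_neg_pos[OF p(2) q] neg[OF pos_root[OF q]] unfolding lower_def by blast
 then show ?thesis by blast
qed

lemma lower_insert_pos:
 assumes "lower (insert al Th)" "al : pos"
 shows "uminus ` pos \<subseteq> Th"
proof clarify
 fix q assume q: "q : pos"
 have "- q : insert al Th" using assms conic_span_neg_pos[OF assms(2) q] neg[OF pos_root[OF q]] unfolding lower_def by blast
 then show "- q : Th" using not_pos_neg[OF q] assms(2) by auto
qed

lemma lower_insert_neg:
 assumes "lower Th" "- al : pos" "al ~: Th"
 shows "insert al Th \<subseteq> uminus ` pos" "- al ~: Th"
proof -
 have al: "al : uminus ` pos" using assms(2) by (intro image_eqI[of _ _ "- al"]) auto
 then have "Th \<subseteq> uminus ` pos" using lower_cases[OF assms(1)] assms(3) by blast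
 then show "insert al Th \<subseteq> uminus ` pos" "- al ~: Th" using al assms(2) not_pos_neg by auto
qed

lemma lower_remove_max:
 assumes Th: "lower Th" and X: "X \<subseteq> Th" "X ~= {}" "!!x y. x : X ==> y : Th - X ==> ht y <= ht x"
 shows "EX al:X. lower (Th - {al})"
proof -
 have "finite X" using Th X(1) fin unfolding lower_def by (meson finite_subset)
 then have "EX al:X. ALL be:Th - {al}. ALL ga:Ph. be - ga : conic_span pos --> ga : Th - {al}"
  by (intro remove_highest) (use Th X in \<open>auto simp: lower_def\<close>)
 then show ?thesis using Th unfolding lower_def by blast
qed

lemma arr_lower_step:
 assumes "lower_step Th al M"
 shows "arr (insert (al, real M) (aarr M Th))" "(al, real M) ~: aarr M Th"
 by (rule arr_aarr[OF lower_stepD(5)[OF assms]], rule not_aarr[OF lower_stepD(5,3)[OF assms]])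

lemma stage_lower_step:
 assumes "lower_step Th al M"
 shows "order_ideal_in apos (stage (real M) Th)" "(al, real M) ~: stage (real M) Th"
  "order_ideal_in apos (insert (al, real M) (stage (real M) Th))"
 using stage_ideal[of Th "real M"] stage_ideal[of "insert al Th" "real M"] insert_stage[of al "real M" Th] lower_stepD[OF assms]
 by (auto simp: stage_def)

definition parallel :: "(real^'n) set => real^'n => nat => ((real^'n) \<times> real) set" where
 "parallel Th al M = {f:stage (real M) Th. fst f : span {al}}"

definition transverse :: "(real^'n) set => real^'n => nat => ((real^'n) \<times> real) set" where
 "transverse Th al M = {f:stage (real M) Th. fst f ~: span {al}}"

lemma aarr_parallel_cases:
 "aarr M Th = insert delta (parallel Th al M) Un transverse Th al M" "insert delta (parallel Th al M) Int transverse Th al M = {}"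
 by (auto simp: aarr_def parallel_def transverse_def delta_def span_zero)

lemma parallel_eq:
 assumes step: "lower_step Th al M"
 shows "parallel Th al M = (%k. (al, real k)) ` {k. k < M & (k >= 1 \<or> al : pos)} Un
  (%k. (- al, real k)) ` {k. (k < M \<or> k = M & - al : Th) & (k >= 1 \<or> - al : pos)}" (is "_ = ?L Un ?R")
proof
 note al = lower_stepD[OF step]
 show "parallel Th al M \<subseteq> ?L Un ?R"
 proof
  fix f assume f: "f : parallel Th al M"
  then have "f : apos" using stage_apos by (auto simp: parallel_def)
  then obtain be k where k: "f = (be, real k)" "be : Ph" "k >= 1 \<or> (k = 0 & be : pos)" by (rule apos_natE)
  obtain u where u: "be = u *R al" using f k(1) by (auto simp: parallel_def span_singleton)
  then have "u = 1 \<or> u = -1" using red[OF al(2)] k(2) by blast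
  then have "be = al \<or> be = - al" using u by auto
  moreover have "k < M \<or> (k = M & be : Th)" using f k(1) by (auto simp: parallel_def stage_def)
  ultimately show "f : ?L Un ?R" using k al(3) by auto
 qed
 have "al : span {al}" "- al : span {al}" by (simp_all add: span_base span_neg)
 then show "?L Un ?R \<subseteq> parallel Th al M" using al(2) neg[OF al(2)] by (auto simp: parallel_def stage_def apos_nat_iff)
qed

lemma card_parallel:
 assumes step: "lower_step Th al M"
 shows "real (card (parallel Th al M)) = 2 * real M - (if al : pos then 0 else 1)"
proof -
 note al = lower_stepD[OF step]
 let ?L = "{k. k < M & (k >= 1 \<or> al : pos)}" and ?R = "{k. (k < M \<or> k = M & - al : Th) & (k >= 1 \<or> - al : pos)}"
 have "al <.> al ~= - al <.> al" using root_nz(1)[OF al(2)] by simp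
 then have "al ~= - al" by metis
 then have disj: "(%k. (al, real k)) ` ?L Int (%k. (- al, real k)) ` ?R = {}" by blast
 have inj: "inj_on (%k. (be, real k)) X" for be :: "real^'n" and X by (auto simp: inj_on_def)
 have "finite ?L" "finite ?R" by (rule finite_subset[of _ "{..M}"]; auto)+
 then have card: "card (parallel Th al M) = card ?L + card ?R"
  unfolding parallel_eq[OF step] using disj by (simp only: card_Un_disjoint card_image[OF inj] finite_imageI)
 show ?thesis
 proof (cases "al : pos")
  case True
  then have "- al : Th" "- al ~: pos" using lower_insert_pos[OF al(4) True] not_pos_neg by blast+
  then have "?L = {..<M}" "?R = {1..M}" using True by auto
  then show ?thesis using card True by simp
 next
  case False
  then have neg_al: "- al : pos" using pos_or_neg[OF al(2)] by blast
  have "M >= 1" using al(5) False by (simp add: apos_nat_iff)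
  moreover have "?L = {1..<M}" "?R = {..<M}" using False neg_al lower_insert_neg(2)[OF al(1) neg_al al(3)] by auto
  ultimately show ?thesis using card False by simp
 qed
qed

lemma parallel_pencil:
 assumes step: "lower_step Th al M" and K: "K : insert delta (parallel Th al M)" and L: "L : insert delta (parallel Th al M)"
 shows "K : span {(al, real M), L}"
proof -
 have "EX k. fst F = k *R al" if "F : insert delta (parallel Th al M)" for F
  using that by (auto simp: parallel_def delta_def span_singleton intro: exI[of _ 0])
 then obtain k l where k: "fst K = k *R al" and l: "fst L = l *R al" using K L by metis
 have "snd L - l * real M ~= 0"
 proof
  assume "snd L - l * real M = 0"
  then have "L = l *R (al, real M)" using l by (simp add: prod_eq_iff)
  then have "L : span {(al, real M)}" using span_scale[OF span_base[of "(al, real M)" "{(al, real M)}"], of l] by simp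
  moreover have "L : aarr M Th" using L by (auto simp: aarr_def parallel_def)
  ultimately show False using arrD(3)[OF arr_lower_step(1)[OF step], of L "(al, real M)"] arr_lower_step(2)[OF step] by blast
 qed
 then obtain v where v: "snd K - k * real M = v * (snd L - l * real M)" by (metis nonzero_eq_divide_eq)
 have "K = (k - v * l) *R (al, real M) + v *R L" using k l v by (simp add: prod_eq_iff algebra_simps)
 then show ?thesis using span_pairI by metis
qed

lemma transverse_saturated:
 assumes K: "K : transverse Th al M" and L: "L : aarr M Th" "K : span {(al, real M), L}"
 shows "L : transverse Th al M"
proof -
 have "fst L ~: span {al}"
 proof
  assume "fst L : span {al}"
  then obtain l where l: "fst L = l *R al" by (auto simp: span_singleton)
  obtain u v where "K = u *R (al, real M) + v *R L" using span_pairE[OF L(2)] by blast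
  then have "fst K = (u + v * l) *R al" using l by (simp add: scaleR_add_left)
  then show False using K by (auto simp: transverse_def span_singleton)
 qed
 then show ?thesis using L(1) by (auto simp: aarr_def transverse_def delta_def span_zero)
qed

lemma parallel_saturated:
 assumes step: "lower_step Th al M" and K: "K : insert delta (parallel Th al M)" and L: "L : aarr M Th" "K : span {(al, real M), L}"
 shows "L : insert delta (parallel Th al M)"
proof (rule ccontr)
 have K_in_A: "K : aarr M Th" using K aarr_parallel_cases(1) by blast
 assume "L ~: insert delta (parallel Th al M)"
 then have "L : transverse Th al M" using L(1) aarr_parallel_cases(1)[of M Th al] by blast
 then have "K : transverse Th al M" using transverse_saturated[OF _ K_in_A] arr_class_sym[OF arr_lower_step[OF step] K_in_A L] by blast
 then show False using K aarr_parallel_cases(2) by blast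
qed

lemma affine_count:
 assumes irr: "irreducible_root_system Ph" and h: "2 * card pos = h * dim Ph"
  and step: "lower_step Th al M" and C: "transversal (aarr M Th) C (al, real M)"
 shows "real (card (aarr M Th - C)) = real (M * h) + ht al - (if al : pos then 1 else 0)"
proof -
 let ?P = "insert delta (parallel Th al M)" and ?N = "transverse Th al M"
 have fin_parts: "finite (parallel Th al M)" "finite ?N" using finite_stage[of M Th] by (auto simp: parallel_def transverse_def)
 have "delta ~: apos" using apos_nz(1)[of delta] by (auto simp: delta_def)
 then have "delta ~: parallel Th al M" using stage_apos by (auto simp: parallel_def)
 moreover have "card (?P - C) + 1 = card ?P"
  by (rule transversal_pencil_card[OF C _ _ _ parallel_saturated[OF step] parallel_pencil[OF step]])
   (use fin_parts aarr_parallel_cases in auto)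
 ultimately have card_P: "card (?P - C) = card (parallel Th al M)" using fin_parts(1) by simp
 have "transversal ?N (C Int ?N) (al, real M)"
  by (rule transversal_Int_saturated[OF C _ transverse_saturated]) (use aarr_parallel_cases in auto)
 then have "real (card (?N - C Int ?N)) = real M * (cox al - 2) + ht al - (if al : pos then 1 else -1)"
  using nonparallel_card[OF stage_lower_step(1)[OF step] finite_stage, of al "int M"] stage_lower_step[OF step] lower_stepD(5)[OF step]
  by (simp add: transverse_def)
 moreover have "?N - C Int ?N = ?N - C" by blast
 ultimately have card_N: "real (card (?N - C)) = real M * (real h - 2) + ht al - (if al : pos then 1 else -1)"
  using cox_eq[OF irr h lower_stepD(2)[OF step]] by simp
 have "aarr M Th - C = (?P - C) Un (?N - C)" using aarr_parallel_cases(1) by blast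
 then have "card (aarr M Th - C) = card (?P - C) + card (?N - C)"
  using card_Un_disjoint[of "?P - C" "?N - C"] fin_parts aarr_parallel_cases(2)[of Th al M] by auto
 then show ?thesis using card_P card_N card_parallel[OF step] by (cases "al : pos") (simp_all add: algebra_simps)
qed

lemma inj_lift_all: "inj (lift v)" by (auto simp: inj_def lift_def)

lemma unit_on_lift:
 assumes unit: "unit_on (emb ` W) (emb ` J) (emb ` G) (emb al)"
 shows "unit_on (emb ` W) (lift v ` J) (lift v ` G) (lift v al)"
proof -
 obtain et where et: "et : tangent_fields (emb ` W) (emb ` J)"
  "!!y. emb al <.> y = 0 ==> emb al <.> et y = (PROD K:emb ` J - emb ` G. K <.> y)" using unit unfolding unit_on_def by blast
 define shift where "shift y = emb (fst y - snd y *R v)" for y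
 have "linear shift" by (rule linearI) (simp_all add: shift_def emb_def algebra_simps)
 then have bl: "bounded_linear shift" by (simp add: linear_conv_bounded_linear)
 have lift_shift: "lift v ga <.> y = emb ga <.> shift y" for ga y
  by (simp add: lift_def shift_def inner_prod_def inner_diff_right mult.commute)
 have lift_et: "lift v ga <.> et y = emb ga <.> et y" for ga y
 proof -
  obtain w where "et y = emb w" using tangent_fieldsD(2)[OF et(1), of y] by blast
  then show ?thesis by (simp add: lift_def)
 qed
 have "(%y. et (shift y)) : tangent_fields (emb ` W) (lift v ` J)"
 proof (rule tangent_fieldsI)
  show "rpoly (%y. u <.> et (shift y))" for u by (rule rpoly_compose_linear[OF tangent_fieldsD(4)[OF et(1)] bl])
  show "et (shift y) : emb ` W" for y by (rule tangent_fieldsD(2)[OF et(1)])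
  fix K y assume "K : lift v ` J" and K0: "K <.> y = 0"
  then obtain ga where ga: "K = lift v ga" "ga : J" by blast
  have "emb ga <.> shift y = 0" using K0 unfolding ga lift_shift .
  then show "K <.> et (shift y) = 0" unfolding ga lift_et using ga(2) by (intro tangent_fieldsD(3)[OF et(1)]) auto
 qed
 moreover have "lift v al <.> et (shift y) = (PROD K:lift v ` J - lift v ` G. K <.> y)" if y: "lift v al <.> y = 0" for y
 proof -
  have inj: "inj_on (lift v) X" for X using inj_lift_all by (rule inj_on_subset) simp
  have "lift v al <.> et (shift y) = (PROD K:emb ` (J - G). K <.> shift y)"
   unfolding lift_et image_set_diff[OF inj_emb[of UNIV]] using y unfolding lift_shift by (rule et(2))
  also have "... = (PROD ga:J - G. lift v ga <.> y)" by (simp only: prod.reindex[OF inj_emb] o_def lift_shift)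
  also have "... = (PROD K:lift v ` J - lift v ` G. K <.> y)"
   unfolding image_set_diff[OF inj_lift_all, symmetric] by (simp only: prod.reindex[OF inj] o_def)
  finally show ?thesis .
 qed
 ultimately show ?thesis unfolding unit_on_def by (intro bexI[of _ "%y. et (shift y)"]) auto
qed

lemma lift_vanish:
 assumes "snd x ~= 0"
 shows "f <.> x = 0 \<longleftrightarrow> f = lift (fst x /\<^sub>R snd x) (fst f)"
proof -
 let ?v = "fst x /\<^sub>R snd x"
 have "f <.> x = snd x * (fst f <.> ?v + snd f)" using assms by (simp add: inner_prod_def algebra_simps)
 then have "f <.> x = 0 \<longleftrightarrow> snd f = - (fst f <.> ?v)" using assms by auto
 then show ?thesis by (simp add: lift_def prod_eq_iff)
qed

lemma local_ideal_step:
 assumes step: "lower_step Th al M" and al: "lift v al = (al, real M)"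
 shows "root_sys.ideal_step (local_roots UNIV v) (c - v) {ga. lift v ga : stage (real M) Th} al"
proof -
 interpret Q: root_sys "local_roots UNIV v" "c - v" by (rule local_root_sys[OF subspace_UNIV])
 have "lift v ga = lift v al \<longleftrightarrow> ga = al" for ga by (auto simp: lift_def)
 then have "{ga. lift v ga : insert (al, real M) (stage (real M) Th)} = insert al {ga. lift v ga : stage (real M) Th}"
  using al by auto
 then show ?thesis
  unfolding Q.ideal_step_def
  using local_ideal[OF subspace_UNIV stage_lower_step(1)[OF step], of v] local_ideal[OF subspace_UNIV stage_lower_step(3)[OF step], of v]
   local_pos_iff[OF subspace_UNIV, of al v] al lower_stepD(5)[OF step] stage_lower_step(2)[OF step] by simp
qed

lemma affine_local_finite:
 assumes step: "lower_step Th al M" and C: "transversal (aarr M Th) C (al, real M)"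
  and x: "(al, real M) <.> x = 0" "snd x ~= 0"
 shows "unit_on (emb ` span Ph) {K:aarr M Th. K <.> x = 0} {K:C. K <.> x = 0} (al, real M)"
proof -
 define v where "v = fst x /\<^sub>R snd x"
 have vanish: "f <.> x = 0 \<longleftrightarrow> f = lift v (fst f)" for f using lift_vanish[OF x(2)] by (simp add: v_def)
 have al: "lift v al = (al, real M)" using vanish[of "(al, real M)"] x(1) by simp
 interpret Q: root_sys "local_roots UNIV v" "c - v" by (rule local_root_sys[OF subspace_UNIV])
 let ?A = "{K:aarr M Th. K <.> x = 0}" and ?C = "{K:C. K <.> x = 0}"
 define J where "J = {ga. lift v ga : stage (real M) Th}"
 define G where "G = {ga:J. lift v ga : C}"
 have J: "Q.ideal_step J al" unfolding J_def by (rule local_ideal_step[OF step al])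
 have A: "?A = lift v ` J"
 proof (intro equalityI subsetI)
  fix K assume K: "K : ?A"
  then have "K ~= delta" using x(2) by (auto simp: delta_inner)
  then have "K : stage (real M) Th" "K = lift v (fst K)" using K vanish by (auto simp: aarr_def)
  then show "K : lift v ` J" unfolding J_def by (metis (mono_tags) image_eqI mem_Collect_eq)
 next
  have "lift v ga <.> x = 0" for ga using vanish[of "lift v ga"] by (simp add: lift_def)
  then show "K : ?A" if "K : lift v ` J" for K using that by (auto simp: J_def aarr_def)
 qed
 have tr: "transversal ?A ?C (al, real M)" by (rule transversal_local[OF arr_lower_step[OF step] C x(1)])
 have "?C = {K:?A. K : C}" using C by (auto simp: transversal_def)
 also have "... = {K:lift v ` J. K : C}" unfolding A ..
 also have "... = lift v ` G" by (auto simp: G_def)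
 finally have C_eq: "?C = lift v ` G" .
 have "transversal (lift v ` J) (lift v ` G) (lift v al)" using tr unfolding A C_eq al .
 then have "transversal J G al" by (rule transversal_linear_image[OF linear_lift inj_lift_all, THEN iffD1])
 then have "transversal (emb ` J) (emb ` G) (emb al)" by (rule transversal_linear_image[OF linear_emb inj_emb, THEN iffD2])
 then have "unit_on (emb ` span (local_roots UNIV v)) (emb ` J) (emb ` G) (emb al)"
  using ideal_arrangements_free[OF Q.root_sys_axioms] J unfolding Q.ideal_units_def by blast
 then have "unit_on (emb ` span (local_roots UNIV v)) ?A ?C (al, real M)" unfolding A C_eq al[symmetric] by (rule unit_on_lift)
 moreover have "span (local_roots UNIV v) \<subseteq> span Ph" by (rule span_mono) (auto simp: local_roots_def)
 ultimately show ?thesis by (rule unit_on_mono[OF _ image_mono])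
qed

end

locale perp_component = affine_sys Ph c for Ph :: "(real^'n) set" and c +
 fixes v al :: "real^'n"
 assumes v: "v : span Ph" "v ~= 0" and al: "al : Ph" "al <.> v = 0"
begin

definition X :: "(real^'n) set" where "X = component {be:Ph. be <.> v = 0} al"

lemma al_in_X: "al : X" unfolding X_def by (rule component_self)

lemma X_irreducible: "irreducible_root_system X" unfolding X_def by (rule component_irreducible)

lemma X_subset: "X \<subseteq> {be:Ph. be <.> v = 0}" unfolding X_def by (rule component_subset) (simp add: al)

lemma X_psubset: "X \<subset> Ph" using X_subset perp_psubset[OF v] by blast

lemma X_orthogonal:
 assumes be: "be : Ph" "be <.> v = 0" "be ~: X" and w: "w : span X"
 shows "be <.> w = 0"
proof -
 have "x <.> be = 0" if "x : X" for x
  using component_extend[of x "{be:Ph. be <.> v = 0}" al be] that be al unfolding X_def by auto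
 then have "X \<subseteq> {w. be <.> w = 0}" by (auto simp: inner_commute)
 then have "span X \<subseteq> {w. be <.> w = 0}" by (rule span_minimal) (rule subspace_hyperplane)
 then show ?thesis using w by blast
qed

sublocale Q: affine_sys X c
proof (rule affine_sys.intro)
 show "root_sys X c"
 proof (rule sub_root_sys)
  show "refl_root a b : X" if "a : X" "b : X" for a b
   using component_refl_root[of al "{be:Ph. be <.> v = 0}" a b] that al refl unfolding X_def by (simp add: refl_root_inner)
 qed (use X_psubset reg in auto)
 show "affine_sys_axioms X c" by (rule affine_sys_axioms.intro) (use small X_psubset in blast)
qed

lemma Q_pos: "Q.pos = pos Int X" unfolding Q.pos_def pos_def using X_psubset by blast

lemma Q_apos: "f : Q.apos \<longleftrightarrow> f : apos & fst f : X" unfolding Q.apos_def apos_def using X_psubset by auto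

lemma Q_aarr: "Q.aarr M (Th Int X) = insert delta {f:stage (real M) Th. fst f : X}"
 unfolding Q.aarr_def Q.stage_def stage_def by (auto simp: Q_apos)

lemma Q_lower:
 assumes "lower Z"
 shows "Q.lower (Z Int X)"
 unfolding Q.lower_def
proof (intro conjI ballI impI)
 fix be ga assume be: "be : Z Int X" "ga : X" "be - ga : conic_span Q.pos"
 have "be - ga : conic_span pos"
  by (rule conic_mono[OF linear_ident _ be(3), of pos]) (use Q_pos conic_base in blast)
 then show "ga : Z Int X" using assms be X_psubset unfolding lower_def by blast
qed simp

lemma Q_lower_step:
 assumes "lower_step Th al M"
 shows "Q.lower_step (Th Int X) al M"
 using Q_lower[of Th] Q_lower[of "insert al Th"] lower_stepD[OF assms] al_in_X
 unfolding Q.lower_step_def by (simp add: Q_apos)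

definition orthogonal_part :: "(real^'n) set => nat => ((real^'n) \<times> real) set" where
 "orthogonal_part Th M = {f:stage (real M) Th. fst f <.> v = 0 & fst f ~: X}"

lemma local_aarr: "{K:aarr M Th. K <.> emb v = 0} = Q.aarr M (Th Int X) Un orthogonal_part Th M"
 using X_subset by (auto simp: aarr_def Q_aarr orthogonal_part_def delta_def inner_commute[of v])

lemma aarr_fst_in_span: "g : Q.aarr M Z ==> fst g : span X"
 by (auto simp: Q.aarr_def Q.stage_def Q_apos delta_def span_zero intro: span_base)

lemma orthogonal_partD:
 assumes "f : orthogonal_part Th M"
 shows "f : apos" "w : span X ==> fst f <.> w = 0" "fst f <.> fst f > 0"
 using assms X_orthogonal[of "fst f" w] root_nz(2)[of "fst f"] by (auto simp: orthogonal_part_def stage_def apos_def)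

lemma orthogonal_part_outside_pencil:
 assumes f: "f : orthogonal_part Th M" and g: "g : Q.aarr M Z"
 shows "f ~: span {(al, real M), g}"
proof
 assume "f : span {(al, real M), g}"
 then obtain u w where "f = u *R (al, real M) + w *R g" by (rule span_pairE)
 then have "fst f : span X" using aarr_fst_in_span[OF g] al_in_X by (simp add: span_add span_scale span_base)
 then show False using orthogonal_partD(2,3)[OF f] by fastforce
qed

lemma orthogonal_part_pencil:
 assumes f: "f : orthogonal_part Th M" and g: "g : orthogonal_part Th M" and fg: "f : span {(al, real M), g}"
 shows "f = g"
proof -
 obtain u w where uw: "f = u *R (al, real M) + w *R g" using span_pairE[OF fg] by blast
 then have "fst f <.> al = u * (al <.> al) + w * (fst g <.> al)" by (simp add: inner_add_left)
 then have "u = 0" using orthogonal_partD(2)[OF f span_base[OF al_in_X]] orthogonal_partD(2)[OF g span_base[OF al_in_X]] root_nz(1)[OF al(1)] by simp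
 then have "f = w *R g" using uw by (simp only: scaleR_zero_left add_0_left)
 then show ?thesis using apos_proportional orthogonal_partD(1) f g by blast
qed

lemma affine_local_infinite:
 assumes units: "Q.affine_units" and step: "lower_step Th al M" and C: "transversal (aarr M Th) C (al, real M)"
 shows "unit_on (emb ` span Ph) {K:aarr M Th. K <.> emb v = 0} {K:C. K <.> emb v = 0} (al, real M)"
proof -
 let ?a = "(al, real M)" and ?A = "{K:aarr M Th. K <.> emb v = 0}" and ?C = "{K:C. K <.> emb v = 0}"
 let ?B = "Q.aarr M (Th Int X)" and ?R = "orthogonal_part Th M"
 note arr = arr_lower_step[OF step]
 have tr: "transversal ?A ?C ?a" by (rule transversal_local[OF arr C]) (simp add: al(2) inner_commute[of v])
 have saturated: "L : ?B" if K: "K : ?B" and L: "L : ?A" "K : span {?a, L}" for K L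
 proof (rule ccontr)
  assume "L ~: ?B"
  then have "L : ?R" using L(1) local_aarr by blast
  moreover have "L : span {?a, K}" using arr_class_sym[OF arr _ _ L(2)] K L(1) local_aarr by blast
  ultimately show False using orthogonal_part_outside_pencil K by blast
 qed
 have "transversal ?B (?C Int ?B) ?a" by (rule transversal_Int_saturated[OF tr _ saturated]) (use local_aarr in blast)
 then have "unit_on (emb ` span X) ?B (?C Int ?B) ?a" using units Q_lower_step[OF step] unfolding Q.affine_units_def by blast
 then have "unit_on (emb ` span Ph) (?B Un ?R) (?C Int ?B Un ?R) ?a"
 proof (rule unit_on_orthogonal_extension)
  show "emb ` span X \<subseteq> emb ` span Ph" using span_mono[of X Ph] X_psubset by blast
  show "?B Int ?R = {}" using orthogonal_part_outside_pencil[of _ Th M] by (blast intro: span_base)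
  show "K <.> u = 0" if "K : ?R" "u : emb ` span X" for K u using orthogonal_partD(2)[OF that(1)] that(2) by auto
 qed
 moreover have "?R \<subseteq> ?C"
 proof
  fix f assume f: "f : ?R"
  then obtain k where k: "k : ?C" "k : ?A" "f : span {?a, k}" using tr local_aarr unfolding transversal_def by blast
  then have "k : ?R" using orthogonal_part_outside_pencil[OF f] local_aarr by blast
  then show "f : ?C" using orthogonal_part_pencil[OF f _ k(3)] k(1) by simp
 qed
 then have "?C Int ?B Un ?R = ?C" using tr local_aarr unfolding transversal_def by blast
 ultimately show ?thesis unfolding local_aarr by simp
qed

end

locale affine_induction = affine_sys Ph c for Ph :: "(real^'n) set" and c +
 fixes h :: nat
 assumes irr: "irreducible_root_system Ph" and h: "2 * card pos = h * dim Ph"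
  and IH: "Ps \<subset> Ph ==> irreducible_root_system Ps ==> affine_sys Ps c ==> affine_sys.affine_units Ps c"
begin

lemma level_duality:
 shows "t >= h ==> level t = {}" "t >= 1 ==> t <= h ==> card (level t) + card (level (h + 1 - t)) = dim Ph"
proof -
 obtain ds where ds: "distinct ds" "set ds = base" using finite_distinct_list[OF finite_base] by blast
 obtain n where n: "2 * card pos = n * dim Ph" "ALL t>=n. level t = {}"
  "ALL t>=1. t <= n --> card (level t) + card (level (n + 1 - t)) = dim Ph"
  using height_duality[OF irr ds] by blast
 have "dim Ph ~= 0" using irr nz unfolding irreducible_root_system_def by (auto simp: dim_eq_0)
 then have "n = h" using n(1) h by simp
 then show "t >= h ==> level t = {}" "t >= 1 ==> t <= h ==> card (level t) + card (level (h + 1 - t)) = dim Ph" using n(2,3) by auto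
qed

lemma step_degree:
 assumes step: "lower_step Th al M" and C: "transversal (aarr M Th) C (al, real M)"
 obtains (pos) k where "al : pos" "k >= 1" "al : level k" "card (aarr M Th - C) + 1 = M * h + k"
 | (neg) k where "- al : pos" "k >= 1" "- al : level k" "card (aarr M Th - C) + k = M * h"
proof (cases "al : pos")
 case True
 obtain k where k: "k >= 1" "ht al = real k" using ht_pos[OF True] by blast
 have "real (card (aarr M Th - C)) = real (M * h) + ht al - 1" using affine_count[OF irr h step C] True by simp
 then have "real (card (aarr M Th - C) + 1) = real (M * h + k)" using k(2) by simp
 then have "card (aarr M Th - C) + 1 = M * h + k" by (simp only: of_nat_eq_iff)
 then show ?thesis using pos(1)[OF True k(1)] True k(2) by (simp add: level_def)
next
 case False
 then have n: "- al : pos" using pos_or_neg[OF lower_stepD(2)[OF step]] by blast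
 obtain k where k: "k >= 1" "ht (- al) = real k" using ht_pos[OF n] by blast
 have "real (card (aarr M Th - C)) = real (M * h) + ht al" using affine_count[OF irr h step C] False by simp
 then have "real (card (aarr M Th - C) + k) = real (M * h)" using k(2) by (simp add: ht_neg)
 then have "card (aarr M Th - C) + k = M * h" by (simp only: of_nat_eq_iff)
 then show ?thesis using neg(1)[OF n k(1)] n k(2) by (simp add: level_def)
qed

lemma card_exponents_above:
 assumes step: "lower_step Th al M" and C: "transversal (aarr M Th) C (al, real M)"
  and I: "finite I" "card I = dim Ph" and pattern: "exponent_pattern h M Th I e"
 shows "card {i:I. card (aarr M Th - C) < e i} < dim Ph"
 using step C
proof (cases rule: step_degree)
 note al = lower_stepD[OF step]
 case (pos k)
 have "{i:I. card (aarr M Th - C) < e i} = {i:I. M * h + k <= e i}" using pos(4) by auto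
 then have "card {i:I. card (aarr M Th - C) < e i} = card (Th Int level k)"
  using exponent_pattern_pos(1)[OF pattern lower_insert_pos[OF al(4) pos(1)] pos(2)] by simp
 also have "... < card (level k)" using pos(3) al(3) finite_level by (intro psubset_card_mono) auto
 also have "... <= dim Ph" by (rule card_level_le)
 finally show ?thesis .
next
 note al = lower_stepD[OF step]
 case (neg k)
 have Th_neg: "Th \<subseteq> uminus ` pos" using lower_insert_neg(1)[OF al(1) neg(1) al(3)] by blast
 have "- al ~: uminus ` Th" using al(3) by auto
 then have "- al : (pos - uminus ` Th) Int level k" using neg by blast
 then have "card {i:I. e i + k <= M * h} ~= 0" using exponent_pattern_neg(1)[OF pattern Th_neg neg(2)] finite_level by auto
 then have "{i:I. e i + k <= M * h} ~= {}" by (metis card.empty)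
 then obtain i where "i : I" "e i + k <= M * h" by blast
 then have "i : I" "i ~: {i:I. card (aarr M Th - C) < e i}" using neg(4) by auto
 then have "{i:I. card (aarr M Th - C) < e i} \<subset> I" by blast
 then show ?thesis using psubset_card_mono[OF I(1)] I(2) by metis
qed

lemma affine_unit:
 assumes step: "lower_step Th al M" and C: "transversal (aarr M Th) C (al, real M)" and ex: "affine_exponents h M Th"
 shows "unit_on (emb ` span Ph) (aarr M Th) C (al, real M)"
proof -
 let ?a = "(al, real M)" and ?A = "aarr M Th" and ?W = "span Ph \<times> (UNIV :: real set)"
 obtain I :: "nat set" and e th where basis: "free_basis (emb ` span Ph) ?A I e th" and I: "card I = dim Ph"
  and pattern: "exponent_pattern h M Th I e" using ex unfolding affine_exponents_def by blast
 interpret addition ?A C ?a "emb ` span Ph" I e th "card (?A - C)"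
  by unfold_locales (use subspace_emb_span arr_lower_step[OF step] C basis in auto)
 have W: "subspace ?W" by (intro subspace_Times) auto
 have "dim ?W = dim Ph + 1" using dim_Times[of "span Ph" "UNIV :: real set"] by (simp add: dim_UNIV)
 then have dim_W: "dim Ph <= dim {x:?W. ?a <.> x = 0}" using dim_kernel_ge[OF W, of ?a] by simp
 show ?thesis
 proof (rule local_to_global[OF W])
  show "card {i:I. card (?A - C) < e i} < dim {x:?W. ?a <.> x = 0}"
   using card_exponents_above[OF step C finite_I I pattern] dim_W by linarith
  fix x assume x: "x : ?W" "?a <.> x = 0" "x ~= 0"
  show "unit_on (emb ` span Ph) {K:?A. K <.> x = 0} {K:C. K <.> x = 0} ?a"
  proof (cases "snd x = 0")
   case True
   then have x': "x = emb (fst x)" by (simp add: emb_def prod_eq_iff)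
   interpret X: perp_component Ph c "fst x" al
    by unfold_locales (use x True lower_stepD(2)[OF step] in \<open>auto simp: inner_prod_def prod_eq_iff\<close>)
   show ?thesis
    using X.affine_local_infinite[OF IH[OF X.X_psubset X.X_irreducible X.Q.affine_sys_axioms] step C] unfolding x'[symmetric] .
  qed (rule affine_local_finite[OF step C x(2)])
 qed
qed

lemma exponent_pattern_insert_pos:
 assumes I: "finite I" "i : I" "Suc (e i) = M * h + k" and pattern: "exponent_pattern h M Th I e"
  and al: "lower_step Th al M" "al : pos" "al : level k"
 shows "exponent_pattern h M (insert al Th) I (e(i := Suc (e i)))"
proof -
 note old = exponent_pattern_pos[OF pattern lower_insert_pos[OF lower_stepD(4)[OF al(1)] al(2)]]
 have "card {j:I. M * h + t <= (e(i := Suc (e i))) j} = card (insert al Th Int level t)" if t: "t >= 1" for t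
 proof -
  have "al : level t \<longleftrightarrow> t = k" using al(3) level_disjoint by blast
  then have "insert al Th Int level t = (if t = k then insert al (Th Int level t) else Th Int level t)" by auto
  moreover have "M * h + t = Suc (e i) \<longleftrightarrow> t = k" using I(3) by auto
  ultimately show ?thesis
   using card_exponents_update[OF I(1,2), of e "e i" "M * h + t"] old(1)[OF t] lower_stepD(3)[OF al(1)] finite_level by simp
 qed
 moreover have "M * h <= (e(i := Suc (e i))) j" if "j : I" for j using old(2)[OF that] old(2)[OF I(2)] by simp
 moreover have "~ insert al Th \<subseteq> uminus ` pos" using al(2) not_pos_neg by auto
 ultimately show ?thesis unfolding exponent_pattern_def by blast
qed

lemma exponent_pattern_complete:
 assumes I: "finite I" and Th: "Th \<subseteq> uminus ` pos" "uminus ` pos \<subseteq> Th"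
  and neg: "card {j:I. e j + 1 <= M * h} = card ((pos - uminus ` Th) Int level 1)" "ALL j:I. e j <= M * h"
 shows "(ALL t>=1. card {j:I. M * h + t <= e j} = card (Th Int level t)) & (ALL j:I. M * h <= e j)"
proof -
 have "pos - uminus ` Th = {}" using Th(2) by (force simp: image_iff)
 then have "card {j:I. e j + 1 <= M * h} = 0" using neg(1) by (simp only: Int_empty_left card.empty)
 then have "{j:I. e j + 1 <= M * h} = {}" using I by simp
 then have lower_bound: "ALL j:I. M * h <= e j" by fastforce
 have "{j:I. M * h + t <= e j} = {}" if "t >= 1" for t using neg(2) that by fastforce
 moreover have "Th Int level t = {}" for t using Th(1) not_pos_neg by (auto simp: level_def)
 ultimately have "card {j:I. M * h + t <= e j} = card (Th Int level t)" if "t >= 1" for t using that by (simp only: card.empty)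
 then show ?thesis using lower_bound by blast
qed

lemma card_exponents_below_update:
 assumes "finite I" "i : I"
 shows "card {j:I. (e(i := Suc (e i))) j + t <= s} = card {j:I. e j + t <= s} - (if e i + t = s then 1 else 0)"
proof (cases "e i + t = s")
 case True
 then have "{j:I. (e(i := Suc (e i))) j + t <= s} = {j:I. e j + t <= s} - {i}" by auto
 then show ?thesis using True assms by simp
next
 case False
 then have "{j:I. (e(i := Suc (e i))) j + t <= s} = {j:I. e j + t <= s}" by auto
 then show ?thesis using False by simp
qed

lemma exponent_pattern_insert_neg:
 assumes I: "finite I" "i : I" "e i + k = M * h" "k >= 1" and pattern: "exponent_pattern h M Th I e"
  and al: "lower_step Th al M" "- al : pos" "- al : level k"
 shows "exponent_pattern h M (insert al Th) I (e(i := Suc (e i)))"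
proof -
 note Th = lower_stepD[OF al(1)]
 have insert_neg: "insert al Th \<subseteq> uminus ` pos" by (rule lower_insert_neg(1)[OF Th(1) al(2) Th(3)])
 then have old: "t >= 1 ==> card {j:I. e j + t <= M * h} = card ((pos - uminus ` Th) Int level t)" "j : I ==> e j <= M * h" for t j
  using exponent_pattern_neg[OF pattern] by blast+
 have card: "card {j:I. (e(i := Suc (e i))) j + t <= M * h} = card ((pos - uminus ` insert al Th) Int level t)" if t: "t >= 1" for t
 proof -
  have "- al : (pos - uminus ` Th) Int level k" using al Th(3) by auto
  moreover have "- al : level t \<longleftrightarrow> t = k" using al(3) level_disjoint by blast
  then have "(pos - uminus ` insert al Th) Int level t = (pos - uminus ` Th) Int level t - (if t = k then {- al} else {})" by auto
  moreover have "e i + t = M * h \<longleftrightarrow> t = k" using I(3) by auto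
  ultimately show ?thesis using card_exponents_below_update[OF I(1,2), of e t "M * h"] old(1)[OF t] finite_level by simp
 qed
 moreover have upper_bound: "ALL j:I. (e(i := Suc (e i))) j <= M * h" using old(2) I(3,4) by auto
 ultimately show ?thesis
  unfolding exponent_pattern_def using exponent_pattern_complete[OF I(1) insert_neg _ card[of 1] upper_bound] by blast
qed

lemma affine_exponents_insert:
 assumes step: "lower_step Th al M" and ex: "affine_exponents h M Th"
 shows "affine_exponents h M (insert al Th)"
proof -
 let ?a = "(al, real M)" and ?A = "aarr M Th"
 obtain I :: "nat set" and e th where basis: "free_basis (emb ` span Ph) ?A I e th" and I: "card I = dim Ph"
  and pattern: "exponent_pattern h M Th I e" using ex unfolding affine_exponents_def by blast
 obtain C where C: "transversal ?A C ?a" using transversal_exists[OF arr_lower_step[OF step]] by blast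
 interpret addition ?A C ?a "emb ` span Ph" I e th "card (?A - C)"
  by unfold_locales (use subspace_emb_span arr_lower_step[OF step] C basis in auto)
 obtain i th' where i: "i : I" "e i = card (?A - C)"
  and basis': "free_basis (emb ` span Ph) (insert ?a ?A) I (e(i := Suc (e i))) th'"
  using free_basis_add[OF affine_unit[OF step C ex]] by metis
 have "exponent_pattern h M (insert al Th) I (e(i := Suc (e i)))"
  using step C
 proof (cases rule: step_degree)
  case (pos k)
  then show ?thesis using exponent_pattern_insert_pos[OF finite_I i(1) _ pattern step] i(2) by simp
 next
  case (neg k)
  then show ?thesis using exponent_pattern_insert_neg[OF finite_I i(1) _ _ pattern step] i(2) by simp
 qed
 moreover have "insert ?a ?A = aarr M (insert al Th)"
  unfolding aarr_def insert_stage[OF lower_stepD(5)[OF step], symmetric] by (rule insert_commute)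
 ultimately show ?thesis unfolding affine_exponents_def using basis' I by auto
qed

lemma affine_exponents_chain:
 assumes start: "affine_exponents h M Th0" "M = 0 ==> uminus ` pos \<subseteq> Th0"
  and low: "lower Th" "Th0 \<subseteq> Th" "!!x y. x : Ph - Th0 ==> y : Th0 ==> ht y <= ht x"
 shows "affine_exponents h M Th"
 using low(1,2)
proof (induction "card (Th - Th0)" arbitrary: Th)
 case 0
 have "finite Th" using "0.prems"(1) fin finite_subset unfolding lower_def by blast
 then have "Th = Th0" using 0 by auto
 then show ?case using start(1) by simp
next
 case (Suc n)
 have Th_subset: "Th \<subseteq> Ph" using Suc.prems(1) unfolding lower_def by blast
 have nonempty: "Th - Th0 ~= {}" using Suc.hyps(2) by (metis card.empty nat.distinct(1))
 have "EX al:Th - Th0. lower (Th - {al})"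
  by (rule lower_remove_max[OF Suc.prems(1) _ nonempty]) (use low(3) Th_subset in auto)
 then obtain al where a: "al : Th" "al ~: Th0" "lower (Th - {al})" by blast
 have "finite (Th - Th0)" using Th_subset fin finite_subset by blast
 then have "n = card ((Th - {al}) - Th0)" using Suc.hyps(2) a by (metis Diff_insert Diff_insert2 DiffI card_Diff_singleton diff_Suc_1)
 then have ex: "affine_exponents h M (Th - {al})" using Suc.hyps(1) a Suc.prems(2) by blast
 have insert_al: "insert al (Th - {al}) = Th" using a by blast
 have aP: "al : Ph" using a Th_subset by blast
 have "al : pos" if "M = 0"
 proof (rule ccontr)
  assume "al ~: pos"
  then have "- al : pos" using pos_or_neg[OF aP] by blast
  then have "- (- al) : Th0" using start(2)[OF that] by blast
  then show False using a by simp
 qed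
 then have "(al, real M) : apos" unfolding apos_nat_iff using aP by (cases "M = 0") auto
 then show ?case using affine_exponents_insert[OF _ ex, of al] insert_al Suc.prems(1) a(3) aP by (simp add: lower_step_def)
qed

lemma affine_exponents_start: "affine_exponents h 0 (uminus ` pos)"
proof -
 have "stage 0 (uminus ` pos) = {}" using stage_zero[of "{}"] by simp
 then have A: "aarr 0 (uminus ` pos) = {delta}" by (simp add: aarr_def)
 have "K <.> u = 0" if "K : {delta}" "u : emb ` span Ph" for K u
  using that(1) delta_inner(1)[of u] imageE[OF that(2)] by (metis emb_simps(2) singletonD)
 then obtain I :: "nat set" and th where basis: "free_basis (emb ` span Ph) {delta} I (%_. 0) th" "card I = dim (emb ` span Ph)"
  using constant_basis[OF subspace_emb_span] by metis
 have "uminus ` pos Int level t = {}" for t using not_pos_neg by (auto simp: level_def)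
 moreover have "(pos - uminus ` uminus ` pos) Int level t = {}" for t by (auto simp: image_image)
 ultimately have "exponent_pattern h 0 (uminus ` pos) I (%_. 0)"
  unfolding exponent_pattern_def by (simp only: card.empty) simp
 then show ?thesis unfolding affine_exponents_def A using basis dim_emb_span by metis
qed

lemma affine_exponents_zero:
 assumes Z: "lower Z" "uminus ` pos \<subseteq> Z"
 shows "affine_exponents h 0 Z"
proof (rule affine_exponents_chain[OF affine_exponents_start _ Z])
 fix x y assume x: "x : Ph - uminus ` pos" and y: "y : uminus ` pos"
 have "x : pos" using pos_or_neg[of x] x by (metis DiffE add.inverse_inverse image_eqI)
 then have "ht x >= 1" by (rule ht_pos_ge1)
 moreover obtain p where "p : pos" "y = - p" using y by blast
 then have "ht y <= 0" using ht_pos_ge1[of p] by (simp add: ht_neg)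
 ultimately show "ht y <= ht x" by linarith
qed simp

lemma aarr_Suc: "aarr (Suc m) {} = aarr m Ph"
proof -
 have "f : stage (real (Suc m)) {} \<longleftrightarrow> f : stage (real m) Ph" for f
 proof -
  have "snd f < real (Suc m) \<longleftrightarrow> snd f < real m \<or> snd f = real m & fst f : Ph" if "f : apos"
   using that by (rule apos_natE) auto
  then show ?thesis by (auto simp: stage_def)
 qed
 then show ?thesis unfolding aarr_def by blast
qed

lemma exponent_pattern_Suc:
 assumes I: "finite I" "card I = dim Ph" and pattern: "exponent_pattern h m Ph I e"
 shows "exponent_pattern h (Suc m) {} I e"
proof -
 have "uminus ` pos \<subseteq> Ph" using neg pos_root by blast
 note old = exponent_pattern_pos[OF pattern this]
 have Ph_level: "Ph Int level t = level t" for t using pos_root by (auto simp: level_def)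
 have "card {i:I. e i + t <= Suc m * h} = card (level t)" if t: "t >= 1" for t
 proof (cases "t <= h")
  case True
  have "{i:I. e i + t <= Suc m * h} = I - {i:I. m * h + (h + 1 - t) <= e i}" using True by auto
  then have "card {i:I. e i + t <= Suc m * h} = card I - card {i:I. m * h + (h + 1 - t) <= e i}"
   using I(1) by (simp add: card_Diff_subset)
  also have "... = dim Ph - card (level (h + 1 - t))" using old(1)[of "h + 1 - t"] True Ph_level I(2) by simp
  also have "... = card (level t)" using level_duality(2)[OF t True] by simp
  finally show ?thesis .
 next
  case False
  then have "{i:I. e i + t <= Suc m * h} = {}" using old(2) by fastforce
  moreover have "level t = {}" using level_duality(1) False by simp
  ultimately show ?thesis by (simp only: card.empty)
 qed
 moreover have "(pos - uminus ` {}) Int level t = level t" for t by (auto simp: level_def)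
 moreover have "ALL i:I. e i <= Suc m * h"
 proof -
  have "card {i:I. m * h + (h + 1) <= e i} = 0" using old(1)[of "h + 1"] level_duality(1)[of "h + 1"] by simp
  then have "{i:I. m * h + (h + 1) <= e i} = {}" using I(1) by simp
  then show ?thesis by fastforce
 qed
 moreover have "Ph ~= {}" using irr by (simp add: irreducible_root_system_def)
 then have "pos ~= {}" using pos_or_neg by blast
 ultimately show ?thesis unfolding exponent_pattern_def by (simp del: image_Collect)
qed

lemma affine_exponents_Suc:
 assumes ex: "affine_exponents h m Ph" and Z: "lower Z"
 shows "affine_exponents h (Suc m) Z"
proof (rule affine_exponents_chain[OF _ _ Z])
 obtain I :: "nat set" and e th where basis: "free_basis (emb ` span Ph) (aarr m Ph) I e th" and I: "card I = dim Ph"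
  and pattern: "exponent_pattern h m Ph I e" using ex unfolding affine_exponents_def by blast
 show "affine_exponents h (Suc m) {}"
  unfolding affine_exponents_def aarr_Suc using basis I exponent_pattern_Suc[OF free_basisD(1)[OF basis] I pattern] by blast
qed auto

lemma affine_exponents_all:
 assumes Z: "lower Z" "M = 0 ==> uminus ` pos \<subseteq> Z"
 shows "affine_exponents h M Z"
proof -
 have Ph: "lower Ph" "uminus ` pos \<subseteq> Ph" using neg pos_root by (auto simp: lower_def)
 have "affine_exponents h m Ph" for m
 proof (induction m)
  case 0
  show ?case by (rule affine_exponents_zero[OF Ph])
 next
  case (Suc m)
  then show ?case by (rule affine_exponents_Suc[OF _ Ph(1)])
 qed
 then show ?thesis using Z affine_exponents_zero affine_exponents_Suc by (cases M) auto
qed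

end

theorem affine_arrangements_free:
 fixes Ph :: "(real^'n) set"
 assumes "affine_sys Ph c" "irreducible_root_system Ph"
 shows "affine_sys.affine_units Ph c & (ALL h Th M. 2 * card (root_sys.pos Ph c) = h * dim Ph --> affine_sys.lower Ph c Th -->
  (M = 0 --> uminus ` root_sys.pos Ph c \<subseteq> Th) --> affine_sys.affine_exponents Ph c h M Th)"
 using assms
proof (induction "card Ph" arbitrary: Ph rule: less_induct)
 case less
 interpret affine_sys Ph c by (rule less.prems(1))
 note irr = less.prems(2)
 have IH: "affine_sys.affine_units Ps c" if "Ps \<subset> Ph" "irreducible_root_system Ps" "affine_sys Ps c" for Ps
  using less.hyps[OF psubset_card_mono[OF fin that(1)] that(3,2)] by blast
 have affine_induction: "affine_induction Ph c h" if "2 * card pos = h * dim Ph" for h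
  by unfold_locales (use irr that IH in auto)
 obtain ds where "distinct ds" "set ds = base" using finite_distinct_list[OF finite_base] by blast
 then obtain n where "2 * card pos = n * dim Ph" using height_duality[OF irr] by blast
 then interpret n: affine_induction Ph c n by (rule affine_induction)
 have "unit_on (emb ` span Ph) (aarr M Th) C (al, real M)"
  if step: "lower_step Th al M" and C: "transversal (aarr M Th) C (al, real M)" for M Th al C
 proof (rule n.affine_unit[OF step C n.affine_exponents_all[OF lower_stepD(1)[OF step]]])
  assume "M = 0"
  then have "al : pos" using lower_stepD(5)[OF step] by (simp add: apos_nat_iff[of al 0, simplified])
  then show "uminus ` pos \<subseteq> Th" by (rule lower_insert_pos[OF lower_stepD(4)[OF step]])
 qed
 then have "affine_units" unfolding affine_units_def by blast
 moreover have "affine_exponents h M Th" if "2 * card pos = h * dim Ph" "lower Th" "M = 0 --> uminus ` pos \<subseteq> Th" for h Th M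
  by (rule affine_induction.affine_exponents_all[OF affine_induction[OF that(1)] that(2)]) (use that(3) in simp)
 ultimately show ?case by (intro conjI allI impI)
qed

section \<open>Logarithmic derivations as tangent fields\<close>

lemma rpoly_monom: "rpoly (monom e :: real^'m::finite => real)"
proof -
 have "rpoly (%x::real^'m. x $ i)" for i using rpoly_inner[of "axis i (1::real) :: real^'m"] by (simp add: inner_axis' inner_real_def)
 then show ?thesis unfolding monom_def[abs_def] by (intro rpoly_prod rpoly_power)
qed

lemma Basis_vec_axis: "(Basis :: (real^'m::finite) set) = range (%i. axis i 1)" "inj (%i::'m. axis i 1 :: real^'m)"
 by (auto simp: Basis_vec_def inj_def axis_eq_axis)

lemma monomial_on_Basis: "monomial_on Basis mu x = monom (%i. mu (axis i 1)) (x :: real^'m::finite)"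
 unfolding monomial_on_def monom_def Basis_vec_axis(1)
 by (subst prod.reindex[OF Basis_vec_axis(2)]) (simp add: inner_axis' inner_real_def)

lemma sum_monomials:
 assumes F: "finite F"
 obtains c' where "!!x :: real^'m::finite. (SUM mu:F. c mu * monomial_on Basis mu x) = (SUM e:(%mu i. mu (axis i 1)) ` F. c' e * monom e x)"
proof (rule that)
 let ?g = "%mu i. mu (axis i 1 :: real^'m)"
 fix x :: "real^'m"
 have "(SUM mu:F. c mu * monomial_on Basis mu x) = (SUM e:?g ` F. SUM mu:{mu:F. ?g mu = e}. c mu * monomial_on Basis mu x)"
  by (rule sum.image_gen[OF F])
 also have "... = (SUM e:?g ` F. (SUM mu:{mu:F. ?g mu = e}. c mu) * monom e x)"
  by (intro sum.cong refl) (simp add: monomial_on_Basis sum_distrib_right)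
 finally show "(SUM mu:F. c mu * monomial_on Basis mu x) = (SUM e:?g ` F. (SUM mu:{mu:F. ?g mu = e}. c mu) * monom e x)" .
qed

lemma poly_fun_iff_rpoly: "poly_fun f \<longleftrightarrow> rpoly (f :: real^'m::finite => real)"
proof
 assume "poly_fun f"
 then obtain E c where f: "f = (%x. SUM e:E. c e * monom e x)" unfolding poly_fun_def by blast
 show "rpoly f" unfolding f by (intro rpoly_sum rpoly_mult rpoly_const rpoly_monom)
next
 assume f: "rpoly f"
 obtain F c where F: "finite F" "!!x. x : span (Basis :: (real^'m) set) ==> f x = (SUM mu:F. c mu * monomial_on Basis mu x)"
  using rpoly_monomialsE[OF f orthonormal_Basis] by blast
 obtain c' where "!!x :: real^'m. (SUM mu:F. c mu * monomial_on Basis mu x) = (SUM e:(%mu i. mu (axis i 1)) ` F. c' e * monom e x)"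
  using sum_monomials[OF F(1)] by blast
 then have "f = (%x. SUM e:(%mu i. mu (axis i 1 :: real^'m)) ` F. c' e * monom e x)" using F(2) by (intro ext) (simp add: span_Basis)
 then show "poly_fun f" unfolding poly_fun_def using finite_imageI[OF F(1)] by blast
qed

lemma finite_multidegrees: "finite {e::'m::finite => nat. sum e UNIV = d}"
proof (rule finite_subset)
 show "{e::'m => nat. sum e UNIV = d} \<subseteq> (\<Pi>\<^sub>E i\<in>UNIV. {..d})"
 proof
  fix e :: "'m => nat" assume e: "e : {e. sum e UNIV = d}"
  have "e i <= d" for i using member_le_sum[of i UNIV e] e by simp
  then show "e : (\<Pi>\<^sub>E i\<in>UNIV. {..d})" by (simp add: PiE_iff extensional_def)
 qed
qed (simp add: finite_PiE)

lemma homog_poly_imp_rpoly: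
 assumes "homog_poly d (f :: real^'m::finite => real)"
 shows "rpoly f" "f (t *R x) = t ^ d * f x"
proof -
 obtain c where f: "f = (%x. SUM e:{e::'m => nat. sum e UNIV = d}. c e * monom e x)" using assms unfolding homog_poly_def by blast
 show "rpoly f" unfolding f by (intro rpoly_sum rpoly_mult rpoly_const rpoly_monom)
 have "monom e (t *R x) = t ^ sum e UNIV * monom e x" for e :: "'m => nat"
  by (simp add: monom_def power_mult_distrib prod.distrib power_sum)
 then show "f (t *R x) = t ^ d * f x" unfolding f sum_distrib_left by (intro sum.cong refl) simp
qed

lemma homog_polyI:
 assumes f: "rpoly f" and hom: "!!t x. f (t *R x) = t ^ d * f (x :: real^'m::finite)"
 shows "homog_poly d f"
proof -
 obtain F c where F: "finite F" "!!mu. mu : F ==> (SUM b:Basis. mu b) = d"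
  "!!x. x : span (Basis :: (real^'m) set) ==> f x = (SUM mu:F. c mu * monomial_on Basis mu x)"
  using homogeneous_monomialsE[OF f orthonormal_Basis hom] by blast
 let ?G = "(%mu i. mu (axis i 1 :: real^'m)) ` F"
 obtain c' where c': "!!x :: real^'m. (SUM mu:F. c mu * monomial_on Basis mu x) = (SUM e:?G. c' e * monom e x)"
  using sum_monomials[OF F(1)] by blast
 have "(SUM i:UNIV. mu (axis i 1)) = (SUM b:(Basis :: (real^'m) set). mu b)" for mu :: "real^'m => nat"
  unfolding Basis_vec_axis(1) by (simp add: sum.reindex[OF Basis_vec_axis(2)])
 then have G: "?G \<subseteq> {e. sum e UNIV = d}" using F(2) by auto
 have "f x = (SUM e:{e::'m => nat. sum e UNIV = d}. (if e : ?G then c' e else 0) * monom e x)" for x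
  unfolding F(3)[unfolded span_Basis, OF UNIV_I] c' by (rule sum.mono_neutral_cong_left[OF finite_multidegrees G]) auto
 then show ?thesis unfolding homog_poly_def by (intro exI[of _ "%e. if e : ?G then c' e else 0"] ext)
qed

definition coefficient_field :: "'m derivation => real^'m::finite => real^'m" where
 "coefficient_field th x = (\<chi> i. th i x)"

lemma apply_lin_coefficient_field: "apply_lin th a x = a <.> coefficient_field th x"
 by (simp add: apply_lin_def coefficient_field_def inner_vec_def mult.commute)

lemma coefficient_field_polynomial:
 "(ALL i. poly_fun (th i)) \<longleftrightarrow> (ALL u. rpoly (%x. u <.> coefficient_field th x))"
proof (intro iffI allI)
 fix u assume th: "ALL i. poly_fun (th i)"
 have "rpoly (%x. SUM i:UNIV. u $ i * th i x)" using th unfolding poly_fun_iff_rpoly by (intro rpoly_sum rpoly_mult rpoly_const) simp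
 then show "rpoly (%x. u <.> coefficient_field th x)" by (simp add: coefficient_field_def inner_vec_def)
next
 fix i assume "ALL u. rpoly (%x. u <.> coefficient_field th x)"
 then have "rpoly (%x. axis i 1 <.> coefficient_field th x)" by blast
 then show "poly_fun (th i)" by (simp add: poly_fun_iff_rpoly coefficient_field_def inner_axis' inner_real_def)
qed

lemma same_hyperplane_span:
 fixes a :: "'a::euclidean_space"
 assumes "{x. K <.> x = 0} = {x. a <.> x = 0}"
 shows "a : span {K}"
proof (rule ccontr)
 assume "a ~: span {K}"
 then obtain x where "K <.> x = 0" "a <.> x ~= 0" using separating_vector by blast
 then show False using assms by blast
qed

lemma log_derivations_iff:
 fixes N :: "(real^'m::finite) set"
 assumes "0 ~: N"
 shows "th : log_derivations (central_arr N) \<longleftrightarrow> coefficient_field th : tangent_fields UNIV N"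
proof
 assume L: "th : log_derivations (central_arr N)"
 show "coefficient_field th : tangent_fields UNIV N"
 proof (rule tangent_fieldsI)
  show "rpoly (%x. u <.> coefficient_field th x)" for u using L coefficient_field_polynomial unfolding log_derivations_def by blast
  fix K x assume K: "K : N" "K <.> x = 0"
  then have "K ~= 0 & {x. K <.> x = 0} = {x. K <.> x = 0}" "{x. K <.> x = 0} : central_arr N" using assms by (auto simp: central_arr_def)
  then obtain g where "ALL x. apply_lin th K x = (K <.> x) * g x" using L unfolding log_derivations_def by blast
  then show "K <.> coefficient_field th x = 0" using K(2) by (simp add: apply_lin_coefficient_field)
 qed simp
next
 assume T: "coefficient_field th : tangent_fields UNIV N"
 have "EX g. poly_fun g & (ALL x. apply_lin th a x = (a <.> x) * g x)" if a: "{x. a <.> x = 0} : central_arr N" for a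
 proof -
  obtain K where K: "{x. a <.> x = 0} = {x. K <.> x = 0}" "K : N" using a unfolding central_arr_def by (rule imageE)
  obtain k where "a = k *R K" using same_hyperplane_span[OF K(1)[symmetric]] by (auto simp: span_singleton)
  then have "a <.> coefficient_field th x = 0" if "a <.> x = 0" for x
   using tangent_fieldsD(3)[OF T K(2), of x] K(1) that by auto
  then obtain g where "rpoly g" "ALL x. a <.> coefficient_field th x = (a <.> x) * g x"
   using rpoly_divide_linear[OF tangent_fieldsD(4)[OF T, of a] subspace_UNIV, of a] by auto
  then show ?thesis by (intro exI[of _ g]) (simp add: poly_fun_iff_rpoly apply_lin_coefficient_field)
 qed
 moreover have "ALL i. poly_fun (th i)" using coefficient_field_polynomial tangent_fieldsD(4)[OF T] by blast
 ultimately show "th : log_derivations (central_arr N)" unfolding log_derivations_def by blast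
qed

lemma free_basis_coeffs_unique:
 assumes basis: "free_basis U A I e th" and f: "!!i. i : I ==> rpoly (f i)" and g: "!!i. i : I ==> rpoly (g i)"
  and eq: "!!x. (SUM i:I. f i x *R th i x) = (SUM i:I. g i x *R th i x)" and i: "i : I"
 shows "f i x = g i x"
proof -
 have "f i x - g i x = 0"
 proof (rule free_basisD(5)[OF basis, of "%i x. f i x - g i x"])
  show "(SUM i:I. (f i x - g i x) *R th i x) = 0" for x using eq[of x] by (simp add: scaleR_diff_left sum_subtractf)
 qed (use f g i real_polynomial_function_diff in blast)+
 then show ?thesis by simp
qed

lemma derivation_expansion_iff:
 "et = (%i x. SUM j:UNIV. f j x * B j i x) \<longleftrightarrow> (ALL x. coefficient_field et x = (SUM j:UNIV. f j x *R coefficient_field (B j) x))"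
 by (auto simp: fun_eq_iff vec_eq_iff coefficient_field_def)

lemma free_with_exponents_imp_basis:
 fixes N :: "(real^'m::finite) set"
 assumes N: "0 ~: N" and free: "free_with_exponents (central_arr N) d"
 shows "EX th. free_basis UNIV N (UNIV :: 'm set) d th"
proof -
 obtain B :: "'m => 'm derivation" where B: "!!j. B j : log_derivations (central_arr N)" "!!j i. homog_poly (d j) (B j i)"
  "ALL et:log_derivations (central_arr N). EX! f. (ALL j. poly_fun (f j)) & et = (%i x. SUM j:UNIV. f j x * B j i x)"
  using free unfolding free_with_exponents_def by blast
 let ?th = "%j. coefficient_field (B j)"
 have rep: "EX! f. (ALL j. rpoly (f j)) & (ALL x. et x = (SUM j:UNIV. f j x *R ?th j x))" if et: "et : tangent_fields UNIV N" for et
 proof -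
  have "coefficient_field (%i x. et x $ i) = et" by (simp add: coefficient_field_def fun_eq_iff)
  then show ?thesis using bspec[OF B(3), of "%i x. et x $ i"] et log_derivations_iff[OF N, of "%i x. et x $ i"]
   by (simp only: derivation_expansion_iff poly_fun_iff_rpoly)
 qed
 have zero: "(%_. 0) : tangent_fields UNIV N" by (rule tangent_fieldsI) (auto intro: rpoly_const)
 have "free_basis UNIV N UNIV d ?th"
  unfolding free_basis_def homogeneous_generators_def
 proof (intro conjI ballI allI impI)
  show "?th j : tangent_fields UNIV N" for j using B(1) log_derivations_iff[OF N] by blast
  show "?th j (t *R x) = t ^ d j *R ?th j x" for j t x using homog_poly_imp_rpoly(2)[OF B(2)] by (simp add: coefficient_field_def vec_eq_iff)
  show "EX f. (ALL j:UNIV. rpoly (f j)) & (ALL x. et x = (SUM j:UNIV. f j x *R ?th j x))" if "et : tangent_fields UNIV N" for et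
   using rep[OF that] by blast
  fix f j x assume "ALL j:UNIV. rpoly (f j)" "ALL x. (SUM j:UNIV. f j x *R ?th j x) = 0"
  then have "f = (%_ _. 0)" by (intro Uniq_D[OF ex1_iff_ex_Uniq[THEN iffD1, THEN conjunct2, OF rep[OF zero]]]) (simp_all add: rpoly_const)
  then show "f j x = 0" by simp
 qed simp
 then show ?thesis by blast
qed

lemma basis_imp_free_with_exponents:
 fixes N :: "(real^'m::finite) set"
 assumes N: "0 ~: N" and basis: "free_basis UNIV N (UNIV :: 'm set) d th"
 shows "free_with_exponents (central_arr N) d"
proof -
 define B where "B j i x = th j x $ i" for j i x
 have field: "coefficient_field (B j) = th j" for j by (simp add: coefficient_field_def B_def fun_eq_iff vec_eq_iff)
 have "EX! f. (ALL j. poly_fun (f j)) & et = (%i x. SUM j:UNIV. f j x * B j i x)" if "et : log_derivations (central_arr N)" for et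
 proof -
  have "coefficient_field et : tangent_fields UNIV N" using that log_derivations_iff[OF N, of et] by simp
  from free_basisD(4)[OF basis this] obtain f
   where f: "ALL j. rpoly (f j)" "ALL x. coefficient_field et x = (SUM j:UNIV. f j x *R th j x)" by auto
  then show ?thesis unfolding derivation_expansion_iff field poly_fun_iff_rpoly
   by (intro ex1I[of _ f]) (auto simp: fun_eq_iff intro!: free_basis_coeffs_unique[OF basis])
 qed
 moreover have "B j : log_derivations (central_arr N)" for j
  unfolding log_derivations_iff[OF N] field by (rule free_basisD(2)[OF basis]) simp
 moreover have "homog_poly (d j) (B j i)" for i j
 proof (rule homog_polyI)
  show "rpoly (B j i)" using tangent_fieldsD(4)[OF free_basisD(2)[OF basis UNIV_I], of "axis i 1" j]
   by (simp add: inner_axis' inner_real_def B_def[abs_def])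
  show "B j i (t *R x) = t ^ d j * B j i x" for t x by (simp add: B_def free_basisD(3)[OF basis])
 qed
 ultimately show ?thesis unfolding free_with_exponents_def by (intro exI[of _ B]) blast
qed

lemma free_basis_reindex:
 assumes basis: "free_basis U A I e th" and b: "bij_betw b J I"
 shows "free_basis U A J (%j. e (b j)) (%j. th (b j))"
 unfolding free_basis_def homogeneous_generators_def
proof (intro conjI ballI allI impI)
 have b_I: "b j : I" if "j : J" for j using b that by (auto simp: bij_betw_def)
 have b_inv: "inv_into J b (b j) = j" if "j : J" for j using b that by (simp add: bij_betw_def)
 have sum_b: "(SUM j:J. f (b j) *R th (b j) x) = (SUM i:I. f i *R th i x)" for f x
  using sum.reindex_bij_betw[OF b, of "%i. f i *R th i x"] .
 show "finite J" using bij_betw_finite[OF b] free_basisD(1)[OF basis] by simp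
 show "th (b j) : tangent_fields U A" "th (b j) (t *R x) = t ^ e (b j) *R th (b j) x" if "j : J" for j t x
  using free_basisD(2,3)[OF basis b_I[OF that]] by auto
 show "EX f. (ALL j:J. rpoly (f j)) & (ALL x. et x = (SUM j:J. f j x *R th (b j) x))" if et: "et : tangent_fields U A" for et
 proof -
  obtain f where "ALL i:I. rpoly (f i)" "ALL x. et x = (SUM i:I. f i x *R th i x)" using free_basisD(4)[OF basis et] by blast
  then show ?thesis using b_I sum_b by (intro exI[of _ "%j. f (b j)"]) (simp add: sum_b[of "%i. f i _"])
 qed
 fix f j x assume f: "ALL j:J. rpoly (f j)" "ALL x. (SUM j:J. f j x *R th (b j) x) = 0" and j: "j : J"
 let ?f = "%i. f (inv_into J b i)"
 have inv_J: "inv_into J b i : J" if "i : I" for i using b that by (auto simp: bij_betw_def intro: inv_into_into)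
 have "(SUM i:I. ?f i x *R th i x) = 0" for x
  using f(2) sum_b[of "%i. ?f i x" x] b_inv by simp
 then have "?f (b j) x = 0" using free_basisD(5)[OF basis, of ?f "b j" x] f(1) inv_J b_I[OF j] by blast
 then show "f j x = 0" using b_inv[OF j] by simp
qed

lemma tangent_fields_transport:
 fixes \<phi> :: "'f::euclidean_space => 'e::euclidean_space"
 assumes lin: "linear \<phi>" and inv: "!!y. \<phi> (\<psi> y) = y" and adj: "!!K x. \<psi> K <.> x = K <.> \<phi> x" and et: "et : tangent_fields UNIV A"
 shows "(%x. \<psi> (et (\<phi> x))) : tangent_fields UNIV (\<psi> ` A)"
proof (rule tangent_fieldsI)
 have bl: "bounded_linear \<phi>" using lin by (simp add: linear_conv_bounded_linear)
 have "u <.> \<psi> y = \<phi> u <.> y" for u y using adj[of y u] by (simp add: inner_commute)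
 then show "rpoly (%x. u <.> \<psi> (et (\<phi> x)))" for u using rpoly_compose_linear[OF tangent_fieldsD(4)[OF et] bl] by simp
 fix K x assume "K : \<psi> ` A" "K <.> x = 0"
 then obtain L where L: "L : A" "K = \<psi> L" "L <.> \<phi> x = 0" using adj by auto
 then show "K <.> \<psi> (et (\<phi> x)) = 0" using tangent_fieldsD(3)[OF et L(1,3)] by (simp add: adj inv)
qed simp

lemma free_basis_transport:
 fixes \<phi> :: "'f::euclidean_space => 'e::euclidean_space"
 assumes basis: "free_basis UNIV A I e th" and lin: "linear \<phi>" "linear \<psi>" and inv: "!!x. \<psi> (\<phi> x) = x" "!!y. \<phi> (\<psi> y) = y"
  and adj: "!!K x. \<psi> K <.> x = K <.> \<phi> x"
 shows "free_basis UNIV (\<psi> ` A) I e (%i x. \<psi> (th i (\<phi> x)))"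
 unfolding free_basis_def homogeneous_generators_def
proof (intro conjI ballI allI impI)
 have bl: "bounded_linear \<phi>" "bounded_linear \<psi>" using lin by (simp_all add: linear_conv_bounded_linear)
 show "finite I" by (rule free_basisD(1)[OF basis])
 show "(%x. \<psi> (th i (\<phi> x))) : tangent_fields UNIV (\<psi> ` A)" if "i : I" for i
  by (rule tangent_fields_transport[OF lin(1) inv(2) adj free_basisD(2)[OF basis that]])
 show "\<psi> (th i (\<phi> (t *R x))) = t ^ e i *R \<psi> (th i (\<phi> x))" if "i : I" for i t x
  by (simp add: linear_scale[OF lin(1)] linear_scale[OF lin(2)] free_basisD(3)[OF basis that])
 show "EX f. (ALL i:I. rpoly (f i)) & (ALL x. et x = (SUM i:I. f i x *R \<psi> (th i (\<phi> x))))" if et: "et : tangent_fields UNIV (\<psi> ` A)" for et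
 proof -
  have "(%y. \<phi> (et (\<psi> y))) : tangent_fields UNIV (\<phi> ` \<psi> ` A)"
   by (rule tangent_fields_transport[OF lin(2) inv(1) _ et]) (metis adj inner_commute)
  then have "(%y. \<phi> (et (\<psi> y))) : tangent_fields UNIV A" by (simp add: image_image inv)
  from free_basisD(4)[OF basis this] obtain f
   where f: "ALL i:I. rpoly (f i)" "!!y. \<phi> (et (\<psi> y)) = (SUM i:I. f i y *R th i y)" by blast
  have "et x = \<psi> (SUM i:I. f i (\<phi> x) *R th i (\<phi> x))" for x using f(2)[of "\<phi> x"] by (metis inv(1))
  then have "et x = (SUM i:I. f i (\<phi> x) *R \<psi> (th i (\<phi> x)))" for x
   by (simp add: linear_sum[OF lin(2)] linear_scale[OF lin(2)])
  moreover have "ALL i:I. rpoly (%x. f i (\<phi> x))" using rpoly_compose_linear[OF _ bl(1)] f(1) by blast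
  ultimately show ?thesis by (intro exI[of _ "%i x. f i (\<phi> x)"]) simp
 qed
 fix f i x assume f: "ALL i:I. rpoly (f i)" "ALL x. (SUM i:I. f i x *R \<psi> (th i (\<phi> x))) = 0" and i: "i : I"
 have "(SUM i:I. f i (\<psi> y) *R th i y) = \<phi> (SUM i:I. f i (\<psi> y) *R \<psi> (th i (\<phi> (\<psi> y))))" for y
  by (simp add: linear_sum[OF lin(1)] linear_scale[OF lin(1)] inv)
 then have "(SUM i:I. f i (\<psi> y) *R th i y) = 0" for y using f(2) linear_0[OF lin(1)] by simp
 from free_basisD(5)[OF basis, of "%i y. f i (\<psi> y)", OF _ this i, of "\<phi> x"] show "f i x = 0"
  using rpoly_compose_linear[OF _ bl(2)] f(1) by (simp add: inv)
qed

lemma euler_quotient: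
 fixes A :: "((real^'n) \<times> real) set"
 assumes d: "delta : A" and et: "et : tangent_fields UNIV A"
 obtains g where "rpoly g" "(%x. et x - g x *R x) : tangent_fields (range emb) A"
proof -
 have "rpoly (%x. snd (et x))" using tangent_fieldsD(4)[OF et, of delta] by (simp add: delta_inner)
 moreover have "snd (et x) = 0" if "delta <.> x = 0" for x using tangent_fieldsD(3)[OF et d that] by (simp add: delta_inner)
 ultimately obtain g where g: "rpoly g" "!!x. snd (et x) = snd x * g x"
  using rpoly_divide_linear[OF _ subspace_UNIV, of "%x. snd (et x)" delta] by (auto simp: delta_inner)
 have "(%x. et x - g x *R x) : tangent_fields (range emb) A"
 proof (rule tangent_fieldsI)
  show "rpoly (%x. u <.> (et x - g x *R x))" for u
   unfolding inner_diff_right inner_scaleR_right by (intro real_polynomial_function_diff tangent_fieldsD(4)[OF et] rpoly_mult g rpoly_inner)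
  have "et x - g x *R x = emb (fst (et x - g x *R x))" for x by (rule prod_eqI) (simp_all add: g(2))
  then show "et x - g x *R x : range emb" for x by blast
  show "K <.> (et x - g x *R x) = 0" if "K : A" "K <.> x = 0" for K x
   using tangent_fieldsD(3)[OF et that] that(2) by (simp add: inner_diff_right)
 qed
 then show ?thesis using that g(1) by blast
qed

lemma euler_independent:
 fixes A :: "((real^'n) \<times> real) set"
 assumes basis: "free_basis (range emb) A I e th" and g: "rpoly g" and f: "!!i. i : I ==> rpoly (f i)"
  and zero: "!!x. g x *R x + (SUM i:I. f i x *R th i x) = 0"
 shows "g x = 0" "i : I ==> f i x = 0"
proof -
 have rpoly_snd: "rpoly (%x::(real^'n) \<times> real. snd x)" using rpoly_inner[of "delta :: (real^'n) \<times> real"] by (simp add: delta_inner)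
 have snd_th: "snd (th i x) = 0" if "i : I" for i x using tangent_fieldsD(2)[OF free_basisD(2)[OF basis that], of x] by auto
 show g0: "g x = 0" for x
 proof (rule rpoly_mult_eq_0[OF rpoly_snd g subspace_UNIV])
  have "snd (g x *R x + (SUM i:I. f i x *R th i x)) = 0" for x unfolding zero by simp
  then show "snd x * g x = 0" for x using snd_th by (simp add: snd_sum mult.commute)
  show "snd (delta :: (real^'n) \<times> real) ~= 0" by (simp add: delta_def)
 qed simp_all
 show "f i x = 0" if "i : I" by (rule free_basisD(5)[OF basis f _ that]) (use zero g0 in simp_all)
qed

lemma free_basis_add_euler:
 fixes A :: "((real^'n) \<times> real) set"
 assumes basis: "free_basis (range emb) A I e th" and d: "delta : A"
 shows "free_basis UNIV A (insert None (Some ` I)) (case_option 1 e) (case_option (%x. x) th)"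
 unfolding free_basis_def homogeneous_generators_def
proof (intro conjI ballI allI impI)
 let ?I = "insert None (Some ` I)" and ?th = "case_option (%x. x) th"
 have finite_I: "finite I" by (rule free_basisD(1)[OF basis])
 have sum_I: "(SUM q:?I. f q *R ?th q x) = f None *R x + (SUM i:I. f (Some i) *R th i x)" for f :: "_ => real" and x
  using finite_I by (simp add: sum.reindex)
 show "finite ?I" using finite_I by simp
 have "(%x. x) : tangent_fields UNIV A" by (rule tangent_fieldsI) (auto intro: rpoly_inner)
 moreover have "tangent_fields (range emb) A \<subseteq> tangent_fields UNIV A" by (rule tangent_fields_mono_range) simp
 ultimately show "?th q : tangent_fields UNIV A" if "q : ?I" for q using that free_basisD(2)[OF basis] by auto
 show "?th q (t *R x) = t ^ case_option 1 e q *R ?th q x" if "q : ?I" for q t x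
  using that free_basisD(3)[OF basis, of _ t x] by (cases q) auto
 show "EX f. (ALL q:?I. rpoly (f q)) & (ALL x. et x = (SUM q:?I. f q x *R ?th q x))" if et: "et : tangent_fields UNIV A" for et
 proof -
  obtain g where g: "rpoly g" "(%x. et x - g x *R x) : tangent_fields (range emb) A" using euler_quotient[OF d et] by blast
  obtain f where f: "ALL i:I. rpoly (f i)" "ALL x. et x - g x *R x = (SUM i:I. f i x *R th i x)" using free_basisD(4)[OF basis g(2)] by blast
  have "et x = (SUM q:?I. case_option g f q x *R ?th q x)" for x
   unfolding sum_I[where f="%q. case_option g f q x"] using f(2)[rule_format, of x] by (simp add: algebra_simps)
  moreover have "ALL q:?I. rpoly (case_option g f q)" using g f by auto
  ultimately show ?thesis by (intro exI[of _ "case_option g f"]) blast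
 qed
 fix f q x assume f: "ALL q:?I. rpoly (f q)" "ALL x. (SUM q:?I. f q x *R ?th q x) = 0" and q: "q : ?I"
 have "f None x *R x + (SUM i:I. f (Some i) x *R th i x) = 0" for x
  using f(2)[rule_format, of x] unfolding sum_I[where f="%q. f q x"] .
 note independent = euler_independent[OF basis _ _ this]
 show "f q x = 0" using q f(1) by (cases q) (auto intro: independent)
qed

lemma bij_of_fibers:
 assumes "finite A" "finite B" "!!k. card {a:A. f a = k} = card {b:B. g b = k}"
 shows "EX h. bij_betw h A B & (ALL a:A. g (h a) = f a)"
proof -
 have "ALL k. EX h. bij_betw h {a:A. f a = k} {b:B. g b = k}"
  using assms by (intro allI finite_same_card_bij) auto
 then obtain H where H: "!!k. bij_betw (H k) {a:A. f a = k} {b:B. g b = k}" by metis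
 let ?h = "%a. H (f a) a"
 have m: "?h a : B" "g (?h a) = f a" if "a : A" for a
  using bij_betwE[OF H[of "f a"]] that by auto
 have "inj_on ?h A"
 proof (rule inj_onI)
  fix a a' assume a: "a : A" "a' : A" "?h a = ?h a'"
  then have "f a = f a'" using m by metis
  then show "a = a'" using bij_betw_imp_inj_on[OF H[of "f a"]] a by (auto simp: inj_on_def)
 qed
 moreover have "B \<subseteq> ?h ` A"
 proof
  fix b assume b: "b : B"
  then have "b : H (g b) ` {a:A. f a = g b}" using bij_betw_imp_surj_on[OF H[of "g b"]] by blast
  then obtain a where "a : A" "f a = g b" "b = H (g b) a" by blast
  then show "b : ?h ` A" by (intro image_eqI[of _ _ a]) simp_all
 qed
 ultimately have "bij_betw ?h A B" using m unfolding bij_betw_def by blast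
 then show ?thesis using m by blast
qed

lemma card_fibers_le_imp_eq:
 assumes fin: "finite I" "finite J" "card I = card J" and card_le: "!!k. card {j:J. e j = k} <= card {i:I. d i = k}"
 shows "card {j:J. e j = k} = card {i:I. d i = k}"
proof -
 define K where "K = insert k (e ` J Un d ` I)"
 have K: "finite K" "k : K" using fin by (simp_all add: K_def)
 have "(SUM k:K. card {j:J. e j = k}) = card J" "(SUM k:K. card {i:I. d i = k}) = card I"
  using sum.group[of J K e "%_. 1::nat"] sum.group[of I K d "%_. 1::nat"] K fin by (auto simp: K_def)
 then have total: "(SUM k:K. card {j:J. e j = k}) = (SUM k:K. card {i:I. d i = k})" using fin(3) by simp
 show ?thesis
 proof (rule ccontr)
  assume "card {j:J. e j = k} ~= card {i:I. d i = k}"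
  then have "card {j:J. e j = k} < card {i:I. d i = k}" using card_le[of k] by simp
  then have "(SUM k:K. card {j:J. e j = k}) < (SUM k:K. card {i:I. d i = k})" using K card_le by (intro sum_strict_mono_ex1) auto
  then show False using total by simp
 qed
qed

text \<open>Modulo the irrelevant ideal the change of basis becomes an invertible scalar matrix, and it respects degrees.\<close>

locale basis_change =
 fixes U A :: "'e::euclidean_space set" and J :: "'j set" and e B and I :: "'i set" and d th
  and F :: "'i => 'j => 'e => real" and G :: "'j => 'i => 'e => real"
 assumes U: "subspace U" and basis: "free_basis U A J e B" and generators: "homogeneous_generators U A I d th"
  and F: "i : I ==> j : J ==> rpoly (F i j)" "i : I ==> th i x = (SUM j:J. F i j x *R B j x)"
  and G: "j : J ==> i : I ==> rpoly (G j i)" "j : J ==> B j x = (SUM i:I. G j i x *R th i x)"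
begin

lemma finite_I: "finite I" and th_homogeneous: "i : I ==> th i (t *R x) = t ^ d i *R th i x"
 using generators by (simp_all add: homogeneous_generators_def)

lemma coefficient_degree:
 assumes i: "i : I" and j: "j : J" and ne: "d i ~= e j"
 shows "F i j 0 = 0"
proof -
 have "2 ^ d i * F i j 0 = 2 ^ e j * F i j (2 *R 0)"
 proof (rule free_basis_coeffs_unique[OF basis, of "%j x. 2 ^ d i * F i j x" "%j x. 2 ^ e j * F i j (2 *R x)"])
  show "rpoly (%x. 2 ^ d i * F i j x)" if "j : J" for j by (intro rpoly_mult rpoly_const F(1)[OF i that])
  show "rpoly (%x. 2 ^ e j * F i j (2 *R x))" if "j : J" for j
   by (intro rpoly_mult rpoly_const rpoly_compose_linear[OF F(1)[OF i that] bounded_linear_scaleR_right])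
  show "(SUM j:J. (2 ^ d i * F i j x) *R B j x) = (SUM j:J. (2 ^ e j * F i j (2 *R x)) *R B j x)" for x
  proof -
   have "(SUM j:J. (2 ^ d i * F i j x) *R B j x) = th i (2 *R x)"
    by (simp add: th_homogeneous[OF i] F(2)[OF i, of x] scaleR_sum_right)
   also have "... = (SUM j:J. F i j (2 *R x) *R (2 ^ e j *R B j x))"
    unfolding F(2)[OF i, of "2 *R x"] by (intro sum.cong refl) (simp add: free_basisD(3)[OF basis])
   finally show ?thesis by (simp add: mult.commute)
  qed
 qed (rule j)
 moreover have "(2::real) ^ d i ~= 2 ^ e j" using ne by simp
 ultimately show ?thesis by simp
qed

lemma coefficients_inverse:
 assumes j: "j : J" "j' : J"
 shows "(SUM i:I. G j i 0 * F i j' 0) = (if j = j' then 1 else 0)"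
proof (rule free_basis_coeffs_unique[OF basis, of "%j' x. SUM i:I. G j i x * F i j' x" "%j' x. if j = j' then 1 else 0", OF _ _ _ j(2)])
 show "rpoly (%x. SUM i:I. G j i x * F i j' x)" if "j' : J" for j' using that j by (intro rpoly_sum rpoly_mult G(1) F(1))
 show "rpoly (%x::'e. if j = j' then 1 else 0)" for j' by (rule rpoly_const)
 have "(SUM j':J. (SUM i:I. G j i x * F i j' x) *R B j' x) = B j x" for x
 proof -
  have "(SUM j':J. (SUM i:I. G j i x * F i j' x) *R B j' x) = (SUM i:I. G j i x *R (SUM j':J. F i j' x *R B j' x))"
   unfolding scaleR_sum_left scaleR_sum_right by (subst sum.swap) simp
  also have "... = (SUM i:I. G j i x *R th i x)" by (intro sum.cong refl) (simp add: F(2)[of _ x, symmetric])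
  finally show ?thesis using G(2)[OF j(1)] by simp
 qed
 moreover have "(SUM j':J. (if j = j' then 1 else 0) *R B j' x) = B j x" for x
  using j(1) free_basisD(1)[OF basis] by (simp add: if_distrib[of "%u. u *R _"] sum.delta cong: if_cong)
 ultimately show "(SUM j':J. (SUM i:I. G j i x * F i j' x) *R B j' x) = (SUM j':J. (if j = j' then 1 else 0) *R B j' x)" for x by simp
qed

lemma card_exponent_le: "card {j:J. e j = k} <= card {i:I. d i = k}"
proof (rule ccontr)
 let ?I = "{i:I. d i = k}" and ?J = "{j:J. e j = k}"
 have finite_J: "finite ?J" using free_basisD(1)[OF basis] by simp
 assume "~ ?thesis"
 then obtain c where c: "EX j:?J. c j ~= 0" "ALL i:?I. (SUM j:?J. c j * G j i 0) = 0"
  using nontrivial_left_kernel[of ?I ?J "%j i. G j i 0"] finite_I finite_J by auto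
 obtain j' where j': "j' : ?J" "c j' ~= 0" using c(1) by blast
 have "c j' = (SUM j:?J. c j * (if j = j' then 1 else 0))"
  using j' finite_J by (simp add: if_distrib[of "%t. _ * t"] sum.delta cong: if_cong)
 also have "... = (SUM j:?J. SUM i:I. c j * G j i 0 * F i j' 0)"
  using j'(1) by (intro sum.cong refl) (simp add: coefficients_inverse[symmetric] sum_distrib_left mult.assoc)
 also have "... = (SUM i:I. (SUM j:?J. c j * G j i 0) * F i j' 0)" by (subst sum.swap) (simp add: sum_distrib_right)
 also have "... = 0"
 proof (rule sum.neutral, rule ballI)
  fix i assume i: "i : I"
  show "(SUM j:?J. c j * G j i 0) * F i j' 0 = 0" using c(2) coefficient_degree[OF i, of j'] i j'(1) by (cases "d i = k") auto
 qed
 finally show False using j'(2) by simp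
qed

end

lemma exponents_unique:
 assumes U: "subspace U" and basis: "free_basis U A J e B" and gens: "homogeneous_generators U A I d th" and card: "card I = card J"
 shows "card {j:J. e j = k} = card {i:I. d i = k}"
proof -
 have "ALL i:I. EX f. (ALL j:J. rpoly (f j)) & (ALL x. th i x = (SUM j:J. f j x *R B j x))"
  using free_basisD(4)[OF basis] gens by (simp add: homogeneous_generators_def)
 then obtain F where F: "ALL i:I. (ALL j:J. rpoly (F i j)) & (ALL x. th i x = (SUM j:J. F i j x *R B j x))" by metis
 have "ALL j:J. EX g. (ALL i:I. rpoly (g i)) & (ALL x. B j x = (SUM i:I. g i x *R th i x))"
  using free_basisD(2)[OF basis] gens by (simp add: homogeneous_generators_def)
 then obtain G where G: "ALL j:J. (ALL i:I. rpoly (G j i)) & (ALL x. B j x = (SUM i:I. G j i x *R th i x))" by metis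
 interpret basis_change U A J e B I d th F G by unfold_locales (use U basis gens F G in auto)
 show ?thesis by (rule card_fibers_le_imp_eq[OF finite_I free_basisD(1)[OF basis] card card_exponent_le])
qed

section \<open>The cone over the deformed arrangement\<close>

definition split_cone :: "real^('n option) => (real^'n) \<times> real" where
 "split_cone x = (\<chi> i. x $ Some i, x $ None)"

definition join_cone :: "(real^'n) \<times> real => real^('n option)" where
 "join_cone y = (\<chi> o'. case o' of None => snd y | Some i => fst y $ i)"

lemma linear_split_cone: "linear split_cone"
 by (rule linearI) (simp_all add: split_cone_def prod_eq_iff vec_eq_iff)

lemma linear_join_cone: "linear join_cone"
 by (rule linearI) (simp_all add: join_cone_def vec_eq_iff split: option.split)

lemma join_split_cone: "join_cone (split_cone x) = x" "split_cone (join_cone y) = y"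
 by (simp_all add: join_cone_def split_cone_def vec_eq_iff prod_eq_iff split: option.split)

lemma sum_option: "(SUM o':UNIV. f o') = f None + (SUM i:UNIV. f (Some (i::'n::finite)))"
 unfolding UNIV_option_conv by (simp add: sum.reindex)

lemma join_cone_inner: "join_cone K <.> x = K <.> split_cone x"
 unfolding inner_vec_def[of "join_cone K" x] sum_option
 by (simp add: join_cone_def split_cone_def inner_prod_def inner_vec_def add.commute)

lemma card_fiber_diff:
 fixes f :: "'i => nat"
 assumes "finite X"
 shows "card {i:X. f i = k} = card {i:X. k <= f i} - card {i:X. Suc k <= f i}"
proof -
 have eq: "{i:X. f i = k} = {i:X. k <= f i} - {i:X. Suc k <= f i}" by auto
 show ?thesis unfolding eq by (rule card_Diff_subset) (use assms in auto)
qed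

lemma fibers_of_tails:
 fixes a :: "'i => nat" and b :: "'j => nat"
 assumes "finite I" "finite J" "card I = card J" "!!t. t >= 1 ==> card {i:I. t <= a i} = card {j:J. t <= b j}"
 shows "card {i:I. a i = k} = card {j:J. b j = k}"
proof -
 have "card {i:I. t <= a i} = card {j:J. t <= b j}" for t using assms(3,4) by (cases "t >= 1") auto
 then show ?thesis by (simp only: card_fiber_diff assms(1,2))
qed

lemma card_of_fibers:
 assumes "finite A" "finite B" "!!k. card {a:A. f a = k} = card {b:B. g b = k}"
 shows "card {a:A. Q (f a)} = card {b:B. Q (g b)}"
proof -
 obtain h where h: "bij_betw h A B" "ALL a:A. g (h a) = f a" using bij_of_fibers[OF assms] by blast
 have "bij_betw h {a:A. Q (f a)} {b:B. Q (g b)}"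
  using h by (auto simp: bij_betw_def inj_on_def image_iff)
 then show ?thesis by (rule bij_betw_same_card)
qed

context root_sys
begin

lemma conic_base_coeffs:
 assumes "x : conic_span pos"
 shows "EX k. (ALL s:base. k s >= (0::real)) & x = (SUM s:base. k s *R s)"
 using assms
proof (induction x rule: conic_span.induct)
 case conic_0
 then show ?case by (intro exI[of _ "%_. 0"]) simp
next
 case (conic_step p t y)
 obtain k where k: "ALL s:base. k s >= 0" "y = (SUM s:base. k s *R s)" using conic_step.IH by blast
 obtain n :: "real^'n => nat" where n: "p = (SUM s:base. real (n s) *R s)" using pos_combination[OF conic_step.hyps(1)] by blast
 have "t *R p + y = (SUM s:base. (t * real (n s) + k s) *R s)"
  unfolding k(2) n by (simp add: scaleR_sum_right scaleR_add_left sum.distrib)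
 then show ?case using k(1) conic_step.hyps(2) by (intro exI[of _ "%s. t * real (n s) + k s"]) simp
qed

lemma conic_imp_root_le: "be - ga : conic_span pos ==> root_le base ga be"
 unfolding root_le_def using conic_base_coeffs by blast

text \<open>Pairing with a fundamental coweight reads off one coefficient, so no positive root other than a multiple of \<open>b\<close>
 can occur in a nonnegative expansion of \<open>b\<close>.\<close>

lemma base_extremal:
 assumes b: "b : base" and S: "finite S" "S \<subseteq> pos" and k: "!!s. s : S ==> k s >= (0::real)" "b = (SUM s:S. k s *R s)"
  and t: "t : S" "k t ~= 0"
 shows "t = b"
proof -
 obtain n where n: "t = (SUM s:base. real (n s) *R s)" using pos_combination S(2) t(1) by blast
 have "n s = 0" if s: "s : base - {b}" for s
 proof -
  obtain w where w: "s <.> w = 1" "!!u. u : base - {s} ==> u <.> w = 0" using fundamental_coweight[of s] s by blast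
  have coeff: "(SUM u:base. m u *R u) <.> w = m s" for m
  proof -
   have "(SUM u:base. m u *R u) <.> w = (SUM u:base. if u = s then m s else 0)"
    unfolding inner_sum_left by (intro sum.cong HOL.refl) (use w in auto)
   then show ?thesis using s finite_base by simp
  qed
  have nonneg: "u <.> w >= 0" if u: "u : S" for u
  proof -
   obtain m :: "real^'n => nat" where "u = (SUM s:base. real (m s) *R s)" using pos_combination S(2) u by blast
   then show ?thesis using coeff[of "%u. real (m u)"] by simp
  qed
  have "(SUM u:S. k u * (u <.> w)) = 0" using w(2)[of b] b s unfolding k(2) by (auto simp: inner_sum_left)
  then have "k t * (t <.> w) = 0" using sum_nonneg_eq_0_iff[OF S(1), of "%u. k u * (u <.> w)"] k(1) nonneg t(1) by auto
  then show ?thesis using t(2) coeff[of "%s. real (n s)"] n by simp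
 qed
 then have "t = (SUM s:base. if s = b then real (n b) *R b else 0)" unfolding n by (intro sum.cong HOL.refl) auto
 then have "t = real (n b) *R b" using b finite_base by simp
 then show ?thesis using proportional_eq[of t b] S(2) t(1) base_pos[OF b] by blast
qed

lemma simple_system_unique:
 assumes S: "simple_system pos S"
 shows "S = base"
proof -
 have S': "S \<subseteq> pos" "independent S" and expand: "!!a. a : pos ==> EX k. (ALL s:S. k s >= (0::real)) & a = (SUM s:S. k s *R s)"
  using S unfolding simple_system_def by blast+
 have fin_S: "finite S" using finite_subset[OF S'(1) finite_pos] .
 have "base \<subseteq> S"
 proof
  fix b assume b: "b : base"
  obtain k where k: "ALL s:S. k s >= 0" "b = (SUM s:S. k s *R s)" using expand[OF base_pos[OF b]] by blast
  have "b ~= 0" using b base_pos pos_root root_nz by blast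
  then have "EX t:S. k t ~= 0" using k(2) by (auto intro: ccontr)
  then show "b : S" using base_extremal[OF b fin_S S'(1) _ k(2)] k(1) by metis
 qed
 moreover have "card S <= card base"
 proof -
  have "S \<subseteq> span base" using S'(1) pos_in_span_base by blast
  then have "card S <= dim (span base)" by (rule independent_card_le_dim[OF _ S'(2)])
  then show ?thesis using dim_eq_card_independent[OF base_independent] by simp
 qed
 ultimately show ?thesis using card_seteq[OF fin_S] by blast
qed

end

lemma fold_refl_root: "fold (%s f. refl_root s \<circ> f) ds g x = cox_elt (rev ds) (g x)"
 by (induction ds arbitrary: g) (simp_all add: cox_elt_append)

context root_sys
begin

lemma coxeter_number_card:
 assumes irr: "irreducible_root_system Ph"
 shows "2 * card pos = coxeter_number base * dim Ph"
proof -
 define ds where "ds = (SOME ds. distinct ds & set ds = base)"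
 have "distinct ds & set ds = base" unfolding ds_def by (rule someI_ex) (use finite_distinct_list[OF finite_base] in blast)
 then have "distinct (rev ds)" "set (rev ds) = base" by simp_all
 then obtain n where n: "n >= 2" "ALL x. (cox_elt (rev ds) ^^ n) x = x" "ALL k>0. (ALL x. (cox_elt (rev ds) ^^ k) x = x) --> n <= k"
  "2 * card pos = n * dim Ph" using height_duality[OF irr] by blast
 have "coxeter_element base = cox_elt (rev ds)"
  unfolding coxeter_element_def ds_def[symmetric] by (simp add: fun_eq_iff fold_refl_root)
 moreover have "(cox_elt (rev ds) ^^ k = id) = (ALL x. (cox_elt (rev ds) ^^ k) x = x)" for k by (simp add: fun_eq_iff)
 ultimately have "coxeter_number base = n" unfolding coxeter_number_def by simp (rule Least_equality; use n in auto)
 then show ?thesis using n(4) by simp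
qed

lemma ideal_exponents_tails:
 assumes sp: "span Ph = (UNIV :: (real^'n) set)" and I: "order_ideal_in pos I" and e: "free_with_exponents (central_arr I) (e :: 'n => nat)"
  and t: "t >= 1"
 shows "card {j. t <= e j} = card (I Int level t)"
proof -
 have "0 ~: I" using order_ideal_inD(1)[OF I] pos_root nz by blast
 then obtain B where basis: "free_basis UNIV I (UNIV :: 'n set) e B" using free_with_exponents_imp_basis[OF _ e] by blast
 have "ideal_exponents I" using ideal_arrangements_free[OF root_sys_axioms] I by blast
 then obtain K :: "nat set" and d th where K: "free_basis (emb ` span Ph) (emb ` I) K d th" "card K = dim Ph"
  and levels: "!!t. t >= 1 ==> card {i:K. d i >= t} = card (I Int level t)" unfolding ideal_exponents_def by blast
 have "card K = CARD('n)" using K(2) dim_span[of Ph] sp by (simp add: dim_UNIV)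
 then have "card {j:UNIV. e j = k} = card {i:K. d i = k}" for k
  using exponents_unique[OF subspace_UNIV basis free_basis_restrict[OF K(1)[unfolded sp]]] by simp
 then have "card {j:UNIV. t <= e j} = card {i:K. t <= d i}"
  by (rule card_of_fibers[OF finite_class.finite_UNIV free_basisD(1)[OF K(1)], where Q="%x. t <= x"])
 then show ?thesis using levels[OF t] by simp
qed

end

definition cone_hyperplane :: "(real^'n) \<times> real => (real^('n option)) set" where
 "cone_hyperplane K = {x. K <.> split_cone x = 0}"

lemma cone_hyperplane_minus: "cone_hyperplane (- K) = cone_hyperplane K" by (simp add: cone_hyperplane_def)

lemma cone_hyperplane_delta: "cone_hyperplane delta = {x. x $ None = 0}"
 by (simp add: cone_hyperplane_def delta_inner split_cone_def)

lemma cone_hyperplane_root: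
 "{x. (SUM i:UNIV. a $ i * x $ Some i) - real_of_int k * x $ None = 0} = cone_hyperplane (a, - real_of_int k)"
 by (simp add: cone_hyperplane_def split_cone_def inner_vec_def)

lemma central_arr_join_cone: "central_arr (join_cone ` A) = cone_hyperplane ` A"
 by (simp add: central_arr_def image_image join_cone_inner cone_hyperplane_def)

lemma cone_arr_cone_hyperplane: "cone_arr X = insert (cone_hyperplane delta) ((%(a, k). cone_hyperplane (a, - real_of_int k)) ` X)"
 unfolding cone_arr_def cone_hyperplane_root cone_hyperplane_delta ..

context affine_sys
begin

text \<open>A hyperplane \<open>al = k\<close> with \<open>k > 0\<close> is the zero set of the positive affine root \<open>(- al, k)\<close>.\<close>

lemma shi_catalan_in_stage:
 assumes I: "I \<subseteq> pos" and ak: "(a, k) : shi_catalan_arr pos I m"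
 shows "cone_hyperplane (a, - real_of_int k) : cone_hyperplane ` stage (real m) (I Un uminus ` pos)"
proof -
 have a: "a : pos" using ak I unfolding shi_catalan_arr_def by auto
 show ?thesis
 proof (cases "k <= 0")
  case True
  have "nat (- k) < m \<or> nat (- k) = m & a : I" using ak True unfolding shi_catalan_arr_def by auto
  then have "(a, real (nat (- k))) : stage (real m) (I Un uminus ` pos)" using a by (auto simp: stage_def apos_nat_iff pos_root)
  then show ?thesis using True by simp
 next
  case False
  have "nat k <= m" "nat k >= 1" using ak False unfolding shi_catalan_arr_def by auto
  then have "(- a, real (nat k)) : stage (real m) (I Un uminus ` pos)"
   using a neg[OF pos_root[OF a]] unfolding stage_def mem_Collect_eq apos_nat_iff by auto
  then show ?thesis using False cone_hyperplane_minus[of "(- a, real (nat k))"] by (intro image_eqI) auto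
 qed
qed

lemma stage_in_shi_catalan:
 assumes K: "K : stage (real m) (I Un uminus ` pos)"
 shows "EX a k. (a, k) : shi_catalan_arr pos I m & cone_hyperplane K = cone_hyperplane (a, - real_of_int k)"
proof -
 have "K : apos" using K stage_apos by blast
 then obtain be j where j: "K = (be, real j)" "be : Ph" "j >= 1 \<or> (j = 0 & be : pos)" by (rule apos_natE)
 have jm: "j < m \<or> j = m & be : I Un uminus ` pos" using K j(1) by (simp add: stage_def)
 show ?thesis
 proof (cases "be : pos")
  case True
  then have "be ~: uminus ` pos" using not_pos_neg by auto
  then have "(be, - int j) : shi_catalan_arr pos I m" using jm True unfolding shi_catalan_arr_def by auto
  then show ?thesis using j(1) by (intro exI[of _ be] exI[of _ "- int j"]) simp
 next
  case False
  then have "- be : pos" "j >= 1" "j <= m" using pos_or_neg[OF j(2)] j(3) jm by auto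
  then have "(- be, int j) : shi_catalan_arr pos I m" unfolding shi_catalan_arr_def by auto
  then show ?thesis using j(1) cone_hyperplane_minus[of K] by (intro exI[of _ "- be"] exI[of _ "int j"]) simp
 qed
qed

lemma cone_shi_catalan_arr:
 assumes I: "I \<subseteq> pos"
 shows "cone_arr (shi_catalan_arr pos I m) = central_arr (join_cone ` aarr m (I Un uminus ` pos))"
proof -
 let ?S = "stage (real m) (I Un uminus ` pos)"
 have "(%(a, k). cone_hyperplane (a, - real_of_int k)) ` shi_catalan_arr pos I m = cone_hyperplane ` ?S"
 proof (intro equalityI subsetI)
  fix Y assume "Y : (%(a, k). cone_hyperplane (a, - real_of_int k)) ` shi_catalan_arr pos I m"
  then show "Y : cone_hyperplane ` ?S" using shi_catalan_in_stage[OF I] by auto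
 next
  fix Y assume "Y : cone_hyperplane ` ?S"
  then show "Y : (%(a, k). cone_hyperplane (a, - real_of_int k)) ` shi_catalan_arr pos I m" using stage_in_shi_catalan by force
 qed
 then show ?thesis unfolding cone_arr_cone_hyperplane central_arr_join_cone aarr_def by simp
qed

lemma zero_notin_aarr: "0 ~: join_cone ` aarr m Th"
proof
 assume "0 : join_cone ` aarr m Th"
 then obtain K where K: "K : aarr m Th" "join_cone K = 0" by auto
 have "K = split_cone (join_cone K)" by (simp only: join_split_cone)
 then have "K = 0" using K(2) linear_0[OF linear_split_cone] by simp
 moreover have "K = delta \<or> K : apos" using K(1) stage_apos[of "real m" Th] unfolding aarr_def by blast
 moreover have "(delta :: (real^'n) \<times> real) ~= 0" by (simp add: delta_def zero_prod_def)
 ultimately show False using apos_nz(2)[of K] by auto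
qed

lemma cone_free_of_affine:
 assumes I: "I \<subseteq> pos" and basis: "free_basis (range emb) (aarr m (I Un uminus ` pos)) (UNIV :: 'n set) d th"
 shows "free_with_exponents (cone_arr (shi_catalan_arr pos I m)) (case_option 1 d)"
proof -
 have "delta : aarr m (I Un uminus ` pos)" by (simp add: aarr_def)
 note euler = free_basis_add_euler[OF basis this]
 show ?thesis
  unfolding cone_shi_catalan_arr[OF I]
  by (rule basis_imp_free_with_exponents[OF zero_notin_aarr])
   (unfold UNIV_option_conv, rule free_basis_transport[OF euler linear_split_cone linear_join_cone join_split_cone join_cone_inner])
qed

lemma affine_exponents_shift:
 assumes irr: "irreducible_root_system Ph" and sp: "span Ph = (UNIV :: (real^'n) set)" and I: "order_ideal_in pos I"
  and e: "free_with_exponents (central_arr I) (e :: 'n => nat)"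
 obtains th where "free_basis (range emb) (aarr m (I Un uminus ` pos)) (UNIV :: 'n set) (%j. e j + m * coxeter_number base) th"
proof -
 let ?Th = "I Un uminus ` pos" and ?h = "coxeter_number base"
 have "affine_exponents ?h m ?Th"
  using affine_arrangements_free[OF affine_sys_axioms irr] coxeter_number_card[OF irr] lower_ideal[OF I] by blast
 then obtain K :: "nat set" and d th where basis: "free_basis (emb ` span Ph) (aarr m ?Th) K d th" and K: "card K = dim Ph"
  and pattern: "exponent_pattern ?h m ?Th K d" unfolding affine_exponents_def by blast
 have fin_K: "finite K" by (rule free_basisD(1)[OF basis])
 have "card {j:UNIV. e j = k} = card {i:K. d i - m * ?h = k}" for k
 proof (rule fibers_of_tails[of UNIV K e "%i. d i - m * ?h"])
  show "card (UNIV :: 'n set) = card K" using K dim_span[of Ph] sp by (simp add: dim_UNIV)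
  fix t :: nat assume t: "t >= 1"
  have "{i:K. t <= d i - m * ?h} = {i:K. m * ?h + t <= d i}" using t by auto
  then have "card {i:K. t <= d i - m * ?h} = card (?Th Int level t)" using exponent_pattern_pos(1)[OF pattern _ t] by simp
  also have "?Th Int level t = I Int level t" using not_pos_neg by (auto simp: level_def)
  finally show "card {j:UNIV. t <= e j} = card {i:K. t <= d i - m * ?h}" using ideal_exponents_tails[OF sp I e t] by simp
 qed (use fin_K in auto)
 then obtain b where b: "bij_betw b UNIV K" "ALL j:UNIV. d (b j) - m * ?h = e j"
  using bij_of_fibers[of "UNIV :: 'n set" K e "%i. d i - m * ?h"] fin_K by auto
 have "d (b j) = e j + m * ?h" for j
 proof -
  have "b j : K" using b(1) by (auto simp: bij_betw_def)
  then have "m * ?h <= d (b j)" using exponent_pattern_pos(2)[OF pattern] by blast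
  then show ?thesis using b(2) by (metis UNIV_I le_add_diff_inverse2)
 qed
 then show ?thesis using that free_basis_reindex[OF basis b(1)] sp by simp
qed

end

lemma positive_system_affine_sys:
 assumes R: "crystallographic_root_system R" and P: "positive_system R P"
 obtains c where "affine_sys R c" "root_sys.pos R c = P"
proof -
 obtain c where c: "ALL a:R. c <.> a ~= 0" "P = {a:R. c <.> a > 0}" using P unfolding positive_system_def by blast
 interpret root_sys R c by unfold_locales (use R c(1) in \<open>auto simp: crystallographic_root_system_def\<close>)
 show ?thesis using normalize_exists that c(2) by (auto simp: pos_def)
qed

theorem mainTheorem12:
  fixes R P S I :: "(real^'n) set" and e :: "'n \<Rightarrow> nat" and m :: nat
  assumes "crystallographic_root_system R"
    and "irreducible_root_system R"
    and "positive_system R P"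
    and "simple_system P S"
    and "order_ideal S P I"
    and "free_with_exponents (central_arr I) e"
  shows "free_with_exponents (cone_arr (shi_catalan_arr P I m))
           (\<lambda>j. case j of None \<Rightarrow> 1 | Some i \<Rightarrow> e i + m * coxeter_number S)"
proof -
 obtain c where c: "affine_sys R c" "root_sys.pos R c = P" using positive_system_affine_sys[OF assms(1,3)] by blast
 interpret affine_sys R c by (rule c(1))
 have P: "P = pos" by (rule c(2)[symmetric])
 have S: "S = base" using simple_system_unique assms(4) unfolding P .
 have sp: "span R = UNIV" using assms(1) unfolding crystallographic_root_system_def by blast
 have I: "I \<subseteq> pos" using assms(5) unfolding order_ideal_def P by blast
 have "order_ideal_in pos I"
  using assms(5) conic_imp_root_le unfolding order_ideal_def order_ideal_in_def P S by blast
 then obtain th where "free_basis (range emb) (aarr m (I Un uminus ` pos)) UNIV (%j. e j + m * coxeter_number S) th"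
  using affine_exponents_shift[OF assms(2) sp _ assms(6)] unfolding S by blast
 then show ?thesis unfolding P by (rule cone_free_of_affine[OF I])
qed

end
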